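(* Let $\mathcal{M}$ be a non-injective factor of type $\mathrm{II}_1$ in standard form on a Hilbert space $\mathcal{H}$, and let $\mathcal{N}=\mathcal{M}'$. For a unit vector $\xi\in\mathcal{H}$ put $\phi_\xi(x)(y)=\langle xy\xi,\xi\rangle$ for $x\in\mathcal{M}$, $y\in\mathcal{M}'$. Then every $\phi_\xi$ is a normal completely bounded map $\mathcal{M}\to\mathcal{N}_*$, but it is not the case that for every unit vector $\xi$ the form $x\otimes y\mapsto\phi_\xi(x)(y)$ extends to a normal functional on $\mathcal{M}\overline{\otimes}\mathcal{M}'$. Hence $\mathcal{N}\mathrm{or}(\mathcal{M},\mathcal{N}_* )\subsetneq\mathrm{CB}^\sigma(\mathcal{M},\mathcal{N}_* )$.
   Context: ${}_*$ denotes the predual (normal functionals) and $\mathcal{M}\overline{\otimes}\mathcal{N}$ the spatial von Neumann tensor product. A linear map $\phi:\mathcal{M}\to\mathcal{N}_*$ is normal if it is continuous from $\sigma(\mathcal{M},\mathcal{M}_* )$ to $\sigma(\mathcal{N}_*,\mathcal{N})$. $\mathrm{CB}(\mathcal{M},\mathcal{N}_* )$ is the space of completely bounded maps ($\mathcal{N}_*$ with its standard operator space structure as a predual), and $\mathrm{CB}^\sigma(\mathcal{M},\mathcal{N}_* )$ is the subspace of normal completely bounded maps. The space $\mathcal{N}\mathrm{or}(\mathcal{M},\mathcal{N}_* )$: let $\mathcal{M}_*\widehat{\otimes}\mathcal{N}_*$ be the operator space projective tensor product; it is identified with $(\mathcal{M}\overline{\otimes}\mathcal{N})_*$ via $\langle\rho\otimes\nu,x\otimes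 y\rangle=\rho(x)\nu(y)$. The elementary tensor $\mu\otimes\nu$ acts as the map $x\mapsto\mu(x)\nu$ from $\mathcal{M}$ to $\mathcal{N}_*$, and this extends to a canonical map from $\mathcal{M}_*\widehat{\otimes}\mathcal{N}_*$ into $\mathrm{CB}(\mathcal{M},\mathcal{N}_* )$; $\mathcal{N}\mathrm{or}(\mathcal{M},\mathcal{N}_* )$ is the image of this map, equipped with the cb-norm. *)

theory Defs
  imports "HOL-Analysis.Analysis"
begin

section \<open>Complex Hilbert spaces\<close>

text \<open>
  The inner product \<open>cinner\<close> is linear in the first variable. The real inner product of the
  parent class \<open>real_inner\<close> is its real part, so the norm, the metric and positive definiteness
  come from there.
\<close>

class chilbert_space = real_inner + complete_space +
  fixes scaleC :: "complex \<Rightarrow> 'a \<Rightarrow> 'a"  (infixr "*\<^sub>C" 75)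
    and cinner :: "'a \<Rightarrow> 'a \<Rightarrow> complex"
  assumes scaleC_add_right: "c *\<^sub>C (x + y) = c *\<^sub>C x + c *\<^sub>C y"
    and scaleC_add_left: "(c + d) *\<^sub>C x = c *\<^sub>C x + d *\<^sub>C x"
    and scaleC_scaleC: "c *\<^sub>C d *\<^sub>C x = (c * d) *\<^sub>C x"
    and scaleC_of_real: "complex_of_real r *\<^sub>C x = r *\<^sub>R x"
    and cinner_commute: "cinner x y = cnj (cinner y x)"
    and cinner_add_left: "cinner (x + y) z = cinner x z + cinner y z"
    and cinner_scaleC_left: "cinner (c *\<^sub>C x) y = c * cinner x y"
    and inner_eq_Re_cinner: "inner x y = Re (cinner x y)"

lemma cinner_scaleC_right: "cinner x (c *\<^sub>C y) = cnj c * cinner x y"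
  for x :: "'a::chilbert_space"
  by (metis cinner_commute cinner_scaleC_left complex_cnj_mult)

lemma cinner_add_right: "cinner x (y + z) = cinner x y + cinner x z"
  for x :: "'a::chilbert_space"
  by (metis cinner_add_left cinner_commute complex_cnj_add)

lemma cinner_zero_left [simp]: "cinner 0 (x :: 'a::chilbert_space) = 0"
  using cinner_add_left[of 0 0 x] by simp

lemma cinner_zero_right [simp]: "cinner (x :: 'a::chilbert_space) 0 = 0"
  using cinner_add_right[of x 0 0] by simp

lemma cinner_minus_left: "cinner (- x) (y :: 'a::chilbert_space) = - cinner x y"
  using cinner_add_left[of x "-x" y] by (simp add: eq_neg_iff_add_eq_0 add.commute)

lemma cinner_minus_right: "cinner (x :: 'a::chilbert_space) (- y) = - cinner x y"
  using cinner_add_right[of x y "-y"] by (simp add: eq_neg_iff_add_eq_0 add.commute)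

lemma cinner_diff_left: "cinner (x - y) (z :: 'a::chilbert_space) = cinner x z - cinner y z"
  using cinner_add_left[of x "-y" z] by (simp add: cinner_minus_left)

lemma cinner_diff_right: "cinner (z :: 'a::chilbert_space) (x - y) = cinner z x - cinner z y"
  using cinner_add_right[of z x "-y"] by (simp add: cinner_minus_right)

lemma cinner_sum_left: "cinner (\<Sum>i\<in>A. f i) (y :: 'a::chilbert_space) = (\<Sum>i\<in>A. cinner (f i) y)"
  by (induction A rule: infinite_finite_induct) (auto simp: cinner_add_left)

lemma cinner_sum_right: "cinner (y :: 'a::chilbert_space) (\<Sum>i\<in>A. f i) = (\<Sum>i\<in>A. cinner y (f i))"
  by (induction A rule: infinite_finite_induct) (auto simp: cinner_add_right)

lemma cinner_same: "cinner x x = complex_of_real ((norm (x :: 'a::chilbert_space))\<^sup>2)"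
proof -
  have "Im (cinner x x) = 0"
    using arg_cong[OF cinner_commute[of x x], of Im] by simp
  moreover have "Re (cinner x x) = (norm x)\<^sup>2"
    by (metis inner_eq_Re_cinner power2_norm_eq_inner)
  ultimately show ?thesis by (simp add: complex_eq_iff)
qed

lemma norm_scaleC: "norm (c *\<^sub>C (x :: 'a::chilbert_space)) = cmod c * norm x"
proof -
  have "complex_of_real ((norm (c *\<^sub>C x))\<^sup>2) = c * cnj c * of_real ((norm x)\<^sup>2)"
    unfolding cinner_same[symmetric] by (simp add: cinner_scaleC_left cinner_scaleC_right)
  also have "\<dots> = of_real ((cmod c * norm x)\<^sup>2)"
    unfolding complex_norm_square[symmetric] power_mult_distrib of_real_mult ..
  finally have "(norm (c *\<^sub>C x))\<^sup>2 = (cmod c * norm x)\<^sup>2"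
    using of_real_eq_iff by blast
  then show ?thesis by (simp add: power2_eq_iff_nonneg)
qed

subsection \<open>Orthonormal bases\<close>

definition is_onb :: "'a::chilbert_space set \<Rightarrow> bool" where
  "is_onb B \<longleftrightarrow> (\<forall>x\<in>B. norm x = 1) \<and> (\<forall>x\<in>B. \<forall>y\<in>B. x \<noteq> y \<longrightarrow> cinner x y = 0)
     \<and> (\<forall>x. (\<forall>b\<in>B. cinner x b = 0) \<longrightarrow> x = 0)"

definition onb :: "'a::chilbert_space set" where
  "onb = (SOME B. is_onb B)"

lemma ex_onb: "\<exists>B :: 'a::chilbert_space set. is_onb B"
proof -
  define S where "S = {B :: 'a set. (\<forall>x\<in>B. norm x = 1) \<and> (\<forall>x\<in>B. \<forall>y\<in>B. x \<noteq> y \<longrightarrow> cinner x y = 0)}"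
  have "\<exists>M\<in>S. \<forall>X\<in>S. M \<subseteq> X \<longrightarrow> X = M"
  proof (rule subset_Zorn_nonempty)
    show "S \<noteq> {}" unfolding S_def by blast
    fix \<C> assume ne: "\<C> \<noteq> {}" and C: "subset.chain S \<C>"
    show "\<Union>\<C> \<in> S"
      unfolding S_def
    proof (intro CollectI conjI ballI impI)
      fix x assume "x \<in> \<Union>\<C>"
      then show "norm x = 1" using C by (auto simp: S_def subset.chain_def)
    next
      fix x y assume "x \<in> \<Union>\<C>" "y \<in> \<Union>\<C>" "x \<noteq> y"
      then obtain X Y where XY: "X \<in> \<C>" "Y \<in> \<C>" "x \<in> X" "y \<in> Y" by blast
      then have "X \<subseteq> Y \<or> Y \<subseteq> X" using C by (auto simp: subset_chain_def)
      then obtain Z where "Z \<in> \<C>" "x \<in> Z" "y \<in> Z" using XY by blast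
      moreover have "Z \<in> S" using C \<open>Z \<in> \<C>\<close> by (auto simp: subset_chain_def)
      ultimately show "cinner x y = 0" using \<open>x \<noteq> y\<close> by (auto simp: S_def)
    qed
  qed
  then obtain B where B: "B \<in> S" and max: "\<And>X. X \<in> S \<Longrightarrow> B \<subseteq> X \<Longrightarrow> X = B" by blast
  have "x = 0" if x: "\<forall>b\<in>B. cinner x b = 0" for x
  proof (rule ccontr)
    assume nz: "x \<noteq> 0"
    define u where "u = x /\<^sub>R norm x"
    have u: "norm u = 1" using nz by (simp add: u_def)
    have ub: "cinner u b = 0" "cinner b u = 0" if "b \<in> B" for b
    proof -
      show "cinner u b = 0"
        unfolding u_def scaleC_of_real[symmetric] using x that by (simp add: cinner_scaleC_left)
      then show "cinner b u = 0" by (metis cinner_commute complex_cnj_zero)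
    qed
    have "insert u B \<in> S" using B u ub by (auto simp: S_def)
    then have "u \<in> B" using max[of "insert u B"] by blast
    then have "cinner u u = 0" using ub by blast
    then show False using u by (simp add: cinner_same)
  qed
  then have "is_onb B" using B unfolding is_onb_def S_def by blast
  then show ?thesis ..
qed

lemma onb_is_onb: "is_onb (onb :: 'a::chilbert_space set)"
  unfolding onb_def by (rule someI_ex[OF ex_onb])

lemma norm_sum_onb:
  fixes B :: "'a::chilbert_space set"
  assumes "is_onb B" "finite F" "F \<subseteq> B"
  shows "(norm (\<Sum>b\<in>F. c b *\<^sub>C b))\<^sup>2 = (\<Sum>b\<in>F. (cmod (c b))\<^sup>2)"
proof -
  have o: "cinner b b' = (if b = b' then 1 else 0)" if "b \<in> F" "b' \<in> F" for b b'
    using assms that by (auto simp: is_onb_def cinner_same subset_iff)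
  have "complex_of_real ((norm (\<Sum>b\<in>F. c b *\<^sub>C b))\<^sup>2)
      = (\<Sum>b\<in>F. \<Sum>b'\<in>F. c b * (cnj (c b') * cinner b b'))"
    unfolding cinner_same[symmetric]
    unfolding cinner_sum_left cinner_scaleC_left
    by (simp add: cinner_sum_right cinner_scaleC_right sum_distrib_left)
  also have "\<dots> = (\<Sum>b\<in>F. \<Sum>b'\<in>F. if b = b' then c b * cnj (c b') else 0)"
    by (intro sum.cong refl) (simp add: o)
  also have "\<dots> = (\<Sum>b\<in>F. c b * cnj (c b))"
    using assms(2) by simp
  also have "\<dots> = of_real (\<Sum>b\<in>F. (cmod (c b))\<^sup>2)"
    unfolding complex_norm_square[symmetric] by simp
  finally show ?thesis using of_real_eq_iff by blast
qed

lemma bessel_onb: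
  fixes B :: "'a::chilbert_space set"
  assumes B: "is_onb B" and F: "finite F" "F \<subseteq> B"
  shows "(\<Sum>b\<in>F. (cmod (cinner x b))\<^sup>2) + (norm (x - (\<Sum>b\<in>F. cinner x b *\<^sub>C b)))\<^sup>2 = (norm x)\<^sup>2"
proof -
  let ?y = "\<Sum>b\<in>F. cinner x b *\<^sub>C b"
  let ?s = "\<Sum>b\<in>F. (cmod (cinner x b))\<^sup>2"
  have xy: "cinner x ?y = of_real ?s"
  proof -
    have "cinner x ?y = (\<Sum>b\<in>F. cinner x b * cnj (cinner x b))"
      unfolding cinner_sum_right cinner_scaleC_right by (simp only: mult.commute)
    then show ?thesis unfolding complex_norm_square[symmetric] by simp
  qed
  have yx: "cinner ?y x = of_real ?s"
    unfolding cinner_commute[of ?y x] xy by (rule complex_cnj_complex_of_real)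
  have yy: "cinner ?y ?y = of_real ?s"
    using norm_sum_onb[OF B F, of "cinner x"] by (simp add: cinner_same)
  have "cinner (x - ?y) (x - ?y) = cinner x x - of_real ?s - (of_real ?s - of_real ?s)"
    by (simp only: cinner_diff_left cinner_diff_right xy yx yy)
  then have "complex_of_real ((norm (x - ?y))\<^sup>2) = of_real ((norm x)\<^sup>2 - ?s)"
    by (simp only: cinner_same of_real_diff diff_self diff_0_right)
  then have "(norm (x - ?y))\<^sup>2 = (norm x)\<^sup>2 - ?s"
    by (rule of_real_eq_iff[THEN iffD1])
  then show ?thesis by simp
qed

lemma parseval_norm:
  fixes B :: "'a::chilbert_space set"
  assumes B: "is_onb B"
  shows "((\<lambda>b. (cmod (cinner x b))\<^sup>2) has_sum (norm x)\<^sup>2) B"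
proof -
  let ?f = "\<lambda>b. (cmod (cinner x b))\<^sup>2"
  have bes: "sum ?f F \<le> (norm x)\<^sup>2" if "finite F" "F \<subseteq> B" for F
    using bessel_onb[OF B that, of x] zero_le_power2[of "norm (x - (\<Sum>b\<in>F. cinner x b *\<^sub>C b))"]
    by linarith
  have summ: "?f summable_on B"
    by (rule nonneg_bdd_above_summable_on) (auto intro!: bdd_aboveI2 bes)
  define s where "s = infsum ?f B"
  have hs: "(?f has_sum s) B" using summ by (simp add: s_def)
  have sF: "sum ?f F \<le> s" if "finite F" "F \<subseteq> B" for F
    unfolding s_def by (rule finite_sum_le_infsum) (use summ that in auto)
  have "\<exists>F. finite F \<and> F \<subseteq> B \<and> s - e < sum ?f F" if "e > 0" for e
  proof -
    have "eventually (\<lambda>F. dist (sum ?f F) s < e) (finite_subsets_at_top B)"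
      using hs that unfolding has_sum_def by (rule tendstoD)
    then obtain F where "finite F" "F \<subseteq> B" "dist (sum ?f F) s < e"
      unfolding eventually_finite_subsets_at_top by blast
    then show ?thesis by (intro exI[of _ F]) (auto simp: dist_real_def)
  qed
  then have "\<forall>n. \<exists>F. finite F \<and> F \<subseteq> B \<and> s - 1 / real (Suc n) < sum ?f F"
    by simp
  then obtain G where G: "\<And>n. finite (G n)" "\<And>n. G n \<subseteq> B" "\<And>n. s - 1 / real (Suc n) < sum ?f (G n)"
    by metis
  define F where "F n = (\<Union>k\<le>n. G k)" for n
  have F: "finite (F n)" "F n \<subseteq> B" for n using G by (auto simp: F_def)
  have Fmono: "F m \<subseteq> F n" if "m \<le> n" for m n
    unfolding F_def using that by (intro UN_mono) auto
  have Fs: "s - 1 / real (Suc n) < sum ?f (F n)" for n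
  proof -
    have "sum ?f (G n) \<le> sum ?f (F n)"
      by (rule sum_mono2) (use F in \<open>auto simp: F_def\<close>)
    then show ?thesis using G(3)[of n] by linarith
  qed
  define y where "y n = (\<Sum>b\<in>F n. cinner x b *\<^sub>C b)" for n
  have yd: "(norm (y n - y m))\<^sup>2 < 1 / real (Suc m)" if "m \<le> n" for m n
  proof -
    have "y n - y m = (\<Sum>b\<in>F n - F m. cinner x b *\<^sub>C b)"
      unfolding y_def by (rule sum_diff[OF F(1) Fmono[OF that], symmetric])
    then have "(norm (y n - y m))\<^sup>2 = sum ?f (F n - F m)"
      by (simp only: norm_sum_onb[OF B finite_Diff[OF F(1)] order_trans[OF Diff_subset F(2)]])
    also have "\<dots> = sum ?f (F n) - sum ?f (F m)"
      by (rule sum_diff[OF F(1) Fmono[OF that]])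
    also have "\<dots> < 1 / real (Suc m)" using sF[OF F, of n] Fs[of m] by linarith
    finally show ?thesis .
  qed
  have "Cauchy y"
  proof (rule metric_CauchyI)
    fix e :: real assume e: "e > 0"
    obtain M where M: "1 / real (Suc M) < (e/2)\<^sup>2"
      using reals_Archimedean[of "(e/2)\<^sup>2"] e unfolding inverse_eq_divide by fastforce
    have near: "dist (y n) (y M) < e / 2" if "n \<ge> M" for n
    proof -
      have "(norm (y n - y M))\<^sup>2 < (e/2)\<^sup>2" using yd[OF that] M by linarith
      moreover have "0 \<le> e / 2" using e by simp
      ultimately have "norm (y n - y M) < e / 2" by (rule power_less_imp_less_base)
      then show ?thesis unfolding dist_norm .
    qed
    show "\<exists>M. \<forall>m\<ge>M. \<forall>n\<ge>M. dist (y m) (y n) < e"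
    proof (intro exI[of _ M] allI impI)
      fix m n assume "m \<ge> M" "n \<ge> M"
      then show "dist (y m) (y n) < e"
        using dist_triangle_half_l[OF near[of m] near[of n]] by simp
    qed
  qed
  then obtain z where z: "y \<longlonglongrightarrow> z" using Cauchy_convergent convergent_def by blast
  have orth: "cinner (x - z) b = 0" if b: "b \<in> B" for b
  proof -
    have lim: "(\<lambda>n. cinner (x - y n) b) \<longlonglongrightarrow> cinner (x - z) b"
    proof -
      have re: "(\<lambda>n. Re (cinner (x - y n) c)) \<longlonglongrightarrow> Re (cinner (x - z) c)" for c
        unfolding inner_eq_Re_cinner[symmetric] by (intro tendsto_intros z)
      have im: "Im (cinner w b) = Re (cinner w (\<i> *\<^sub>C b))" for w
        by (simp add: cinner_scaleC_right)
      show ?thesis unfolding tendsto_complex_iff im using re by blast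
    qed
    have yb: "cinner (y n) b = (if b \<in> F n then cinner x b else 0)" for n
    proof -
      have "cinner (y n) b = (\<Sum>b'\<in>F n. if b = b' then cinner x b' else 0)"
        unfolding y_def cinner_sum_left cinner_scaleC_left
      proof (rule sum.cong[OF refl])
        fix b' assume "b' \<in> F n"
        then have "b' \<in> B" using F by blast
        then have "cinner b' b = (if b = b' then 1 else 0)"
          using B b by (auto simp: is_onb_def cinner_same)
        then show "cinner x b' * cinner b' b = (if b = b' then cinner x b' else 0)" by simp
      qed
      then show ?thesis using F by simp
    qed
    have "eventually (\<lambda>n. cinner (x - y n) b = 0) sequentially"
    proof (cases "\<exists>k. b \<in> F k")
      case True
      then obtain k where k: "b \<in> F k" ..
      show ?thesis
        unfolding eventually_sequentially
        using Fmono k by (intro exI[of _ k]) (auto simp: cinner_diff_left yb)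
    next
      case False
      have "?f b < 1 / real (Suc n)" for n
      proof -
        have "sum ?f (insert b (F n)) = ?f b + sum ?f (F n)" using False F by simp
        moreover have "sum ?f (insert b (F n)) \<le> s" using F b by (intro sF) auto
        ultimately show ?thesis using Fs[of n] by linarith
      qed
      then have "\<not> ?f b > 0"
        using reals_Archimedean[of "?f b"] unfolding inverse_eq_divide by (meson less_asym)
      then have "cinner x b = 0" by simp
      then show ?thesis using False by (simp add: cinner_diff_left yb)
    qed
    then have "(\<lambda>n. cinner (x - y n) b) \<longlonglongrightarrow> 0" by (rule tendsto_eventually)
    then show ?thesis using LIMSEQ_unique[OF lim] by simp
  qed
  then have "x - z = 0" using B unfolding is_onb_def by blast
  then have yx: "y \<longlonglongrightarrow> x" using z by simp
  have ny: "(norm (y n))\<^sup>2 = sum ?f (F n)" for n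
    unfolding y_def by (rule norm_sum_onb[OF B F])
  have "(\<lambda>n. sum ?f (F n)) \<longlonglongrightarrow> (norm x)\<^sup>2"
    unfolding ny[symmetric] by (intro tendsto_intros yx)
  then have "(norm x)\<^sup>2 \<le> s" by (rule LIMSEQ_le_const2) (use sF F in blast)
  moreover have "s \<le> (norm x)\<^sup>2"
    unfolding s_def by (rule infsum_le_finite_sums[OF summ bes])
  ultimately show ?thesis using hs by simp
qed

lemma complex_polarization:
  "4 * (z * cnj w) = of_real ((cmod (z + w))\<^sup>2) - of_real ((cmod (z - w))\<^sup>2)
     + \<i> * of_real ((cmod (z + \<i> * w))\<^sup>2) - \<i> * of_real ((cmod (z - \<i> * w))\<^sup>2)"
  unfolding complex_norm_square by (simp add: algebra_simps)

lemma cinner_polarization: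
  fixes x y :: "'a::chilbert_space"
  shows "4 * cinner x y = of_real ((norm (x + y))\<^sup>2) - of_real ((norm (x - y))\<^sup>2)
     + \<i> * of_real ((norm (x + \<i> *\<^sub>C y))\<^sup>2) - \<i> * of_real ((norm (x - \<i> *\<^sub>C y))\<^sup>2)"
  unfolding cinner_same[symmetric] cinner_add_left cinner_add_right cinner_diff_left
    cinner_diff_right cinner_scaleC_left cinner_scaleC_right
  by (simp add: algebra_simps)

lemma parseval:
  fixes B :: "'a::chilbert_space set"
  assumes B: "is_onb B"
  shows "((\<lambda>b. cinner x b * cnj (cinner y b)) has_sum cinner x y) B"
proof -
  have h: "((\<lambda>b. complex_of_real ((cmod (cinner v b))\<^sup>2)) has_sum of_real ((norm v)\<^sup>2)) B" for v
    using has_sum_of_real[OF parseval_norm[OF B, of v]] .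
  have "((\<lambda>b. of_real ((cmod (cinner (x + y) b))\<^sup>2) + (- of_real ((cmod (cinner (x - y) b))\<^sup>2))
      + \<i> * of_real ((cmod (cinner (x + \<i> *\<^sub>C y) b))\<^sup>2) + (- (\<i> * of_real ((cmod (cinner (x - \<i> *\<^sub>C y) b))\<^sup>2))))
     has_sum (of_real ((norm (x + y))\<^sup>2) + (- of_real ((norm (x - y))\<^sup>2))
     + \<i> * of_real ((norm (x + \<i> *\<^sub>C y))\<^sup>2) + (- (\<i> * of_real ((norm (x - \<i> *\<^sub>C y))\<^sup>2))))) B"
    by (intro has_sum_add has_sum_cmult_right h has_sum_uminusI)
  then have "((\<lambda>b. 4 * (cinner x b * cnj (cinner y b))) has_sum 4 * cinner x y) B"
    unfolding cinner_polarization complex_polarization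
    by (simp add: cinner_add_left cinner_diff_left cinner_scaleC_left)
  from has_sum_cmult_right[OF this, of "1/4"] show ?thesis by simp
qed

subsection \<open>The Hilbert space tensor product\<close>

text \<open>
  With orthonormal bases \<open>B\<close> and \<open>C\<close> of the two factors, the tensor product is modelled as
  \<open>\<ell>\<^sup>2(B \<times> C)\<close>, and \<open>x \<otimes> y\<close> has the coordinates \<open>\<langle>x, b\<rangle> \<langle>y, c\<rangle>\<close>. The lemmas \<open>cinner_tensor\<close>
  and \<open>tensor_total\<close> below show that this is the Hilbert space tensor product: they determine
  it up to a unique unitary compatible with \<open>\<otimes>\<close>.
\<close>

definition ell2_on :: "'i set \<Rightarrow> ('i \<Rightarrow> complex) set" where
  "ell2_on I = {f. (\<forall>i. i \<notin> I \<longrightarrow> f i = 0) \<and> (\<lambda>i. (cmod (f i))\<^sup>2) summable_on UNIV}"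

lemma ell2_on_zero: "(\<lambda>i. 0) \<in> ell2_on I"
  by (simp add: ell2_on_def)

lemma ell2_on_scale: "f \<in> ell2_on I \<Longrightarrow> (\<lambda>i. c * f i) \<in> ell2_on I"
  by (auto simp: ell2_on_def norm_mult power_mult_distrib intro: summable_on_cmult_right)

lemma ell2_on_add:
  assumes "f \<in> ell2_on I" "g \<in> ell2_on I"
  shows "(\<lambda>i. f i + g i) \<in> ell2_on I"
proof -
  have "(\<lambda>i. 2 * (cmod (f i))\<^sup>2 + 2 * (cmod (g i))\<^sup>2) summable_on UNIV"
    using assms by (intro summable_on_add summable_on_cmult_right) (auto simp: ell2_on_def)
  moreover have "(cmod (f i + g i))\<^sup>2 \<le> 2 * (cmod (f i))\<^sup>2 + 2 * (cmod (g i))\<^sup>2" for i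
  proof -
    have "(cmod (f i + g i))\<^sup>2 \<le> (cmod (f i) + cmod (g i))\<^sup>2"
      by (intro power_mono norm_triangle_ineq) simp
    also have "\<dots> \<le> 2 * (cmod (f i))\<^sup>2 + 2 * (cmod (g i))\<^sup>2"
      using sum_squares_bound[of "cmod (f i)" "cmod (g i)"] by (simp add: power2_sum)
    finally show ?thesis .
  qed
  ultimately have "(\<lambda>i. (cmod (f i + g i))\<^sup>2) summable_on UNIV"
    by (rule summable_on_comparison_test) auto
  then show ?thesis using assms by (auto simp: ell2_on_def)
qed

lemma ell2_on_prod_summable:
  assumes "f \<in> ell2_on I" "g \<in> ell2_on I"
  shows "(\<lambda>i. f i * cnj (g i)) summable_on UNIV"
proof (rule abs_summable_summable, rule abs_summable_product)
  show "(\<lambda>i. norm (f i * f i)) summable_on UNIV" "(\<lambda>i. norm (cnj (g i) * cnj (g i))) summable_on UNIV"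
    using assms by (simp_all add: ell2_on_def norm_mult power2_eq_square)
qed

typedef (overloaded) ('a, 'b) htensor =
  "ell2_on (onb \<times> onb) :: ('a::chilbert_space \<times> 'b::chilbert_space \<Rightarrow> complex) set"
  by (rule exI[of _ "\<lambda>_. 0"]) (rule ell2_on_zero)

setup_lifting type_definition_htensor

instantiation htensor :: (chilbert_space, chilbert_space) real_inner
begin

lift_definition zero_htensor :: "('a, 'b) htensor" is "\<lambda>_. 0"
  by (rule ell2_on_zero)

lift_definition plus_htensor :: "('a, 'b) htensor \<Rightarrow> ('a, 'b) htensor \<Rightarrow> ('a, 'b) htensor"
  is "\<lambda>f g i. f i + g i"
  by (rule ell2_on_add)

lift_definition scaleR_htensor :: "real \<Rightarrow> ('a, 'b) htensor \<Rightarrow> ('a, 'b) htensor"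
  is "\<lambda>c f i. complex_of_real c * f i"
  by (rule ell2_on_scale)

lift_definition uminus_htensor :: "('a, 'b) htensor \<Rightarrow> ('a, 'b) htensor"
  is "\<lambda>f i. (-1) * f i"
  by (rule ell2_on_scale)

lift_definition inner_htensor :: "('a, 'b) htensor \<Rightarrow> ('a, 'b) htensor \<Rightarrow> real"
  is "\<lambda>f g. Re (\<Sum>\<^sub>\<infinity>i. f i * cnj (g i))" .

definition minus_htensor :: "('a, 'b) htensor \<Rightarrow> ('a, 'b) htensor \<Rightarrow> ('a, 'b) htensor" where
  "minus_htensor x y = x + - y"

definition norm_htensor :: "('a, 'b) htensor \<Rightarrow> real" where
  "norm_htensor x = sqrt (inner x x)"

definition sgn_htensor :: "('a, 'b) htensor \<Rightarrow> ('a, 'b) htensor" where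
  "sgn_htensor x = scaleR (inverse (norm x)) x"

definition dist_htensor :: "('a, 'b) htensor \<Rightarrow> ('a, 'b) htensor \<Rightarrow> real" where
  "dist_htensor x y = norm (x - y)"

definition uniformity_htensor :: "(('a, 'b) htensor \<times> ('a, 'b) htensor) filter" where
  "uniformity_htensor = (INF e\<in>{0<..}. principal {(x, y). dist x y < e})"

definition open_htensor :: "('a, 'b) htensor set \<Rightarrow> bool" where
  "open_htensor U \<longleftrightarrow> (\<forall>x\<in>U. eventually (\<lambda>(x', y). x' = x \<longrightarrow> y \<in> U) uniformity)"

lemma htensor_inner_same: "inner x x = (\<Sum>\<^sub>\<infinity>i. (cmod (Rep_htensor x i))\<^sup>2)"
  for x :: "('a, 'b) htensor"
proof -
  have "(\<Sum>\<^sub>\<infinity>i. Rep_htensor x i * cnj (Rep_htensor x i))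
      = (\<Sum>\<^sub>\<infinity>i. complex_of_real ((cmod (Rep_htensor x i))\<^sup>2))"
    unfolding complex_norm_square ..
  also have "\<dots> = of_real (\<Sum>\<^sub>\<infinity>i. (cmod (Rep_htensor x i))\<^sup>2)"
    by (rule infsumI, rule has_sum_of_real)
      (use Rep_htensor[of x] in \<open>simp add: ell2_on_def\<close>)
  finally show ?thesis by (simp add: inner_htensor.rep_eq)
qed

lemma htensor_sum_le: "finite F \<Longrightarrow> (\<Sum>i\<in>F. (cmod (Rep_htensor x i))\<^sup>2) \<le> inner x x"
  for x :: "('a, 'b) htensor"
  unfolding htensor_inner_same
  by (rule finite_sum_le_infsum) (use Rep_htensor[of x] in \<open>auto simp: ell2_on_def\<close>)

instance
proof
  fix x y z :: "('a, 'b) htensor" and a b :: real and U :: "('a, 'b) htensor set"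
  show "x + y + z = x + (y + z)" by transfer (simp add: add.assoc)
  show "x + y = y + x" by transfer (simp add: add.commute)
  show "0 + x = x" by transfer simp
  show "- x + x = 0" by transfer simp
  show "x - y = x + - y" by (rule minus_htensor_def)
  show "a *\<^sub>R (x + y) = a *\<^sub>R x + a *\<^sub>R y" by transfer (simp add: distrib_left)
  show "(a + b) *\<^sub>R x = a *\<^sub>R x + b *\<^sub>R x" by transfer (simp add: distrib_right)
  show "a *\<^sub>R b *\<^sub>R x = (a * b) *\<^sub>R x" by transfer (simp add: mult.assoc)
  show "1 *\<^sub>R x = x" by transfer simp
  show "sgn x = inverse (norm x) *\<^sub>R x" by (rule sgn_htensor_def)
  show "dist x y = norm (x - y)" by (rule dist_htensor_def)
  show "(uniformity :: (('a, 'b) htensor \<times> ('a, 'b) htensor) filter)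
      = (INF e\<in>{0<..}. principal {(x, y). dist x y < e})" by (rule uniformity_htensor_def)
  show "open U = (\<forall>x\<in>U. eventually (\<lambda>(x', y). x' = x \<longrightarrow> y \<in> U) uniformity)"
    by (rule open_htensor_def)
  have "(\<Sum>\<^sub>\<infinity>i. Rep_htensor x i * cnj (Rep_htensor y i))
      = (\<Sum>\<^sub>\<infinity>i. cnj (Rep_htensor y i * cnj (Rep_htensor x i)))"
    by (simp add: mult.commute)
  also have "\<dots> = cnj (\<Sum>\<^sub>\<infinity>i. Rep_htensor y i * cnj (Rep_htensor x i))"
    by (rule infsum_cnj)
  finally show "inner x y = inner y x" by (simp add: inner_htensor.rep_eq)
  show "inner (x + y) z = inner x z + inner y z"
    by transfer (simp add: distrib_right infsum_add ell2_on_prod_summable)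
  show "inner (a *\<^sub>R x) y = a * inner x y"
    by transfer (simp add: mult.assoc infsum_cmult_right')
  show "0 \<le> inner x x" unfolding htensor_inner_same by (rule infsum_nonneg) simp
  show "inner x x = 0 \<longleftrightarrow> x = 0"
  proof
    assume "inner x x = 0"
    then have "(cmod (Rep_htensor x i))\<^sup>2 \<le> 0" for i
      using htensor_sum_le[of "{i}" x] by simp
    then show "x = 0" by (simp add: Rep_htensor_inject[symmetric] zero_htensor.rep_eq fun_eq_iff)
  qed (simp add: htensor_inner_same zero_htensor.rep_eq)
  show "norm x = sqrt (inner x x)" by (rule norm_htensor_def)
qed

end

lemma htensor_diff_rep: "Rep_htensor (x - y) i = Rep_htensor x i - Rep_htensor y i"
  unfolding minus_htensor_def plus_htensor.rep_eq uminus_htensor.rep_eq by simp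

lemma htensor_sum_le_norm: "finite F \<Longrightarrow> (\<Sum>i\<in>F. (cmod (Rep_htensor x i))\<^sup>2) \<le> (norm x)\<^sup>2"
  using htensor_sum_le[of F x] by (simp add: power2_norm_eq_inner)

instantiation htensor :: (chilbert_space, chilbert_space) chilbert_space
begin

lift_definition scaleC_htensor :: "complex \<Rightarrow> ('a, 'b) htensor \<Rightarrow> ('a, 'b) htensor"
  is "\<lambda>c f i. c * f i"
  by (rule ell2_on_scale)

lift_definition cinner_htensor :: "('a, 'b) htensor \<Rightarrow> ('a, 'b) htensor \<Rightarrow> complex"
  is "\<lambda>f g. \<Sum>\<^sub>\<infinity>i. f i * cnj (g i)" .

instance
proof
  fix X :: "nat \<Rightarrow> ('a, 'b) htensor"
  assume X: "Cauchy X"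
  let ?r = "\<lambda>n i. Rep_htensor (X n) i"
  have comp: "cmod (?r m i - ?r n i) \<le> norm (X m - X n)" for m n i
    by (rule power2_le_imp_le)
       (use htensor_sum_le_norm[of "{i}" "X m - X n"] in \<open>simp_all add: htensor_diff_rep\<close>)
  have "Cauchy (\<lambda>n. ?r n i)" for i
  proof (rule metric_CauchyI)
    fix e :: real assume "e > 0"
    then obtain M where "\<forall>m\<ge>M. \<forall>n\<ge>M. dist (X m) (X n) < e"
      using metric_CauchyD[OF X] by blast
    then show "\<exists>M. \<forall>m\<ge>M. \<forall>n\<ge>M. dist (?r m i) (?r n i) < e"
      using le_less_trans[OF comp] unfolding dist_norm by blast
  qed
  then have "\<exists>l. (\<lambda>n. ?r n i) \<longlonglongrightarrow> l" for i
    using Cauchy_convergent convergent_def by blast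
  then obtain L where L: "\<And>i. (\<lambda>n. ?r n i) \<longlonglongrightarrow> L i" by metis
  have near: "\<exists>M. \<forall>m\<ge>M. \<forall>F. finite F \<longrightarrow> (\<Sum>i\<in>F. (cmod (?r m i - L i))\<^sup>2) \<le> e\<^sup>2"
    if e: "e > 0" for e :: real
  proof -
    obtain M where M: "\<And>m n. m \<ge> M \<Longrightarrow> n \<ge> M \<Longrightarrow> dist (X m) (X n) < e"
      using metric_CauchyD[OF X e] by blast
    have "(\<Sum>i\<in>F. (cmod (?r m i - L i))\<^sup>2) \<le> e\<^sup>2" if m: "m \<ge> M" and F: "finite F" for m F
    proof (rule LIMSEQ_le_const2)
      show "(\<lambda>n. \<Sum>i\<in>F. (cmod (?r m i - ?r n i))\<^sup>2) \<longlonglongrightarrow> (\<Sum>i\<in>F. (cmod (?r m i - L i))\<^sup>2)"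
        by (intro tendsto_intros L)
      have "(\<Sum>i\<in>F. (cmod (?r m i - ?r n i))\<^sup>2) \<le> e\<^sup>2" if "n \<ge> M" for n
      proof -
        have "(\<Sum>i\<in>F. (cmod (?r m i - ?r n i))\<^sup>2) \<le> (norm (X m - X n))\<^sup>2"
          using htensor_sum_le_norm[OF F, of "X m - X n"] by (simp add: htensor_diff_rep)
        also have "\<dots> \<le> e\<^sup>2"
          using M[OF m that] by (intro power_mono) (auto simp: dist_norm)
        finally show ?thesis .
      qed
      then show "\<exists>N. \<forall>n\<ge>N. (\<Sum>i\<in>F. (cmod (?r m i - ?r n i))\<^sup>2) \<le> e\<^sup>2" by blast
    qed
    then show ?thesis by blast
  qed
  have supp: "?r n i = 0" if "i \<notin> onb \<times> onb" for n i
    using Rep_htensor[of "X n"] that unfolding ell2_on_def by blast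
  have Lsupp: "L i = 0" if "i \<notin> onb \<times> onb" for i
    using LIMSEQ_unique[OF L[of i], of 0] supp[OF that] by simp
  obtain M1 where M1: "\<And>F. finite F \<Longrightarrow> (\<Sum>i\<in>F. (cmod (?r M1 i - L i))\<^sup>2) \<le> 1"
    using near[of 1] by (metis le_refl one_power2 zero_less_one)
  have d: "(\<lambda>i. ?r M1 i - L i) \<in> ell2_on (onb \<times> onb)"
    unfolding ell2_on_def using supp Lsupp
    by (auto intro!: nonneg_bdd_above_summable_on bdd_aboveI2[where M = 1] M1)
  have Lmem: "L \<in> ell2_on (onb \<times> onb)"
    using ell2_on_add[OF Rep_htensor[of "X M1"] ell2_on_scale[OF d, of "-1"]] by simp
  have "X \<longlonglongrightarrow> Abs_htensor L"
  proof (rule metric_LIMSEQ_I)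
    fix e :: real assume e: "e > 0"
    obtain M where M: "\<And>m F. m \<ge> M \<Longrightarrow> finite F \<Longrightarrow> (\<Sum>i\<in>F. (cmod (?r m i - L i))\<^sup>2) \<le> (e/2)\<^sup>2"
      using near[of "e/2"] half_gt_zero[OF e] by blast
    have "dist (X m) (Abs_htensor L) < e" if m: "m \<ge> M" for m
    proof -
      have r: "Rep_htensor (X m - Abs_htensor L) i = ?r m i - L i" for i
        using Lmem by (simp add: htensor_diff_rep Abs_htensor_inverse)
      have "(\<lambda>i. (cmod (?r m i - L i))\<^sup>2) summable_on UNIV"
        using Rep_htensor[of "X m - Abs_htensor L"] by (simp add: ell2_on_def r)
      then have "inner (X m - Abs_htensor L) (X m - Abs_htensor L) \<le> (e/2)\<^sup>2"
        unfolding htensor_inner_same r by (rule infsum_le_finite_sums) (rule M[OF m])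
      then have "(norm (X m - Abs_htensor L))\<^sup>2 \<le> (e/2)\<^sup>2"
        unfolding power2_norm_eq_inner .
      then have "norm (X m - Abs_htensor L) \<le> e / 2"
        by (rule power2_le_imp_le) (use e in simp)
      then show ?thesis using e unfolding dist_norm by linarith
    qed
    then show "\<exists>M. \<forall>n\<ge>M. dist (X n) (Abs_htensor L) < e" by blast
  qed
  then show "convergent X" unfolding convergent_def by blast
next
  fix x y z :: "('a, 'b) htensor" and a :: real and c d :: complex
  note eqI = Rep_htensor_inject[THEN iffD1, OF ext]
  note rep = plus_htensor.rep_eq scaleC_htensor.rep_eq scaleR_htensor.rep_eq
  show "c *\<^sub>C (x + y) = c *\<^sub>C x + c *\<^sub>C y"
    by (rule eqI) (simp only: rep distrib_left)
  show "(c + d) *\<^sub>C x = c *\<^sub>C x + d *\<^sub>C x"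
    by (rule eqI) (simp only: rep distrib_right)
  show "c *\<^sub>C d *\<^sub>C x = (c * d) *\<^sub>C x"
    by (rule eqI) (simp only: rep mult.assoc)
  show "complex_of_real a *\<^sub>C x = a *\<^sub>R x"
    by (rule eqI) (simp only: rep)
  have "cinner x y = (\<Sum>\<^sub>\<infinity>i. cnj (Rep_htensor y i * cnj (Rep_htensor x i)))"
    by (simp add: cinner_htensor.rep_eq mult.commute)
  also have "\<dots> = cnj (cinner y x)"
    unfolding cinner_htensor.rep_eq by (rule infsum_cnj)
  finally show "cinner x y = cnj (cinner y x)" .
  show "cinner (x + y) z = cinner x z + cinner y z"
    by transfer (simp add: distrib_right infsum_add ell2_on_prod_summable)
  show "cinner (c *\<^sub>C x) y = c * cinner x y"
    by transfer (simp add: mult.assoc infsum_cmult_right')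
  show "inner x y = Re (cinner x y)" by transfer simp
qed

end

lemma onb_tensor_coords:
  fixes x :: "'a::chilbert_space" and y :: "'b::chilbert_space"
  shows "(\<lambda>(b, c). if b \<in> onb \<and> c \<in> onb then cinner x b * cinner y c else 0) \<in> ell2_on (onb \<times> onb)"
proof -
  have "(\<lambda>b. (cmod (cinner x b))\<^sup>2 * (norm y)\<^sup>2) summable_on onb"
    using has_sum_cmult_left[OF parseval_norm[OF onb_is_onb]] by (rule has_sum_imp_summable)
  then have "(\<lambda>(b, c). (cmod (cinner x b))\<^sup>2 * (cmod (cinner y c))\<^sup>2) summable_on (onb \<times> onb)"
    by (rule summable_on_SigmaI[rotated])
       (auto intro!: has_sum_cmult_right parseval_norm onb_is_onb)
  then have "(\<lambda>i. (cmod (case i of (b, c) \<Rightarrow> if b \<in> onb \<and> c \<in> onb then cinner x b * cinner y c else 0))\<^sup>2)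
      summable_on UNIV"
    by (subst summable_on_cong_neutral[where T = "onb \<times> onb" and
          g = "\<lambda>(b, c). (cmod (cinner x b))\<^sup>2 * (cmod (cinner y c))\<^sup>2"])
       (auto simp: norm_mult power_mult_distrib split: if_splits)
  then show ?thesis by (auto simp: ell2_on_def)
qed

lift_definition tensor :: "'a::chilbert_space \<Rightarrow> 'b::chilbert_space \<Rightarrow> ('a, 'b) htensor"  (infixr "\<otimes>\<^sub>h" 70)
  is "\<lambda>x y (b, c). if b \<in> onb \<and> c \<in> onb then cinner x b * cinner y c else 0"
  by (rule onb_tensor_coords)

lemma cinner_tensor: "cinner (x \<otimes>\<^sub>h y) (x' \<otimes>\<^sub>h y') = cinner x x' * cinner y y'"
proof -
  define f where "f = (\<lambda>i. Rep_htensor (x \<otimes>\<^sub>h y) i * cnj (Rep_htensor (x' \<otimes>\<^sub>h y') i))"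
  let ?A = "\<lambda>b. cinner x b * cnj (cinner x' b)" and ?B = "\<lambda>c. cinner y c * cnj (cinner y' c)"
  have fS: "f summable_on UNIV"
    unfolding f_def by (rule ell2_on_prod_summable) (rule Rep_htensor)+
  have fh: "(f has_sum infsum f UNIV) (onb \<times> onb)"
    using has_sum_infsum[OF fS]
    by (subst has_sum_cong_neutral[where T = UNIV and g = f]) (auto simp: f_def tensor.rep_eq split: if_splits)
  have "((\<lambda>b. ?A b * cinner y y') has_sum infsum f UNIV) onb"
  proof (rule has_sum_SigmaD[OF fh])
    fix b :: 'a assume "b \<in> onb"
    have "((\<lambda>c. ?A b * ?B c) has_sum ?A b * cinner y y') onb"
      by (rule has_sum_cmult_right[OF parseval[OF onb_is_onb]])
    then show "((\<lambda>c. f (b, c)) has_sum ?A b * cinner y y') onb"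
      by (rule has_sum_cong[THEN iffD1, rotated])
         (use \<open>b \<in> onb\<close> in \<open>simp add: f_def tensor.rep_eq\<close>)
  qed
  moreover have "((\<lambda>b. ?A b * cinner y y') has_sum cinner x x' * cinner y y') onb"
    by (rule has_sum_cmult_left[OF parseval[OF onb_is_onb]])
  ultimately have "infsum f UNIV = cinner x x' * cinner y y'" by (rule has_sum_unique)
  then show ?thesis by (simp add: cinner_htensor.rep_eq f_def)
qed

lemma tensor_total:
  fixes z :: "('a::chilbert_space, 'b::chilbert_space) htensor"
  assumes "\<And>x y. cinner z (x \<otimes>\<^sub>h y) = 0"
  shows "z = 0"
proof -
  have "Rep_htensor z (b, c) = 0" for b c
  proof (cases "b \<in> onb \<and> c \<in> onb")
    case True
    have d: "cinner e e' = (if e = e' then 1 else 0)" if "e \<in> onb" "e' \<in> onb"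
      for e e' :: "'e::chilbert_space"
      using onb_is_onb[where 'a = 'e] that by (auto simp: is_onb_def cinner_same)
    have "Rep_htensor (b \<otimes>\<^sub>h c) i = (if i = (b, c) then 1 else 0)" for i
      using True by (cases i) (auto simp: tensor.rep_eq d)
    then have "cinner z (b \<otimes>\<^sub>h c) = (\<Sum>\<^sub>\<infinity>i. if i = (b, c) then Rep_htensor z i else 0)"
      unfolding cinner_htensor.rep_eq by (intro infsum_cong) simp
    also have "\<dots> = (\<Sum>\<^sub>\<infinity>i\<in>{(b, c)}. Rep_htensor z i)"
      by (rule infsum_cong_neutral) auto
    finally show ?thesis using assms by simp
  next
    case False
    then show ?thesis using Rep_htensor[of z] by (auto simp: ell2_on_def)
  qed
  then show ?thesis by (simp add: Rep_htensor_inject[symmetric] zero_htensor.rep_eq fun_eq_iff)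
qed

section \<open>Operators and von Neumann algebras\<close>

type_synonym 'a op = "'a \<Rightarrow> 'a"

definition bounded_ops :: "'a::chilbert_space op set" where
  "bounded_ops = {a. bounded_linear a \<and> (\<forall>c x. a (c *\<^sub>C x) = c *\<^sub>C a x)}"

definition op_add :: "'a::chilbert_space op \<Rightarrow> 'a op \<Rightarrow> 'a op" where
  "op_add a b = (\<lambda>h. a h + b h)"

definition op_scale :: "complex \<Rightarrow> 'a::chilbert_space op \<Rightarrow> 'a op" where
  "op_scale c a = (\<lambda>h. c *\<^sub>C a h)"

definition adj :: "'a::chilbert_space op \<Rightarrow> 'a op" where
  "adj a = (THE b. \<forall>x y. cinner (a x) y = cinner x (b y))"

definition commutant :: "'a::chilbert_space op set \<Rightarrow> 'a op set" where
  "commutant S = {b \<in> bounded_ops. \<forall>a\<in>S. a \<circ> b = b \<circ> a}"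

definition von_neumann_algebra :: "'a::chilbert_space op set \<Rightarrow> bool" where
  "von_neumann_algebra M \<longleftrightarrow>
     M \<subseteq> bounded_ops \<and> id \<in> M
     \<and> (\<forall>a\<in>M. \<forall>b\<in>M. op_add a b \<in> M \<and> a \<circ> b \<in> M)
     \<and> (\<forall>c. \<forall>a\<in>M. op_scale c a \<in> M)
     \<and> (\<forall>a\<in>M. adj a \<in> M)
     \<and> commutant (commutant M) = M"

definition factor :: "'a::chilbert_space op set \<Rightarrow> bool" where
  "factor M \<longleftrightarrow> von_neumann_algebra M \<and> (id :: 'a op) \<noteq> (\<lambda>_. 0)
     \<and> M \<inter> commutant M = range (\<lambda>c. op_scale c id)"

subsection \<open>Type II1\<close>

definition projections :: "'a::chilbert_space op set \<Rightarrow> 'a op set" where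
  "projections M = {p \<in> M. p \<circ> p = p \<and> adj p = p}"

definition mvn_equiv :: "'a::chilbert_space op set \<Rightarrow> 'a op \<Rightarrow> 'a op \<Rightarrow> bool" where
  "mvn_equiv M p q \<longleftrightarrow> (\<exists>v\<in>M. adj v \<circ> v = p \<and> v \<circ> adj v = q)"

text \<open>For projections, \<open>q \<le> p\<close> is written \<open>p \<circ> q = q\<close>.\<close>

definition finite_projection :: "'a::chilbert_space op set \<Rightarrow> 'a op \<Rightarrow> bool" where
  "finite_projection M p \<longleftrightarrow> p \<in> projections M
     \<and> (\<forall>q\<in>projections M. p \<circ> q = q \<and> mvn_equiv M p q \<longrightarrow> q = p)"

definition abelian_projection :: "'a::chilbert_space op set \<Rightarrow> 'a op \<Rightarrow> bool" where
  "abelian_projection M p \<longleftrightarrow> p \<in> projections M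
     \<and> (\<forall>a\<in>M. \<forall>b\<in>M. (p \<circ> a \<circ> p) \<circ> (p \<circ> b \<circ> p) = (p \<circ> b \<circ> p) \<circ> (p \<circ> a \<circ> p))"

text \<open>
  Type II requires in addition that every nonzero central projection dominates a nonzero finite
  one; as the unit is finite, so is every projection, and this holds automatically.
\<close>

definition type_II1 :: "'a::chilbert_space op set \<Rightarrow> bool" where
  "type_II1 M \<longleftrightarrow> von_neumann_algebra M \<and> finite_projection M id
     \<and> (\<forall>p. abelian_projection M p \<longrightarrow> p = (\<lambda>_. 0))"

subsection \<open>Injectivity\<close>

text \<open>Injectivity: existence of a norm one projection from all bounded operators onto \<open>M\<close>.\<close>

definition injective_vna :: "'a::chilbert_space op set \<Rightarrow> bool" where
  "injective_vna M \<longleftrightarrow> (\<exists>E :: 'a op \<Rightarrow> 'a op.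
     (\<forall>a\<in>bounded_ops. \<forall>b\<in>bounded_ops. E (op_add a b) = op_add (E a) (E b))
     \<and> (\<forall>c. \<forall>a\<in>bounded_ops. E (op_scale c a) = op_scale c (E a))
     \<and> (\<forall>a\<in>bounded_ops. E a \<in> M \<and> onorm (E a) \<le> onorm a)
     \<and> (\<forall>a\<in>M. E a = a))"

subsection \<open>Standard form\<close>

text \<open>
  \<open>M\<close> is in standard form (Haagerup) if there are an antiunitary involution \<open>J\<close> and a self-dual
  cone \<open>P\<close> with \<open>J M J = M'\<close>, \<open>J z J = z\<^sup>*\<close> for central \<open>z\<close>, \<open>J\<close> trivial on \<open>P\<close>, and
  \<open>a J a J P \<subseteq> P\<close> for \<open>a \<in> M\<close>. Self-duality includes that \<open>P\<close> is a closed convex cone.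
\<close>

definition antiunitary_involution :: "'a::chilbert_space op \<Rightarrow> bool" where
  "antiunitary_involution J \<longleftrightarrow> (\<forall>x y. J (x + y) = J x + J y) \<and> (\<forall>c x. J (c *\<^sub>C x) = cnj c *\<^sub>C J x)
     \<and> (\<forall>x y. cinner (J x) (J y) = cinner y x) \<and> (\<forall>x. J (J x) = x)"

definition self_dual_cone :: "'a::chilbert_space set \<Rightarrow> bool" where
  "self_dual_cone P \<longleftrightarrow> P = {x. \<forall>y\<in>P. Im (cinner x y) = 0 \<and> Re (cinner x y) \<ge> 0}"

definition standard_form :: "'a::chilbert_space op set \<Rightarrow> bool" where
  "standard_form M \<longleftrightarrow> von_neumann_algebra M \<and>
     (\<exists>J P. antiunitary_involution J \<and> self_dual_cone P
        \<and> (\<lambda>a. J \<circ> a \<circ> J) ` M = commutant M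
        \<and> (\<forall>z\<in>M \<inter> commutant M. J \<circ> z \<circ> J = adj z)
        \<and> (\<forall>x\<in>P. J x = x)
        \<and> (\<forall>a\<in>M. (a \<circ> J \<circ> a \<circ> J) ` P \<subseteq> P))"

section \<open>Normal functionals and the predual\<close>

text \<open>The initial topology on \<open>X\<close> for a family \<open>F\<close> of complex functions.\<close>

definition sigma_topology :: "'x set \<Rightarrow> ('x \<Rightarrow> complex) set \<Rightarrow> 'x topology" where
  "sigma_topology X F =
     topology_generated_by (insert X {{x \<in> X. f x \<in> U} |f U. f \<in> F \<and> open U})"

definition ultraweak_topology :: "'a::chilbert_space op set \<Rightarrow> 'a op topology" where
  "ultraweak_topology M = sigma_topology M
     {(\<lambda>a. \<Sum>n. cinner (a (\<xi> n)) (\<eta> n)) |\<xi> \<eta> :: nat \<Rightarrow> 'a.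
        summable (\<lambda>n. (norm (\<xi> n))\<^sup>2) \<and> summable (\<lambda>n. (norm (\<eta> n))\<^sup>2)}"

text \<open>The predual consists of the normal, i.e. ultraweakly continuous, linear functionals.\<close>

definition predual :: "'a::chilbert_space op set \<Rightarrow> ('a op \<Rightarrow> complex) set" where
  "predual M = {f \<in> extensional M.
     (\<forall>a\<in>M. \<forall>b\<in>M. f (op_add a b) = f a + f b) \<and> (\<forall>c. \<forall>a\<in>M. f (op_scale c a) = c * f a)
     \<and> continuous_map (ultraweak_topology M) euclidean f}"

section \<open>The spatial tensor product\<close>

definition op_tensor ::
    "'a::chilbert_space op \<Rightarrow> 'b::chilbert_space op \<Rightarrow> ('a, 'b) htensor op" where
  "op_tensor a b = (THE t. t \<in> bounded_ops \<and> (\<forall>\<xi> \<eta>. t (\<xi> \<otimes>\<^sub>h \<eta>) = a \<xi> \<otimes>\<^sub>h b \<eta>))"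

definition vn_tensor ::
    "'a::chilbert_space op set \<Rightarrow> 'b::chilbert_space op set \<Rightarrow> ('a, 'b) htensor op set" where
  "vn_tensor M N = commutant (commutant {op_tensor a b |a b. a \<in> M \<and> b \<in> N})"

section \<open>Operator space structures\<close>

text \<open>
  The norm of the matrix \<open>(a\<^sub>i\<^sub>j)\<close>, with indices in the finite set \<open>I\<close>, as an operator on the
  direct sum of copies of the Hilbert space. Scalar matrices act on copies of \<open>\<complex>\<close>.
\<close>

definition opmat_norm :: "'i set \<Rightarrow> ('i \<Rightarrow> 'i \<Rightarrow> 'a::real_normed_vector \<Rightarrow> 'a) \<Rightarrow> real" where
  "opmat_norm I a = Sup {sqrt (\<Sum>i\<in>I. (norm (\<Sum>j\<in>I. a i j (\<xi> j)))\<^sup>2) |\<xi>.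
     (\<Sum>j\<in>I. (norm (\<xi> j))\<^sup>2) \<le> 1}"

definition cmat_norm :: "'i set \<Rightarrow> ('i \<Rightarrow> 'i \<Rightarrow> complex) \<Rightarrow> real" where
  "cmat_norm I c = opmat_norm I (\<lambda>i j z. c i j * z)"

definition mats :: "'x set \<Rightarrow> nat \<Rightarrow> (nat \<Rightarrow> nat \<Rightarrow> 'x) set" where
  "mats X n = {x. \<forall>i<n. \<forall>j<n. x i j \<in> X}"

text \<open>
  The norm of \<open>M\<^sub>n(N\<^sub>*)\<close>: a matrix \<open>(f\<^sub>i\<^sub>j)\<close> has the completely bounded norm of
  \<open>y \<mapsto> (f\<^sub>i\<^sub>j(y))\<close> from \<open>N\<close> to \<open>M\<^sub>n\<close>. The \<open>m\<close>-th amplification of that map sends \<open>(y\<^sub>k\<^sub>l)\<close> to the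
  scalar matrix \<open>(f\<^sub>i\<^sub>j(y\<^sub>k\<^sub>l))\<close> with rows \<open>(i, k)\<close> and columns \<open>(j, l)\<close>.
\<close>

definition predual_mat_norm ::
    "'b::chilbert_space op set \<Rightarrow> nat \<Rightarrow> (nat \<Rightarrow> nat \<Rightarrow> 'b op \<Rightarrow> complex) \<Rightarrow> real" where
  "predual_mat_norm N n f =
     Sup {cmat_norm ({..<n} \<times> {..<m}) (\<lambda>(i, k) (j, l). f i j (y k l)) |m y.
       y \<in> mats N m \<and> opmat_norm {..<m} y \<le> 1}"

subsection \<open>Completely bounded maps into the predual\<close>

definition linear_into_predual ::
    "'a::chilbert_space op set \<Rightarrow> 'b::chilbert_space op set \<Rightarrow> ('a op \<Rightarrow> 'b op \<Rightarrow> complex) set" where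
  "linear_into_predual M N = {\<phi> \<in> M \<rightarrow>\<^sub>E predual N.
     (\<forall>a\<in>M. \<forall>b\<in>M. \<forall>y\<in>N. \<phi> (op_add a b) y = \<phi> a y + \<phi> b y)
     \<and> (\<forall>c. \<forall>a\<in>M. \<forall>y\<in>N. \<phi> (op_scale c a) y = c * \<phi> a y)}"

definition CB ::
    "'a::chilbert_space op set \<Rightarrow> 'b::chilbert_space op set \<Rightarrow> ('a op \<Rightarrow> 'b op \<Rightarrow> complex) set" where
  "CB M N = {\<phi> \<in> linear_into_predual M N. \<exists>C. \<forall>n. \<forall>x\<in>mats M n.
     predual_mat_norm N n (\<lambda>i j. \<phi> (x i j)) \<le> C * opmat_norm {..<n} x}"

definition cb_norm ::
    "'a::chilbert_space op set \<Rightarrow> 'b::chilbert_space op set \<Rightarrow> ('a op \<Rightarrow> 'b op \<Rightarrow> complex) \<Rightarrow> real" where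
  "cb_norm M N \<phi> = Sup {predual_mat_norm N n (\<lambda>i j. \<phi> (x i j)) |n x.
     x \<in> mats M n \<and> opmat_norm {..<n} x \<le> 1}"

text \<open>Normality: continuity from \<open>\<sigma>(M, M\<^sub>*)\<close> to \<open>\<sigma>(N\<^sub>*, N)\<close>.\<close>

definition normal_map ::
    "'a::chilbert_space op set \<Rightarrow> 'b::chilbert_space op set \<Rightarrow> ('a op \<Rightarrow> 'b op \<Rightarrow> complex) \<Rightarrow> bool" where
  "normal_map M N \<phi> \<longleftrightarrow> continuous_map (sigma_topology M (predual M))
     (sigma_topology (predual N) {(\<lambda>f. f y) |y. y \<in> N}) \<phi>"

definition CB_normal ::
    "'a::chilbert_space op set \<Rightarrow> 'b::chilbert_space op set \<Rightarrow> ('a op \<Rightarrow> 'b op \<Rightarrow> complex) set" where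
  "CB_normal M N = {\<phi> \<in> CB M N. normal_map M N \<phi>}"

subsection \<open>The operator space projective tensor product and its image\<close>

text \<open>
  The algebraic tensor product of the preduals embeds into the maps \<open>M \<rightarrow> N\<^sub>*\<close>, with \<open>\<mu> \<otimes> \<nu>\<close> acting
  as \<open>x \<mapsto> \<mu>(x) \<nu>\<close>. This embedding is injective, so algebraic tensors are identified with their
  images.
\<close>

definition alg_tensor ::
    "'a::chilbert_space op set \<Rightarrow> 'b::chilbert_space op set \<Rightarrow> ('a op \<Rightarrow> 'b op \<Rightarrow> complex) set" where
  "alg_tensor M N = {(\<lambda>x\<in>M. \<lambda>y\<in>N. \<Sum>i<k. \<mu> i x * \<nu> i y) |(k::nat) \<mu> \<nu>.
     (\<forall>i<k. \<mu> i \<in> predual M \<and> \<nu> i \<in> predual N)}"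

text \<open>
  The operator space projective norm of \<open>u \<in> M\<^sub>* \<odot> N\<^sub>*\<close> is the infimum of
  \<open>\<parallel>\<alpha>\<parallel> \<parallel>f\<parallel> \<parallel>g\<parallel> \<parallel>\<beta>\<parallel>\<close> over all factorizations \<open>u = \<alpha> (f \<otimes> g) \<beta>\<close> with \<open>f \<in> M\<^sub>p(M\<^sub>*)\<close>,
  \<open>g \<in> M\<^sub>q(N\<^sub>*)\<close>, a row \<open>\<alpha>\<close> and a column \<open>\<beta>\<close> of length \<open>p q\<close>.
\<close>

definition proj_norm ::
    "'a::chilbert_space op set \<Rightarrow> 'b::chilbert_space op set \<Rightarrow> ('a op \<Rightarrow> 'b op \<Rightarrow> complex) \<Rightarrow> real" where
  "proj_norm M N u = Inf {sqrt (\<Sum>i<p. \<Sum>k<q. (cmod (\<alpha> i k))\<^sup>2) * predual_mat_norm M p f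
       * predual_mat_norm N q g * sqrt (\<Sum>j<p. \<Sum>l<q. (cmod (\<beta> j l))\<^sup>2) |
     (p::nat) (q::nat) (\<alpha> :: nat \<Rightarrow> nat \<Rightarrow> complex) f g (\<beta> :: nat \<Rightarrow> nat \<Rightarrow> complex).
     f \<in> mats (predual M) p \<and> g \<in> mats (predual N) q
     \<and> (\<forall>x\<in>M. \<forall>y\<in>N. u x y =
          (\<Sum>i<p. \<Sum>j<p. \<Sum>k<q. \<Sum>l<q. \<alpha> i k * (f i j x * g k l y) * \<beta> j l))}"

text \<open>
  The canonical map is contractive from the projective norm to the cb-norm, so the image of the
  completion consists of the cb-norm limits of the sequences of algebraic tensors that are Cauchy
  in the projective norm.
\<close>

definition Nor ::
    "'a::chilbert_space op set \<Rightarrow> 'b::chilbert_space op set \<Rightarrow> ('a op \<Rightarrow> 'b op \<Rightarrow> complex) set" where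
  "Nor M N = {\<phi> \<in> CB M N. \<exists>u :: nat \<Rightarrow> 'a op \<Rightarrow> 'b op \<Rightarrow> complex.
     (\<forall>n. u n \<in> alg_tensor M N)
     \<and> (\<forall>e>0. \<exists>K. \<forall>m\<ge>K. \<forall>n\<ge>K. proj_norm M N (\<lambda>x y. u m x y - u n x y) < e)
     \<and> (\<lambda>n. cb_norm M N (\<lambda>x y. u n x y - \<phi> x y)) \<longlonglongrightarrow> 0}"

section \<open>The vector forms\<close>

definition vector_form ::
    "'a::chilbert_space op set \<Rightarrow> 'a op set \<Rightarrow> 'a \<Rightarrow> 'a op \<Rightarrow> 'a op \<Rightarrow> complex" where
  "vector_form M N \<xi> = (\<lambda>x\<in>M. \<lambda>y\<in>N. cinner (x (y \<xi>)) \<xi>)"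

definition extends_normally ::
    "'a::chilbert_space op set \<Rightarrow> 'b::chilbert_space op set \<Rightarrow> ('a op \<Rightarrow> 'b op \<Rightarrow> complex) \<Rightarrow> bool" where
  "extends_normally M N \<phi> \<longleftrightarrow>
     (\<exists>\<omega>\<in>predual (vn_tensor M N). \<forall>x\<in>M. \<forall>y\<in>N. \<omega> (op_tensor x y) = \<phi> x y)"

end

theory Submission
  imports Defs
begin

text \<open>
  Suppose that for one unit vector \<open>\<xi>\<close> the form \<open>x \<otimes> y \<mapsto> \<langle>x y \<xi>, \<xi>\<rangle>\<close> extends to a normal functional
  \<open>\<Sum>\<langle>\<sqdot> \<zeta>\<^sub>n, \<eta>\<^sub>n\<rangle>\<close> on the tensor product. Then \<open>\<parallel>\<pi>(a) \<xi>\<parallel> \<le> \<parallel>a \<chi>\<parallel>\<close> with \<open>\<pi>(x \<otimes> y) = x y\<close> and a vector \<open>\<chi>\<close> in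
  a multiple of \<open>H \<otimes> H\<close>, so the adjoint of \<open>a \<chi> \<mapsto> \<pi>(a) \<xi>\<close> is an intertwiner \<open>T\<close> from \<open>H\<close> to that multiple.
  Since \<open>M\<close> is a factor, \<open>T\<^sup>* T\<close> is a scalar, and \<open>t \<mapsto> T\<^sup>* (t \<otimes> 1) T\<close> is, after normalization, a
  projection of norm one onto \<open>M\<close>, against the hypothesis that \<open>M\<close> is not injective.

  Elements of \<open>Nor\<close> do extend normally, because the projective norm of an algebraic tensor dominates
  the norm of its functional on the tensor product and preduals are norm closed. Closedness comes
  from \<open>M\<^sub>* = B(H)\<^sub>* / M\<^sub>\<bottom>\<close>: a Hahn-Banach functional on the normal functionals of \<open>M\<close> is evaluation
  at an operator in \<open>M'' = M\<close>.
\<close>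

text \<open>The extended functional is given by two unrelated sequences, and no positive
  representative is extracted from it. The orbit therefore carries \<open>a Z\<close> and
  \<open>a E\<close> side by side, and \<open>Z + E\<close> takes the place of a single cyclic
  vector. \<open>T\<close> has to intertwine both actions: with \<open>M\<close> and
  \<open>N\<close> together, \<open>T^* T\<close> becomes central; the \<open>N\<close>-part pushes
  every compression into \<open>N' = M\<close>; the \<open>M\<close>-part makes the compression a
  multiple of the identity on \<open>M\<close>.

  On the side of \<open>Nor\<close>, all norms are bare \<open>Sup\<close> and \<open>Inf\<close> of
  sets of reals, which say nothing until the sets are known to be bounded or nonempty; this is the
  purpose of the crude entrywise estimates next to the sharp ones. The norm of a normal functional
  is an infimum over representing sequences. Once this infimum is bounded by the supremum over the
  unit ball, a convergent series of functionals is handled by concatenating representations. Matrix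
  norms over a predual are tested on finite matrices only, so operators on a tensor product are read
  through finite orthonormal families in the second leg.\<close>

lemma norm_cinner_le: "cmod (cinner x y) \<le> norm x * norm (y :: 'a::chilbert_space)"
proof -
  \<comment> \<open>The phase \<open>c\<close> makes the inner product real and nonnegative, so that
    the Cauchy-Schwarz inequality of the underlying real inner product applies.\<close>
  obtain c where c: "cmod c = 1" "c * cinner x y = of_real (cmod (cinner x y))"
  proof (cases "cinner x y = 0")
    case True
    then show ?thesis using that[of 1] by simp
  next
    case False
    have "cnj (cinner x y) / of_real (cmod (cinner x y)) * cinner x y = of_real (cmod (cinner x y))"
      using False complex_norm_square[of "cinner x y"] by (simp add: power2_eq_square field_simps)
    then show ?thesis
      using that[of "cnj (cinner x y) / of_real (cmod (cinner x y))"] False by (simp add: norm_divide)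
  qed
  have "cmod (cinner x y) = inner (c *\<^sub>C x) y"
    unfolding inner_eq_Re_cinner cinner_scaleC_left c(2) by simp
  also have "\<dots> \<le> norm (c *\<^sub>C x) * norm y" by (rule norm_cauchy_schwarz)
  finally show ?thesis by (simp add: norm_scaleC c(1))
qed

lemma cinner_scaleR_left: "cinner (r *\<^sub>R x) y = of_real r * cinner x (y :: 'a::chilbert_space)"
  by (simp add: scaleC_of_real[symmetric] cinner_scaleC_left)

lemma cinner_scaleR_right: "cinner x (r *\<^sub>R y) = of_real r * cinner x (y :: 'a::chilbert_space)"
  by (simp add: scaleC_of_real[symmetric] cinner_scaleC_right)

lemma bounded_bilinear_cinner: "bounded_bilinear (cinner :: 'a::chilbert_space \<Rightarrow> _)"
proof
  show "\<exists>K. \<forall>a b :: 'a. cmod (cinner a b) \<le> norm a * norm b * K"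
    by (rule exI[of _ 1]) (simp add: norm_cinner_le)
qed (auto simp: cinner_add_left cinner_add_right cinner_scaleR_left cinner_scaleR_right scaleR_conv_of_real)

lemmas tendsto_cinner = bounded_bilinear.tendsto[OF bounded_bilinear_cinner]

lemma cinner_ext:
  fixes x y :: "'a::chilbert_space"
  assumes "\<And>w. cinner x w = cinner y w"
  shows "x = y"
proof -
  have "cinner (x - y) (x - y) = 0" by (simp add: cinner_diff_left assms)
  then show ?thesis by (simp add: cinner_same)
qed

lemma cinner_ext_right:
  fixes x y :: "'a::chilbert_space"
  assumes "\<And>w. cinner w x = cinner w y"
  shows "x = y"
  by (rule cinner_ext) (metis assms cinner_commute)

lemma norm_le_from_cinner:
  fixes x :: "'a::chilbert_space"
  assumes "C \<ge> 0" "\<And>w. cmod (cinner x w) \<le> C * norm w"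
  shows "norm x \<le> C"
proof (cases "norm x = 0")
  case False
  have "norm x * norm x \<le> C * norm x"
    using assms(2)[of x] unfolding cinner_same norm_of_real by (simp add: power2_eq_square)
  then show ?thesis using False by simp
qed (use assms in simp)

lemma scaleC_zero_right [simp]: "c *\<^sub>C (0 :: 'a::chilbert_space) = 0"
  using scaleC_add_right[of c 0 "0 :: 'a"] by simp

lemma scaleC_zero_left [simp]: "0 *\<^sub>C (x :: 'a::chilbert_space) = 0"
  using scaleC_of_real[of 0 x] by simp

lemma scaleC_one [simp]: "1 *\<^sub>C (x :: 'a::chilbert_space) = x"
  using scaleC_of_real[of 1 x] by simp

lemma scaleC_minus_one: "(-1) *\<^sub>C (x :: 'a::chilbert_space) = - x"
  using scaleC_of_real[of "-1" x] by simp

lemma scaleC_sum_right: "c *\<^sub>C (\<Sum>i\<in>A. f i) = (\<Sum>i\<in>A. c *\<^sub>C (f i :: 'a::chilbert_space))"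
  by (induction A rule: infinite_finite_induct) (auto simp: scaleC_add_right)

subsection \<open>Riesz representation\<close>

text \<open>The vector is the limit of a sequence in \<open>S\<close> minimizing \<open>\<parallel>s\<parallel>\<^sup>2 - 2 Re (l s)\<close>.\<close>

lemma riesz_on_subspace:
  fixes S :: "'a::chilbert_space set" and l :: "'a \<Rightarrow> complex"
  assumes S0: "0 \<in> S" and Sadd: "\<And>s t. s \<in> S \<Longrightarrow> t \<in> S \<Longrightarrow> s + t \<in> S"
    and Ssc: "\<And>c s. s \<in> S \<Longrightarrow> c *\<^sub>C s \<in> S"
    and ladd: "\<And>s t. s \<in> S \<Longrightarrow> t \<in> S \<Longrightarrow> l (s + t) = l s + l t"
    and lsc: "\<And>c s. s \<in> S \<Longrightarrow> l (c *\<^sub>C s) = c * l s"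
    and lb: "\<And>s. s \<in> S \<Longrightarrow> cmod (l s) \<le> C * norm s"
  shows "\<exists>u\<in>closure S. \<forall>s\<in>S. cinner s u = l s"
proof -
  define J where "J s = (norm s)\<^sup>2 - 2 * Re (l s)" for s
  have Ssr: "r *\<^sub>R s \<in> S" if "s \<in> S" for r s using Ssc[OF that, of "of_real r"] by (simp add: scaleC_of_real)
  have lsr: "l (r *\<^sub>R s) = of_real r * l s" if "s \<in> S" for r s
    using lsc[OF that, of "of_real r"] by (simp add: scaleC_of_real)
  have Jlow: "- C\<^sup>2 \<le> J s" if "s \<in> S" for s
  proof -
    have "Re (l s) \<le> C * norm s" using lb[OF that] complex_Re_le_cmod[of "l s"] by linarith
    then have "J s \<ge> (norm s)\<^sup>2 - 2 * (C * norm s)" by (simp add: J_def)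
    moreover have "(norm s - C)\<^sup>2 \<ge> 0" by simp
    ultimately show ?thesis by (simp add: power2_diff algebra_simps)
  qed
  define m where "m = Inf (J ` S)"
  have mle: "m \<le> J s" if "s \<in> S" for s
    unfolding m_def by (rule cInf_lower) (use that Jlow in \<open>auto intro!: bdd_belowI2\<close>)
  have "\<exists>s\<in>S. J s < m + 1 / real (Suc n)" for n
  proof -
    have "Inf (J ` S) < m + 1 / real (Suc n)" unfolding m_def[symmetric] by simp
    then show ?thesis using cInf_lessD[of "J ` S"] S0 by blast
  qed
  then obtain s where sS: "\<And>n. s n \<in> S" and sJ: "\<And>n. J (s n) < m + 1 / real (Suc n)" by metis
  \<comment> \<open>The midpoint of two near-minimizers lies in \<open>S\<close>, so
    \<open>J\<close> is at least \<open>m\<close> there; the parallelogram law turns this into a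
    bound on their distance.\<close>
  have sd: "(norm (s n - s k))\<^sup>2 \<le> 2 / real (Suc n) + 2 / real (Suc k)" for n k
  proof -
    have mid: "(1/2) *\<^sub>R (s n + s k) \<in> S" using Ssr Sadd sS by blast
    have "J ((1/2) *\<^sub>R (s n + s k)) = (norm (s n + s k))\<^sup>2 / 4 - (Re (l (s n)) + Re (l (s k)))"
      unfolding J_def lsr[OF Sadd[OF sS sS]] ladd[OF sS sS]
      by (simp add: power_mult_distrib power_divide add_divide_distrib)
    with mle[OF mid] have "4 * m \<le> (norm (s n + s k))\<^sup>2 - 4 * (Re (l (s n)) + Re (l (s k)))" by simp
    moreover have "(norm (s n + s k))\<^sup>2 + (norm (s n - s k))\<^sup>2 = 2 * (norm (s n))\<^sup>2 + 2 * (norm (s k))\<^sup>2"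
      by (simp add: power2_norm_eq_inner inner_add_left inner_add_right inner_diff_left inner_diff_right inner_commute)
    moreover have "2 * J (s n) + 2 * J (s k) < 4 * m + 2 * (1 / real (Suc n)) + 2 * (1 / real (Suc k))"
      using sJ[of n] sJ[of k] by linarith
    ultimately show ?thesis unfolding J_def by simp
  qed
  have "Cauchy s"
  proof (rule metric_CauchyI)
    fix e :: real assume e: "e > 0"
    obtain M where M: "1 / real (Suc M) < e\<^sup>2 / 4"
      using reals_Archimedean[of "e\<^sup>2/4"] e unfolding inverse_eq_divide by fastforce
    show "\<exists>M. \<forall>m\<ge>M. \<forall>n\<ge>M. dist (s m) (s n) < e"
    proof (intro exI[of _ M] allI impI)
      fix p q assume pq: "p \<ge> M" "q \<ge> M"
      have "1 / real (Suc p) \<le> 1 / real (Suc M)" "1 / real (Suc q) \<le> 1 / real (Suc M)"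
        using pq by (auto intro!: divide_left_mono)
      then have "(norm (s p - s q))\<^sup>2 < e\<^sup>2" using sd[of p q] M by simp
      then show "dist (s p) (s q) < e" using e unfolding dist_norm by (simp add: power_less_imp_less_base)
    qed
  qed
  then obtain u where u: "s \<longlonglongrightarrow> u" using Cauchy_convergent convergent_def by blast
  have Jlim: "(\<lambda>n. J (s n)) \<longlonglongrightarrow> m"
  proof (rule tendsto_sandwich[of "\<lambda>_. m" _ _ "\<lambda>n. m + 1 / real (Suc n)"])
    show "(\<lambda>n. m + 1 / real (Suc n)) \<longlonglongrightarrow> m"
      using tendsto_add[OF tendsto_const LIMSEQ_inverse_real_of_nat, of m] by (simp add: inverse_eq_divide)
  qed (use mle sS sJ in \<open>auto simp: less_imp_le\<close>)
  have re: "Re (cinner d u) = Re (l d)" if d: "d \<in> S" for d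
  proof -
    define q where "q = inner u d - Re (l d)"
    define D where "D = (norm d)\<^sup>2"
    have D0: "D \<ge> 0" by (simp add: D_def)
    \<comment> \<open>The limit \<open>u\<close> need not lie in \<open>S\<close>, so the variation
      \<open>e *\<^sub>R d\<close> is applied to the minimizing sequence and the inequality is
      passed to the limit.\<close>
    have var: "0 \<le> 2 * e * q + e\<^sup>2 * D" for e
    proof -
      have "m \<le> J (s n) + 2 * e * (inner (s n) d - Re (l d)) + e\<^sup>2 * D" for n
      proof -
        have "s n + e *\<^sub>R d \<in> S" using Sadd Ssr sS d by blast
        moreover have "(norm (s n + e *\<^sub>R d))\<^sup>2 = (norm (s n))\<^sup>2 + 2 * e * inner (s n) d + e\<^sup>2 * (norm d)\<^sup>2"
          unfolding power2_norm_eq_inner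
          by (simp add: inner_add_left inner_add_right inner_commute power2_eq_square algebra_simps)
        moreover have "Re (l (s n + e *\<^sub>R d)) = Re (l (s n)) + e * Re (l d)"
          using ladd[OF sS Ssr[OF d]] lsr[OF d] by simp
        ultimately show ?thesis using mle[of "s n + e *\<^sub>R d"] unfolding J_def D_def by (simp add: algebra_simps)
      qed
      moreover have "(\<lambda>n. J (s n) + 2 * e * (inner (s n) d - Re (l d)) + e\<^sup>2 * D)
          \<longlonglongrightarrow> m + 2 * e * (inner u d - Re (l d)) + e\<^sup>2 * D"
        by (intro tendsto_intros Jlim u)
      ultimately have "m \<le> m + 2 * e * (inner u d - Re (l d)) + e\<^sup>2 * D"
        by (intro LIMSEQ_le_const) auto
      then show ?thesis by (simp add: q_def)
    qed
    have "q = 0"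
    proof (rule ccontr)
      assume "q \<noteq> 0"
      \<comment> \<open>The optimal \<open>e\<close> would be \<open>- q / D\<close>; the
        denominator \<open>D + 1\<close> avoids division by zero and still makes the quadratic
        negative.\<close>
      have "2 * (- q / (D + 1)) * q + (- q / (D + 1))\<^sup>2 * D = - (q\<^sup>2 * (D + 2)) / (D + 1)\<^sup>2"
        using D0 by (simp add: power2_eq_square divide_simps) (simp add: algebra_simps)
      also have "\<dots> < 0" using \<open>q \<noteq> 0\<close> D0 by (intro divide_neg_pos) auto
      finally show False using var[of "- q / (D + 1)"] by linarith
    qed
    then have "inner d u = Re (l d)" unfolding q_def inner_commute[of u d] by simp
    then show ?thesis unfolding inner_eq_Re_cinner .
  qed
  have "cinner d u = l d" if d: "d \<in> S" for d
  proof (rule complex_eqI)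
    show "Re (cinner d u) = Re (l d)" by (rule re[OF d])
    show "Im (cinner d u) = Im (l d)"
      using re[OF Ssc[OF d, of "\<i>"]] lsc[OF d, of "\<i>"] by (simp add: cinner_scaleC_left)
  qed
  moreover have "u \<in> closure S" unfolding closure_sequential using sS u by blast
  ultimately show ?thesis by blast
qed

lemma closure_sequenceE:
  fixes u :: "'a::metric_space"
  assumes "u \<in> closure S"
  obtains s where "\<And>n. s n \<in> S" "s \<longlonglongrightarrow> u"
proof -
  from assms obtain s where "\<forall>n. s n \<in> S" "s \<longlonglongrightarrow> u" unfolding closure_sequential by blast
  then show thesis by (intro that) auto
qed

lemma closure_orthogonal_zero:
  fixes u :: "'a::chilbert_space"
  assumes "u \<in> closure S" "\<And>s. s \<in> S \<Longrightarrow> cinner s u = 0"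
  shows "u = 0"
proof -
  obtain s where s: "\<And>n. s n \<in> S" "s \<longlonglongrightarrow> u" using closure_sequenceE[OF assms(1)] by blast
  have "(\<lambda>n. cinner (s n) u) \<longlonglongrightarrow> cinner u u" by (intro tendsto_cinner s tendsto_const)
  then have "(\<lambda>n::nat. 0::complex) \<longlonglongrightarrow> cinner u u" using assms(2) s(1) by simp
  then have "cinner u u = 0" by (simp add: LIMSEQ_const_iff)
  then show ?thesis by (simp add: cinner_same)
qed

section \<open>Bounded complex-linear maps between two Hilbert spaces and their adjoints\<close>

definition cblinear :: "('a::chilbert_space \<Rightarrow> 'b::chilbert_space) \<Rightarrow> bool" where
  "cblinear f \<longleftrightarrow> bounded_linear f \<and> (\<forall>c x. f (c *\<^sub>C x) = c *\<^sub>C f x)"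

lemma bounded_ops_iff: "a \<in> bounded_ops \<longleftrightarrow> cblinear a"
  by (simp add: bounded_ops_def cblinear_def)

lemma cblinearI:
  assumes "\<And>x y. f (x + y) = f x + f y" "\<And>c x. f (c *\<^sub>C x) = c *\<^sub>C f x" "\<And>x. norm (f x) \<le> norm x * K"
  shows "cblinear f"
  unfolding cblinear_def
  by (auto intro!: bounded_linear_intro assms simp: scaleC_of_real[symmetric])

lemma cblinear_simps:
  assumes "cblinear f"
  shows "f (x + y) = f x + f y" "f (x - y) = f x - f y" "f (- x) = - f x" "f 0 = 0"
    "f (c *\<^sub>C x) = c *\<^sub>C f x" "f (r *\<^sub>R x) = r *\<^sub>R f x" "f (\<Sum>i\<in>A. g i) = (\<Sum>i\<in>A. f (g i))"
proof -
  have l: "linear f" and c: "\<And>c x. f (c *\<^sub>C x) = c *\<^sub>C f x"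
    using assms unfolding cblinear_def by (auto intro: bounded_linear.linear)
  show "f (x + y) = f x + f y" "f (x - y) = f x - f y" "f (- x) = - f x" "f 0 = 0"
    "f (c *\<^sub>C x) = c *\<^sub>C f x" "f (r *\<^sub>R x) = r *\<^sub>R f x" "f (\<Sum>i\<in>A. g i) = (\<Sum>i\<in>A. f (g i))"
    by (rule linear_add[OF l] linear_diff[OF l] linear_neg[OF l] linear_0[OF l] c linear_scale[OF l] linear_sum[OF l])+
qed

lemma cblinear_bounded_linear: "cblinear f \<Longrightarrow> bounded_linear f" by (simp add: cblinear_def)

lemma cblinear_norm_le: "cblinear f \<Longrightarrow> norm (f x) \<le> onorm f * norm x"
  by (simp add: cblinear_def onorm)

lemma onorm_nonneg: "cblinear f \<Longrightarrow> 0 \<le> onorm f" by (simp add: cblinear_def onorm_pos_le)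

lemma cblinear_compose: "cblinear f \<Longrightarrow> cblinear g \<Longrightarrow> cblinear (\<lambda>x. f (g x))"
  unfolding cblinear_def by (auto intro: bounded_linear_compose)

lemma cblinear_add: "cblinear f \<Longrightarrow> cblinear g \<Longrightarrow> cblinear (\<lambda>x. f x + g x)"
  unfolding cblinear_def by (auto intro: bounded_linear_add simp: scaleC_add_right)

lemma cblinear_scaleC:
  assumes f: "cblinear f"
  shows "cblinear (\<lambda>x. c *\<^sub>C f x)"
proof (rule cblinearI[where K = "cmod c * onorm f"])
  fix x
  show "norm (c *\<^sub>C f x) \<le> norm x * (cmod c * onorm f)"
    using mult_left_mono[OF cblinear_norm_le[OF f, of x] norm_ge_zero[of c]] by (simp add: norm_scaleC ac_simps)
qed (auto simp: cblinear_simps[OF f] scaleC_add_right scaleC_scaleC mult.commute)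

lemma cblinear_id: "cblinear (\<lambda>x. x)" unfolding cblinear_def by auto

lemma cblinear_zero: "cblinear (\<lambda>x. 0)" unfolding cblinear_def by auto

text \<open>Operators known only through their matrix coefficients all come from here: adjoints, the
  operator behind a Hahn-Banach functional, \<open>(f \<otimes> id)(a)\<close>, \<open>T^* T\<close>
  and the final projection. Riesz is applied to the conjugate of the form, which is linear in
  \<open>w\<close>.\<close>

lemma sesquilinear_rep:
  fixes B :: "'a::chilbert_space \<Rightarrow> 'b::chilbert_space \<Rightarrow> complex"
  assumes add1: "\<And>v v' w. B (v + v') w = B v w + B v' w"
    and add2: "\<And>v w w'. B v (w + w') = B v w + B v w'"
    and sc1: "\<And>c v w. B (c *\<^sub>C v) w = c * B v w"
    and sc2: "\<And>c v w. B v (c *\<^sub>C w) = cnj c * B v w"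
    and bd: "\<And>v w. cmod (B v w) \<le> C * norm v * norm w" and C: "C \<ge> 0"
  obtains A where "cblinear A" "\<And>v w. cinner (A v) w = B v w" "\<And>v. norm (A v) \<le> C * norm v"
proof -
  have "\<exists>u. \<forall>w. cinner u w = B v w" for v
  proof -
    have "\<exists>u\<in>closure UNIV. \<forall>w\<in>UNIV. cinner w u = cnj (B v w)"
      by (rule riesz_on_subspace[where C = "C * norm v"]) (auto simp: add2 sc2 bd)
    then obtain u where "\<And>w. cinner w u = cnj (B v w)" by blast
    then have "cinner u w = B v w" for w by (metis cinner_commute complex_cnj_cnj)
    then show ?thesis by blast
  qed
  then obtain A where A: "\<And>v w. cinner (A v) w = B v w" by metis
  have n: "norm (A v) \<le> C * norm v" for v
    by (rule norm_le_from_cinner) (use C bd[of v] in \<open>simp_all add: A\<close>)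
  have "cblinear A"
  proof (rule cblinearI)
    show "A (x + y) = A x + A y" for x y by (rule cinner_ext) (simp add: A add1 cinner_add_left)
    show "A (c *\<^sub>C x) = c *\<^sub>C A x" for c x by (rule cinner_ext) (simp add: A sc1 cinner_scaleC_left)
    show "norm (A x) \<le> norm x * C" for x using n[of x] by (simp add: mult.commute)
  qed
  then show thesis using that A n by blast
qed

lemma cblinear_adjoint:
  fixes f :: "'a::chilbert_space \<Rightarrow> 'b::chilbert_space"
  assumes "cblinear f"
  obtains g where "cblinear g" "\<And>x y. cinner (f x) y = cinner x (g y)" "\<And>y. norm (g y) \<le> onorm f * norm y"
proof -
  have bd: "cmod (cinner v (f w)) \<le> onorm f * norm v * norm w" for v w
    using norm_cinner_le[of v "f w"] mult_left_mono[OF cblinear_norm_le[OF assms, of w] norm_ge_zero[of v]]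
    by (simp add: ac_simps)
  obtain g where g: "cblinear g" "\<And>v w. cinner (g v) w = cinner v (f w)" "\<And>v. norm (g v) \<le> onorm f * norm v"
    by (rule sesquilinear_rep[of "\<lambda>v w. cinner v (f w)" "onorm f"])
       (use assms bd onorm_nonneg in \<open>auto simp: cinner_add_left cinner_add_right cinner_scaleC_left
          cinner_scaleC_right cblinear_simps[OF assms]\<close>)
  have "cinner (f x) y = cinner x (g y)" for x y using g(2)[of y x] by (metis cinner_commute)
  then show thesis using that g by blast
qed

lemma adj_exists:
  assumes "a \<in> bounded_ops"
  shows "adj a \<in> bounded_ops" "cinner (a x) y = cinner x (adj a y)" "cinner (adj a x) y = cinner x (a y)"
    "onorm (adj a) \<le> onorm a"
proof -
  obtain g where g: "cblinear g" "\<And>x y. cinner (a x) y = cinner x (g y)" "\<And>y. norm (g y) \<le> onorm a * norm y"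
    using cblinear_adjoint assms bounded_ops_iff by blast
  have "adj a = g" unfolding adj_def
  proof (rule the_equality)
    show "\<forall>x y. cinner (a x) y = cinner x (g y)" using g by blast
    fix b assume b: "\<forall>x y. cinner (a x) y = cinner x (b y)"
    show "b = g" by (rule ext, rule cinner_ext_right) (metis b g(2))
  qed
  then show "adj a \<in> bounded_ops" "cinner (a x) y = cinner x (adj a y)"
    using g by (simp_all add: bounded_ops_iff)
  show "cinner (adj a x) y = cinner x (a y)"
    unfolding \<open>adj a = g\<close> using g(2)[of y x] cinner_commute[of "g x" y] cinner_commute[of x "a y"] by simp
  have "0 \<le> onorm a" using assms onorm_nonneg by (simp add: bounded_ops_iff)
  then show "onorm (adj a) \<le> onorm a" unfolding \<open>adj a = g\<close> by (rule onorm_bound) (use g in auto)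
qed

section \<open>Bounded linear relations with a non-closed domain\<close>

lemma closure_subspace_combination:
  fixes S :: "'a::chilbert_space set"
  assumes add: "\<And>s t. s \<in> S \<Longrightarrow> t \<in> S \<Longrightarrow> s + t \<in> S" and sc: "\<And>c s. s \<in> S \<Longrightarrow> c *\<^sub>C s \<in> S"
    and a: "a \<in> closure S" and b: "b \<in> closure S"
  shows "c *\<^sub>C a + b \<in> closure S"
proof -
  obtain x where x: "\<And>n. x n \<in> S" "x \<longlonglongrightarrow> a" using closure_sequenceE[OF a] by blast
  obtain y where y: "\<And>n. y n \<in> S" "y \<longlonglongrightarrow> b" using closure_sequenceE[OF b] by blast
  have "(\<lambda>n. c *\<^sub>C x n + y n) \<longlonglongrightarrow> c *\<^sub>C a + b"
    by (intro tendsto_add y bounded_linear.tendsto[OF cblinear_bounded_linear[OF cblinear_scaleC[OF cblinear_id]] x(2)])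
  moreover have "c *\<^sub>C x n + y n \<in> S" for n by (intro add sc x(1) y(1))
  ultimately show ?thesis unfolding closure_sequential by (intro exI[of _ "\<lambda>n. c *\<^sub>C x n + y n"]) simp
qed

lemma closure_subspace_unique:
  fixes S :: "'a::chilbert_space set"
  assumes add: "\<And>s t. s \<in> S \<Longrightarrow> t \<in> S \<Longrightarrow> s + t \<in> S" and sc: "\<And>c s. s \<in> S \<Longrightarrow> c *\<^sub>C s \<in> S"
    and a: "a \<in> closure S" and b: "b \<in> closure S" and eq: "\<And>s. s \<in> S \<Longrightarrow> cinner s a = cinner s b"
  shows "a = b"
proof -
  have "(-1) *\<^sub>C b + a = 0"
  proof (rule closure_orthogonal_zero)
    show "(-1) *\<^sub>C b + a \<in> closure S" by (rule closure_subspace_combination) (fact add sc a b)+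
    show "cinner s ((-1) *\<^sub>C b + a) = 0" if "s \<in> S" for s
      using eq[OF that] by (simp add: cinner_add_right cinner_scaleC_right)
  qed
  then show ?thesis by (simp add: scaleC_minus_one)
qed

text \<open>Riesz on the domain of \<open>G\<close> gives each value of the adjoint separately.
  Choosing the value in the closure of the domain makes it unique, and linearity and the norm bound
  follow from this uniqueness and from approximation by domain vectors.\<close>

lemma relation_adjoint:
  fixes G :: "('a::chilbert_space \<times> 'b::chilbert_space) set"
  assumes zero: "(0, 0) \<in> G"
    and add: "\<And>d w d' w'. (d, w) \<in> G \<Longrightarrow> (d', w') \<in> G \<Longrightarrow> (d + d', w + w') \<in> G"
    and sc: "\<And>c d w. (d, w) \<in> G \<Longrightarrow> (c *\<^sub>C d, c *\<^sub>C w) \<in> G"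
    and bd: "\<And>d w. (d, w) \<in> G \<Longrightarrow> norm w \<le> C * norm d" and C: "C \<ge> 0"
  obtains T where "cblinear T" "\<And>v. T v \<in> closure (fst ` G)"
    "\<And>d w v. (d, w) \<in> G \<Longrightarrow> cinner d (T v) = cinner w v" "\<And>v. norm (T v) \<le> C * norm v"
proof -
  \<comment> \<open>The difference of the two pairs is \<open>(0, w - w')\<close>, which the bound
    forces to vanish: a bounded linear relation is the graph of a function.\<close>
  have fn: "w = w'" if "(d, w) \<in> G" "(d, w') \<in> G" for d w w'
    using bd[OF add[OF that(1) sc[OF that(2), of "-1"]]] by (simp add: scaleC_minus_one)
  define F where "F d = (SOME w. (d, w) \<in> G)" for d
  have FG: "(d, F d) \<in> G" if "d \<in> fst ` G" for d using that someI_ex[of "\<lambda>w. (d, w) \<in> G"] unfolding F_def by force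
  have Fe: "F d = w" if "(d, w) \<in> G" for d w using fn[OF FG that] that by force
  have dom: "0 \<in> fst ` G" "\<And>s t. s \<in> fst ` G \<Longrightarrow> t \<in> fst ` G \<Longrightarrow> s + t \<in> fst ` G"
    "\<And>c s. s \<in> fst ` G \<Longrightarrow> c *\<^sub>C s \<in> fst ` G"
    using zero add sc by (force, force, force)
  have "\<exists>u\<in>closure (fst ` G). \<forall>d\<in>fst ` G. cinner d u = cinner (F d) v" for v
  proof (rule riesz_on_subspace[where C = "C * norm v"])
    fix s t assume st: "s \<in> fst ` G" "t \<in> fst ` G"
    show "cinner (F (s + t)) v = cinner (F s) v + cinner (F t) v"
      using Fe[OF add[OF FG FG, OF st]] by (simp add: cinner_add_left)
  next
    fix c s assume s: "s \<in> fst ` G"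
    show "cinner (F (c *\<^sub>C s)) v = c * cinner (F s) v"
      using Fe[OF sc[OF FG[OF s]]] by (simp add: cinner_scaleC_left)
  next
    fix s assume s: "s \<in> fst ` G"
    show "cmod (cinner (F s) v) \<le> C * norm v * norm s"
      using norm_cinner_le[of "F s" v] mult_right_mono[OF bd[OF FG[OF s]] norm_ge_zero[of v]] by (simp add: ac_simps)
  qed (use dom in auto)
  then obtain T where T1: "\<And>v. T v \<in> closure (fst ` G)" and T2: "\<And>v d. d \<in> fst ` G \<Longrightarrow> cinner d (T v) = cinner (F d) v"
    by metis
  have T3: "cinner d (T v) = cinner w v" if "(d, w) \<in> G" for d w v
    using T2[of d v] Fe[OF that] that by force
  have clsub: "c *\<^sub>C a + b \<in> closure (fst ` G)" if "a \<in> closure (fst ` G)" "b \<in> closure (fst ` G)" for a b c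
    by (rule closure_subspace_combination) (fact dom that)+
  have uniq: "a = b" if "a \<in> closure (fst ` G)" "b \<in> closure (fst ` G)" "\<And>d w. (d, w) \<in> G \<Longrightarrow> cinner d a = cinner d b" for a b
  proof (rule closure_subspace_unique)
    show "cinner s a = cinner s b" if "s \<in> fst ` G" for s
      using that \<open>\<And>d w. (d, w) \<in> G \<Longrightarrow> cinner d a = cinner d b\<close> by force
  qed (fact dom that)+
  have cl0: "0 \<in> closure (fst ` G)" by (rule subsetD[OF closure_subset dom(1)])
  \<comment> \<open>\<open>T v\<close> is tested against domain vectors that converge to
    \<open>T v\<close> itself.\<close>
  have nT: "norm (T v) \<le> C * norm v" for v
  proof -
    obtain x where x: "\<And>n. x n \<in> fst ` G" "x \<longlonglongrightarrow> T v" using closure_sequenceE[OF T1[of v]] by blast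
    have "cmod (cinner (x n) (T v)) \<le> C * norm v * norm (x n)" for n
      using T2[OF x(1)[of n], of v] norm_cinner_le[of "F (x n)" v]
        mult_right_mono[OF bd[OF FG[OF x(1)[of n]]] norm_ge_zero[of v]] by (simp add: ac_simps)
    moreover have "(\<lambda>n. cmod (cinner (x n) (T v))) \<longlonglongrightarrow> cmod (cinner (T v) (T v))"
      by (intro tendsto_norm tendsto_cinner x tendsto_const)
    moreover have "(\<lambda>n. C * norm v * norm (x n)) \<longlonglongrightarrow> C * norm v * norm (T v)"
      by (intro tendsto_intros x)
    ultimately have "cmod (cinner (T v) (T v)) \<le> C * norm v * norm (T v)"
      using LIMSEQ_le by blast
    then have "norm (T v) * norm (T v) \<le> C * norm v * norm (T v)"
      unfolding cinner_same norm_of_real by (simp add: power2_eq_square)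
    then show ?thesis using C by (cases "norm (T v) = 0") auto
  qed
  have "cblinear T"
  proof (rule cblinearI)
    fix v w c
    show "T (v + w) = T v + T w"
      using clsub[OF T1 T1, of 1 v w] by (intro uniq) (simp_all add: T1 T3 cinner_add_right)
    show "T (c *\<^sub>C v) = c *\<^sub>C T v"
      using clsub[OF T1 cl0, of c v] by (intro uniq) (simp_all add: T1 T3 cinner_scaleC_right)
    show "norm (T v) \<le> norm v * C" using nT[of v] by (simp add: mult.commute)
  qed
  then show thesis using that T1 T3 nT by blast
qed

text \<open>The extension is the adjoint of the map from \<open>relation_adjoint\<close>; it is zero
  on the orthogonal complement of the domain.\<close>

lemma bounded_linear_relation_extension:
  fixes G :: "('a::chilbert_space \<times> 'b::chilbert_space) set"
  assumes "(0, 0) \<in> G"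
    and "\<And>d w d' w'. (d, w) \<in> G \<Longrightarrow> (d', w') \<in> G \<Longrightarrow> (d + d', w + w') \<in> G"
    and "\<And>c d w. (d, w) \<in> G \<Longrightarrow> (c *\<^sub>C d, c *\<^sub>C w) \<in> G"
    and "\<And>d w. (d, w) \<in> G \<Longrightarrow> norm w \<le> C * norm d" and "C \<ge> 0"
  obtains W where "cblinear W" "\<And>d w. (d, w) \<in> G \<Longrightarrow> W d = w" "\<And>d. norm (W d) \<le> C * norm d"
proof -
  obtain T where T: "cblinear T" "\<And>d w v. (d, w) \<in> G \<Longrightarrow> cinner d (T v) = cinner w v" "\<And>v. norm (T v) \<le> C * norm v"
    using relation_adjoint[OF assms] by metis
  obtain W where W: "cblinear W" "\<And>x y. cinner (T x) y = cinner x (W y)" "\<And>y. norm (W y) \<le> onorm T * norm y"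
    using cblinear_adjoint[OF T(1)] by metis
  have "onorm T \<le> C" by (rule onorm_bound[OF assms(5) T(3)])
  then have nW: "norm (W d) \<le> C * norm d" for d
    using W(3)[of d] mult_right_mono[of "onorm T" C "norm d"] by simp
  have "W d = w" if "(d, w) \<in> G" for d w
  proof (rule cinner_ext)
    fix v show "cinner (W d) v = cinner w v"
      using T(2)[OF that, of v] W(2)[of v d] by (metis cinner_commute)
  qed
  then show thesis using that W(1) nW by blast
qed

section \<open>Operators on the Hilbert space tensor product\<close>

lemma tensor_add_left: "(x + x') \<otimes>\<^sub>h y = x \<otimes>\<^sub>h y + x' \<otimes>\<^sub>h y"
proof -
  have "(x + x') \<otimes>\<^sub>h y - (x \<otimes>\<^sub>h y + x' \<otimes>\<^sub>h y) = 0"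
    by (rule tensor_total) (simp add: cinner_diff_left cinner_add_left cinner_tensor algebra_simps)
  then show ?thesis by simp
qed

lemma tensor_add_right: "x \<otimes>\<^sub>h (y + y') = x \<otimes>\<^sub>h y + x \<otimes>\<^sub>h y'"
proof -
  have "x \<otimes>\<^sub>h (y + y') - (x \<otimes>\<^sub>h y + x \<otimes>\<^sub>h y') = 0"
    by (rule tensor_total) (simp add: cinner_diff_left cinner_add_left cinner_tensor algebra_simps)
  then show ?thesis by simp
qed

lemma tensor_scaleC_left: "(c *\<^sub>C x) \<otimes>\<^sub>h y = c *\<^sub>C (x \<otimes>\<^sub>h y)"
proof -
  have "(c *\<^sub>C x) \<otimes>\<^sub>h y - c *\<^sub>C (x \<otimes>\<^sub>h y) = 0"
    by (rule tensor_total) (simp add: cinner_diff_left cinner_scaleC_left cinner_tensor)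
  then show ?thesis by simp
qed

lemma tensor_scaleC_right: "x \<otimes>\<^sub>h (c *\<^sub>C y) = c *\<^sub>C (x \<otimes>\<^sub>h y)"
proof -
  have "x \<otimes>\<^sub>h (c *\<^sub>C y) - c *\<^sub>C (x \<otimes>\<^sub>h y) = 0"
    by (rule tensor_total) (simp add: cinner_diff_left cinner_scaleC_left cinner_tensor)
  then show ?thesis by simp
qed

lemma norm_tensor: "norm (x \<otimes>\<^sub>h y) = norm x * norm y"
proof -
  have "complex_of_real ((norm (x \<otimes>\<^sub>h y))\<^sup>2) = of_real ((norm x * norm y)\<^sup>2)"
    using cinner_tensor[of x y x y] unfolding cinner_same by (simp add: power_mult_distrib)
  then have "(norm (x \<otimes>\<^sub>h y))\<^sup>2 = (norm x * norm y)\<^sup>2" using of_real_eq_iff by blast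
  then show ?thesis by (simp add: power2_eq_iff_nonneg)
qed

lemma cinner_tensor_total_ext:
  fixes z z' :: "('a::chilbert_space, 'b::chilbert_space) htensor"
  assumes "\<And>x y. cinner z (x \<otimes>\<^sub>h y) = cinner z' (x \<otimes>\<^sub>h y)"
  shows "z = z'"
proof -
  have "z - z' = 0" by (rule tensor_total) (simp add: cinner_diff_left assms)
  then show ?thesis by simp
qed

text \<open>Totality is available in the form that only 0 is orthogonal to all
  \<open>x \<otimes>\<^sub>h y\<close>. The comparison therefore passes to the adjoints, whose
  values are determined by their pairings with elementary tensors.\<close>

lemma cblinear_eq_on_tensors:
  fixes S T :: "('a::chilbert_space, 'b::chilbert_space) htensor \<Rightarrow> 'c::chilbert_space"
  assumes S: "cblinear S" and T: "cblinear T" and eq: "\<And>x y. S (x \<otimes>\<^sub>h y) = T (x \<otimes>\<^sub>h y)"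
  shows "S = T"
proof -
  obtain S' where S': "\<And>x y. cinner (S x) y = cinner x (S' y)" using cblinear_adjoint[OF S] by metis
  obtain T' where T': "\<And>x y. cinner (T x) y = cinner x (T' y)" using cblinear_adjoint[OF T] by metis
  have "S' w = T' w" for w
  proof (rule cinner_tensor_total_ext)
    fix x y show "cinner (S' w) (x \<otimes>\<^sub>h y) = cinner (T' w) (x \<otimes>\<^sub>h y)"
      using S'[of "x \<otimes>\<^sub>h y" w] T'[of "x \<otimes>\<^sub>h y" w] eq[of x y]
        cinner_commute[of "S' w" "x \<otimes>\<^sub>h y"] cinner_commute[of "T' w" "x \<otimes>\<^sub>h y"] by simp
  qed
  then show ?thesis by (intro ext cinner_ext) (simp add: S' T')
qed

lemma has_sum_finite_sum:
  fixes f :: "'i \<Rightarrow> 'x \<Rightarrow> 'a::topological_comm_monoid_add"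
  assumes "finite I" "\<And>i. i \<in> I \<Longrightarrow> (f i has_sum s i) A"
  shows "((\<lambda>x. \<Sum>i\<in>I. f i x) has_sum (\<Sum>i\<in>I. s i)) A"
  using assms by (induction I rule: finite_induct) (auto intro: has_sum_add)

text \<open>Slicing along an orthonormal basis \<open>(c)\<close> of the second factor turns \<open>z = \<Sum> x\<^sub>i \<otimes> y\<^sub>i\<close> into the
  family \<open>z\<^sub>c = \<Sum> \<langle>y\<^sub>i, c\<rangle> x\<^sub>i\<close> with \<open>\<parallel>z\<parallel>\<^sup>2 = \<Sum> \<parallel>z\<^sub>c\<parallel>\<^sup>2\<close>, and \<open>a\<close> acts on each slice.\<close>

lemma tensor_sum_norm_left:
  fixes a :: "'a::chilbert_space \<Rightarrow> 'c::chilbert_space" and y :: "nat \<Rightarrow> 'b::chilbert_space"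
  assumes a: "cblinear a"
  shows "norm (\<Sum>i<k. a (x i) \<otimes>\<^sub>h y i) \<le> onorm a * norm (\<Sum>i<k. x i \<otimes>\<^sub>h y i)"
proof -
  have ns: "((\<lambda>c. (norm (\<Sum>i<k. cinner (y i) c *\<^sub>C x i))\<^sup>2) has_sum (norm (\<Sum>i<k. x i \<otimes>\<^sub>h y i))\<^sup>2) onb"
    for x :: "nat \<Rightarrow> 'd::chilbert_space"
  proof -
    have "((\<lambda>c. \<Sum>i<k. \<Sum>j<k. cinner (x i) (x j) * (cinner (y i) c * cnj (cinner (y j) c)))
        has_sum (\<Sum>i<k. \<Sum>j<k. cinner (x i) (x j) * cinner (y i) (y j))) onb"
      by (intro has_sum_finite_sum finite_lessThan has_sum_cmult_right parseval onb_is_onb)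
    moreover have "(\<Sum>i<k. \<Sum>j<k. cinner (x i) (x j) * (cinner (y i) c * cnj (cinner (y j) c)))
        = of_real ((norm (\<Sum>i<k. cinner (y i) c *\<^sub>C x i))\<^sup>2)" for c
      unfolding cinner_same[symmetric] cinner_sum_left cinner_sum_right cinner_scaleC_left cinner_scaleC_right
        sum_distrib_left by (subst sum.swap) (simp add: ac_simps)
    moreover have "(\<Sum>i<k. \<Sum>j<k. cinner (x i) (x j) * cinner (y i) (y j))
        = of_real ((norm (\<Sum>i<k. x i \<otimes>\<^sub>h y i))\<^sup>2)"
      unfolding cinner_same[symmetric] cinner_sum_left cinner_sum_right cinner_tensor sum_distrib_left by (rule sum.swap)
    ultimately have "((\<lambda>c. complex_of_real ((norm (\<Sum>i<k. cinner (y i) c *\<^sub>C x i))\<^sup>2))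
        has_sum of_real ((norm (\<Sum>i<k. x i \<otimes>\<^sub>h y i))\<^sup>2)) onb" by simp
    from has_sum_bounded_linear[OF bounded_linear_Re this] show ?thesis by (simp add: o_def)
  qed
  have le: "(norm (\<Sum>i<k. cinner (y i) c *\<^sub>C a (x i)))\<^sup>2 \<le> (onorm a)\<^sup>2 * (norm (\<Sum>i<k. cinner (y i) c *\<^sub>C x i))\<^sup>2" for c
  proof -
    have "(\<Sum>i<k. cinner (y i) c *\<^sub>C a (x i)) = a (\<Sum>i<k. cinner (y i) c *\<^sub>C x i)"
      by (simp add: cblinear_simps[OF a])
    then have "norm (\<Sum>i<k. cinner (y i) c *\<^sub>C a (x i)) \<le> onorm a * norm (\<Sum>i<k. cinner (y i) c *\<^sub>C x i)"
      using cblinear_norm_le[OF a] by simp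
    then show ?thesis unfolding power_mult_distrib[symmetric] by (rule power_mono) simp
  qed
  have "(norm (\<Sum>i<k. a (x i) \<otimes>\<^sub>h y i))\<^sup>2 \<le> (onorm a)\<^sup>2 * (norm (\<Sum>i<k. x i \<otimes>\<^sub>h y i))\<^sup>2"
    by (rule has_sum_mono[OF ns[of "\<lambda>i. a (x i)"] has_sum_cmult_right[OF ns[of x]]]) (rule le)
  then have "(norm (\<Sum>i<k. a (x i) \<otimes>\<^sub>h y i))\<^sup>2 \<le> (onorm a * norm (\<Sum>i<k. x i \<otimes>\<^sub>h y i))\<^sup>2"
    by (simp add: power_mult_distrib)
  then show ?thesis by (rule power2_le_imp_le) (simp add: onorm_nonneg[OF a])
qed

lemma tensor_sum_norm_right:
  fixes b :: "'b::chilbert_space \<Rightarrow> 'c::chilbert_space" and x :: "nat \<Rightarrow> 'a::chilbert_space"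
  assumes b: "cblinear b"
  shows "norm (\<Sum>i<k. x i \<otimes>\<^sub>h b (y i)) \<le> onorm b * norm (\<Sum>i<k. x i \<otimes>\<^sub>h y i)"
proof -
  \<comment> \<open>Exchanging the two legs leaves Gram matrices, hence norms of finite sums,
    unchanged; this reduces the second leg to the first.\<close>
  have sw: "norm (\<Sum>i<k. x i \<otimes>\<^sub>h y i) = norm (\<Sum>i<k. y i \<otimes>\<^sub>h x i)" for y :: "nat \<Rightarrow> 'd::chilbert_space"
  proof -
    have "complex_of_real ((norm (\<Sum>i<k. x i \<otimes>\<^sub>h y i))\<^sup>2) = of_real ((norm (\<Sum>i<k. y i \<otimes>\<^sub>h x i))\<^sup>2)"
      unfolding cinner_same[symmetric] cinner_sum_left cinner_sum_right cinner_tensor by (simp add: mult.commute)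
    then show ?thesis unfolding of_real_eq_iff by (simp add: power2_eq_iff_nonneg)
  qed
  show ?thesis unfolding sw by (rule tensor_sum_norm_left[OF b])
qed

lemma sum_concat_lessThan:
  fixes f g :: "nat \<Rightarrow> 'a::comm_monoid_add"
  shows "(\<Sum>i<k. f i) + (\<Sum>i<l. g i) = (\<Sum>i<k + l. if i < k then f i else g (i - k))"
proof -
  have "(\<Sum>i<k + l. if i < k then f i else g (i - k))
      = (\<Sum>i<k. if i < k then f i else g (i - k)) + (\<Sum>i=k..<k + l. if i < k then f i else g (i - k))"
    using sum.atLeastLessThan_concat[of 0 k "k + l" "\<lambda>i. if i < k then f i else g (i - k)"]
    by (simp add: lessThan_atLeast0)
  also have "(\<Sum>i=k..<k + l. if i < k then f i else g (i - k)) = (\<Sum>i<l. g i)"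
    by (rule sum.reindex_bij_witness[of _ "\<lambda>i. i + k" "\<lambda>i. i - k"]) auto
  finally show ?thesis by simp
qed

text \<open>The bound on finite sums of tensors gives well-definedness and boundedness at once,
  because it makes the pairs of sums a bounded linear relation. Sums of pairs are formed by
  concatenating index ranges, and scalars are absorbed into the first leg.\<close>

lemma tensor_map_exists:
  fixes F :: "'a::chilbert_space \<Rightarrow> 'b::chilbert_space \<Rightarrow> 'c::chilbert_space"
  assumes sc: "\<And>c x y. F (c *\<^sub>C x) y = c *\<^sub>C F x y"
    and bd: "\<And>k x y. norm (\<Sum>i<k::nat. F (x i) (y i)) \<le> C * norm (\<Sum>i<k. x i \<otimes>\<^sub>h y i)" and C: "C \<ge> 0"
  obtains t where "cblinear t" "\<And>x y. t (x \<otimes>\<^sub>h y) = F x y" "\<And>z. norm (t z) \<le> C * norm z"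
proof -
  define G where "G = {(\<Sum>i<k. x i \<otimes>\<^sub>h y i, \<Sum>i<k. F (x i) (y i)) |(k::nat) x y. True}"
  obtain t where t: "cblinear t" "\<And>d w. (d, w) \<in> G \<Longrightarrow> t d = w" "\<And>z. norm (t z) \<le> C * norm z"
  proof (rule bounded_linear_relation_extension[of G C])
    show "(0, 0) \<in> G" unfolding G_def by (intro CollectI exI[of _ 0]) simp
  next
    fix d w d' w' assume "(d, w) \<in> G" "(d', w') \<in> G"
    then obtain k x y l x' y' where e: "d = (\<Sum>i<k::nat. x i \<otimes>\<^sub>h y i)" "w = (\<Sum>i<k. F (x i) (y i))"
      "d' = (\<Sum>i<l::nat. x' i \<otimes>\<^sub>h y' i)" "w' = (\<Sum>i<l. F (x' i) (y' i))" unfolding G_def by blast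
    define X where "X i = (if i < k then x i else x' (i - k))" for i
    define Y where "Y i = (if i < k then y i else y' (i - k))" for i
    have "d + d' = (\<Sum>i<k + l. X i \<otimes>\<^sub>h Y i)" "w + w' = (\<Sum>i<k + l. F (X i) (Y i))"
      unfolding e sum_concat_lessThan X_def Y_def by (auto intro!: sum.cong)
    then show "(d + d', w + w') \<in> G" unfolding G_def
      by (intro CollectI exI[of _ "k + l"] exI[of _ X] exI[of _ Y]) simp
  next
    fix c d w assume "(d, w) \<in> G"
    then obtain k x y where e: "d = (\<Sum>i<k::nat. x i \<otimes>\<^sub>h y i)" "w = (\<Sum>i<k. F (x i) (y i))"
      unfolding G_def by blast
    have "c *\<^sub>C d = (\<Sum>i<k. (c *\<^sub>C x i) \<otimes>\<^sub>h y i)" "c *\<^sub>C w = (\<Sum>i<k. F (c *\<^sub>C x i) (y i))"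
      unfolding e by (simp_all add: scaleC_sum_right tensor_scaleC_left sc)
    then show "(c *\<^sub>C d, c *\<^sub>C w) \<in> G" unfolding G_def
      by (intro CollectI exI[of _ k] exI[of _ "\<lambda>i. c *\<^sub>C x i"] exI[of _ y]) simp
  next
    fix d w assume "(d, w) \<in> G"
    then show "norm w \<le> C * norm d" unfolding G_def using bd by blast
  qed (use C in auto)
  have "t (x \<otimes>\<^sub>h y) = F x y" for x y
  proof (rule t(2))
    show "(x \<otimes>\<^sub>h y, F x y) \<in> G" unfolding G_def
      by (intro CollectI exI[of _ "Suc 0"] exI[of _ "\<lambda>_. x"] exI[of _ "\<lambda>_. y"]) simp
  qed
  then show thesis using that t(1,3) by blast
qed

text \<open>\<open>a \<otimes> b\<close> is built as \<open>a \<otimes> 1\<close> after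
  \<open>1 \<otimes> b\<close>, since the slicing estimates bound one leg at a time. Uniqueness on
  elementary tensors then resolves the definite description.\<close>

lemma op_tensor:
  fixes a :: "'a::chilbert_space op" and b :: "'b::chilbert_space op"
  assumes a: "a \<in> bounded_ops" and b: "b \<in> bounded_ops"
  shows "op_tensor a b \<in> bounded_ops" "op_tensor a b (\<xi> \<otimes>\<^sub>h \<eta>) = a \<xi> \<otimes>\<^sub>h b \<eta>"
proof -
  note al = a[unfolded bounded_ops_iff] and bl = b[unfolded bounded_ops_iff]
  obtain s :: "('a, 'b) htensor op" where s: "cblinear s" "\<And>x y. s (x \<otimes>\<^sub>h y) = a x \<otimes>\<^sub>h y"
    by (rule tensor_map_exists[of "\<lambda>x y. a x \<otimes>\<^sub>h y" "onorm a"])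
       (auto simp: cblinear_simps(5)[OF al] tensor_scaleC_left tensor_sum_norm_left[OF al] onorm_nonneg[OF al])
  obtain t :: "('a, 'b) htensor op" where t: "cblinear t" "\<And>x y. t (x \<otimes>\<^sub>h y) = x \<otimes>\<^sub>h b y"
    by (rule tensor_map_exists[of "\<lambda>x y. x \<otimes>\<^sub>h b y" "onorm b"])
       (auto simp: cblinear_simps(5)[OF bl] tensor_scaleC_left tensor_scaleC_right tensor_sum_norm_right[OF bl] onorm_nonneg[OF bl])
  have "\<exists>!u. u \<in> bounded_ops \<and> (\<forall>\<xi> \<eta>. u (\<xi> \<otimes>\<^sub>h \<eta>) = a \<xi> \<otimes>\<^sub>h b \<eta>)"
  proof (rule ex1I[of _ "\<lambda>z. s (t z)"])
    show "(\<lambda>z. s (t z)) \<in> bounded_ops \<and> (\<forall>\<xi> \<eta>. s (t (\<xi> \<otimes>\<^sub>h \<eta>)) = a \<xi> \<otimes>\<^sub>h b \<eta>)"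
      using s t by (simp add: bounded_ops_iff cblinear_compose)
    fix u assume u: "u \<in> bounded_ops \<and> (\<forall>\<xi> \<eta>. u (\<xi> \<otimes>\<^sub>h \<eta>) = a \<xi> \<otimes>\<^sub>h b \<eta>)"
    show "u = (\<lambda>z. s (t z))"
      by (rule cblinear_eq_on_tensors) (use u s t in \<open>auto simp: bounded_ops_iff cblinear_compose\<close>)
  qed
  from theI'[OF this, folded op_tensor_def]
  show "op_tensor a b \<in> bounded_ops" "op_tensor a b (\<xi> \<otimes>\<^sub>h \<eta>) = a \<xi> \<otimes>\<^sub>h b \<eta>" by simp_all
qed

text \<open>The exact constant \<open>onorm a\<close> matters: it is what makes the final projection
  onto \<open>M\<close> contractive.\<close>

lemma norm_op_tensor_id_le:
  fixes a :: "'a::chilbert_space op" and z :: "('a, 'b::chilbert_space) htensor"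
  assumes a: "a \<in> bounded_ops"
  shows "norm (op_tensor a id z) \<le> onorm a * norm z"
proof -
  note al = a[unfolded bounded_ops_iff]
  have i: "(id :: 'b op) \<in> bounded_ops" unfolding bounded_ops_iff id_def by (rule cblinear_id)
  obtain s :: "('a, 'b) htensor op" where s: "cblinear s" "\<And>x y. s (x \<otimes>\<^sub>h y) = a x \<otimes>\<^sub>h y" "\<And>z. norm (s z) \<le> onorm a * norm z"
    by (rule tensor_map_exists[of "\<lambda>x y. a x \<otimes>\<^sub>h y" "onorm a"])
       (auto simp: cblinear_simps(5)[OF al] tensor_scaleC_left tensor_sum_norm_left[OF al] onorm_nonneg[OF al])
  have "op_tensor a id = s"
    by (rule cblinear_eq_on_tensors) (use op_tensor[OF a i] s in \<open>auto simp: bounded_ops_iff\<close>)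
  then show ?thesis using s(3) by simp
qed

lemma cinner_op_tensor_adj:
  assumes a: "a \<in> bounded_ops" and b: "b \<in> bounded_ops"
  shows "cinner (op_tensor a b z) z' = cinner z (op_tensor (adj a) (adj b) z')"
proof -
  note T = op_tensor(1)[OF a b] and T' = op_tensor(1)[OF adj_exists(1)[OF a] adj_exists(1)[OF b]]
  have "adj (op_tensor a b) = op_tensor (adj a) (adj b)"
  proof (rule cblinear_eq_on_tensors)
    fix x y
    show "adj (op_tensor a b) (x \<otimes>\<^sub>h y) = op_tensor (adj a) (adj b) (x \<otimes>\<^sub>h y)"
      by (rule cinner_tensor_total_ext)
         (simp add: adj_exists(3)[OF T] op_tensor a b adj_exists(1) cinner_tensor adj_exists(3)[OF a] adj_exists(3)[OF b])
  qed (use adj_exists(1)[OF T] T' in \<open>auto simp: bounded_ops_iff\<close>)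
  then show ?thesis using adj_exists(2)[OF T] by simp
qed

section \<open>Slice maps on the second leg\<close>

lemma cblinear_tensor_right: "cblinear (\<lambda>v. v \<otimes>\<^sub>h \<zeta>)"
  by (rule cblinearI[where K = "norm \<zeta>"]) (simp_all add: tensor_add_left tensor_scaleC_left norm_tensor)

text \<open>This is \<open>(id \<otimes> \<omega>)(t)\<close> for the vector functional
  \<open>\<omega>\<close> of \<open>\<zeta>\<close> and \<open>\<zeta>'\<close>. For vectors of an
  orthonormal basis the slices are the entries of \<open>t\<close> as a block matrix.\<close>

definition slice :: "('a::chilbert_space, 'b::chilbert_space) htensor op \<Rightarrow> 'b \<Rightarrow> 'b \<Rightarrow> 'a op" where
  "slice t \<zeta> \<zeta>' = (SOME s. s \<in> bounded_ops \<and> (\<forall>v w. cinner (s v) w = cinner (t (v \<otimes>\<^sub>h \<zeta>)) (w \<otimes>\<^sub>h \<zeta>')))"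

lemma slice:
  fixes t :: "('a::chilbert_space, 'b::chilbert_space) htensor op"
  assumes t: "t \<in> bounded_ops"
  shows "slice t \<zeta> \<zeta>' \<in> bounded_ops" "cinner (slice t \<zeta> \<zeta>' v) w = cinner (t (v \<otimes>\<^sub>h \<zeta>)) (w \<otimes>\<^sub>h \<zeta>')"
proof -
  obtain V :: "('a, 'b) htensor \<Rightarrow> 'a" where V: "cblinear V" "\<And>x y. cinner (x \<otimes>\<^sub>h \<zeta>') y = cinner x (V y)"
    using cblinear_adjoint[OF cblinear_tensor_right] by metis
  have V': "cinner (V y) x = cinner y (x \<otimes>\<^sub>h \<zeta>')" for x y
    using V(2)[of x y] cinner_commute[of "V y" x] cinner_commute[of y "x \<otimes>\<^sub>h \<zeta>'"] by simp
  have c: "cblinear (\<lambda>v. V (t (v \<otimes>\<^sub>h \<zeta>)))"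
    by (rule cblinear_compose[OF V(1) cblinear_compose[OF t[unfolded bounded_ops_iff] cblinear_tensor_right]])
  have "\<exists>s. s \<in> bounded_ops \<and> (\<forall>v w. cinner (s v) w = cinner (t (v \<otimes>\<^sub>h \<zeta>)) (w \<otimes>\<^sub>h \<zeta>'))"
    by (rule exI[of _ "\<lambda>v. V (t (v \<otimes>\<^sub>h \<zeta>))"]) (simp add: c bounded_ops_iff V')
  from someI_ex[OF this, folded slice_def] show "slice t \<zeta> \<zeta>' \<in> bounded_ops"
    "cinner (slice t \<zeta> \<zeta>' v) w = cinner (t (v \<otimes>\<^sub>h \<zeta>)) (w \<otimes>\<^sub>h \<zeta>')" by simp_all
qed

section \<open>Square summable sequences and the functionals they represent\<close>

definition sqsum :: "(nat \<Rightarrow> 'a::real_normed_vector) \<Rightarrow> bool" where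
  "sqsum \<xi> \<longleftrightarrow> summable (\<lambda>n. (norm (\<xi> n))\<^sup>2)"

definition sqnorm :: "(nat \<Rightarrow> 'a::real_normed_vector) \<Rightarrow> real" where
  "sqnorm \<xi> = (\<Sum>n. (norm (\<xi> n))\<^sup>2)"

text \<open>These are the generating functionals of \<open>ultraweak_topology\<close>, that is,
  pairings of \<open>a\<close> with the trace class operator that is the sum of the rank one
  operators given by \<open>\<xi> n\<close> and \<open>\<eta> n\<close>.\<close>

definition trf :: "(nat \<Rightarrow> 'a::chilbert_space) \<Rightarrow> (nat \<Rightarrow> 'a) \<Rightarrow> 'a op \<Rightarrow> complex" where
  "trf \<xi> \<eta> a = (\<Sum>n. cinner (a (\<xi> n)) (\<eta> n))"

lemma sqnorm_nonneg: "sqsum \<xi> \<Longrightarrow> 0 \<le> sqnorm \<xi>"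
  unfolding sqsum_def sqnorm_def by (rule suminf_nonneg) auto

lemma norm_cinner_op_le_half:
  assumes "cblinear a"
  shows "cmod (cinner (a x) y) \<le> onorm a * (((norm x)\<^sup>2 + (norm y)\<^sup>2) / 2)"
proof -
  have "cmod (cinner (a x) y) \<le> norm (a x) * norm y" by (rule norm_cinner_le)
  also have "\<dots> \<le> (onorm a * norm x) * norm y"
    by (rule mult_right_mono[OF cblinear_norm_le[OF assms]]) simp
  also have "\<dots> = onorm a * (norm x * norm y)" by simp
  also have "\<dots> \<le> onorm a * (((norm x)\<^sup>2 + (norm y)\<^sup>2) / 2)"
    using sum_squares_bound[of "norm x" "norm y"] by (intro mult_left_mono onorm_nonneg[OF assms]) simp
  finally show ?thesis .
qed

lemma trf_sums:
  assumes a: "cblinear a" and x: "sqsum \<xi>" and y: "sqsum \<eta>"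
  shows "summable (\<lambda>n. norm (cinner (a (\<xi> n)) (\<eta> n)))" "(\<lambda>n. cinner (a (\<xi> n)) (\<eta> n)) sums trf \<xi> \<eta> a"
    "((\<lambda>n. cinner (a (\<xi> n)) (\<eta> n)) has_sum trf \<xi> \<eta> a) UNIV"
    "cmod (trf \<xi> \<eta> a) \<le> onorm a * ((sqnorm \<xi> + sqnorm \<eta>) / 2)"
proof -
  have s: "(\<lambda>n. onorm a * (((norm (\<xi> n))\<^sup>2 + (norm (\<eta> n))\<^sup>2) / 2)) sums (onorm a * ((sqnorm \<xi> + sqnorm \<eta>) / 2))"
    unfolding sqnorm_def by (rule sums_mult[OF sums_divide[OF sums_add[OF summable_sums[OF x[unfolded sqsum_def]]
          summable_sums[OF y[unfolded sqsum_def]]]]])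
  show 1: "summable (\<lambda>n. norm (cinner (a (\<xi> n)) (\<eta> n)))"
    by (rule summable_comparison_test[OF _ sums_summable[OF s]])
       (intro exI allI impI, simp only: real_norm_def abs_norm_cancel norm_cinner_op_le_half[OF a])
  then show 2: "(\<lambda>n. cinner (a (\<xi> n)) (\<eta> n)) sums trf \<xi> \<eta> a"
    unfolding trf_def by (rule summable_sums[OF summable_norm_cancel])
  show "((\<lambda>n. cinner (a (\<xi> n)) (\<eta> n)) has_sum trf \<xi> \<eta> a) UNIV"
    by (rule norm_summable_imp_has_sum[OF 1 2])
  have "cmod (trf \<xi> \<eta> a) \<le> (\<Sum>n. cmod (cinner (a (\<xi> n)) (\<eta> n)))"
    unfolding trf_def by (rule summable_norm[OF 1])
  also have "\<dots> \<le> onorm a * ((sqnorm \<xi> + sqnorm \<eta>) / 2)"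
    unfolding sums_unique[OF s] by (rule suminf_le[OF _ 1 sums_summable[OF s]]) (rule norm_cinner_op_le_half[OF a])
  finally show "cmod (trf \<xi> \<eta> a) \<le> onorm a * ((sqnorm \<xi> + sqnorm \<eta>) / 2)" .
qed

subsection \<open>Concatenating countably many sequences\<close>

definition flatten :: "(nat \<Rightarrow> nat \<Rightarrow> 'a) \<Rightarrow> nat \<Rightarrow> 'a" where
  "flatten \<xi> m = (case prod_decode m of (k, n) \<Rightarrow> \<xi> k n)"

lemma has_sum_flatten: "((\<lambda>m. f (flatten \<xi> m) (flatten \<eta> m)) has_sum s) UNIV \<longleftrightarrow> ((\<lambda>(k, n). f (\<xi> k n) (\<eta> k n)) has_sum s) UNIV"
proof -
  have "(\<lambda>m. f (flatten \<xi> m) (flatten \<eta> m)) = (\<lambda>m. (\<lambda>(k, n). f (\<xi> k n) (\<eta> k n)) (prod_decode m))"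
    unfolding flatten_def by (auto split: prod.splits)
  then show ?thesis using has_sum_reindex_bij_betw[OF bij_prod_decode, of "\<lambda>(k, n). f (\<xi> k n) (\<eta> k n)" s] by simp
qed

lemma flatten_sqsum:
  assumes x: "\<And>k. sqsum (\<xi> k)" and s: "summable (\<lambda>k. sqnorm (\<xi> k))"
  shows "sqsum (flatten \<xi>)" "sqnorm (flatten \<xi>) = (\<Sum>k. sqnorm (\<xi> k))"
    "(\<lambda>(k, n). (norm (\<xi> k n))\<^sup>2) summable_on UNIV"
proof -
  have h: "((\<lambda>n. (norm (\<xi> k n))\<^sup>2) has_sum sqnorm (\<xi> k)) UNIV" for k
    unfolding sqnorm_def by (rule sums_nonneg_imp_has_sum) (use x[of k] in \<open>auto simp: sqsum_def summable_sums\<close>)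
  have o: "((\<lambda>k. sqnorm (\<xi> k)) has_sum (\<Sum>k. sqnorm (\<xi> k))) UNIV"
    by (rule sums_nonneg_imp_has_sum) (use s sqnorm_nonneg[OF x] in \<open>auto simp: summable_sums\<close>)
  have "(\<lambda>(k, n). (norm (\<xi> k n))\<^sup>2) summable_on (UNIV \<times> UNIV)"
    by (rule summable_on_SigmaI[where g = "\<lambda>k. sqnorm (\<xi> k)"]) (use h has_sum_imp_summable[OF o] in auto)
  then show S: "(\<lambda>(k, n). (norm (\<xi> k n))\<^sup>2) summable_on UNIV" by simp
  have "((\<lambda>(k, n). (norm (\<xi> k n))\<^sup>2) has_sum (\<Sum>k. sqnorm (\<xi> k))) (UNIV \<times> UNIV)"
    by (rule has_sum_SigmaI[OF _ o]) (use h S in auto)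
  then have "((\<lambda>m. (norm (flatten \<xi> m))\<^sup>2) has_sum (\<Sum>k. sqnorm (\<xi> k))) UNIV"
    using has_sum_flatten[of "\<lambda>a b. (norm a)\<^sup>2" \<xi> \<xi>] by simp
  then have "(\<lambda>m. (norm (flatten \<xi> m))\<^sup>2) sums (\<Sum>k. sqnorm (\<xi> k))" by (rule has_sum_imp_sums)
  then show "sqsum (flatten \<xi>)" "sqnorm (flatten \<xi>) = (\<Sum>k. sqnorm (\<xi> k))"
    unfolding sqsum_def sqnorm_def by (auto simp: sums_iff)
qed

text \<open>The double series converges unconditionally, so it may be regrouped by rows. This is how
  a countable sum of functionals \<open>trf\<close> becomes a single one.\<close>

lemma trf_flatten:
  assumes a: "cblinear a" and x: "\<And>k. sqsum (\<xi> k)" "summable (\<lambda>k. sqnorm (\<xi> k))"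
    and y: "\<And>k. sqsum (\<eta> k)" "summable (\<lambda>k. sqnorm (\<eta> k))"
  shows "(\<lambda>k. trf (\<xi> k) (\<eta> k) a) sums trf (flatten \<xi>) (flatten \<eta>) a"
proof -
  have "((\<lambda>m. cinner (a (flatten \<xi> m)) (flatten \<eta> m)) has_sum trf (flatten \<xi>) (flatten \<eta>) a) UNIV"
    by (rule trf_sums(3)[OF a flatten_sqsum(1)[OF x] flatten_sqsum(1)[OF y]])
  then have "((\<lambda>(k, n). cinner (a (\<xi> k n)) (\<eta> k n)) has_sum trf (flatten \<xi>) (flatten \<eta>) a) (UNIV \<times> UNIV)"
    using has_sum_flatten[of "\<lambda>v w. cinner (a v) w" \<xi> \<eta>] by simp
  then have "((\<lambda>k. trf (\<xi> k) (\<eta> k) a) has_sum trf (flatten \<xi>) (flatten \<eta>) a) UNIV"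
    by (rule has_sum_SigmaD) (use trf_sums(3)[OF a x(1) y(1)] in simp)
  then show ?thesis by (rule has_sum_imp_sums)
qed

text \<open>Two sequences are joined as the first two rows of a double sequence with zero rows after
  them, so that everything about \<open>join\<close> is inherited from
  \<open>flatten\<close>.\<close>

definition join :: "(nat \<Rightarrow> 'a::zero) \<Rightarrow> (nat \<Rightarrow> 'a) \<Rightarrow> nat \<Rightarrow> 'a" where
  "join \<xi> \<xi>' = flatten (\<lambda>k. if k = 0 then \<xi> else if k = 1 then \<xi>' else (\<lambda>_. 0))"

lemma sums_two: "(\<lambda>k. if k = 0 then a else if k = 1 then b else 0) sums (a + b)"
  for a b :: "'a::real_normed_vector"
  using sums_finite[of "{0, 1::nat}" "\<lambda>k. if k = 0 then a else if k = 1 then b else 0"] by simp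

lemma join:
  fixes \<xi> \<xi>' :: "nat \<Rightarrow> 'a::chilbert_space"
  assumes "sqsum \<xi>" "sqsum \<xi>'"
  shows "sqsum (join \<xi> \<xi>')" "sqnorm (join \<xi> \<xi>') = sqnorm \<xi> + sqnorm \<xi>'"
    "\<And>\<eta> \<eta>' a. cblinear a \<Longrightarrow> sqsum \<eta> \<Longrightarrow> sqsum \<eta>' \<Longrightarrow> trf (join \<xi> \<xi>') (join \<eta> \<eta>') a = trf \<xi> \<eta> a + trf \<xi>' \<eta>' a"
proof -
  have s: "sqsum (if k = 0 then \<xi> else if k = 1 then \<xi>' else (\<lambda>_. 0))" if "sqsum \<xi>" "sqsum \<xi>'"
    for \<xi> \<xi>' :: "nat \<Rightarrow> 'x::real_normed_vector" and k :: nat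
    using that by (auto simp: sqsum_def)
  have e: "(\<lambda>k. sqnorm (if k = (0::nat) then \<xi> else if k = 1 then \<xi>' else (\<lambda>_. 0)))
      = (\<lambda>k. if k = 0 then sqnorm \<xi> else if k = 1 then sqnorm \<xi>' else 0)" for \<xi> \<xi>' :: "nat \<Rightarrow> 'x::real_normed_vector"
    by (auto simp: fun_eq_iff sqnorm_def)
  have t: "(\<lambda>k. sqnorm (if k = (0::nat) then \<xi> else if k = 1 then \<xi>' else (\<lambda>_. 0))) sums (sqnorm \<xi> + sqnorm \<xi>')"
    for \<xi> \<xi>' :: "nat \<Rightarrow> 'x::real_normed_vector" unfolding e by (rule sums_two)
  show "sqsum (join \<xi> \<xi>')" unfolding join_def by (rule flatten_sqsum(1)[OF s[OF assms] sums_summable[OF t]])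
  show "sqnorm (join \<xi> \<xi>') = sqnorm \<xi> + sqnorm \<xi>'"
    unfolding join_def flatten_sqsum(2)[OF s[OF assms] sums_summable[OF t]] by (rule sums_unique[OF t, symmetric])
next
  fix \<eta> \<eta>' :: "nat \<Rightarrow> 'a" and a :: "'a op" assume a: "cblinear a" and y: "sqsum \<eta>" "sqsum \<eta>'"
  let ?j = "\<lambda>\<xi> \<xi>' k. if k = (0::nat) then \<xi> else if k = 1 then \<xi>' else (\<lambda>_. 0)"
  have s: "sqsum (?j \<xi> \<xi>' k)" if "sqsum \<xi>" "sqsum \<xi>'"
    for \<xi> \<xi>' :: "nat \<Rightarrow> 'x::real_normed_vector" and k :: nat
    using that by (auto simp: sqsum_def)
  have e: "(\<lambda>k. sqnorm (?j \<xi> \<xi>' k)) = (\<lambda>k. if k = 0 then sqnorm \<xi> else if k = 1 then sqnorm \<xi>' else 0)" for \<xi> \<xi>' :: "nat \<Rightarrow> 'x::real_normed_vector"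
    by (auto simp: fun_eq_iff sqnorm_def)
  have t: "summable (\<lambda>k. sqnorm (?j \<xi> \<xi>' k))"
    for \<xi> \<xi>' :: "nat \<Rightarrow> 'x::real_normed_vector" unfolding e by (rule sums_summable[OF sums_two])
  have "(\<lambda>k. trf (?j \<xi> \<xi>' k) (?j \<eta> \<eta>' k) a) sums trf (join \<xi> \<xi>') (join \<eta> \<eta>') a"
    unfolding join_def by (rule trf_flatten[OF a s[OF assms] t s[OF y] t])
  also have "(\<lambda>k. trf (?j \<xi> \<xi>' k) (?j \<eta> \<eta>' k) a) = (\<lambda>k. if k = 0 then trf \<xi> \<eta> a else if k = 1 then trf \<xi>' \<eta>' a else 0)"
    by (auto simp: fun_eq_iff trf_def)
  finally show "trf (join \<xi> \<xi>') (join \<eta> \<eta>') a = trf \<xi> \<eta> a + trf \<xi>' \<eta>' a"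
    by (rule sums_unique2[OF _ sums_two])
qed

lemma sqsum_scaleC:
  assumes "sqsum (\<xi> :: nat \<Rightarrow> 'a::chilbert_space)"
  shows "sqsum (\<lambda>n. c *\<^sub>C \<xi> n)" "sqnorm (\<lambda>n. c *\<^sub>C \<xi> n) = (cmod c)\<^sup>2 * sqnorm \<xi>"
proof -
  have e: "(\<lambda>n. (norm (c *\<^sub>C \<xi> n))\<^sup>2) = (\<lambda>n. (cmod c)\<^sup>2 * (norm (\<xi> n))\<^sup>2)"
    by (simp add: norm_scaleC power_mult_distrib)
  show "sqsum (\<lambda>n. c *\<^sub>C \<xi> n)"
    unfolding sqsum_def e by (rule summable_mult[OF assms[unfolded sqsum_def]])
  show "sqnorm (\<lambda>n. c *\<^sub>C \<xi> n) = (cmod c)\<^sup>2 * sqnorm \<xi>"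
    unfolding sqnorm_def e by (rule suminf_mult[OF assms[unfolded sqsum_def]])
qed

lemma trf_scaleC:
  assumes "cblinear a" "sqsum \<xi>" "sqsum \<eta>"
  shows "trf (\<lambda>n. c *\<^sub>C \<xi> n) (\<lambda>n. d *\<^sub>C \<eta> n) a = c * cnj d * trf \<xi> \<eta> a"
proof -
  have "(\<lambda>n. (c * cnj d) * cinner (a (\<xi> n)) (\<eta> n)) sums ((c * cnj d) * trf \<xi> \<eta> a)"
    by (rule sums_mult[OF trf_sums(2)[OF assms]])
  moreover have "(\<lambda>n. (c * cnj d) * cinner (a (\<xi> n)) (\<eta> n)) = (\<lambda>n. cinner (a (c *\<^sub>C \<xi> n)) (d *\<^sub>C \<eta> n))"
    by (simp add: cblinear_simps(5)[OF assms(1)] cinner_scaleC_left cinner_scaleC_right mult_ac)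
  ultimately show ?thesis unfolding trf_def by (simp add: sums_iff)
qed

lemma single_sqsum:
  fixes x :: "'a::real_normed_vector"
  shows "sqsum (\<lambda>n. if n = (0::nat) then x else 0)" "sqnorm (\<lambda>n. if n = (0::nat) then x else 0) = (norm x)\<^sup>2"
proof -
  have "(\<lambda>n. (norm (if n = (0::nat) then x else 0))\<^sup>2) sums (norm x)\<^sup>2"
    using sums_finite[of "{0::nat}" "\<lambda>n. (norm (if n = (0::nat) then x else 0))\<^sup>2"] by simp
  then show "sqsum (\<lambda>n. if n = (0::nat) then x else 0)" "sqnorm (\<lambda>n. if n = (0::nat) then x else 0) = (norm x)\<^sup>2"
    unfolding sqsum_def sqnorm_def by (auto simp: sums_iff)
qed

lemma trf_single: "trf (\<lambda>n. if n = 0 then x else 0) (\<lambda>n. if n = 0 then y else 0) a = cinner (a x) y"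
proof -
  have "(\<lambda>n. cinner (a (if n = (0::nat) then x else 0)) (if n = 0 then y else 0)) sums cinner (a x) y"
    using sums_finite[of "{0::nat}" "\<lambda>n. cinner (a (if n = (0::nat) then x else 0)) (if n = 0 then y else 0)"] by simp
  then show ?thesis unfolding trf_def by (simp add: sums_iff)
qed

subsection \<open>The predual\<close>

definition op_subspace :: "'a::chilbert_space op set \<Rightarrow> bool" where
  "op_subspace M \<longleftrightarrow> M \<subseteq> bounded_ops \<and> (\<lambda>_. 0) \<in> M \<and> (\<forall>a\<in>M. \<forall>b\<in>M. op_add a b \<in> M) \<and> (\<forall>c. \<forall>a\<in>M. op_scale c a \<in> M)"

definition op_linear :: "'a::chilbert_space op set \<Rightarrow> ('a op \<Rightarrow> complex) \<Rightarrow> bool" where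
  "op_linear M f \<longleftrightarrow> (\<forall>a\<in>M. \<forall>b\<in>M. f (op_add a b) = f a + f b) \<and> (\<forall>c. \<forall>a\<in>M. f (op_scale c a) = c * f a)"

lemma op_linear_trf:
  assumes "M \<subseteq> bounded_ops" "sqsum \<xi>" "sqsum \<eta>"
  shows "op_linear M (trf \<xi> \<eta>)"
proof -
  have c: "cblinear a" if "a \<in> M" for a using assms(1) that bounded_ops_iff by blast
  have "trf \<xi> \<eta> (op_add a b) = trf \<xi> \<eta> a + trf \<xi> \<eta> b" if "a \<in> M" "b \<in> M" for a b
    using sums_add[OF trf_sums(2)[OF c assms(2,3), of a] trf_sums(2)[OF c assms(2,3), of b]] that
    unfolding trf_def op_add_def by (simp add: cinner_add_left sums_iff)
  moreover have "trf \<xi> \<eta> (op_scale d a) = d * trf \<xi> \<eta> a" if "a \<in> M" for d a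
    using sums_mult[OF trf_sums(2)[OF c assms(2,3), of a], of d] that
    unfolding trf_def op_scale_def by (simp add: cinner_scaleC_left sums_iff)
  ultimately show ?thesis unfolding op_linear_def by blast
qed

text \<open>Induction on \<open>F\<close>: on the kernel of the new functional \<open>h\<close> the
  induction hypothesis supplies the coefficients, and the coefficient of \<open>h\<close> is read
  off at one point \<open>a0\<close> outside this kernel.\<close>

lemma op_linear_in_span:
  assumes "finite F" "op_subspace M" "\<And>g. g \<in> F \<Longrightarrow> op_linear M g" "op_linear M f"
    and "\<And>a. a \<in> M \<Longrightarrow> (\<And>g. g \<in> F \<Longrightarrow> g a = 0) \<Longrightarrow> f a = 0"
  shows "\<exists>c. \<forall>a\<in>M. f a = (\<Sum>g\<in>F. c g * g a)"
  using assms
proof (induction F arbitrary: M f rule: finite_induct)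
  case empty
  then show ?case by auto
next
  case (insert h F)
  define M' where "M' = {a \<in> M. h a = 0}"
  have hl: "op_linear M h" using insert.prems(2) by blast
  have sub: "op_subspace M'"
  proof -
    have "h (\<lambda>_. 0) = 0"
    proof -
      have "op_scale 0 (\<lambda>_. 0 :: 'a) = (\<lambda>_. 0)" by (simp add: op_scale_def)
      moreover have "h (op_scale 0 (\<lambda>_. 0)) = 0 * h (\<lambda>_. 0)"
        using hl insert.prems(1) unfolding op_linear_def op_subspace_def by blast
      ultimately show ?thesis by simp
    qed
    then show ?thesis using insert.prems(1) hl unfolding op_subspace_def op_linear_def M'_def by auto
  qed
  have restr: "op_linear M' g" if "op_linear M g" for g
    using that unfolding op_linear_def M'_def by auto
  have "\<exists>c. \<forall>a\<in>M'. f a = (\<Sum>g\<in>F. c g * g a)"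
  proof (rule insert.IH[OF sub])
    show "op_linear M' g" if "g \<in> F" for g using restr insert.prems(2) that by blast
    show "op_linear M' f" by (rule restr[OF insert.prems(3)])
    fix a assume "a \<in> M'" "\<And>g. g \<in> F \<Longrightarrow> g a = 0"
    then show "f a = 0" using insert.prems(4)[of a] unfolding M'_def by blast
  qed
  then obtain c where c: "\<And>a. a \<in> M' \<Longrightarrow> f a = (\<Sum>g\<in>F. c g * g a)" by blast
  show ?case
  proof (cases "\<exists>a0\<in>M. h a0 \<noteq> 0")
    case False
    then have "M' = M" by (auto simp: M'_def)
    then have "f a = (\<Sum>g\<in>insert h F. (c(h := 0)) g * g a)" if "a \<in> M" for a
      using c[of a] that insert.hyps by (auto intro!: sum.cong)
    then show ?thesis by blast
  next
    case True
    then obtain a0 where a0: "a0 \<in> M" "h a0 \<noteq> 0" by blast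
    define d where "d = (f a0 - (\<Sum>g\<in>F. c g * g a0)) / h a0"
    have "f a = (\<Sum>g\<in>insert h F. (c(h := d)) g * g a)" if a: "a \<in> M" for a
    proof -
      \<comment> \<open>Adding \<open>t\<close> times \<open>a0\<close> moves \<open>a\<close> along
        \<open>a0\<close> into the kernel of \<open>h\<close>, where the formula with the old
        coefficients holds.\<close>
      define t where "t = - (h a / h a0)"
      let ?b = "op_add a (op_scale t a0)"
      have s: "op_scale t a0 \<in> M" using insert.prems(1) a0 unfolding op_subspace_def by blast
      have b: "?b \<in> M" using insert.prems(1) a s unfolding op_subspace_def by blast
      have lin: "g ?b = g a + t * g a0" if "op_linear M g" for g
        using that a a0 s unfolding op_linear_def by simp
      have "h ?b = 0" using lin[OF hl] a0 by (simp add: t_def)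
      then have "f ?b = (\<Sum>g\<in>F. c g * g ?b)" using c[of ?b] b by (simp add: M'_def)
      moreover have "(\<Sum>g\<in>F. c g * g ?b) = (\<Sum>g\<in>F. c g * g a + t * (c g * g a0))"
      proof (rule sum.cong[OF refl])
        fix g assume "g \<in> F"
        then have "op_linear M g" using insert.prems(2) by blast
        from lin[OF this] show "c g * g ?b = c g * g a + t * (c g * g a0)" by (simp add: algebra_simps)
      qed
      then have "(\<Sum>g\<in>F. c g * g ?b) = (\<Sum>g\<in>F. c g * g a) + t * (\<Sum>g\<in>F. c g * g a0)"
        by (simp add: sum.distrib sum_distrib_left)
      ultimately have "f a = (\<Sum>g\<in>F. c g * g a) - t * (f a0 - (\<Sum>g\<in>F. c g * g a0))"
        using lin[OF insert.prems(3)] by (simp add: algebra_simps)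
      also have "\<dots> = (\<Sum>g\<in>F. c g * g a) + d * h a"
        using a0 by (simp add: t_def d_def field_simps)
      also have "\<dots> = (\<Sum>g\<in>insert h F. (c(h := d)) g * g a)"
        using insert.hyps by (auto intro!: sum.cong)
      finally show ?thesis .
    qed
    then show ?thesis by blast
  qed
qed

text \<open>\<open>sigma_topology\<close> is given by a generating family and not by a base, so
  basic neighbourhoods are extracted by induction over the generation; intersections unite the
  finite families and take the smaller radius.\<close>

lemma sigma_topology_nhd:
  assumes "openin (sigma_topology X F) V" "x \<in> V"
  shows "\<exists>F0 e. finite F0 \<and> F0 \<subseteq> F \<and> e > 0 \<and> (\<forall>y\<in>X. (\<forall>g\<in>F0. cmod (g y - g x) < e) \<longrightarrow> y \<in> V)"
proof -
  have "generate_topology_on (insert X {{x \<in> X. f x \<in> U} |f U. f \<in> F \<and> open U}) V"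
    using assms(1) unfolding sigma_topology_def by (rule openin_topology_generated_by)
  then show ?thesis using assms(2)
  proof (induction V arbitrary: x rule: generate_topology_on.induct)
    case Empty
    then show ?case by simp
  next
    case (Int A B)
    then have x: "x \<in> A" "x \<in> B" by auto
    obtain F1 e1 where *: "finite F1" "F1 \<subseteq> F" "e1 > 0" "\<forall>y\<in>X. (\<forall>g\<in>F1. cmod (g y - g x) < e1) \<longrightarrow> y \<in> A"
      using Int.IH(1)[OF x(1)] by blast
    obtain F2 e2 where **: "finite F2" "F2 \<subseteq> F" "e2 > 0" "\<forall>y\<in>X. (\<forall>g\<in>F2. cmod (g y - g x) < e2) \<longrightarrow> y \<in> B"
      using Int.IH(2)[OF x(2)] by blast
    show ?case by (rule exI[of _ "F1 \<union> F2"], rule exI[of _ "min e1 e2"]) (use * ** in auto)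
  next
    case (UN K)
    then obtain k where "k \<in> K" "x \<in> k" by blast
    from UN.IH[OF this] obtain F1 e1 where "finite F1" "F1 \<subseteq> F" "e1 > 0" "\<forall>y\<in>X. (\<forall>g\<in>F1. cmod (g y - g x) < e1) \<longrightarrow> y \<in> k"
      by blast
    then show ?case using \<open>k \<in> K\<close> by (intro exI[of _ F1] exI[of _ e1]) auto
  next
    case (Basis S)
    show ?case
    proof (cases "S = X")
      case True
      then show ?thesis by (intro exI[of _ "{}"] exI[of _ 1]) auto
    next
      case False
      then obtain f U where S: "S = {x \<in> X. f x \<in> U}" "f \<in> F" "open U" using Basis by blast
      then obtain e where "e > 0" "ball (f x) e \<subseteq> U" using Basis by (auto elim: openE)
      then show ?thesis
        by (intro exI[of _ "{f}"] exI[of _ e]) (use S in \<open>auto simp: subset_iff dist_norm norm_minus_commute\<close>)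
    qed
  qed
qed

lemma topspace_sigma_topology [simp]: "topspace (sigma_topology X F) = X"
  unfolding sigma_topology_def topology_generated_by_topspace by auto

lemma sigma_topology_continuous:
  assumes "f \<in> F"
  shows "continuous_map (sigma_topology X F) euclidean f"
  unfolding continuous_map_def
proof (intro conjI allI impI)
  fix U :: "complex set" assume "openin euclidean U"
  then have "{x \<in> X. f x \<in> U} \<in> insert X {{x \<in> X. f x \<in> U} |f U. f \<in> F \<and> open U}" using assms by auto
  then show "openin (sigma_topology X F) {x \<in> topspace (sigma_topology X F). f x \<in> U}"
    unfolding topspace_sigma_topology unfolding sigma_topology_def by (rule topology_generated_by_Basis)
qed simp

definition normal_rep :: "'a::chilbert_space op set \<Rightarrow> ('a op \<Rightarrow> complex) \<Rightarrow> (nat \<Rightarrow> 'a) \<Rightarrow> (nat \<Rightarrow> 'a) \<Rightarrow> bool" where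
  "normal_rep M f \<xi> \<eta> \<longleftrightarrow> sqsum \<xi> \<and> sqsum \<eta> \<and> (\<forall>a\<in>M. f a = trf \<xi> \<eta> a)"

lemma normal_rep_add:
  assumes "M \<subseteq> bounded_ops" "normal_rep M f \<xi> \<eta>" "normal_rep M g \<xi>' \<eta>'" "\<And>a. a \<in> M \<Longrightarrow> h a = f a + g a"
  shows "normal_rep M h (join \<xi> \<xi>') (join \<eta> \<eta>')"
proof -
  have c: "cblinear a" if "a \<in> M" for a using assms(1) that bounded_ops_iff by blast
  show ?thesis using assms(2,3,4) unfolding normal_rep_def by (simp add: join(1) join(3)[OF _ _ c])
qed

lemma normal_rep_scale:
  assumes "M \<subseteq> bounded_ops" "normal_rep M f \<xi> \<eta>" "\<And>a. a \<in> M \<Longrightarrow> h a = c * cnj d * f a"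
  shows "normal_rep M h (\<lambda>n. c *\<^sub>C \<xi> n) (\<lambda>n. d *\<^sub>C \<eta> n)"
proof -
  have c: "cblinear a" if "a \<in> M" for a using assms(1) that bounded_ops_iff by blast
  have x: "sqsum \<xi>" "sqsum \<eta>" and f: "\<And>a. a \<in> M \<Longrightarrow> f a = trf \<xi> \<eta> a"
    using assms(2) unfolding normal_rep_def by auto
  have "h a = trf (\<lambda>n. c *\<^sub>C \<xi> n) (\<lambda>n. d *\<^sub>C \<eta> n) a" if "a \<in> M" for a
    unfolding trf_scaleC[OF c[OF that] x] assms(3)[OF that] f[OF that] ..
  then show ?thesis unfolding normal_rep_def using sqsum_scaleC(1) x by blast
qed

lemma normal_rep_sum:
  assumes "M \<subseteq> bounded_ops" "finite I" "\<And>i. i \<in> I \<Longrightarrow> \<exists>\<xi> \<eta>. normal_rep M (f i) \<xi> \<eta>"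
  shows "\<exists>\<xi> \<eta>. normal_rep M (\<lambda>a. \<Sum>i\<in>I. c i * f i a) \<xi> \<eta>"
  using assms(2,3)
proof (induction I rule: finite_induct)
  case empty
  have "normal_rep M (\<lambda>a. \<Sum>i\<in>{}. c i * f i a) (\<lambda>_. 0) (\<lambda>_. 0)"
    by (simp add: normal_rep_def sqsum_def trf_def)
  then show ?case by blast
next
  case (insert i I)
  then obtain \<xi> \<eta> \<xi>' \<eta>' where r: "normal_rep M (f i) \<xi> \<eta>" "normal_rep M (\<lambda>a. \<Sum>i\<in>I. c i * f i a) \<xi>' \<eta>'"
    using insert.IH insert.prems by blast
  have "normal_rep M (\<lambda>a. c i * f i a) (\<lambda>n. c i *\<^sub>C \<xi> n) (\<lambda>n. 1 *\<^sub>C \<eta> n)"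
    by (rule normal_rep_scale[OF assms(1) r(1)]) simp
  then have "normal_rep M (\<lambda>a. \<Sum>i\<in>insert i I. c i * f i a) (join (\<lambda>n. c i *\<^sub>C \<xi> n) \<xi>') (join (\<lambda>n. 1 *\<^sub>C \<eta> n) \<eta>')"
    by (rule normal_rep_add[OF assms(1) _ r(2)]) (use insert.hyps in simp)
  then show ?case by blast
qed

text \<open>A continuous functional is bounded on a neighbourhood cut out by finitely many
  generators, hence vanishes on their common kernel and is a combination of them. Combinations of
  functionals \<open>trf\<close> are again of this form by scaling and joining the
  sequences.\<close>

lemma predual_iff:
  assumes M: "op_subspace M"
  shows "f \<in> predual M \<longleftrightarrow> f \<in> extensional M \<and> (\<exists>\<xi> \<eta>. normal_rep M f \<xi> \<eta>)"
proof -
  have Mb: "M \<subseteq> bounded_ops" using M by (simp add: op_subspace_def)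
  define F where "F = {trf \<xi> \<eta> |\<xi> \<eta> :: nat \<Rightarrow> 'a. sqsum \<xi> \<and> sqsum \<eta>}"
  have uw: "ultraweak_topology M = sigma_topology M F"
    unfolding ultraweak_topology_def F_def trf_def[abs_def] sqsum_def ..
  show ?thesis
  proof
    assume f: "f \<in> predual M"
    then have ext: "f \<in> extensional M" and lin: "op_linear M f"
      and cont: "continuous_map (sigma_topology M F) euclidean f"
      unfolding predual_def op_linear_def uw by auto
    have M0: "(\<lambda>_. 0) \<in> M" using M by (simp add: op_subspace_def)
    have zero: "g (\<lambda>_. 0) = 0" if "op_linear M g" for g
    proof -
      have "g (op_scale 0 (\<lambda>_. 0)) = 0 * g (\<lambda>_. 0)" using that M0 unfolding op_linear_def by blast
      then show ?thesis by (simp add: op_scale_def)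
    qed
    have "openin (sigma_topology M F) {a \<in> topspace (sigma_topology M F). f a \<in> ball 0 1}"
      using cont unfolding continuous_map_def by (metis open_ball open_openin)
    from sigma_topology_nhd[OF this, of "\<lambda>_. 0"] M0 zero[OF lin] obtain F0 e where F0: "finite F0" "F0 \<subseteq> F" "e > 0"
      and nh: "\<forall>y\<in>M. (\<forall>g\<in>F0. cmod (g y - g (\<lambda>_. 0)) < e) \<longrightarrow> y \<in> {a \<in> topspace (sigma_topology M F). f a \<in> ball 0 1}"
      by auto
    have Fl: "op_linear M g" if "g \<in> F0" for g
      using that F0(2) op_linear_trf[OF Mb] unfolding F_def by blast
    have "\<exists>c. \<forall>a\<in>M. f a = (\<Sum>g\<in>F0. c g * g a)"
    proof (rule op_linear_in_span[OF F0(1) M Fl lin])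
      fix a assume a: "a \<in> M" "\<And>g. g \<in> F0 \<Longrightarrow> g a = 0"
      \<comment> \<open>Every multiple of \<open>a\<close> stays in the common kernel and so in the
        neighbourhood of 0 on which \<open>f\<close> is smaller than 1.\<close>
      have small: "cmod (c * f a) < 1" for c
      proof -
        have s: "op_scale c a \<in> M" using M a unfolding op_subspace_def by blast
        have "g (op_scale c a) - g (\<lambda>_. 0) = 0" if "g \<in> F0" for g
          using Fl[OF that] a(1) a(2)[OF that] zero[OF Fl[OF that]] unfolding op_linear_def by simp
        then have "f (op_scale c a) \<in> ball 0 1" using nh s F0(3) by fastforce
        then show ?thesis using lin a(1) unfolding op_linear_def by simp
      qed
      show "f a = 0"
      proof (rule ccontr)
        assume "f a \<noteq> 0"
        then show False using small[of "1 / f a"] by simp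
      qed
    qed
    then obtain c where c: "\<And>a. a \<in> M \<Longrightarrow> f a = (\<Sum>g\<in>F0. c g * g a)" by blast
    have "\<exists>\<xi> \<eta>. normal_rep M (\<lambda>a. \<Sum>g\<in>F0. c g * g a) \<xi> \<eta>"
    proof (rule normal_rep_sum[OF Mb F0(1)])
      fix g assume "g \<in> F0"
      then obtain \<xi> \<eta> where "g = trf \<xi> \<eta>" "sqsum \<xi>" "sqsum \<eta>" using F0(2) unfolding F_def by blast
      then show "\<exists>\<xi> \<eta>. normal_rep M g \<xi> \<eta>" unfolding normal_rep_def by blast
    qed
    then have "\<exists>\<xi> \<eta>. normal_rep M f \<xi> \<eta>" using c unfolding normal_rep_def by fastforce
    then show "f \<in> extensional M \<and> (\<exists>\<xi> \<eta>. normal_rep M f \<xi> \<eta>)" using ext by blast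
  next
    assume "f \<in> extensional M \<and> (\<exists>\<xi> \<eta>. normal_rep M f \<xi> \<eta>)"
    then obtain \<xi> \<eta> where ext: "f \<in> extensional M" and r: "sqsum \<xi>" "sqsum \<eta>" "\<And>a. a \<in> M \<Longrightarrow> f a = trf \<xi> \<eta> a"
      unfolding normal_rep_def by blast
    have "trf \<xi> \<eta> \<in> F" using r unfolding F_def by blast
    then have "continuous_map (sigma_topology M F) euclidean f"
      by (intro continuous_map_eq[OF sigma_topology_continuous[of "trf \<xi> \<eta>"]]) (simp_all add: r)
    moreover have "op_linear M f"
      using op_linear_trf[OF Mb r(1,2)] M unfolding op_linear_def op_subspace_def by (simp add: r)
    ultimately show "f \<in> predual M" using ext unfolding predual_def op_linear_def uw by blast
  qed
qed

subsection \<open>A Hahn-Banach theorem for spaces of functions\<close>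

definition fn_subspace :: "('x \<Rightarrow> complex) set \<Rightarrow> bool" where
  "fn_subspace V \<longleftrightarrow> (\<lambda>_. 0) \<in> V \<and> (\<forall>f\<in>V. \<forall>g\<in>V. (\<lambda>x. f x + g x) \<in> V) \<and> (\<forall>c. \<forall>f\<in>V. (\<lambda>x. c * f x) \<in> V)"

text \<open>Homogeneity is asked for as an inequality, which is easy to verify for infima; applied
  to \<open>inverse r\<close> as well, it yields equality in \<open>sublinD\<close>. Only real
  scalars occur, so the complex functions are treated as a real vector space.\<close>

definition sublin :: "('x \<Rightarrow> complex) set \<Rightarrow> (('x \<Rightarrow> complex) \<Rightarrow> real) \<Rightarrow> bool" where
  "sublin V p \<longleftrightarrow> (\<forall>f\<in>V. \<forall>g\<in>V. p (\<lambda>x. f x + g x) \<le> p f + p g) \<and> (\<forall>f\<in>V. \<forall>r>0. p (\<lambda>x. of_real r * f x) \<le> r * p f)"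

lemma sublinD:
  assumes "fn_subspace V" "sublin V p"
  shows "f \<in> V \<Longrightarrow> g \<in> V \<Longrightarrow> p (\<lambda>x. f x + g x) \<le> p f + p g"
    and "f \<in> V \<Longrightarrow> r > 0 \<Longrightarrow> p (\<lambda>x. of_real r * f x) = r * p f"
    and "p (\<lambda>_. 0) = 0"
    and "f \<in> V \<Longrightarrow> 0 \<le> p f + p (\<lambda>x. - f x)"
proof -
  show add: "p (\<lambda>x. f x + g x) \<le> p f + p g" if "f \<in> V" "g \<in> V" for f g
    using assms(2) that unfolding sublin_def by blast
  have sc: "p (\<lambda>x. of_real r * f x) \<le> r * p f" if "f \<in> V" "r > 0" for f r
    using assms(2) that unfolding sublin_def by blast
  have z: "(\<lambda>_. 0) \<in> V" using assms(1) unfolding fn_subspace_def by blast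
  have mem: "(\<lambda>x. c * f x) \<in> V" if "f \<in> V" for c f using assms(1) that unfolding fn_subspace_def by blast
  show "p (\<lambda>x. of_real r * f x) = r * p f" if "f \<in> V" "r > 0" for f r
  proof (rule antisym[OF sc[OF that]])
    have "p (\<lambda>x. of_real (inverse r) * (of_real r * f x)) \<le> inverse r * p (\<lambda>x. of_real r * f x)"
      using sc[OF mem[OF that(1), of "of_real r"], of "inverse r"] that(2) by simp
    moreover have "(\<lambda>x. of_real (inverse r) * (of_real r * f x)) = f" using that(2) by (simp add: fun_eq_iff)
    ultimately show "r * p f \<le> p (\<lambda>x. of_real r * f x)" using that(2) by (simp add: field_simps)
  qed
  from this[OF z, of 2] show p0: "p (\<lambda>_. 0) = 0" by simp
  show "0 \<le> p f + p (\<lambda>x. - f x)" if "f \<in> V" for f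
    using add[OF that mem[OF that, of "-1"]] p0 by simp
qed

lemma fn_subspaceD:
  assumes "fn_subspace V"
  shows "(\<lambda>_. 0) \<in> V" "f \<in> V \<Longrightarrow> g \<in> V \<Longrightarrow> (\<lambda>x. f x + g x) \<in> V" "f \<in> V \<Longrightarrow> (\<lambda>x. c * f x) \<in> V"
    "f \<in> V \<Longrightarrow> (\<lambda>x. - f x) \<in> V"
proof -
  show "(\<lambda>x. - f x) \<in> V" if "f \<in> V"
  proof -
    have "(\<lambda>x. (-1) * f x) \<in> V" using assms that unfolding fn_subspace_def by blast
    then show ?thesis by simp
  qed
qed (use assms in \<open>auto simp: fn_subspace_def\<close>)

text \<open>The new functional is the infimum of \<open>p (f + t h) - t p h\<close> over
  \<open>t \<ge> 0\<close>, and \<open>t = 1\<close> at \<open>f = - h\<close> gives its last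
  property. Consequently a functional that cannot be shrunk is odd.\<close>

lemma sublin_shrink:
  assumes V: "fn_subspace V" and p: "sublin V p" and h: "h \<in> V"
  obtains q where "sublin V q" "\<And>f. f \<in> V \<Longrightarrow> q f \<le> p f" "q (\<lambda>x. - h x) \<le> - p h"
proof -
  note pD = sublinD[OF V p] and VD = fn_subspaceD[OF V]
  define A where "A f = (\<lambda>t. p (\<lambda>x. f x + of_real t * h x) - t * p h) ` {0..}" for f
  define q where "q f = Inf (A f)" for f
  have th: "p (\<lambda>x. of_real t * h x) = t * p h" if "t \<ge> 0" for t
    using that pD(2)[OF h, of t] pD(3) by (cases "t = 0") auto
  \<comment> \<open>A lower bound independent of \<open>t\<close> makes the infimum
    meaningful.\<close>
  have low: "- p (\<lambda>x. - f x) \<le> p (\<lambda>x. f x + of_real t * h x) - t * p h" if "f \<in> V" "t \<ge> 0" for f t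
    using pD(1)[OF VD(2)[OF that(1) VD(3)[OF h, of "of_real t"]] VD(4)[OF that(1)]] th[OF that(2)] by simp
  have bdd: "bdd_below (A f)" if "f \<in> V" for f unfolding A_def using low[OF that] by (intro bdd_belowI2) auto
  have qle: "q f \<le> p (\<lambda>x. f x + of_real t * h x) - t * p h" if "f \<in> V" "t \<ge> 0" for f t
    unfolding q_def by (rule cInf_lower[OF _ bdd[OF that(1)]]) (use that in \<open>auto simp: A_def\<close>)
  have qge: "z \<le> q f" if "\<And>t. t \<ge> 0 \<Longrightarrow> z \<le> p (\<lambda>x. f x + of_real t * h x) - t * p h" for z f
    unfolding q_def by (rule cInf_greatest) (use that in \<open>auto simp: A_def\<close>)
  have "sublin V q" unfolding sublin_def
  proof (intro conjI ballI allI impI)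
    fix f g assume f: "f \<in> V" and g: "g \<in> V"
    have "q (\<lambda>x. f x + g x) - q f \<le> q g"
    proof (rule qge)
      fix s :: real assume s: "s \<ge> 0"
      have "q (\<lambda>x. f x + g x) - (p (\<lambda>x. g x + of_real s * h x) - s * p h) \<le> q f"
      proof (rule qge)
        fix t :: real assume t: "t \<ge> 0"
        have "q (\<lambda>x. f x + g x) \<le> p (\<lambda>x. (f x + g x) + of_real (t + s) * h x) - (t + s) * p h"
          by (rule qle) (use s t VD f g in auto)
        also have "(\<lambda>x. (f x + g x) + of_real (t + s) * h x) = (\<lambda>x. (f x + of_real t * h x) + (g x + of_real s * h x))"
          by (simp add: algebra_simps)
        also have "p \<dots> \<le> p (\<lambda>x. f x + of_real t * h x) + p (\<lambda>x. g x + of_real s * h x)"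
          by (intro pD VD f g h)
        finally show "q (\<lambda>x. f x + g x) - (p (\<lambda>x. g x + of_real s * h x) - s * p h) \<le> p (\<lambda>x. f x + of_real t * h x) - t * p h"
          by (simp add: algebra_simps)
      qed
      then show "q (\<lambda>x. f x + g x) - q f \<le> p (\<lambda>x. g x + of_real s * h x) - s * p h" by simp
    qed
    then show "q (\<lambda>x. f x + g x) \<le> q f + q g" by simp
  next
    fix f and r :: real assume f: "f \<in> V" and r: "0 < r"
    have "q (\<lambda>x. of_real r * f x) / r \<le> q f"
    proof (rule qge)
      fix t :: real assume t: "t \<ge> 0"
      have "q (\<lambda>x. of_real r * f x) \<le> p (\<lambda>x. of_real r * f x + of_real (r * t) * h x) - (r * t) * p h"
        by (rule qle) (use r t VD f in auto)
      also have "(\<lambda>x. of_real r * f x + of_real (r * t) * h x) = (\<lambda>x. of_real r * (f x + of_real t * h x))"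
        by (simp add: algebra_simps)
      also have "p \<dots> = r * p (\<lambda>x. f x + of_real t * h x)" by (rule pD(2)[OF VD(2)[OF f VD(3)[OF h]] r])
      finally show "q (\<lambda>x. of_real r * f x) / r \<le> p (\<lambda>x. f x + of_real t * h x) - t * p h"
        using r by (simp add: field_simps)
    qed
    then show "q (\<lambda>x. of_real r * f x) \<le> r * q f" using r by (simp add: field_simps)
  qed
  moreover have "q f \<le> p f" if "f \<in> V" for f using qle[OF that, of 0] by simp
  moreover have "q (\<lambda>x. - h x) \<le> - p h" using qle[OF VD(4)[OF h], of 1] pD(3) by simp
  ultimately show thesis using that by blast
qed

text \<open>Zorn's lemma for the reversed pointwise order. The infimum of a chain is again sublinear
  because two members of the chain always have one of them below both, and subadditivity can be used
  for that one.\<close>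

lemma sublin_minimal:
  assumes V: "fn_subspace V" and P: "sublin V P"
  obtains m where "sublin V m" "\<And>f. f \<in> V \<Longrightarrow> m f \<le> P f"
    "\<And>q. sublin V q \<Longrightarrow> (\<And>f. f \<in> V \<Longrightarrow> q f \<le> m f) \<Longrightarrow> (\<And>f. f \<in> V \<Longrightarrow> q f = m f)"
proof -
  note VD = fn_subspaceD[OF V]
  define S where "S = {p. sublin V p \<and> (\<forall>f\<in>V. p f \<le> P f) \<and> (\<forall>f. f \<notin> V \<longrightarrow> p f = 0)}"
  \<comment> \<open>Values off \<open>V\<close> are set to 0, so that comparisons on
    \<open>V\<close> alone become comparisons of functions in the order used by Zorn's
    lemma.\<close>
  define cut where "cut p = (\<lambda>f. if f \<in> V then p f else 0)" for p :: "('a \<Rightarrow> complex) \<Rightarrow> real"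
  have cut: "cut p \<in> S" if "sublin V p" "\<And>f. f \<in> V \<Longrightarrow> p f \<le> P f" for p
    using that VD unfolding S_def cut_def sublin_def by simp
  have lowb: "- P (\<lambda>x. - f x) \<le> p f" if "p \<in> S" "f \<in> V" for p f
  proof -
    have "sublin V p" "p (\<lambda>x. - f x) \<le> P (\<lambda>x. - f x)" using that VD(4) unfolding S_def by auto
    then show ?thesis using sublinD(4)[OF V, of p f] that(2) by simp
  qed
  have "\<exists>m\<in>S. \<forall>a\<in>S. a \<le> m \<longrightarrow> a = m"
  proof (rule predicate_Zorn[where P = "\<lambda>a b. b \<le> a"])
    show "partial_order_on S (relation_of (\<lambda>a b. b \<le> a) S)"
      by (rule partial_order_on_relation_ofI) auto
  next
    fix C assume C: "C \<in> Chains (relation_of (\<lambda>a b. b \<le> a) S)"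
    have CS: "C \<subseteq> S" using C by (auto simp: Chains_def relation_of_def)
    have lin: "a \<le> b \<or> b \<le> a" if "a \<in> C" "b \<in> C" for a b
      using C that by (auto simp: Chains_def relation_of_def)
    show "\<exists>u\<in>S. \<forall>a\<in>C. u \<le> a"
    proof (cases "C = {}")
      case True
      have "cut P \<in> S" by (rule cut[OF P]) simp
      then show ?thesis using True by blast
    next
      case False
      define q where "q f = Inf ((\<lambda>p. p f) ` C)" for f
      have qle: "q f \<le> p f" if "p \<in> C" "f \<in> V" for p f
        unfolding q_def using that CS lowb by (intro cInf_lower bdd_belowI2[where m = "- P (\<lambda>x. - f x)"]) auto
      have qge: "z \<le> q f" if "\<And>p. p \<in> C \<Longrightarrow> z \<le> p f" for z f
        unfolding q_def using False that by (intro cInf_greatest) auto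
      have sl: "sublin V p" if "p \<in> C" for p using CS that unfolding S_def by blast
      have "sublin V q" unfolding sublin_def
      proof (intro conjI ballI allI impI)
        fix f g assume f: "f \<in> V" and g: "g \<in> V"
        have "q (\<lambda>x. f x + g x) - q f \<le> q g"
        proof (rule qge)
          fix b assume b: "b \<in> C"
          have "q (\<lambda>x. f x + g x) - b g \<le> q f"
          proof (rule qge)
            fix a assume a: "a \<in> C"
            obtain c where c: "c \<in> C" "c \<le> a" "c \<le> b" using lin[OF a b] a b by blast
            have "q (\<lambda>x. f x + g x) \<le> c (\<lambda>x. f x + g x)" by (rule qle[OF c(1) VD(2)[OF f g]])
            also have "\<dots> \<le> c f + c g" by (rule sublinD(1)[OF V sl[OF c(1)] f g])
            also have "\<dots> \<le> a f + b g" using c(2,3) by (intro add_mono) (auto simp: le_fun_def)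
            finally show "q (\<lambda>x. f x + g x) - b g \<le> a f" by simp
          qed
          then show "q (\<lambda>x. f x + g x) - q f \<le> b g" by simp
        qed
        then show "q (\<lambda>x. f x + g x) \<le> q f + q g" by simp
      next
        fix f and r :: real assume f: "f \<in> V" and r: "0 < r"
        have "q (\<lambda>x. of_real r * f x) / r \<le> q f"
        proof (rule qge)
          fix a assume a: "a \<in> C"
          have "q (\<lambda>x. of_real r * f x) \<le> r * a f"
            using qle[OF a VD(3)[OF f, of "of_real r"]] sublinD(2)[OF V sl[OF a] f r] by simp
          then show "q (\<lambda>x. of_real r * f x) / r \<le> a f" using r by (simp add: field_simps)
        qed
        then show "q (\<lambda>x. of_real r * f x) \<le> r * q f" using r by (simp add: field_simps)
      qed
      moreover have "q f \<le> P f" if "f \<in> V" for f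
      proof -
        obtain p where p: "p \<in> C" using False by blast
        then have "p f \<le> P f" using CS that unfolding S_def by blast
        then show ?thesis using qle[OF p that] by simp
      qed
      ultimately have "cut q \<in> S" by (rule cut)
      moreover have "cut q \<le> a" if "a \<in> C" for a
        unfolding le_fun_def cut_def using qle[OF that] CS that by (auto simp: S_def)
      ultimately show ?thesis by blast
    qed
  qed
  then obtain m where m: "m \<in> S" and min: "\<And>a. a \<in> S \<Longrightarrow> a \<le> m \<Longrightarrow> a = m" by blast
  have "q f = m f" if q: "sublin V q" "\<And>f. f \<in> V \<Longrightarrow> q f \<le> m f" and f: "f \<in> V" for q f
  proof -
    have mP: "m g \<le> P g" if "g \<in> V" for g using m that unfolding S_def by blast
    have "cut q \<in> S" by (rule cut[OF q(1)]) (use q(2) mP order_trans in blast)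
    moreover have "cut q \<le> m" unfolding le_fun_def cut_def using q(2) m by (auto simp: S_def)
    ultimately have "cut q = m" by (rule min)
    then show ?thesis using f unfolding cut_def by auto
  qed
  moreover have "sublin V m" "\<And>f. f \<in> V \<Longrightarrow> m f \<le> P f" using m unfolding S_def by auto
  ultimately show thesis using that by blast
qed

text \<open>Minimal sublinear functionals are linear; shrinking \<open>P\<close> along \<open>f0\<close> first forces \<open>L f0 = P f0\<close>.\<close>

lemma hahn_banach_fn:
  assumes V: "fn_subspace V" and P: "sublin V P" and f0: "f0 \<in> V"
  obtains L where "\<And>f g. f \<in> V \<Longrightarrow> g \<in> V \<Longrightarrow> L (\<lambda>x. f x + g x) = L f + L g"
    "\<And>f r. f \<in> V \<Longrightarrow> L (\<lambda>x. of_real r * f x) = r * L f" "\<And>f. f \<in> V \<Longrightarrow> L f \<le> P f" "L f0 = P f0"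
proof -
  note VD = fn_subspaceD[OF V]
  obtain P' where P': "sublin V P'" "\<And>f. f \<in> V \<Longrightarrow> P' f \<le> P f" "P' (\<lambda>x. - f0 x) \<le> - P f0"
    using sublin_shrink[OF V P f0] by blast
  obtain m where m: "sublin V m" "\<And>f. f \<in> V \<Longrightarrow> m f \<le> P' f"
    and min: "\<And>q f. sublin V q \<Longrightarrow> (\<And>f. f \<in> V \<Longrightarrow> q f \<le> m f) \<Longrightarrow> f \<in> V \<Longrightarrow> q f = m f"
    using sublin_minimal[OF V P'(1)] by blast
  note mD = sublinD[OF V m(1)]
  have neg: "m (\<lambda>x. - h x) = - m h" if h: "h \<in> V" for h
  proof -
    obtain q where q: "sublin V q" "\<And>f. f \<in> V \<Longrightarrow> q f \<le> m f" "q (\<lambda>x. - h x) \<le> - m h"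
      using sublin_shrink[OF V m(1) h] by blast
    \<comment> \<open>By minimality \<open>m\<close> agrees on \<open>V\<close> with its own
      shrinking along \<open>h\<close>. This makes \<open>m\<close> odd, and an odd subadditive
      functional is additive.\<close>
    have "m (\<lambda>x. - h x) \<le> - m h" using min[OF q(1,2) VD(4)[OF h]] q(3) by simp
    then show ?thesis using mD(4)[OF h] by simp
  qed
  have add: "m (\<lambda>x. f x + g x) = m f + m g" if "f \<in> V" "g \<in> V" for f g
  proof -
    have "m (\<lambda>x. - f x + - g x) \<le> - m f - m g" using mD(1)[OF VD(4)[OF that(1)] VD(4)[OF that(2)]] neg that by simp
    moreover have "m (\<lambda>x. - f x + - g x) = - m (\<lambda>x. f x + g x)" using neg[OF VD(2)[OF that]] by simp
    ultimately show ?thesis using mD(1)[OF that] by simp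
  qed
  have sc: "m (\<lambda>x. of_real r * f x) = r * m f" if f: "f \<in> V" for f r
  proof (cases r "0 :: real" rule: linorder_cases)
    case less
    then show ?thesis using neg[OF VD(3)[OF f, of "of_real (- r)"]] mD(2)[OF f, of "- r"] by simp
  qed (use mD(2)[OF f] mD(3) in auto)
  have "m f0 = P f0" using m(2)[OF VD(4)[OF f0]] m(2)[OF f0] P'(2)[OF f0] P'(3) neg[OF f0] by simp
  then show thesis using that[of m] add sc m(2) P'(2) order_trans by blast
qed

subsection \<open>The predual norm\<close>

text \<open>This is the quotient norm coming from the trace class. The mean of the two square norms
  replaces their geometric mean: rescaling \<open>\<xi>\<close> against \<open>\<eta>\<close> shows
  that the infimum is the same, and the mean is additive under \<open>join\<close>, which gives
  subadditivity.\<close>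

definition rep_norm :: "'a::chilbert_space op set \<Rightarrow> ('a op \<Rightarrow> complex) \<Rightarrow> real" where
  "rep_norm M f = Inf {(sqnorm \<xi> + sqnorm \<eta>) / 2 |\<xi> \<eta>. normal_rep M f \<xi> \<eta>}"

text \<open>Unlike the members of \<open>predual\<close>, these functions are unconstrained off
  \<open>M\<close>, so they form a vector space under the plain pointwise operations on which
  Hahn-Banach can run.\<close>

definition normals :: "'a::chilbert_space op set \<Rightarrow> ('a op \<Rightarrow> complex) set" where
  "normals M = {f. \<exists>\<xi> \<eta>. normal_rep M f \<xi> \<eta>}"

lemma rep_norm_le:
  assumes "normal_rep M f \<xi> \<eta>"
  shows "rep_norm M f \<le> (sqnorm \<xi> + sqnorm \<eta>) / 2"
  unfolding rep_norm_def
proof (rule cInf_lower)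
  show "bdd_below {(sqnorm \<xi> + sqnorm \<eta>) / 2 |\<xi> \<eta>. normal_rep M f \<xi> \<eta>}"
    by (rule bdd_belowI[of _ 0]) (force simp: normal_rep_def dest: sqnorm_nonneg)
qed (use assms in blast)

lemma rep_norm_approx:
  assumes "f \<in> normals M" "rep_norm M f < e"
  obtains \<xi> \<eta> where "normal_rep M f \<xi> \<eta>" "(sqnorm \<xi> + sqnorm \<eta>) / 2 < e"
proof -
  have "{(sqnorm \<xi> + sqnorm \<eta>) / 2 |\<xi> \<eta>. normal_rep M f \<xi> \<eta>} \<noteq> {}" using assms(1) unfolding normals_def by blast
  from cInf_lessD[OF this assms(2)[unfolded rep_norm_def]] show thesis using that by blast
qed

lemma fn_subspace_normals:
  assumes M: "M \<subseteq> bounded_ops"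
  shows "fn_subspace (normals M)"
  unfolding fn_subspace_def
proof (intro conjI ballI allI)
  have "normal_rep M (\<lambda>_. 0) (\<lambda>_. 0) (\<lambda>_. 0)" by (simp add: normal_rep_def sqsum_def trf_def)
  then show "(\<lambda>_. 0) \<in> normals M" unfolding normals_def by blast
next
  fix f g assume "f \<in> normals M" "g \<in> normals M"
  then obtain \<xi> \<eta> \<xi>' \<eta>' where "normal_rep M f \<xi> \<eta>" "normal_rep M g \<xi>' \<eta>'" unfolding normals_def by blast
  from normal_rep_add[OF M this, of "\<lambda>x. f x + g x"] show "(\<lambda>x. f x + g x) \<in> normals M" unfolding normals_def by blast
next
  fix c f assume "f \<in> normals M"
  then obtain \<xi> \<eta> where "normal_rep M f \<xi> \<eta>" unfolding normals_def by blast
  from normal_rep_scale[OF M this, of "\<lambda>x. c * f x" c 1] show "(\<lambda>x. c * f x) \<in> normals M" unfolding normals_def by auto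
qed

text \<open>Scalars act on the two sequences separately. With \<open>c = d\<close> the square root
  of a positive number this gives positive homogeneity, with \<open>d = 1\<close> and
  \<open>c\<close> of modulus one invariance under phases.\<close>

lemma rep_norm_scale_le:
  assumes M: "M \<subseteq> bounded_ops" and f: "f \<in> normals M" and cd: "cmod c = cmod d" "cmod c > 0"
  shows "rep_norm M (\<lambda>x. c * cnj d * f x) \<le> (cmod c)\<^sup>2 * rep_norm M f"
proof -
  have "rep_norm M (\<lambda>x. c * cnj d * f x) / (cmod c)\<^sup>2 \<le> rep_norm M f" unfolding rep_norm_def[of M f]
  proof (rule cInf_greatest)
    show "{(sqnorm \<xi> + sqnorm \<eta>) / 2 |\<xi> \<eta>. normal_rep M f \<xi> \<eta>} \<noteq> {}" using f unfolding normals_def by blast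
    fix z assume "z \<in> {(sqnorm \<xi> + sqnorm \<eta>) / 2 |\<xi> \<eta>. normal_rep M f \<xi> \<eta>}"
    then obtain \<xi> \<eta> where z: "z = (sqnorm \<xi> + sqnorm \<eta>) / 2" and r: "normal_rep M f \<xi> \<eta>" by blast
    have s: "sqsum \<xi>" "sqsum \<eta>" using r unfolding normal_rep_def by auto
    have "rep_norm M (\<lambda>x. c * cnj d * f x) \<le> (sqnorm (\<lambda>n. c *\<^sub>C \<xi> n) + sqnorm (\<lambda>n. d *\<^sub>C \<eta> n)) / 2"
      by (rule rep_norm_le[OF normal_rep_scale[OF M r]]) simp
    also have "\<dots> = (cmod c)\<^sup>2 * z"
      unfolding sqsum_scaleC(2)[OF s(1)] sqsum_scaleC(2)[OF s(2)] z cd(1) by (simp add: algebra_simps)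
    finally show "rep_norm M (\<lambda>x. c * cnj d * f x) / (cmod c)\<^sup>2 \<le> z" using cd(2) by (simp add: field_simps)
  qed
  then show ?thesis using cd(2) by (simp add: field_simps)
qed

lemma sublin_rep_norm:
  assumes M: "M \<subseteq> bounded_ops"
  shows "sublin (normals M) (rep_norm M)"
  unfolding sublin_def
proof (intro conjI ballI allI impI)
  fix f g assume f: "f \<in> normals M" and g: "g \<in> normals M"
  show "rep_norm M (\<lambda>x. f x + g x) \<le> rep_norm M f + rep_norm M g"
  proof (rule field_le_epsilon)
    fix e :: real assume e: "e > 0"
    obtain \<xi> \<eta> where r: "normal_rep M f \<xi> \<eta>" "(sqnorm \<xi> + sqnorm \<eta>) / 2 < rep_norm M f + e / 2"
      using rep_norm_approx[OF f, of "rep_norm M f + e / 2"] e by auto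
    obtain \<xi>' \<eta>' where r': "normal_rep M g \<xi>' \<eta>'" "(sqnorm \<xi>' + sqnorm \<eta>') / 2 < rep_norm M g + e / 2"
      using rep_norm_approx[OF g, of "rep_norm M g + e / 2"] e by auto
    have s: "sqsum \<xi>" "sqsum \<eta>" "sqsum \<xi>'" "sqsum \<eta>'" using r r' unfolding normal_rep_def by auto
    have "rep_norm M (\<lambda>x. f x + g x) \<le> (sqnorm (join \<xi> \<xi>') + sqnorm (join \<eta> \<eta>')) / 2"
      by (rule rep_norm_le[OF normal_rep_add[OF M r(1) r'(1)]]) simp
    also have "\<dots> = (sqnorm \<xi> + sqnorm \<eta>) / 2 + (sqnorm \<xi>' + sqnorm \<eta>') / 2"
      unfolding join(2)[OF s(1,3)] join(2)[OF s(2,4)] by (simp add: field_simps)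
    finally show "rep_norm M (\<lambda>x. f x + g x) \<le> rep_norm M f + rep_norm M g + e" using r(2) r'(2) by linarith
  qed
next
  fix f and r :: real assume f: "f \<in> normals M" and r: "0 < r"
  have "complex_of_real (sqrt r) * cnj (of_real (sqrt r)) = of_real r"
    using r by (simp flip: of_real_mult)
  then show "rep_norm M (\<lambda>x. of_real r * f x) \<le> r * rep_norm M f"
    using rep_norm_scale_le[OF M f, of "of_real (sqrt r)" "of_real (sqrt r)"] r by simp
qed

lemma rep_norm_vector_functional:
  assumes M: "M \<subseteq> bounded_ops"
  shows "(\<lambda>a. cinner (a x) y) \<in> normals M" "rep_norm M (\<lambda>a. cinner (a x) y) \<le> norm x * norm y"
proof -
  have r: "normal_rep M (\<lambda>a. cinner (a x) y) (\<lambda>n. if n = 0 then x else 0) (\<lambda>n. if n = 0 then y else 0)" for x y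
    unfolding normal_rep_def by (simp add: single_sqsum trf_single)
  then show mem: "(\<lambda>a. cinner (a x) y) \<in> normals M" unfolding normals_def by blast
  show "rep_norm M (\<lambda>a. cinner (a x) y) \<le> norm x * norm y"
  proof (cases "x = 0 \<or> y = 0")
    case True
    have "cinner (a x) y = 0" if "a \<in> M" for a
    proof -
      have "cblinear a" using M that bounded_ops_iff by blast
      from cblinear_simps(4)[OF this] show ?thesis using True by auto
    qed
    then have "normal_rep M (\<lambda>a. cinner (a x) y) (\<lambda>_. 0) (\<lambda>_. 0)"
      unfolding normal_rep_def by (simp add: sqsum_def trf_def)
    from rep_norm_le[OF this] show ?thesis using True by (auto simp: sqnorm_def)
  next
    case False
    \<comment> \<open>This factor balances the two vectors: the scaled pair has equal norms, so the
      mean of the squares becomes the product of the original norms.\<close>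
    define t where "t = sqrt (norm y / norm x)"
    have t: "t > 0" "t\<^sup>2 = norm y / norm x" using False by (simp_all add: t_def)
    have e: "cinner (a x) y = cinner (a (t *\<^sub>R x)) (inverse t *\<^sub>R y)" if "a \<in> M" for a
    proof -
      have "cblinear a" using M that bounded_ops_iff by blast
      from cblinear_simps(6)[OF this] show ?thesis using t(1)
        by (simp add: cinner_scaleR_left cinner_scaleR_right flip: of_real_mult of_real_inverse)
    qed
    have "normal_rep M (\<lambda>a. cinner (a x) y) (\<lambda>n. if n = 0 then t *\<^sub>R x else 0) (\<lambda>n. if n = 0 then inverse t *\<^sub>R y else 0)"
      using r[of "t *\<^sub>R x" "inverse t *\<^sub>R y"] e unfolding normal_rep_def by simp
    from rep_norm_le[OF this] have "rep_norm M (\<lambda>a. cinner (a x) y) \<le> ((norm (t *\<^sub>R x))\<^sup>2 + (norm (inverse t *\<^sub>R y))\<^sup>2) / 2"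
      unfolding single_sqsum .
    also have "(norm (t *\<^sub>R x))\<^sup>2 = t\<^sup>2 * (norm x)\<^sup>2" by (simp add: power_mult_distrib)
    also have "t\<^sup>2 * (norm x)\<^sup>2 = norm x * norm y" unfolding t(2) using False by (simp add: power2_eq_square)
    also have "(norm (inverse t *\<^sub>R y))\<^sup>2 = (norm y)\<^sup>2 / t\<^sup>2"
      using t(1) by (simp add: power_mult_distrib power_divide divide_inverse_commute power_inverse)
    also have "(norm y)\<^sup>2 / t\<^sup>2 = norm x * norm y" unfolding t(2) using False by (simp add: power2_eq_square)
    finally have "rep_norm M (\<lambda>a. cinner (a x) y) \<le> (norm x * norm y + norm x * norm y) / 2" .
    then show ?thesis by simp
  qed
qed

lemma rep_norm_zero_on:
  assumes "\<And>a. a \<in> M \<Longrightarrow> f a = 0"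
  shows "f \<in> normals M" "rep_norm M f \<le> 0"
proof -
  have r: "normal_rep M f (\<lambda>_. 0) (\<lambda>_. 0)" using assms by (simp add: normal_rep_def sqsum_def trf_def)
  then show "f \<in> normals M" unfolding normals_def by blast
  show "rep_norm M f \<le> 0" using rep_norm_le[OF r] by (simp add: sqnorm_def)
qed

text \<open>A Hahn-Banach functional for \<open>rep_norm\<close> is evaluation at a contraction of \<open>M'' = M\<close>.\<close>

lemma rep_norm_le_bound:
  assumes M: "op_subspace M" and bic: "commutant (commutant M) = M" and f: "f \<in> normals M"
    and b: "\<And>a. a \<in> M \<Longrightarrow> onorm a \<le> 1 \<Longrightarrow> cmod (f a) \<le> e"
  shows "rep_norm M f \<le> e"
proof -
  have Mb: "M \<subseteq> bounded_ops" using M unfolding op_subspace_def by blast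
  note V = fn_subspace_normals[OF Mb] and P = sublin_rep_norm[OF Mb]
  note VD = fn_subspaceD[OF V]
  obtain L where Ladd: "\<And>f g. f \<in> normals M \<Longrightarrow> g \<in> normals M \<Longrightarrow> L (\<lambda>x. f x + g x) = L f + L g"
    and Lsc: "\<And>f r. f \<in> normals M \<Longrightarrow> L (\<lambda>x. of_real r * f x) = r * L f"
    and LP: "\<And>f. f \<in> normals M \<Longrightarrow> L f \<le> rep_norm M f" and Lf: "L f = rep_norm M f"
    using hahn_banach_fn[OF V P f] by blast
  \<comment> \<open>The usual complex-linear functional with real part \<open>L\<close>.\<close>
  define K where "K g = Complex (L g) (- L (\<lambda>x. \<i> * g x))" for g
  have Lneg: "L (\<lambda>x. - g x) = - L g" if "g \<in> normals M" for g using Lsc[OF that, of "-1"] by simp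
  have Kadd: "K (\<lambda>x. g x + h x) = K g + K h" if "g \<in> normals M" "h \<in> normals M" for g h
    using Ladd[OF that] Ladd[OF VD(3)[OF that(1), of \<i>] VD(3)[OF that(2), of \<i>]]
    by (simp add: K_def distrib_left complex_eq_iff)
  have Ksc: "K (\<lambda>x. c * g x) = c * K g" if g: "g \<in> normals M" for c g
  proof -
    have i: "(\<lambda>x. \<i> * g x) \<in> normals M" by (rule VD(3)[OF g])
    have e1: "L (\<lambda>x. c * g x) = Re c * L g + Im c * L (\<lambda>x. \<i> * g x)"
    proof -
      have "(\<lambda>x. c * g x) = (\<lambda>x. of_real (Re c) * g x + of_real (Im c) * (\<i> * g x))"
        by (simp add: fun_eq_iff complex_eq_iff)
      then show ?thesis using Ladd[OF VD(3)[OF g, of "of_real (Re c)"] VD(3)[OF i, of "of_real (Im c)"]] Lsc[OF g] Lsc[OF i] by simp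
    qed
    have e2: "L (\<lambda>x. \<i> * (c * g x)) = Re c * L (\<lambda>x. \<i> * g x) - Im c * L g"
    proof -
      have "(\<lambda>x. \<i> * (c * g x)) = (\<lambda>x. of_real (Re c) * (\<i> * g x) + of_real (- Im c) * g x)"
        by (simp add: fun_eq_iff complex_eq_iff)
      then show ?thesis using Ladd[OF VD(3)[OF i, of "of_real (Re c)"] VD(3)[OF g, of "of_real (- Im c)"]] Lsc[OF g, of "- Im c"] Lsc[OF i] by simp
    qed
    show ?thesis unfolding K_def e1 e2 by (simp add: complex_eq_iff algebra_simps)
  qed
  have KP: "cmod (K g) \<le> rep_norm M g" if g: "g \<in> normals M" for g
  proof -
    define c where "c = (if K g = 0 then 1 else cnj (K g) / of_real (cmod (K g)))"
    have c: "cmod c = 1" "c * K g = of_real (cmod (K g))"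
      using complex_norm_square[of "K g"] by (auto simp: c_def norm_divide power2_eq_square field_simps)
    have "of_real (cmod (K g)) = K (\<lambda>x. c * g x)" using Ksc[OF g] c by simp
    then have "cmod (K g) = L (\<lambda>x. c * g x)" by (simp add: K_def complex_eq_iff)
    also have "\<dots> \<le> rep_norm M (\<lambda>x. c * g x)" by (rule LP[OF VD(3)[OF g]])
    also have "\<dots> \<le> rep_norm M g" using rep_norm_scale_le[OF Mb g, of c 1] c(1) by simp
    finally show ?thesis .
  qed
  have Kdiff: "K g - K h = K (\<lambda>x. g x + - h x)" if "g \<in> normals M" "h \<in> normals M" for g h
    using Kadd[OF that(1) VD(4)[OF that(2)]] Ksc[OF that(2), of "-1"] by simp
  \<comment> \<open>Functions that agree on \<open>M\<close> differ by one of norm 0, so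
    \<open>K\<close> sees only the values on \<open>M\<close>. The identities for vector functionals
    below hold only for linear arguments, hence only there.\<close>
  have Keq: "K g = K h" if "g \<in> normals M" "h \<in> normals M" "\<And>a. a \<in> M \<Longrightarrow> g a = h a" for g h
  proof -
    have z: "g a + - h a = 0" if "a \<in> M" for a using \<open>\<And>a. a \<in> M \<Longrightarrow> g a = h a\<close>[OF that] by simp
    have "cmod (K g - K h) \<le> 0" unfolding Kdiff[OF that(1,2)]
      by (rule order_trans[OF KP[OF rep_norm_zero_on(1)[OF z]] rep_norm_zero_on(2)[OF z]])
    then show ?thesis by simp
  qed
  define w where "w x y = (\<lambda>a. cinner (a x) y)" for x y :: 'a
  have wn: "w x y \<in> normals M" for x y unfolding w_def by (rule rep_norm_vector_functional[OF Mb])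
  have cb: "cblinear a" if "a \<in> M" for a using Mb that bounded_ops_iff by blast
  obtain a where a: "cblinear a" "\<And>x y. cinner (a x) y = K (w x y)" "\<And>x. norm (a x) \<le> 1 * norm x"
  proof (rule sesquilinear_rep[of "\<lambda>x y. K (w x y)" 1])
    show "K (w (x + x') y) = K (w x y) + K (w x' y)" for x x' y
      unfolding Kadd[OF wn wn, symmetric]
      by (rule Keq[OF wn VD(2)[OF wn wn]]) (simp add: w_def cblinear_simps(1)[OF cb] cinner_add_left)
    show "K (w x (y + y')) = K (w x y) + K (w x y')" for x y y'
      unfolding Kadd[OF wn wn, symmetric] by (simp add: w_def cinner_add_right)
    show "K (w (c *\<^sub>C x) y) = c * K (w x y)" for c x y
      unfolding Ksc[OF wn, symmetric]
      by (rule Keq[OF wn VD(3)[OF wn]]) (simp add: w_def cblinear_simps(5)[OF cb] cinner_scaleC_left)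
    show "K (w x (c *\<^sub>C y)) = cnj c * K (w x y)" for c x y
      unfolding Ksc[OF wn, symmetric] by (simp add: w_def cinner_scaleC_right)
    show "cmod (K (w x y)) \<le> 1 * norm x * norm y" for x y
      using KP[OF wn, of x y] rep_norm_vector_functional(2)[OF Mb, of x y] unfolding w_def by simp
  qed auto
  \<comment> \<open>For \<open>y\<close> in the commutant, the vector functionals of
    \<open>(y x, z)\<close> and of \<open>(x, adj y z)\<close> agree on \<open>M\<close>, so
    \<open>K\<close> takes the same value at both; this says that \<open>a\<close> commutes with
    \<open>y\<close>.\<close>
  have aM: "a \<in> M"
  proof -
    have "y \<circ> a = a \<circ> y" if y: "y \<in> commutant M" for y
    proof -
      have yb: "y \<in> bounded_ops" and yc: "\<And>m x. m \<in> M \<Longrightarrow> m (y x) = y (m x)"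
        using y unfolding commutant_def by (auto simp: fun_eq_iff)
      have "a (y x) = y (a x)" for x
      proof (rule cinner_ext)
        fix z
        have "K (w (y x) z) = K (w x (adj y z))"
          by (rule Keq[OF wn wn]) (simp add: w_def yc adj_exists(2)[OF yb])
        then show "cinner (a (y x)) z = cinner (y (a x)) z" unfolding adj_exists(2)[OF yb] a(2) .
      qed
      then show ?thesis by auto
    qed
    then have "a \<in> commutant (commutant M)" using a(1) unfolding commutant_def[of "commutant M"] bounded_ops_iff by blast
    then show ?thesis using bic by simp
  qed
  have a1: "onorm a \<le> 1" by (rule onorm_bound) (use a(3) in auto)
  obtain \<xi> \<eta> where r: "sqsum \<xi>" "sqsum \<eta>" "\<And>a. a \<in> M \<Longrightarrow> f a = trf \<xi> \<eta> a"
    using f unfolding normals_def normal_rep_def by blast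
  define S where "S N = (\<lambda>b. \<Sum>n<N. w (\<xi> n) (\<eta> n) b)" for N
  have Sn: "S N \<in> normals M \<and> K (S N) = (\<Sum>n<N. cinner (a (\<xi> n)) (\<eta> n))" for N
  proof (induction N)
    case 0
    have "K (S 0) = 0" using Ksc[OF VD(1), of 0] by (simp add: S_def)
    then show ?case using VD(1) by (simp add: S_def)
  next
    case (Suc N)
    have e: "S (Suc N) = (\<lambda>b. S N b + w (\<xi> N) (\<eta> N) b)" by (simp add: S_def)
    show ?case unfolding e using Suc Kadd[of "S N", OF _ wn] VD(2)[of "S N", OF _ wn] by (simp add: a(2))
  qed
  \<comment> \<open>\<open>a\<close> was built from vector functionals only. The remainder of the
    series for \<open>f\<close> is represented by the tails of \<open>\<xi>\<close> and
    \<open>\<eta>\<close>, whose norms tend to 0, so that \<open>K f\<close> is the value of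
    \<open>f\<close> at \<open>a\<close>.\<close>
  have tail: "cmod (K f - K (S N)) \<le> (sqnorm (\<lambda>n. \<xi> (n + N)) + sqnorm (\<lambda>n. \<eta> (n + N))) / 2" for N
  proof -
    have ss: "sqsum (\<lambda>n. \<xi> (n + N))" "sqsum (\<lambda>n. \<eta> (n + N))"
      using r(1,2) unfolding sqsum_def by (simp_all add: summable_iff_shift[of "\<lambda>n. (norm (\<xi> n))\<^sup>2"] summable_iff_shift[of "\<lambda>n. (norm (\<eta> n))\<^sup>2"])
    have "normal_rep M (\<lambda>x. f x + - S N x) (\<lambda>n. \<xi> (n + N)) (\<lambda>n. \<eta> (n + N))"
      unfolding normal_rep_def
    proof (intro conjI ballI ss)
      fix b assume b: "b \<in> M"
      have "summable (\<lambda>n. cinner (b (\<xi> n)) (\<eta> n))" using trf_sums(2)[OF cb[OF b] r(1,2)] by (rule sums_summable)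
      from suminf_split_initial_segment[OF this, of N]
      show "f b + - S N b = trf (\<lambda>n. \<xi> (n + N)) (\<lambda>n. \<eta> (n + N)) b" unfolding r(3)[OF b] trf_def S_def w_def by simp
    qed
    from rep_norm_le[OF this] show ?thesis
      unfolding Kdiff[OF f conjunct1[OF Sn]] using KP[OF VD(2)[OF f VD(4)[OF conjunct1[OF Sn, of N]]]] by linarith
  qed
  have sh: "(\<lambda>N. sqnorm (\<lambda>n. \<zeta> (n + N))) \<longlonglongrightarrow> 0" if "sqsum \<zeta>" for \<zeta> :: "nat \<Rightarrow> 'a"
    unfolding sqnorm_def by (rule suminf_exist_split2) (use that in \<open>simp add: sqsum_def\<close>)
  have "(\<lambda>N. K f - K (S N)) \<longlonglongrightarrow> 0"
  proof (rule Lim_null_comparison[OF always_eventually])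
    show "\<forall>N. cmod (K f - K (S N)) \<le> (sqnorm (\<lambda>n. \<xi> (n + N)) + sqnorm (\<lambda>n. \<eta> (n + N))) / 2" using tail by blast
    show "(\<lambda>N. (sqnorm (\<lambda>n. \<xi> (n + N)) + sqnorm (\<lambda>n. \<eta> (n + N))) / 2) \<longlonglongrightarrow> 0"
      using tendsto_divide[OF tendsto_add[OF sh[OF r(1)] sh[OF r(2)]] tendsto_const[of 2]] by simp
  qed
  moreover have "(\<lambda>N. K f - K (S N)) \<longlonglongrightarrow> K f - f a"
    using tendsto_diff[OF tendsto_const trf_sums(2)[OF a(1) r(1,2), unfolded sums_def], of "K f"] Sn r(3)[OF aM] by simp
  ultimately have "K f = f a" using LIMSEQ_unique by fastforce
  then have "rep_norm M f = Re (f a)" unfolding Lf[symmetric] by (metis K_def complex.sel(1))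
  also have "\<dots> \<le> e" using b[OF aM a1] complex_Re_le_cmod[of "f a"] by linarith
  finally show ?thesis .
qed

text \<open>Completeness of the predual in the form of a series. Bounds on the unit ball give
  representing sequences with summable square norms by \<open>rep_norm_le_bound\<close>, and
  flattening them represents the sum.\<close>

lemma normals_series:
  assumes M: "op_subspace M" and bic: "commutant (commutant M) = M" and g: "\<And>k. g k \<in> normals M"
    and b: "\<And>k a. a \<in> M \<Longrightarrow> onorm a \<le> 1 \<Longrightarrow> cmod (g k a) \<le> e k" and e: "summable e"
  obtains f where "f \<in> normals M" "\<And>a. a \<in> M \<Longrightarrow> (\<lambda>k. g k a) sums f a"
proof -
  have Mb: "M \<subseteq> bounded_ops" using M unfolding op_subspace_def by blast
  \<comment> \<open>The infimum \<open>rep_norm\<close> is at most \<open>e k\<close> but need not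
    be attained; the extra \<open>(1/2) ^ k\<close> makes the inequality strict and keeps the bounds
    summable.\<close>
  define d where "d k = e k + (1/2) ^ k" for k
  have ds: "summable d" unfolding d_def by (intro summable_add e summable_geometric) simp
  have "\<exists>\<xi> \<eta>. normal_rep M (g k) \<xi> \<eta> \<and> (sqnorm \<xi> + sqnorm \<eta>) / 2 < d k" for k
  proof -
    have "rep_norm M (g k) \<le> e k" by (rule rep_norm_le_bound[OF M bic g b])
    then have "rep_norm M (g k) < d k" unfolding d_def by (simp add: le_less_trans)
    from rep_norm_approx[OF g this] show ?thesis by blast
  qed
  then obtain X Y where XY: "\<And>k. normal_rep M (g k) (X k) (Y k)" "\<And>k. (sqnorm (X k) + sqnorm (Y k)) / 2 < d k" by metis
  have s: "sqsum (X k)" "sqsum (Y k)" for k using XY(1)[of k] unfolding normal_rep_def by auto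
  have "summable (\<lambda>k. sqnorm (X k))"
  proof (rule summable_comparison_test[OF _ summable_mult[OF ds, of 2]], intro exI allI impI)
    show "norm (sqnorm (X k)) \<le> 2 * d k" for k
      using XY(2)[of k] sqnorm_nonneg[OF s(1), of k] sqnorm_nonneg[OF s(2), of k] by simp
  qed
  moreover have "summable (\<lambda>k. sqnorm (Y k))"
  proof (rule summable_comparison_test[OF _ summable_mult[OF ds, of 2]], intro exI allI impI)
    show "norm (sqnorm (Y k)) \<le> 2 * d k" for k
      using XY(2)[of k] sqnorm_nonneg[OF s(1), of k] sqnorm_nonneg[OF s(2), of k] by simp
  qed
  ultimately have S: "summable (\<lambda>k. sqnorm (X k))" "summable (\<lambda>k. sqnorm (Y k))" by auto
  have "normal_rep M (trf (flatten X) (flatten Y)) (flatten X) (flatten Y)"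
    unfolding normal_rep_def using flatten_sqsum(1)[OF s(1) S(1)] flatten_sqsum(1)[OF s(2) S(2)] by simp
  then have "trf (flatten X) (flatten Y) \<in> normals M" unfolding normals_def by blast
  moreover have "(\<lambda>k. g k a) sums trf (flatten X) (flatten Y) a" if a: "a \<in> M" for a
  proof -
    have "cblinear a" using Mb a bounded_ops_iff by blast
    from trf_flatten[OF this s(1) S(1) s(2) S(2)]
    show ?thesis using XY(1) a unfolding normal_rep_def by simp
  qed
  ultimately show thesis using that by blast
qed

subsection \<open>Matrix norms\<close>

text \<open>Only finiteness of the supremum in \<open>opmat_norm\<close> is at stake, so the sum of
  all entry norms is good enough.\<close>

lemma opmat_norm_bdd:
  fixes a :: "'i \<Rightarrow> 'i \<Rightarrow> 'a::real_normed_vector \<Rightarrow> 'a"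
  assumes I: "finite I" and a: "\<And>i j. i \<in> I \<Longrightarrow> j \<in> I \<Longrightarrow> bounded_linear (a i j)"
  shows "bdd_above {sqrt (\<Sum>i\<in>I. (norm (\<Sum>j\<in>I. a i j (\<xi> j)))\<^sup>2) |\<xi>. (\<Sum>j\<in>I. (norm (\<xi> j))\<^sup>2) \<le> 1}"
proof (rule bdd_aboveI, clarify)
  fix \<xi> assume x: "(\<Sum>j\<in>I. (norm (\<xi> j :: 'a))\<^sup>2) \<le> 1"
  have n1: "norm (\<xi> j) \<le> 1" if "j \<in> I" for j
  proof -
    have "(norm (\<xi> j))\<^sup>2 \<le> 1" using member_le_sum[OF that _ I, of "\<lambda>j. (norm (\<xi> j))\<^sup>2"] x by simp
    then show ?thesis by (simp add: abs_square_le_1)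
  qed
  have "sqrt (\<Sum>i\<in>I. (norm (\<Sum>j\<in>I. a i j (\<xi> j)))\<^sup>2) \<le> (\<Sum>i\<in>I. norm (\<Sum>j\<in>I. a i j (\<xi> j)))"
    using L2_set_le_sum[of I "\<lambda>i. norm (\<Sum>j\<in>I. a i j (\<xi> j))"] by (simp add: L2_set_def)
  also have "\<dots> \<le> (\<Sum>i\<in>I. \<Sum>j\<in>I. onorm (a i j))"
  proof (rule sum_mono)
    fix i assume i: "i \<in> I"
    have "norm (\<Sum>j\<in>I. a i j (\<xi> j)) \<le> (\<Sum>j\<in>I. norm (a i j (\<xi> j)))" by (rule norm_sum)
    also have "\<dots> \<le> (\<Sum>j\<in>I. onorm (a i j))"
    proof (rule sum_mono)
      fix j assume j: "j \<in> I"
      have "norm (a i j (\<xi> j)) \<le> onorm (a i j) * norm (\<xi> j)" by (rule onorm[OF a[OF i j]])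
      also have "\<dots> \<le> onorm (a i j) * 1" by (rule mult_left_mono[OF n1[OF j] onorm_pos_le[OF a[OF i j]]])
      finally show "norm (a i j (\<xi> j)) \<le> onorm (a i j)" by simp
    qed
    finally show "norm (\<Sum>j\<in>I. a i j (\<xi> j)) \<le> (\<Sum>j\<in>I. onorm (a i j))" .
  qed
  finally show "sqrt (\<Sum>i\<in>I. (norm (\<Sum>j\<in>I. a i j (\<xi> j)))\<^sup>2) \<le> (\<Sum>i\<in>I. \<Sum>j\<in>I. onorm (a i j))" .
qed

lemma opmat_norm_le:
  fixes a :: "'i \<Rightarrow> 'i \<Rightarrow> 'a::real_normed_vector \<Rightarrow> 'a"
  assumes I: "finite I" and a: "\<And>i j. i \<in> I \<Longrightarrow> j \<in> I \<Longrightarrow> bounded_linear (a i j)"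
  shows "L2_set (\<lambda>i. norm (\<Sum>j\<in>I. a i j (\<xi> j))) I \<le> opmat_norm I a * L2_set (\<lambda>j. norm (\<xi> j)) I"
proof (cases "L2_set (\<lambda>j. norm (\<xi> j)) I = 0")
  case True
  then have "\<xi> j = 0" if "j \<in> I" for j using L2_set_eq_0_iff[OF I, of "\<lambda>j. norm (\<xi> j)"] that by simp
  then have "(\<Sum>j\<in>I. a i j (\<xi> j)) = 0" if "i \<in> I" for i
    using bounded_linear.linear[OF a[OF that]] by (intro sum.neutral) (auto simp: linear_0)
  then have "L2_set (\<lambda>i. norm (\<Sum>j\<in>I. a i j (\<xi> j))) I = 0" by (simp add: L2_set_eq_0_iff[OF I])
  then show ?thesis using True by simp
next
  case False
  define r where "r = L2_set (\<lambda>j. norm (\<xi> j)) I"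
  have r: "r > 0" using False L2_set_nonneg[of "\<lambda>j. norm (\<xi> j)" I] unfolding r_def by linarith
  define \<zeta> where "\<zeta> j = inverse r *\<^sub>R \<xi> j" for j
  have "L2_set (\<lambda>j. norm (\<zeta> j)) I = L2_set (\<lambda>j. inverse r * norm (\<xi> j)) I" unfolding \<zeta>_def using r by simp
  also have "\<dots> = inverse r * r" unfolding r_def by (rule L2_set_right_distrib[symmetric]) (simp add: L2_set_nonneg)
  finally have "L2_set (\<lambda>j. norm (\<zeta> j)) I = 1" using r by simp
  then have "(\<Sum>j\<in>I. (norm (\<zeta> j))\<^sup>2) = 1" by (simp add: L2_set_def)
  then have "L2_set (\<lambda>i. norm (\<Sum>j\<in>I. a i j (\<zeta> j))) I \<le> opmat_norm I a"
    unfolding opmat_norm_def L2_set_def by (intro cSup_upper opmat_norm_bdd[OF I a]) auto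
  moreover have "L2_set (\<lambda>i. norm (\<Sum>j\<in>I. a i j (\<zeta> j))) I = inverse r * L2_set (\<lambda>i. norm (\<Sum>j\<in>I. a i j (\<xi> j))) I"
  proof -
    have "norm (\<Sum>j\<in>I. a i j (\<zeta> j)) = inverse r * norm (\<Sum>j\<in>I. a i j (\<xi> j))" if i: "i \<in> I" for i
    proof -
      have "(\<Sum>j\<in>I. a i j (\<zeta> j)) = (\<Sum>j\<in>I. inverse r *\<^sub>R a i j (\<xi> j))"
        unfolding \<zeta>_def by (rule sum.cong[OF refl]) (rule linear_scale[OF bounded_linear.linear[OF a[OF i]]])
      then show ?thesis using r by (simp add: scaleR_sum_right[symmetric])
    qed
    then have "L2_set (\<lambda>i. norm (\<Sum>j\<in>I. a i j (\<zeta> j))) I = L2_set (\<lambda>i. inverse r * norm (\<Sum>j\<in>I. a i j (\<xi> j))) I"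
      by (rule L2_set_cong[OF refl])
    also have "\<dots> = inverse r * L2_set (\<lambda>i. norm (\<Sum>j\<in>I. a i j (\<xi> j))) I"
      by (rule L2_set_right_distrib[symmetric]) (use r in simp)
    finally show ?thesis .
  qed
  ultimately show ?thesis using r unfolding r_def[symmetric] by (simp add: field_simps)
qed

lemma opmat_norm_leI:
  assumes "0 \<le> C" "\<And>\<xi>. L2_set (\<lambda>i. norm (\<Sum>j\<in>I. a i j (\<xi> j))) I \<le> C * L2_set (\<lambda>j. norm (\<xi> j)) I"
  shows "opmat_norm I a \<le> C"
  unfolding opmat_norm_def
proof (rule cSup_least)
  have "sqrt (\<Sum>i\<in>I. (norm (\<Sum>j\<in>I. a i j 0))\<^sup>2) \<in> {sqrt (\<Sum>i\<in>I. (norm (\<Sum>j\<in>I. a i j (\<xi> j)))\<^sup>2) |\<xi>. (\<Sum>j\<in>I. (norm (\<xi> j))\<^sup>2) \<le> 1}"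
    by (intro CollectI exI[of _ "\<lambda>_. 0"]) simp
  then show "{sqrt (\<Sum>i\<in>I. (norm (\<Sum>j\<in>I. a i j (\<xi> j)))\<^sup>2) |\<xi>. (\<Sum>j\<in>I. (norm (\<xi> j))\<^sup>2) \<le> 1} \<noteq> {}" by blast
next
  fix z assume "z \<in> {sqrt (\<Sum>i\<in>I. (norm (\<Sum>j\<in>I. a i j (\<xi> j)))\<^sup>2) |\<xi>. (\<Sum>j\<in>I. (norm (\<xi> j))\<^sup>2) \<le> 1}"
  then obtain \<xi> where z: "z = L2_set (\<lambda>i. norm (\<Sum>j\<in>I. a i j (\<xi> j))) I" and x: "L2_set (\<lambda>j. norm (\<xi> j)) I \<le> 1"
    by (auto simp: L2_set_def)
  have "z \<le> C * L2_set (\<lambda>j. norm (\<xi> j)) I" unfolding z by (rule assms(2))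
  also have "\<dots> \<le> C" using mult_left_mono[OF x assms(1)] by simp
  finally show "z \<le> C" .
qed

lemma opmat_norm_nonneg:
  fixes a :: "'i \<Rightarrow> 'i \<Rightarrow> 'a::real_normed_vector \<Rightarrow> 'a"
  assumes I: "finite I" and a: "\<And>i j. i \<in> I \<Longrightarrow> j \<in> I \<Longrightarrow> bounded_linear (a i j)"
  shows "0 \<le> opmat_norm I a"
proof -
  have "sqrt (\<Sum>i\<in>I. (norm (\<Sum>j\<in>I. a i j 0))\<^sup>2) \<le> opmat_norm I a"
    unfolding opmat_norm_def
    by (intro cSup_upper opmat_norm_bdd[OF I a]) (auto intro!: exI[of _ "\<lambda>_. 0"])
  moreover have "0 \<le> sqrt (\<Sum>i\<in>I. (norm (\<Sum>j\<in>I. a i j 0))\<^sup>2)" by (simp add: sum_nonneg)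
  ultimately show ?thesis by linarith
qed

text \<open>The form is tested with \<open>\<eta>\<close> equal to the image of
  \<open>\<xi>\<close>, after which one factor cancels; the real part of the form suffices for
  this.\<close>

lemma opmat_norm_le_formI:
  fixes a :: "'i \<Rightarrow> 'i \<Rightarrow> 'a::real_inner \<Rightarrow> 'a"
  assumes C: "0 \<le> C" and b: "\<And>\<xi> \<eta>. (\<Sum>i\<in>I. inner (\<Sum>j\<in>I. a i j (\<xi> j)) (\<eta> i))
      \<le> C * L2_set (\<lambda>j. norm (\<xi> j)) I * L2_set (\<lambda>i. norm (\<eta> i)) I"
  shows "opmat_norm I a \<le> C"
proof (rule opmat_norm_leI[OF C])
  fix \<xi>
  let ?t = "L2_set (\<lambda>i. norm (\<Sum>j\<in>I. a i j (\<xi> j))) I"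
  have "?t * ?t = (\<Sum>i\<in>I. (norm (\<Sum>j\<in>I. a i j (\<xi> j)))\<^sup>2)"
    unfolding L2_set_def by (simp add: sum_nonneg)
  also have "\<dots> \<le> C * L2_set (\<lambda>j. norm (\<xi> j)) I * ?t"
    using b[of \<xi> "\<lambda>i. \<Sum>j\<in>I. a i j (\<xi> j)"] by (simp add: power2_norm_eq_inner)
  finally have *: "?t * ?t \<le> C * L2_set (\<lambda>j. norm (\<xi> j)) I * ?t" .
  show "?t \<le> C * L2_set (\<lambda>j. norm (\<xi> j)) I"
  proof (cases "?t = 0")
    case True
    then show ?thesis using C L2_set_nonneg[of "\<lambda>j. norm (\<xi> j)" I] by simp
  next
    case False
    then have "?t > 0" using L2_set_nonneg[of "\<lambda>i. norm (\<Sum>j\<in>I. a i j (\<xi> j))" I] by linarith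
    then show ?thesis using * by simp
  qed
qed

lemma sum_cinner_le_L2: "cmod (\<Sum>i\<in>I. cinner (x i) (y i)) \<le> L2_set (\<lambda>i. norm (x i)) I * L2_set (\<lambda>i. norm (y i)) I"
proof -
  have "cmod (\<Sum>i\<in>I. cinner (x i) (y i)) \<le> (\<Sum>i\<in>I. norm (x i) * norm (y i))"
    by (rule sum_norm_le) (rule norm_cinner_le)
  also have "\<dots> \<le> L2_set (\<lambda>i. norm (x i)) I * L2_set (\<lambda>i. norm (y i)) I"
    using L2_set_mult_ineq[of "\<lambda>i. norm (x i)" "\<lambda>i. norm (y i)" I] by simp
  finally show ?thesis .
qed

lemma opmat_form_le:
  fixes a :: "'i \<Rightarrow> 'i \<Rightarrow> 'a::chilbert_space op"
  assumes I: "finite I" and a: "\<And>i j. i \<in> I \<Longrightarrow> j \<in> I \<Longrightarrow> a i j \<in> bounded_ops"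
  shows "cmod (\<Sum>i\<in>I. \<Sum>j\<in>I. cinner (a i j (\<xi> j)) (\<eta> i)) \<le> opmat_norm I a * L2_set (\<lambda>j. norm (\<xi> j)) I * L2_set (\<lambda>i. norm (\<eta> i)) I"
proof -
  have bl: "bounded_linear (a i j)" if "i \<in> I" "j \<in> I" for i j using a[OF that] by (simp add: bounded_ops_def)
  have "cmod (\<Sum>i\<in>I. \<Sum>j\<in>I. cinner (a i j (\<xi> j)) (\<eta> i)) = cmod (\<Sum>i\<in>I. cinner (\<Sum>j\<in>I. a i j (\<xi> j)) (\<eta> i))"
    by (simp add: cinner_sum_left)
  also have "\<dots> \<le> L2_set (\<lambda>i. norm (\<Sum>j\<in>I. a i j (\<xi> j))) I * L2_set (\<lambda>i. norm (\<eta> i)) I"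
    by (rule sum_cinner_le_L2)
  also have "\<dots> \<le> (opmat_norm I a * L2_set (\<lambda>j. norm (\<xi> j)) I) * L2_set (\<lambda>i. norm (\<eta> i)) I"
    by (intro mult_right_mono opmat_norm_le I bl L2_set_nonneg)
  finally show ?thesis .
qed

lemma cmat_norm_leI:
  assumes C: "0 \<le> C" and b: "\<And>\<gamma> \<delta>. cmod (\<Sum>i\<in>I. \<Sum>j\<in>I. c i j * \<gamma> j * cnj (\<delta> i)) \<le> C * L2_set (\<lambda>j. cmod (\<gamma> j)) I * L2_set (\<lambda>i. cmod (\<delta> i)) I"
  shows "cmat_norm I c \<le> C"
  unfolding cmat_norm_def
proof (rule opmat_norm_le_formI[OF C])
  fix \<gamma> \<delta> :: "'a \<Rightarrow> complex"
  have i: "inner z w = Re (z * cnj w)" for z w :: complex by (simp add: inner_complex_def)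
  have "(\<Sum>i\<in>I. inner (\<Sum>j\<in>I. c i j * \<gamma> j) (\<delta> i)) = Re (\<Sum>i\<in>I. \<Sum>j\<in>I. c i j * \<gamma> j * cnj (\<delta> i))"
    unfolding i by (simp only: Re_sum sum_distrib_right)
  also have "\<dots> \<le> C * L2_set (\<lambda>j. cmod (\<gamma> j)) I * L2_set (\<lambda>i. cmod (\<delta> i)) I"
    using b[of \<gamma> \<delta>] complex_Re_le_cmod order_trans by blast
  finally show "(\<Sum>i\<in>I. inner (\<Sum>j\<in>I. c i j * \<gamma> j) (\<delta> i)) \<le> C * L2_set (\<lambda>j. norm (\<gamma> j)) I * L2_set (\<lambda>i. norm (\<delta> i)) I" .
qed

lemma cmat_norm_nonneg: "finite I \<Longrightarrow> 0 \<le> cmat_norm I c"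
  unfolding cmat_norm_def by (rule opmat_norm_nonneg) (auto intro: bounded_linear_mult_right)

lemma cmat_form_le:
  assumes I: "finite I"
  shows "cmod (\<Sum>i\<in>I. \<Sum>j\<in>I. c i j * \<gamma> j * cnj (\<delta> i)) \<le> cmat_norm I c * L2_set (\<lambda>j. cmod (\<gamma> j)) I * L2_set (\<lambda>i. cmod (\<delta> i)) I"
proof -
  have "cmod (\<Sum>i\<in>I. \<Sum>j\<in>I. c i j * \<gamma> j * cnj (\<delta> i)) = cmod (\<Sum>i\<in>I. (\<Sum>j\<in>I. c i j * \<gamma> j) * cnj (\<delta> i))"
    by (simp only: sum_distrib_right)
  also have "\<dots> \<le> (\<Sum>i\<in>I. cmod (\<Sum>j\<in>I. c i j * \<gamma> j) * cmod (\<delta> i))"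
    by (rule sum_norm_le) (simp add: norm_mult)
  also have "\<dots> \<le> L2_set (\<lambda>i. cmod (\<Sum>j\<in>I. c i j * \<gamma> j)) I * L2_set (\<lambda>i. cmod (\<delta> i)) I"
    using L2_set_mult_ineq[of "\<lambda>i. cmod (\<Sum>j\<in>I. c i j * \<gamma> j)" "\<lambda>i. cmod (\<delta> i)" I] by simp
  also have "\<dots> \<le> (cmat_norm I c * L2_set (\<lambda>j. cmod (\<gamma> j)) I) * L2_set (\<lambda>i. cmod (\<delta> i)) I"
    unfolding cmat_norm_def
    by (intro mult_right_mono opmat_norm_le[OF I] bounded_linear_mult_right L2_set_nonneg)
  finally show ?thesis .
qed

lemma L2_set_prod: "L2_set (\<lambda>(i, k). f i k) (I \<times> K) = L2_set (\<lambda>i. L2_set (f i) K) I"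
  unfolding L2_set_def by (simp add: sum_nonneg sum.cartesian_product case_prod_unfold)

lemma L2_set_prod_swap: "L2_set (\<lambda>i. L2_set (f i) K) I = L2_set (\<lambda>k. L2_set (\<lambda>i. f i k) I) K"
  unfolding L2_set_def by (simp add: sum_nonneg) (rule sum.swap)

text \<open>The matrix with entries \<open>x i j\<close> after \<open>y k l\<close> acts in two
  steps: \<open>y\<close> on the index \<open>l\<close>, then \<open>x\<close> on the index
  \<open>j\<close>, and the square norms over \<open>I \<times> K\<close> are iterated in the
  matching order. It serves operator matrices for the vector forms and scalar matrices for
  \<open>cmat_norm_tensor\<close>.\<close>

lemma opmat_tensor_le:
  fixes x y :: "'i \<Rightarrow> 'i \<Rightarrow> 'a::real_normed_vector \<Rightarrow> 'a"
  assumes I: "finite I" and K: "finite K" and x: "\<And>i j. i \<in> I \<Longrightarrow> j \<in> I \<Longrightarrow> bounded_linear (x i j)"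
    and y: "\<And>i j. i \<in> K \<Longrightarrow> j \<in> K \<Longrightarrow> bounded_linear (y i j)"
  shows "L2_set (\<lambda>(i, k). norm (\<Sum>(j, l)\<in>I \<times> K. x i j (y k l (v j l)))) (I \<times> K)
    \<le> opmat_norm I x * opmat_norm K y * L2_set (\<lambda>(j, l). norm (v j l)) (I \<times> K)"
proof -
  define u where "u k j = (\<Sum>l\<in>K. y k l (v j l))" for k j
  have e: "(\<Sum>(j, l)\<in>I \<times> K. x i j (y k l (v j l))) = (\<Sum>j\<in>I. x i j (u k j))" if "i \<in> I" for i k
    unfolding sum.cartesian_product[symmetric] u_def
    by (rule sum.cong[OF refl]) (rule linear_sum[OF bounded_linear.linear[OF x[OF that]], symmetric])
  have nx: "0 \<le> opmat_norm I x" and ny: "0 \<le> opmat_norm K y" using opmat_norm_nonneg I K x y by blast+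
  have "L2_set (\<lambda>(i, k). norm (\<Sum>(j, l)\<in>I \<times> K. x i j (y k l (v j l)))) (I \<times> K)
      = L2_set (\<lambda>(i, k). norm (\<Sum>j\<in>I. x i j (u k j))) (I \<times> K)"
    by (rule L2_set_cong[OF refl]) (auto simp: e)
  also have "\<dots> = L2_set (\<lambda>k. L2_set (\<lambda>i. norm (\<Sum>j\<in>I. x i j (u k j))) I) K"
    unfolding L2_set_prod by (rule L2_set_prod_swap)
  also have "\<dots> \<le> L2_set (\<lambda>k. opmat_norm I x * L2_set (\<lambda>j. norm (u k j)) I) K"
    by (rule L2_set_mono[OF opmat_norm_le[OF I x]]) (auto simp: L2_set_nonneg)
  also have "\<dots> = opmat_norm I x * L2_set (\<lambda>j. L2_set (\<lambda>k. norm (u k j)) K) I"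
    unfolding L2_set_right_distrib[OF nx, symmetric]
    by (rule arg_cong[where f = "\<lambda>z. opmat_norm I x * z", OF L2_set_prod_swap])
  also have "\<dots> \<le> opmat_norm I x * L2_set (\<lambda>j. opmat_norm K y * L2_set (\<lambda>l. norm (v j l)) K) I"
    unfolding u_def by (intro mult_left_mono[OF _ nx] L2_set_mono opmat_norm_le[OF K y]) (auto simp: L2_set_nonneg)
  also have "\<dots> = opmat_norm I x * opmat_norm K y * L2_set (\<lambda>(j, l). norm (v j l)) (I \<times> K)"
    unfolding L2_set_right_distrib[OF ny, symmetric] L2_set_prod by simp
  finally show ?thesis .
qed

lemma cmat_norm_mono_cong:
  assumes "\<And>i j. i \<in> I \<Longrightarrow> j \<in> I \<Longrightarrow> c i j = d i j"
  shows "cmat_norm I c = cmat_norm I d"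
proof -
  have "(\<Sum>j\<in>I. c i j * \<gamma> j) = (\<Sum>j\<in>I. d i j * \<gamma> j)" if "i \<in> I" for i \<gamma>
    by (rule sum.cong) (use assms that in auto)
  then show ?thesis unfolding cmat_norm_def opmat_norm_def by simp
qed

lemma L2_set_norm_scaleC: "L2_set (\<lambda>i. norm (c i *\<^sub>C x)) I = L2_set (\<lambda>i. cmod (c i)) I * norm (x :: 'a::chilbert_space)"
  by (simp add: norm_scaleC L2_set_left_distrib)

text \<open>Pairing the scalar matrix with \<open>\<gamma>\<close> and \<open>\<delta>\<close> is
  pairing the operator matrix with the vectors \<open>\<gamma> q *\<^sub>C \<xi>\<close> and
  \<open>\<delta> p *\<^sub>C \<xi>\<close>; each of them contributes one factor
  \<open>norm \<xi>\<close>.\<close>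

lemma cmat_norm_vector_functional:
  fixes x y :: "nat \<Rightarrow> nat \<Rightarrow> 'a::chilbert_space op"
  assumes I: "finite I" and K: "finite K" and x: "\<And>i j. i \<in> I \<Longrightarrow> j \<in> I \<Longrightarrow> x i j \<in> bounded_ops"
    and y: "\<And>i j. i \<in> K \<Longrightarrow> j \<in> K \<Longrightarrow> y i j \<in> bounded_ops"
  shows "cmat_norm (I \<times> K) (\<lambda>(i, k) (j, l). cinner (x i j (y k l \<xi>)) \<xi>) \<le> opmat_norm I x * opmat_norm K y * (norm \<xi>)\<^sup>2"
proof (rule cmat_norm_leI)
  have xb: "\<And>i j. i \<in> I \<Longrightarrow> j \<in> I \<Longrightarrow> bounded_linear (x i j)" and yb: "\<And>i j. i \<in> K \<Longrightarrow> j \<in> K \<Longrightarrow> bounded_linear (y i j)"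
    using x y by (auto simp: bounded_ops_def)
  have nx: "0 \<le> opmat_norm I x" and ny: "0 \<le> opmat_norm K y" using opmat_norm_nonneg I K xb yb by blast+
  then show "0 \<le> opmat_norm I x * opmat_norm K y * (norm \<xi>)\<^sup>2" by simp
  fix \<gamma> \<delta> :: "nat \<times> nat \<Rightarrow> complex"
  have t: "(case p of (i, k) \<Rightarrow> \<lambda>(j, l). cinner (x i j (y k l \<xi>)) \<xi>) q * \<gamma> q * cnj (\<delta> p)
      = cinner (case q of (j, l) \<Rightarrow> x (fst p) j (y (snd p) l (\<gamma> (j, l) *\<^sub>C \<xi>))) (\<delta> p *\<^sub>C \<xi>)"
    if "p \<in> I \<times> K" "q \<in> I \<times> K" for p q
  proof -
    obtain i k where p: "p = (i, k)" by (cases p)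
    obtain j l where q: "q = (j, l)" by (cases q)
    note pq = p q
    have pq': "i \<in> I" "k \<in> K" "j \<in> I" "l \<in> K" using that unfolding pq by auto
    have "cblinear (x i j)" "cblinear (y k l)" using x[OF pq'(1,3)] y[OF pq'(2,4)] bounded_ops_iff by blast+
    from cblinear_simps(5)[OF this(1)] cblinear_simps(5)[OF this(2)] show ?thesis
      unfolding pq by (simp add: cinner_scaleC_left cinner_scaleC_right mult_ac)
  qed
  have "(\<Sum>p\<in>I \<times> K. \<Sum>q\<in>I \<times> K. (case p of (i, k) \<Rightarrow> \<lambda>(j, l). cinner (x i j (y k l \<xi>)) \<xi>) q * \<gamma> q * cnj (\<delta> p))
      = (\<Sum>p\<in>I \<times> K. cinner (\<Sum>(j, l)\<in>I \<times> K. x (fst p) j (y (snd p) l (\<gamma> (j, l) *\<^sub>C \<xi>))) (\<delta> p *\<^sub>C \<xi>))"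
    unfolding cinner_sum_left by (intro sum.cong refl t)
  also have "cmod \<dots> \<le> L2_set (\<lambda>p. norm (\<Sum>(j, l)\<in>I \<times> K. x (fst p) j (y (snd p) l (\<gamma> (j, l) *\<^sub>C \<xi>)))) (I \<times> K)
      * L2_set (\<lambda>p. norm (\<delta> p *\<^sub>C \<xi>)) (I \<times> K)" by (rule sum_cinner_le_L2)
  also have "\<dots> \<le> (opmat_norm I x * opmat_norm K y * L2_set (\<lambda>(j, l). norm (\<gamma> (j, l) *\<^sub>C \<xi>)) (I \<times> K))
      * L2_set (\<lambda>p. norm (\<delta> p *\<^sub>C \<xi>)) (I \<times> K)"
    using opmat_tensor_le[where x = x and y = y and v = "\<lambda>j l. \<gamma> (j, l) *\<^sub>C \<xi>", OF I K xb yb]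
    by (intro mult_right_mono L2_set_nonneg) (simp add: case_prod_unfold)
  also have "\<dots> = opmat_norm I x * opmat_norm K y * (norm \<xi>)\<^sup>2 * L2_set (\<lambda>j. cmod (\<gamma> j)) (I \<times> K) * L2_set (\<lambda>i. cmod (\<delta> i)) (I \<times> K)"
    by (simp add: case_prod_unfold L2_set_norm_scaleC power2_eq_square mult_ac)
  finally show "cmod (\<Sum>p\<in>I \<times> K. \<Sum>q\<in>I \<times> K. (case p of (i, k) \<Rightarrow> \<lambda>(j, l). cinner (x i j (y k l \<xi>)) \<xi>) q * \<gamma> q * cnj (\<delta> p))
      \<le> opmat_norm I x * opmat_norm K y * (norm \<xi>)\<^sup>2 * L2_set (\<lambda>j. cmod (\<gamma> j)) (I \<times> K) * L2_set (\<lambda>i. cmod (\<delta> i)) (I \<times> K)" .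
qed

lemma cmat_norm_tensor:
  fixes c d :: "nat \<Rightarrow> nat \<Rightarrow> complex"
  assumes I: "finite I" and K: "finite K"
  shows "cmat_norm (I \<times> K) (\<lambda>(i, k) (j, l). c i j * d k l) \<le> cmat_norm I c * cmat_norm K d"
  unfolding cmat_norm_def[of "I \<times> K"]
proof (rule opmat_norm_leI)
  show "0 \<le> cmat_norm I c * cmat_norm K d" using cmat_norm_nonneg[OF I, of c] cmat_norm_nonneg[OF K, of d] by simp
  fix \<gamma> :: "nat \<times> nat \<Rightarrow> complex"
  show "L2_set (\<lambda>p. cmod (\<Sum>q\<in>I \<times> K. (case p of (i, k) \<Rightarrow> \<lambda>(j, l). c i j * d k l) q * \<gamma> q)) (I \<times> K)
      \<le> cmat_norm I c * cmat_norm K d * L2_set (\<lambda>q. norm (\<gamma> q)) (I \<times> K)"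
    using opmat_tensor_le[OF I K, of "\<lambda>i j z. c i j * z" "\<lambda>k l z. d k l * z" "\<lambda>j l. \<gamma> (j, l)"]
    unfolding cmat_norm_def by (simp add: bounded_linear_mult_right case_prod_unfold mult.assoc)
qed

text \<open>A normal functional is completely bounded with the same bound as its representation. For
  each \<open>n\<close> the scalar form is the operator form at the vectors
  \<open>\<gamma> j *\<^sub>C \<xi> n\<close> and \<open>\<delta> i *\<^sub>C \<eta> n\<close>, and
  the resulting bounds are summed over \<open>n\<close>.\<close>

lemma cmat_norm_normal:
  fixes x :: "'i \<Rightarrow> 'i \<Rightarrow> 'a::chilbert_space op"
  assumes M: "M \<subseteq> bounded_ops" and r: "normal_rep M f \<xi> \<eta>" and I: "finite I"
    and x: "\<And>i j. i \<in> I \<Longrightarrow> j \<in> I \<Longrightarrow> x i j \<in> M"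
  shows "cmat_norm I (\<lambda>i j. f (x i j)) \<le> (sqnorm \<xi> + sqnorm \<eta>) / 2 * opmat_norm I x"
proof (rule cmat_norm_leI)
  have s: "sqsum \<xi>" "sqsum \<eta>" and fr: "\<And>a. a \<in> M \<Longrightarrow> f a = trf \<xi> \<eta> a" using r unfolding normal_rep_def by auto
  have xb: "x i j \<in> bounded_ops" if "i \<in> I" "j \<in> I" for i j using x M that by blast
  have nx: "0 \<le> opmat_norm I x" by (rule opmat_norm_nonneg[OF I]) (use xb in \<open>auto simp: bounded_ops_def\<close>)
  show "0 \<le> (sqnorm \<xi> + sqnorm \<eta>) / 2 * opmat_norm I x"
    using nx sqnorm_nonneg[OF s(1)] sqnorm_nonneg[OF s(2)] by simp
  fix \<gamma> \<delta>
  let ?g = "L2_set (\<lambda>j. cmod (\<gamma> j)) I" and ?d = "L2_set (\<lambda>i. cmod (\<delta> i)) I"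
  define t where "t n = (\<Sum>i\<in>I. \<Sum>j\<in>I. cinner (x i j (\<xi> n)) (\<eta> n) * \<gamma> j * cnj (\<delta> i))" for n
  have ts: "t sums (\<Sum>i\<in>I. \<Sum>j\<in>I. f (x i j) * \<gamma> j * cnj (\<delta> i))"
    unfolding t_def[abs_def]
  proof (rule sums_sum, rule sums_sum)
    fix i j assume ij: "i \<in> I" "j \<in> I"
    have "(\<lambda>n. cinner (x i j (\<xi> n)) (\<eta> n)) sums f (x i j)"
      unfolding fr[OF x[OF ij]] by (rule trf_sums(2)[OF xb[OF ij, unfolded bounded_ops_iff] s])
    from sums_mult2[OF sums_mult2[OF this]] show "(\<lambda>n. cinner (x i j (\<xi> n)) (\<eta> n) * \<gamma> j * cnj (\<delta> i)) sums (f (x i j) * \<gamma> j * cnj (\<delta> i))" .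
  qed
  have tb: "cmod (t n) \<le> opmat_norm I x * ?g * ?d * (((norm (\<xi> n))\<^sup>2 + (norm (\<eta> n))\<^sup>2) / 2)" for n
  proof -
    have "t n = (\<Sum>i\<in>I. \<Sum>j\<in>I. cinner (x i j (\<gamma> j *\<^sub>C \<xi> n)) (\<delta> i *\<^sub>C \<eta> n))"
      unfolding t_def
    proof (intro sum.cong refl)
      fix i j assume "i \<in> I" "j \<in> I"
      then have "cblinear (x i j)" using xb bounded_ops_iff by blast
      from cblinear_simps(5)[OF this] show "cinner (x i j (\<xi> n)) (\<eta> n) * \<gamma> j * cnj (\<delta> i) = cinner (x i j (\<gamma> j *\<^sub>C \<xi> n)) (\<delta> i *\<^sub>C \<eta> n)"
        by (simp add: cinner_scaleC_left cinner_scaleC_right mult_ac)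
    qed
    then have "cmod (t n) \<le> opmat_norm I x * (?g * norm (\<xi> n)) * (?d * norm (\<eta> n))"
      using opmat_form_le[where a = x and \<xi> = "\<lambda>j. \<gamma> j *\<^sub>C \<xi> n" and \<eta> = "\<lambda>i. \<delta> i *\<^sub>C \<eta> n", OF I xb] by (simp add: L2_set_norm_scaleC)
    also have "\<dots> = opmat_norm I x * ?g * ?d * (norm (\<xi> n) * norm (\<eta> n))" by (simp add: mult_ac)
    also have "\<dots> \<le> opmat_norm I x * ?g * ?d * (((norm (\<xi> n))\<^sup>2 + (norm (\<eta> n))\<^sup>2) / 2)"
      using sum_squares_bound[of "norm (\<xi> n)" "norm (\<eta> n)"] nx
      by (intro mult_left_mono mult_nonneg_nonneg L2_set_nonneg) auto
    finally show ?thesis .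
  qed
  have S: "(\<lambda>n. opmat_norm I x * ?g * ?d * (((norm (\<xi> n))\<^sup>2 + (norm (\<eta> n))\<^sup>2) / 2)) sums (opmat_norm I x * ?g * ?d * ((sqnorm \<xi> + sqnorm \<eta>) / 2))"
    unfolding sqnorm_def
    by (rule sums_mult[OF sums_divide[OF sums_add[OF summable_sums[OF s(1)[unfolded sqsum_def]]
          summable_sums[OF s(2)[unfolded sqsum_def]]]]])
  have "cmod (suminf t) \<le> opmat_norm I x * ?g * ?d * ((sqnorm \<xi> + sqnorm \<eta>) / 2)"
    using norm_suminf_le[of t, OF tb sums_summable[OF S]] sums_unique[OF S] by simp
  then show "cmod (\<Sum>i\<in>I. \<Sum>j\<in>I. f (x i j) * \<gamma> j * cnj (\<delta> i)) \<le> (sqnorm \<xi> + sqnorm \<eta>) / 2 * opmat_norm I x * ?g * ?d"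
    unfolding sums_unique[OF ts, symmetric] by (simp add: mult_ac)
qed

lemma L2_set_slice_le:
  assumes "finite I" "i \<in> I"
  shows "L2_set (\<lambda>k. f (i, k)) K \<le> L2_set f (I \<times> K)"
proof -
  have "L2_set f (I \<times> K) = L2_set (\<lambda>i. L2_set (\<lambda>k. f (i, k)) K) I"
    using L2_set_prod[of "\<lambda>i k. f (i, k)" I K] by simp
  moreover have "L2_set (\<lambda>k. f (i, k)) K \<le> L2_set (\<lambda>i. L2_set (\<lambda>k. f (i, k)) K) I"
    by (rule member_le_L2_set[OF assms, of "\<lambda>i. L2_set (\<lambda>k. f (i, k)) K"])
  ultimately show ?thesis by simp
qed

lemma sum_Times: "(\<Sum>p\<in>A \<times> B. F p) = (\<Sum>i\<in>A. \<Sum>k\<in>B. F (i, k))"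
  by (simp add: sum.cartesian_product)

text \<open>The constant is the sum of bounds for the single entries and far from sharp. Its purpose
  is that the supremum in \<open>predual_mat_norm\<close> runs over a bounded set for every matrix
  over the predual.\<close>

lemma predual_matrix_bounded:
  assumes N: "op_subspace N" and f: "f \<in> mats (predual N) n"
  obtains C where "C \<ge> 0" "\<And>m y. y \<in> mats N m \<Longrightarrow>
    cmat_norm ({..<n} \<times> {..<m}) (\<lambda>(i, k) (j, l). f i j (y k l)) \<le> C * opmat_norm {..<m} y"
proof -
  have Nb: "N \<subseteq> bounded_ops" using N unfolding op_subspace_def by blast
  have "\<exists>c\<ge>0. \<forall>m. \<forall>y\<in>mats N m. cmat_norm {..<m} (\<lambda>k l. f i j (y k l)) \<le> c * opmat_norm {..<m} y"
    if "i < n" "j < n" for i j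
  proof -
    have "f i j \<in> predual N" using f that unfolding mats_def by blast
    then obtain \<xi> \<eta> where r: "normal_rep N (f i j) \<xi> \<eta>" using predual_iff[OF N] by blast
    then have "0 \<le> (sqnorm \<xi> + sqnorm \<eta>) / 2"
      using sqnorm_nonneg[of \<xi>] sqnorm_nonneg[of \<eta>] unfolding normal_rep_def by simp
    moreover have "cmat_norm {..<m} (\<lambda>k l. f i j (y k l)) \<le> (sqnorm \<xi> + sqnorm \<eta>) / 2 * opmat_norm {..<m} y"
      if "y \<in> mats N m" for m y
      by (rule cmat_norm_normal[OF Nb r]) (use that in \<open>auto simp: mats_def\<close>)
    ultimately show ?thesis by blast
  qed
  then obtain c where c: "\<And>i j. i < n \<Longrightarrow> j < n \<Longrightarrow> 0 \<le> c i j"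
    "\<And>i j m y. i < n \<Longrightarrow> j < n \<Longrightarrow> y \<in> mats N m \<Longrightarrow> cmat_norm {..<m} (\<lambda>k l. f i j (y k l)) \<le> c i j * opmat_norm {..<m} y"
    by metis
  define C where "C = (\<Sum>i<n. \<Sum>j<n. c i j)"
  have C0: "C \<ge> 0" unfolding C_def by (intro sum_nonneg) (use c(1) in auto)
  have "cmat_norm ({..<n} \<times> {..<m}) (\<lambda>(i, k) (j, l). f i j (y k l)) \<le> C * opmat_norm {..<m} y"
    if y: "y \<in> mats N m" for m y
  proof (rule cmat_norm_leI)
    have ny: "0 \<le> opmat_norm {..<m} y"
      by (rule opmat_norm_nonneg) (use y Nb in \<open>auto simp: mats_def bounded_ops_def\<close>)
    show "0 \<le> C * opmat_norm {..<m} y" using C0 ny by simp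
    fix \<gamma> \<delta> :: "nat \<times> nat \<Rightarrow> complex"
    let ?g = "L2_set (\<lambda>p. cmod (\<gamma> p)) ({..<n} \<times> {..<m})" and ?d = "L2_set (\<lambda>p. cmod (\<delta> p)) ({..<n} \<times> {..<m})"
    have "(\<Sum>p\<in>{..<n} \<times> {..<m}. \<Sum>q\<in>{..<n} \<times> {..<m}. (case p of (i, k) \<Rightarrow> \<lambda>(j, l). f i j (y k l)) q * \<gamma> q * cnj (\<delta> p))
       = (\<Sum>i<n. \<Sum>k<m. \<Sum>j<n. \<Sum>l<m. f i j (y k l) * \<gamma> (j, l) * cnj (\<delta> (i, k)))"
      unfolding sum_Times by simp
    also have "\<dots> = (\<Sum>i<n. \<Sum>j<n. \<Sum>k<m. \<Sum>l<m. f i j (y k l) * \<gamma> (j, l) * cnj (\<delta> (i, k)))"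
      by (rule sum.cong[OF refl], rule sum.swap)
    finally have e: "(\<Sum>p\<in>{..<n} \<times> {..<m}. \<Sum>q\<in>{..<n} \<times> {..<m}. (case p of (i, k) \<Rightarrow> \<lambda>(j, l). f i j (y k l)) q * \<gamma> q * cnj (\<delta> p))
       = (\<Sum>i<n. \<Sum>j<n. \<Sum>k<m. \<Sum>l<m. f i j (y k l) * \<gamma> (j, l) * cnj (\<delta> (i, k)))" .
    have "cmod (\<Sum>i<n. \<Sum>j<n. \<Sum>k<m. \<Sum>l<m. f i j (y k l) * \<gamma> (j, l) * cnj (\<delta> (i, k))) \<le> (\<Sum>i<n. \<Sum>j<n. c i j * (opmat_norm {..<m} y * ?g * ?d))"
    proof (intro sum_norm_le)
      fix i j assume ij: "i \<in> {..<n}" "j \<in> {..<n}"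
      have "cmod (\<Sum>k<m. \<Sum>l<m. f i j (y k l) * \<gamma> (j, l) * cnj (\<delta> (i, k)))
          \<le> cmat_norm {..<m} (\<lambda>k l. f i j (y k l)) * L2_set (\<lambda>l. cmod (\<gamma> (j, l))) {..<m} * L2_set (\<lambda>k. cmod (\<delta> (i, k))) {..<m}"
        by (rule cmat_form_le) simp
      also have "\<dots> \<le> (c i j * opmat_norm {..<m} y) * ?g * ?d"
        using ij c y ny
        by (intro mult_mono c(2) L2_set_slice_le[of "{..<n}" _ "\<lambda>p. cmod (\<gamma> p)"] L2_set_slice_le[of "{..<n}" _ "\<lambda>p. cmod (\<delta> p)"] mult_nonneg_nonneg L2_set_nonneg) auto
      finally show "cmod (\<Sum>k<m. \<Sum>l<m. f i j (y k l) * \<gamma> (j, l) * cnj (\<delta> (i, k))) \<le> c i j * (opmat_norm {..<m} y * ?g * ?d)"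
        by (simp add: mult_ac)
    qed
    also have "\<dots> = C * (opmat_norm {..<m} y * ?g * ?d)" unfolding C_def by (simp only: sum_distrib_right)
    also have "\<dots> = C * opmat_norm {..<m} y * ?g * ?d" by (simp only: mult.assoc)
    finally show "cmod (\<Sum>p\<in>{..<n} \<times> {..<m}. \<Sum>q\<in>{..<n} \<times> {..<m}. (case p of (i, k) \<Rightarrow> \<lambda>(j, l). f i j (y k l)) q * \<gamma> q * cnj (\<delta> p))
        \<le> C * opmat_norm {..<m} y * ?g * ?d" unfolding e .
  qed
  then show thesis using that C0 by blast
qed

lemma predual_mat_norm_leI:
  assumes "0 \<le> C" "\<And>m y. y \<in> mats N m \<Longrightarrow> opmat_norm {..<m} y \<le> 1 \<Longrightarrow>
    cmat_norm ({..<n} \<times> {..<m}) (\<lambda>(i, k) (j, l). f i j (y k l)) \<le> C"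
  shows "predual_mat_norm N n f \<le> C"
  unfolding predual_mat_norm_def
proof (rule cSup_least)
  \<comment> \<open>The empty matrix shows that the supremum is over a nonempty set.\<close>
  have "(\<lambda>_ _. undefined) \<in> mats N 0" by (simp add: mats_def)
  moreover have "opmat_norm {..<0::nat} (\<lambda>_ _. undefined :: 'a op) \<le> 1" by (rule opmat_norm_leI) auto
  ultimately show "{cmat_norm ({..<n} \<times> {..<m}) (\<lambda>(i, k) (j, l). f i j (y k l)) |m y. y \<in> mats N m \<and> opmat_norm {..<m} y \<le> 1} \<noteq> {}"
    by blast
qed (use assms(2) in blast)

lemma cmat_norm_le_predual_mat_norm_unit:
  assumes bd: "\<And>m y. y \<in> mats N m \<Longrightarrow> opmat_norm {..<m} y \<le> 1 \<Longrightarrow>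
      cmat_norm ({..<n} \<times> {..<m}) (\<lambda>(i, k) (j, l). f i j (y k l)) \<le> C"
    and y: "y \<in> mats N m" "opmat_norm {..<m} y \<le> 1"
  shows "cmat_norm ({..<n} \<times> {..<m}) (\<lambda>(i, k) (j, l). f i j (y k l)) \<le> predual_mat_norm N n f"
  unfolding predual_mat_norm_def
proof (rule cSup_upper)
  show "bdd_above {cmat_norm ({..<n} \<times> {..<m}) (\<lambda>(i, k) (j, l). f i j (y k l)) |m y. y \<in> mats N m \<and> opmat_norm {..<m} y \<le> 1}"
    by (rule bdd_aboveI[of _ C]) (use bd in blast)
qed (use y in blast)

lemma opmat_norm_op_scale:
  fixes y :: "'i \<Rightarrow> 'i \<Rightarrow> 'a::chilbert_space op"
  assumes "finite I" "\<And>i j. i \<in> I \<Longrightarrow> j \<in> I \<Longrightarrow> y i j \<in> bounded_ops" "opmat_norm I y \<le> r" "r > 0"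
  shows "opmat_norm I (\<lambda>i j. op_scale (of_real (inverse r)) (y i j)) \<le> 1"
proof (rule opmat_norm_leI)
  fix \<xi> :: "'i \<Rightarrow> 'a"
  have bl: "bounded_linear (y i j)" if "i \<in> I" "j \<in> I" for i j using assms(2)[OF that] by (simp add: bounded_ops_def)
  have "L2_set (\<lambda>i. norm (\<Sum>j\<in>I. op_scale (of_real (inverse r)) (y i j) (\<xi> j))) I
      = L2_set (\<lambda>i. inverse r * norm (\<Sum>j\<in>I. y i j (\<xi> j))) I"
    unfolding op_scale_def scaleC_sum_right[symmetric] norm_scaleC using assms(4) by (simp add: norm_inverse)
  also have "\<dots> = inverse r * L2_set (\<lambda>i. norm (\<Sum>j\<in>I. y i j (\<xi> j))) I"
    by (rule L2_set_right_distrib[symmetric]) (use assms(4) in simp)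
  also have "\<dots> \<le> inverse r * (opmat_norm I y * L2_set (\<lambda>j. norm (\<xi> j)) I)"
    by (rule mult_left_mono[OF opmat_norm_le[OF assms(1) bl]]) (use assms(4) in auto)
  also have "\<dots> \<le> inverse r * (r * L2_set (\<lambda>j. norm (\<xi> j)) I)"
    using assms(3,4) by (intro mult_left_mono mult_right_mono L2_set_nonneg) auto
  also have "\<dots> = 1 * L2_set (\<lambda>j. norm (\<xi> j)) I" using assms(4) by simp
  finally show "L2_set (\<lambda>i. norm (\<Sum>j\<in>I. op_scale (of_real (inverse r)) (y i j) (\<xi> j))) I \<le> 1 * L2_set (\<lambda>j. norm (\<xi> j)) I" .
qed simp

lemma cmat_norm_le_predual_mat_norm:
  assumes N: "op_subspace N" and f: "f \<in> mats (predual N) n" and y: "y \<in> mats N m"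
  shows "cmat_norm ({..<n} \<times> {..<m}) (\<lambda>(i, k) (j, l). f i j (y k l)) \<le> predual_mat_norm N n f * opmat_norm {..<m} y"
proof -
  have Nb: "N \<subseteq> bounded_ops" using N unfolding op_subspace_def by blast
  have yb: "y i j \<in> bounded_ops" if "i \<in> {..<m}" "j \<in> {..<m}" for i j using y Nb that unfolding mats_def by blast
  obtain C where C: "C \<ge> 0" "\<And>m y. y \<in> mats N m \<Longrightarrow>
    cmat_norm ({..<n} \<times> {..<m}) (\<lambda>(i, k) (j, l). f i j (y k l)) \<le> C * opmat_norm {..<m} y"
    using predual_matrix_bounded[OF N f] by blast
  have C1: "cmat_norm ({..<n} \<times> {..<m}) (\<lambda>(i, k) (j, l). f i j (y k l)) \<le> C"
    if "y \<in> mats N m" "opmat_norm {..<m} y \<le> 1" for m y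
    using C(2)[OF that(1)] mult_left_mono[OF that(2) C(1)] by simp
  have ny: "0 \<le> opmat_norm {..<m} y" by (rule opmat_norm_nonneg) (use yb in \<open>auto simp: bounded_ops_def\<close>)
  show ?thesis
  proof (cases "opmat_norm {..<m} y = 0")
    case True
    \<comment> \<open>A matrix of norm 0 cannot be normalized; here the crude bound already forces
      the left-hand side to be at most 0.\<close>
    then show ?thesis using C(2)[OF y] by simp
  next
    case False
    define r where "r = opmat_norm {..<m} y"
    have r: "r > 0" using False ny by (simp add: r_def)
    define z where "z i j = op_scale (of_real (inverse r)) (y i j)" for i j
    have z: "z \<in> mats N m" using y N unfolding mats_def z_def op_subspace_def by blast
    have z1: "opmat_norm {..<m} z \<le> 1"
      unfolding z_def by (rule opmat_norm_op_scale[OF _ yb _ r]) (auto simp: r_def)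
    have b: "cmat_norm ({..<n} \<times> {..<m}) (\<lambda>(i, k) (j, l). f i j (z k l)) \<le> predual_mat_norm N n f"
      by (rule cmat_norm_le_predual_mat_norm_unit[OF C1 z z1])
    show ?thesis
    proof (rule cmat_norm_leI)
      have "0 \<le> predual_mat_norm N n f" using b cmat_norm_nonneg[of "{..<n} \<times> {..<m}"] by (meson finite_SigmaI finite_lessThan order_trans)
      then show "0 \<le> predual_mat_norm N n f * opmat_norm {..<m} y" using ny by simp
      fix \<gamma> \<delta> :: "nat \<times> nat \<Rightarrow> complex"
      let ?I = "{..<n} \<times> {..<m}"
      have e: "(case p of (i, k) \<Rightarrow> \<lambda>(j, l). f i j (y k l)) q = of_real r * (case p of (i, k) \<Rightarrow> \<lambda>(j, l). f i j (z k l)) q"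
        if "p \<in> ?I" "q \<in> ?I" for p q
      proof -
        obtain i k where p: "p = (i, k)" by (cases p)
        obtain j l where q: "q = (j, l)" by (cases q)
        have "i < n" "j < n" "k < m" "l < m" using that unfolding p q by auto
        then have "f i j \<in> predual N" "y k l \<in> N" using f y unfolding mats_def by auto
        then have "f i j (z k l) = of_real (inverse r) * f i j (y k l)" unfolding predual_def z_def by blast
        then show ?thesis unfolding p q using r by simp
      qed
      have "(\<Sum>p\<in>?I. \<Sum>q\<in>?I. (case p of (i, k) \<Rightarrow> \<lambda>(j, l). f i j (y k l)) q * \<gamma> q * cnj (\<delta> p))
          = of_real r * (\<Sum>p\<in>?I. \<Sum>q\<in>?I. (case p of (i, k) \<Rightarrow> \<lambda>(j, l). f i j (z k l)) q * \<gamma> q * cnj (\<delta> p))"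
        unfolding sum_distrib_left by (intro sum.cong refl) (simp add: e)
      then have "cmod (\<Sum>p\<in>?I. \<Sum>q\<in>?I. (case p of (i, k) \<Rightarrow> \<lambda>(j, l). f i j (y k l)) q * \<gamma> q * cnj (\<delta> p))
          = r * cmod (\<Sum>p\<in>?I. \<Sum>q\<in>?I. (case p of (i, k) \<Rightarrow> \<lambda>(j, l). f i j (z k l)) q * \<gamma> q * cnj (\<delta> p))"
        using r by (simp add: norm_mult)
      also have "\<dots> \<le> r * (cmat_norm ?I (\<lambda>(i, k) (j, l). f i j (z k l)) * L2_set (\<lambda>j. cmod (\<gamma> j)) ?I * L2_set (\<lambda>i. cmod (\<delta> i)) ?I)"
        by (rule mult_left_mono[OF cmat_form_le]) (use r in auto)
      also have "\<dots> \<le> r * (predual_mat_norm N n f * L2_set (\<lambda>j. cmod (\<gamma> j)) ?I * L2_set (\<lambda>i. cmod (\<delta> i)) ?I)"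
        using r by (intro mult_left_mono mult_right_mono b L2_set_nonneg) auto
      finally show "cmod (\<Sum>p\<in>?I. \<Sum>q\<in>?I. (case p of (i, k) \<Rightarrow> \<lambda>(j, l). f i j (y k l)) q * \<gamma> q * cnj (\<delta> p))
          \<le> predual_mat_norm N n f * opmat_norm {..<m} y * L2_set (\<lambda>j. cmod (\<gamma> j)) ?I * L2_set (\<lambda>i. cmod (\<delta> i)) ?I"
        unfolding r_def by (simp add: mult_ac)
    qed
  qed
qed

lemma predual_mat_norm_nonneg:
  assumes N: "op_subspace N" and f: "f \<in> mats (predual N) n"
  shows "0 \<le> predual_mat_norm N n f"
proof -
  have y: "(\<lambda>_ _. undefined) \<in> mats N 0" by (simp add: mats_def)
  have y1: "opmat_norm {..<0::nat} (\<lambda>_ _. undefined :: 'a op) \<le> 1" by (rule opmat_norm_leI) auto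
  obtain C where C: "C \<ge> 0" "\<And>m y. y \<in> mats N m \<Longrightarrow>
    cmat_norm ({..<n} \<times> {..<m}) (\<lambda>(i, k) (j, l). f i j (y k l)) \<le> C * opmat_norm {..<m} y"
    using predual_matrix_bounded[OF N f] by blast
  have C1: "cmat_norm ({..<n} \<times> {..<m}) (\<lambda>(i, k) (j, l). f i j (y k l)) \<le> C"
    if "y \<in> mats N m" "opmat_norm {..<m} y \<le> 1" for m y
    using C(2)[OF that(1)] mult_left_mono[OF that(2) C(1)] by simp
  show ?thesis
    using cmat_norm_le_predual_mat_norm_unit[OF C1 y y1] cmat_norm_nonneg[of "{..<n} \<times> {..<0::nat}"]
    by (meson finite_SigmaI finite_lessThan order_trans)
qed

subsection \<open>Vector forms are normal and completely bounded\<close>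

lemma op_subspace_commutant: "op_subspace (commutant S :: 'a::chilbert_space op set)" if "S \<subseteq> bounded_ops"
proof -
  have c: "cblinear a" if "a \<in> S" for a using \<open>S \<subseteq> bounded_ops\<close> that bounded_ops_iff by blast
  show ?thesis
    unfolding op_subspace_def
  proof (intro conjI ballI allI subsetI)
    fix b :: "'a op" assume "b \<in> commutant S" then show "b \<in> bounded_ops" by (simp add: commutant_def)
  next
    show "(\<lambda>_. 0) \<in> commutant S"
      using cblinear_zero cblinear_simps(4)[OF c] by (auto simp: commutant_def bounded_ops_iff fun_eq_iff)
  next
    fix a b assume "a \<in> commutant S" "b \<in> commutant S"
    then show "op_add a b \<in> commutant S"
      using cblinear_add[of a b] cblinear_simps(1)[OF c] by (auto simp: commutant_def bounded_ops_iff fun_eq_iff op_add_def)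
  next
    fix d a assume "a \<in> commutant S"
    then show "op_scale d a \<in> commutant S"
      using cblinear_scaleC[of a d] cblinear_simps(5)[OF c] by (auto simp: commutant_def bounded_ops_iff fun_eq_iff op_scale_def)
  qed
qed

text \<open>The topology on the target is generated by evaluations at the elements of
  \<open>N\<close>, so continuity is tested on each \<open>x \<mapsto> \<phi> x y\<close>
  separately.\<close>

lemma normal_mapI:
  assumes \<phi>: "\<phi> \<in> M \<rightarrow> predual N" and M: "\<And>y. y \<in> N \<Longrightarrow> (\<lambda>x\<in>M. \<phi> x y) \<in> predual M"
  shows "normal_map M N \<phi>"
  unfolding normal_map_def sigma_topology_def[of "predual N"]
proof (rule continuous_on_generated_topo)
  fix U assume "U \<in> insert (predual N) {{x \<in> predual N. f x \<in> U} |f U. f \<in> {(\<lambda>f. f y) |y. y \<in> N} \<and> open U}"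
  then consider "U = predual N" | y V where "y \<in> N" "open V" "U = {x \<in> predual N. x y \<in> V}" by blast
  then show "openin (sigma_topology M (predual M)) (\<phi> -` U \<inter> topspace (sigma_topology M (predual M)))"
  proof cases
    case 1
    then have "\<phi> -` U \<inter> topspace (sigma_topology M (predual M)) = topspace (sigma_topology M (predual M))" using \<phi> by auto
    then show ?thesis by (metis openin_topspace)
  next
    case 2
    have "continuous_map (sigma_topology M (predual M)) euclidean (\<lambda>x\<in>M. \<phi> x y)"
      by (rule sigma_topology_continuous[OF M[OF 2(1)]])
    then have "openin (sigma_topology M (predual M)) {x \<in> topspace (sigma_topology M (predual M)). (\<lambda>x\<in>M. \<phi> x y) x \<in> V}"
      by (rule openin_continuous_map_preimage) (use 2(2) open_openin in blast)
    moreover have "{x \<in> topspace (sigma_topology M (predual M)). (\<lambda>x\<in>M. \<phi> x y) x \<in> V} = \<phi> -` U \<inter> topspace (sigma_topology M (predual M))"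
      using 2(3) \<phi> by auto
    ultimately show ?thesis by simp
  qed
next
  show "\<phi> ` topspace (sigma_topology M (predual M)) \<subseteq> \<Union> (insert (predual N) {{x \<in> predual N. f x \<in> U} |f U. f \<in> {(\<lambda>f. f y) |y. y \<in> N} \<and> open U})"
    using \<phi> by auto
qed

lemma predual_vector_functional:
  assumes M: "op_subspace M" and e: "\<And>a. a \<in> M \<Longrightarrow> f a = cinner (a \<xi>) \<eta>"
  shows "restrict f M \<in> predual M"
  unfolding predual_iff[OF M]
proof
  have "normal_rep M (restrict f M) (\<lambda>n. if n = 0 then \<xi> else 0) (\<lambda>n. if n = 0 then \<eta> else 0)"
    unfolding normal_rep_def using e by (simp add: single_sqsum trf_single)
  then show "\<exists>\<xi> \<eta>. normal_rep M (restrict f M) \<xi> \<eta>" by blast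
qed simp

text \<open>As \<open>x\<close> and \<open>y\<close> commute, the form is a vector functional in
  either variable: of \<open>x \<xi>\<close> and \<open>\<xi>\<close> for fixed \<open>x\<close>, of
  \<open>y \<xi>\<close> and \<open>\<xi>\<close> for fixed \<open>y\<close>. The complete bound is
  1.\<close>

lemma vector_form_CB_normal:
  fixes M N :: "'a::chilbert_space op set"
  assumes M: "op_subspace M" and N: "N = commutant M" and x1: "norm \<xi> = 1"
  shows "vector_form M N \<xi> \<in> CB_normal M N"
proof -
  have Mb: "M \<subseteq> bounded_ops" using M unfolding op_subspace_def by blast
  have Ns: "op_subspace N" unfolding N by (rule op_subspace_commutant[OF Mb])
  have Nb: "N \<subseteq> bounded_ops" using Ns unfolding op_subspace_def by blast
  have comm: "x (y v) = y (x v)" if "x \<in> M" "y \<in> N" for x y v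
    using that unfolding N commutant_def by (auto simp: fun_eq_iff)
  have p1: "vector_form M N \<xi> x \<in> predual N" if x: "x \<in> M" for x
  proof -
    have "(\<lambda>y\<in>N. cinner (x (y \<xi>)) \<xi>) \<in> predual N"
      by (rule predual_vector_functional[OF Ns, of _ "x \<xi>" \<xi>]) (simp add: comm[OF x])
    then show ?thesis unfolding vector_form_def using x by simp
  qed
  have p2: "(\<lambda>x\<in>M. vector_form M N \<xi> x y) \<in> predual M" if y: "y \<in> N" for y
    by (rule predual_vector_functional[OF M, of _ "y \<xi>" \<xi>]) (simp add: vector_form_def y)
  have lin: "vector_form M N \<xi> \<in> linear_into_predual M N"
  proof -
    have "op_add a b \<in> M" "op_scale c a \<in> M" if "a \<in> M" "b \<in> M" for a b c using M that unfolding op_subspace_def by auto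
    then show ?thesis unfolding linear_into_predual_def
      using p1 by (auto simp: vector_form_def op_add_def op_scale_def cinner_add_left cinner_scaleC_left)
  qed
  have "predual_mat_norm N n (\<lambda>i j. vector_form M N \<xi> (x i j)) \<le> 1 * opmat_norm {..<n} x" if x: "x \<in> mats M n" for n x
  proof (rule predual_mat_norm_leI)
    have xb: "x i j \<in> bounded_ops" if "i \<in> {..<n}" "j \<in> {..<n}" for i j using x Mb that unfolding mats_def by blast
    have nx: "0 \<le> opmat_norm {..<n} x" by (rule opmat_norm_nonneg) (use xb in \<open>auto simp: bounded_ops_def\<close>)
    then show "0 \<le> 1 * opmat_norm {..<n} x" by simp
    fix m y assume y: "y \<in> mats N m" and y1: "opmat_norm {..<m} y \<le> 1"
    have yb: "y i j \<in> bounded_ops" if "i \<in> {..<m}" "j \<in> {..<m}" for i j using y Nb that unfolding mats_def by blast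
    have "cmat_norm ({..<n} \<times> {..<m}) (\<lambda>(i, k) (j, l). vector_form M N \<xi> (x i j) (y k l))
        = cmat_norm ({..<n} \<times> {..<m}) (\<lambda>(i, k) (j, l). cinner (x i j (y k l \<xi>)) \<xi>)"
      by (rule cmat_norm_mono_cong) (use x y in \<open>auto simp: vector_form_def mats_def\<close>)
    also have "\<dots> \<le> opmat_norm {..<n} x * opmat_norm {..<m} y * (norm \<xi>)\<^sup>2"
      by (rule cmat_norm_vector_functional) (use xb yb in auto)
    also have "\<dots> \<le> 1 * opmat_norm {..<n} x" using mult_left_mono[OF y1 nx] x1 by simp
    finally show "cmat_norm ({..<n} \<times> {..<m}) (\<lambda>(i, k) (j, l). vector_form M N \<xi> (x i j) (y k l)) \<le> 1 * opmat_norm {..<n} x" .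
  qed
  then have "vector_form M N \<xi> \<in> CB M N" unfolding CB_def using lin by blast
  moreover have "normal_map M N (vector_form M N \<xi>)"
    by (rule normal_mapI) (use p1 p2 in auto)
  ultimately show ?thesis unfolding CB_normal_def by blast
qed

subsection \<open>The cb-norm on differences\<close>

text \<open>A finite joint bound on all amplifications, with a non-sharp constant. It ensures that
  the suprema in \<open>cb_norm\<close> of a difference from a map in \<open>CB\<close> are over
  bounded sets.\<close>

lemma alg_tensor_cb_bound:
  assumes M: "op_subspace M" and N: "op_subspace N" and u: "u \<in> alg_tensor M N"
  obtains C where "C \<ge> 0" "\<And>n m x y. x \<in> mats M n \<Longrightarrow> y \<in> mats N m \<Longrightarrow>
    cmat_norm ({..<n} \<times> {..<m}) (\<lambda>(i, k) (j, l). u (x i j) (y k l)) \<le> C * opmat_norm {..<n} x * opmat_norm {..<m} y"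
proof -
  have Mb: "M \<subseteq> bounded_ops" and Nb: "N \<subseteq> bounded_ops" using M N unfolding op_subspace_def by auto
  obtain k \<mu> \<nu> where ue: "u = (\<lambda>x\<in>M. \<lambda>y\<in>N. \<Sum>i<(k::nat). \<mu> i x * \<nu> i y)" and mn: "\<And>i. i < k \<Longrightarrow> \<mu> i \<in> predual M \<and> \<nu> i \<in> predual N"
    using u unfolding alg_tensor_def by blast
  have ex: "\<exists>c\<ge>0. \<forall>n. \<forall>x\<in>mats M n. cmat_norm {..<n} (\<lambda>i j. \<mu> (x i j)) \<le> c * opmat_norm {..<n} x"
    if Ms: "op_subspace M" and mu: "\<mu> \<in> predual M" for \<mu> and M :: "'c::chilbert_space op set"
  proof -
    obtain \<xi> \<eta> where r: "normal_rep M \<mu> \<xi> \<eta>" using mu predual_iff[OF Ms] by blast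
    have "0 \<le> (sqnorm \<xi> + sqnorm \<eta>) / 2" using r sqnorm_nonneg[of \<xi>] sqnorm_nonneg[of \<eta>] unfolding normal_rep_def by simp
    moreover have "cmat_norm {..<n} (\<lambda>i j. \<mu> (x i j)) \<le> (sqnorm \<xi> + sqnorm \<eta>) / 2 * opmat_norm {..<n} x" if "x \<in> mats M n" for n x
      by (rule cmat_norm_normal[OF _ r]) (use that \<open>op_subspace M\<close> in \<open>auto simp: mats_def op_subspace_def\<close>)
    ultimately show ?thesis by blast
  qed
  have "\<exists>c\<ge>0. \<forall>n. \<forall>x\<in>mats M n. cmat_norm {..<n} (\<lambda>i j. \<mu> s (x i j)) \<le> c * opmat_norm {..<n} x" if "s < k" for s
    using ex[OF M] mn[OF that] by blast
  then obtain a where a: "\<And>s. s < k \<Longrightarrow> a s \<ge> 0" "\<And>s n x. s < k \<Longrightarrow> x \<in> mats M n \<Longrightarrow> cmat_norm {..<n} (\<lambda>i j. \<mu> s (x i j)) \<le> a s * opmat_norm {..<n} x"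
    by metis
  have "\<exists>c\<ge>0. \<forall>n. \<forall>x\<in>mats N n. cmat_norm {..<n} (\<lambda>i j. \<nu> s (x i j)) \<le> c * opmat_norm {..<n} x" if "s < k" for s
    using ex[OF N] mn[OF that] by blast
  then obtain b where b: "\<And>s. s < k \<Longrightarrow> b s \<ge> 0" "\<And>s n x. s < k \<Longrightarrow> x \<in> mats N n \<Longrightarrow> cmat_norm {..<n} (\<lambda>i j. \<nu> s (x i j)) \<le> b s * opmat_norm {..<n} x"
    by metis
  define C where "C = (\<Sum>s<k. a s * b s)"
  have C0: "C \<ge> 0" unfolding C_def by (intro sum_nonneg mult_nonneg_nonneg) (use a b in auto)
  have "cmat_norm ({..<n} \<times> {..<m}) (\<lambda>(i, k) (j, l). u (x i j) (y k l)) \<le> C * opmat_norm {..<n} x * opmat_norm {..<m} y"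
    if x: "x \<in> mats M n" and y: "y \<in> mats N m" for n m x y
  proof -
    have nx: "0 \<le> opmat_norm {..<n} x" by (rule opmat_norm_nonneg) (use x Mb in \<open>auto simp: mats_def bounded_ops_def\<close>)
    have ny: "0 \<le> opmat_norm {..<m} y" by (rule opmat_norm_nonneg) (use y Nb in \<open>auto simp: mats_def bounded_ops_def\<close>)
    let ?I = "{..<n} \<times> {..<m}"
    show ?thesis
    proof (rule cmat_norm_leI)
      show "0 \<le> C * opmat_norm {..<n} x * opmat_norm {..<m} y" using C0 nx ny by simp
      fix \<gamma> \<delta> :: "nat \<times> nat \<Rightarrow> complex"
      let ?g = "L2_set (\<lambda>p. cmod (\<gamma> p)) ?I" and ?d = "L2_set (\<lambda>p. cmod (\<delta> p)) ?I"
      have "(\<Sum>p\<in>?I. \<Sum>q\<in>?I. (case p of (i, k) \<Rightarrow> \<lambda>(j, l). u (x i j) (y k l)) q * \<gamma> q * cnj (\<delta> p))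
          = (\<Sum>p\<in>?I. \<Sum>q\<in>?I. \<Sum>s<k. (case p of (i, k) \<Rightarrow> \<lambda>(j, l). \<mu> s (x i j) * \<nu> s (y k l)) q * \<gamma> q * cnj (\<delta> p))"
        by (intro sum.cong refl) (use x y in \<open>auto simp: ue mats_def sum_distrib_right\<close>)
      also have "\<dots> = (\<Sum>p\<in>?I. \<Sum>s<k. \<Sum>q\<in>?I. (case p of (i, k) \<Rightarrow> \<lambda>(j, l). \<mu> s (x i j) * \<nu> s (y k l)) q * \<gamma> q * cnj (\<delta> p))"
        by (rule sum.cong[OF refl], rule sum.swap)
      also have "\<dots> = (\<Sum>s<k. \<Sum>p\<in>?I. \<Sum>q\<in>?I. (case p of (i, k) \<Rightarrow> \<lambda>(j, l). \<mu> s (x i j) * \<nu> s (y k l)) q * \<gamma> q * cnj (\<delta> p))"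
        by (rule sum.swap)
      finally have e: "(\<Sum>p\<in>?I. \<Sum>q\<in>?I. (case p of (i, k) \<Rightarrow> \<lambda>(j, l). u (x i j) (y k l)) q * \<gamma> q * cnj (\<delta> p))
          = (\<Sum>s<k. \<Sum>p\<in>?I. \<Sum>q\<in>?I. (case p of (i, k) \<Rightarrow> \<lambda>(j, l). \<mu> s (x i j) * \<nu> s (y k l)) q * \<gamma> q * cnj (\<delta> p))" .
      have "cmod (\<Sum>s<k. \<Sum>p\<in>?I. \<Sum>q\<in>?I. (case p of (i, k) \<Rightarrow> \<lambda>(j, l). \<mu> s (x i j) * \<nu> s (y k l)) q * \<gamma> q * cnj (\<delta> p)) \<le> (\<Sum>s<k. (a s * b s) * (opmat_norm {..<n} x * opmat_norm {..<m} y * ?g * ?d))"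
      proof (rule sum_norm_le)
        fix s assume "s \<in> {..<k}"
        then have s: "s < k" by simp
        have "cmod (\<Sum>p\<in>?I. \<Sum>q\<in>?I. (case p of (i, k) \<Rightarrow> \<lambda>(j, l). \<mu> s (x i j) * \<nu> s (y k l)) q * \<gamma> q * cnj (\<delta> p))
            \<le> cmat_norm ?I (\<lambda>(i, k) (j, l). \<mu> s (x i j) * \<nu> s (y k l)) * ?g * ?d"
          by (rule cmat_form_le) simp
        also have "\<dots> \<le> (cmat_norm {..<n} (\<lambda>i j. \<mu> s (x i j)) * cmat_norm {..<m} (\<lambda>k l. \<nu> s (y k l))) * ?g * ?d"
          by (intro mult_right_mono cmat_norm_tensor L2_set_nonneg) auto
        also have "\<dots> \<le> ((a s * opmat_norm {..<n} x) * (b s * opmat_norm {..<m} y)) * ?g * ?d"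
          by (intro mult_right_mono mult_mono a(2)[OF s x] b(2)[OF s y] L2_set_nonneg mult_nonneg_nonneg a(1)[OF s] nx cmat_norm_nonneg) auto
        finally show "cmod (\<Sum>p\<in>?I. \<Sum>q\<in>?I. (case p of (i, k) \<Rightarrow> \<lambda>(j, l). \<mu> s (x i j) * \<nu> s (y k l)) q * \<gamma> q * cnj (\<delta> p))
            \<le> (a s * b s) * (opmat_norm {..<n} x * opmat_norm {..<m} y * ?g * ?d)" by (simp add: mult_ac)
      qed
      also have "\<dots> = C * (opmat_norm {..<n} x * opmat_norm {..<m} y * ?g * ?d)"
        unfolding C_def by (simp only: sum_distrib_right)
      also have "\<dots> = C * opmat_norm {..<n} x * opmat_norm {..<m} y * ?g * ?d" by (simp only: mult.assoc)
      finally show "cmod (\<Sum>p\<in>?I. \<Sum>q\<in>?I. (case p of (i, k) \<Rightarrow> \<lambda>(j, l). u (x i j) (y k l)) q * \<gamma> q * cnj (\<delta> p))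
          \<le> C * opmat_norm {..<n} x * opmat_norm {..<m} y * ?g * ?d" unfolding e .
    qed
  qed
  then show thesis using that C0 by blast
qed

lemma cmat_norm_diff_le:
  assumes I: "finite I"
  shows "cmat_norm I (\<lambda>p q. c p q - d p q) \<le> cmat_norm I c + cmat_norm I d"
proof (rule cmat_norm_leI)
  show "0 \<le> cmat_norm I c + cmat_norm I d" using cmat_norm_nonneg[OF I, of c] cmat_norm_nonneg[OF I, of d] by simp
  fix \<gamma> \<delta>
  have "(\<Sum>i\<in>I. \<Sum>j\<in>I. (c i j - d i j) * \<gamma> j * cnj (\<delta> i))
     = (\<Sum>i\<in>I. \<Sum>j\<in>I. c i j * \<gamma> j * cnj (\<delta> i)) - (\<Sum>i\<in>I. \<Sum>j\<in>I. d i j * \<gamma> j * cnj (\<delta> i))"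
    by (simp only: left_diff_distrib sum_subtractf)
  then have "cmod (\<Sum>i\<in>I. \<Sum>j\<in>I. (c i j - d i j) * \<gamma> j * cnj (\<delta> i))
     \<le> cmod (\<Sum>i\<in>I. \<Sum>j\<in>I. c i j * \<gamma> j * cnj (\<delta> i)) + cmod (\<Sum>i\<in>I. \<Sum>j\<in>I. d i j * \<gamma> j * cnj (\<delta> i))"
    by (simp only: norm_triangle_ineq4)
  also have "\<dots> \<le> cmat_norm I c * L2_set (\<lambda>j. cmod (\<gamma> j)) I * L2_set (\<lambda>i. cmod (\<delta> i)) I
      + cmat_norm I d * L2_set (\<lambda>j. cmod (\<gamma> j)) I * L2_set (\<lambda>i. cmod (\<delta> i)) I"
    by (intro add_mono cmat_form_le I)
  finally show "cmod (\<Sum>i\<in>I. \<Sum>j\<in>I. (c i j - d i j) * \<gamma> j * cnj (\<delta> i))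
     \<le> (cmat_norm I c + cmat_norm I d) * L2_set (\<lambda>j. cmod (\<gamma> j)) I * L2_set (\<lambda>i. cmod (\<delta> i)) I"
    by (simp add: algebra_simps)
qed

text \<open>The value at contractions is an entry of a matrix of size one. The work lies in the
  boundedness of the two nested suprema in \<open>cb_norm\<close>, for which the bounds for
  \<open>u\<close> and for \<open>\<phi>\<close> are added.\<close>

lemma pointwise_le_cb_norm:
  assumes M: "op_subspace M" and N: "op_subspace N" and u: "u \<in> alg_tensor M N" and \<phi>: "\<phi> \<in> CB M N"
    and x: "x \<in> M" "onorm x \<le> 1" and y: "y \<in> N" "onorm y \<le> 1"
  shows "cmod (u x y - \<phi> x y) \<le> cb_norm M N (\<lambda>x y. u x y - \<phi> x y)"
proof -
  have Mb: "M \<subseteq> bounded_ops" and Nb: "N \<subseteq> bounded_ops" using M N unfolding op_subspace_def by auto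
  obtain C where C: "C \<ge> 0" "\<And>n m x y. x \<in> mats M n \<Longrightarrow> y \<in> mats N m \<Longrightarrow>
    cmat_norm ({..<n} \<times> {..<m}) (\<lambda>(i, k) (j, l). u (x i j) (y k l)) \<le> C * opmat_norm {..<n} x * opmat_norm {..<m} y"
    using alg_tensor_cb_bound[OF M N u] by blast
  obtain D where D: "\<And>n x. x \<in> mats M n \<Longrightarrow> predual_mat_norm N n (\<lambda>i j. \<phi> (x i j)) \<le> D * opmat_norm {..<n} x"
    using \<phi> unfolding CB_def by blast
  have pp: "\<phi> x \<in> predual N" if "x \<in> M" for x using \<phi> that unfolding CB_def linear_into_predual_def by (auto simp: PiE_iff)
  let ?d = "\<lambda>x y. u x y - \<phi> x y"
  have bd: "cmat_norm ({..<n} \<times> {..<m}) (\<lambda>(i, k) (j, l). ?d (x i j) (y k l)) \<le> C + \<bar>D\<bar>"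
    if x: "x \<in> mats M n" "opmat_norm {..<n} x \<le> 1" and y: "y \<in> mats N m" "opmat_norm {..<m} y \<le> 1" for n m x y
  proof -
    have nx: "0 \<le> opmat_norm {..<n} x" by (rule opmat_norm_nonneg) (use x Mb in \<open>auto simp: mats_def bounded_ops_def\<close>)
    have ny: "0 \<le> opmat_norm {..<m} y" by (rule opmat_norm_nonneg) (use y Nb in \<open>auto simp: mats_def bounded_ops_def\<close>)
    have pm: "(\<lambda>i j. \<phi> (x i j)) \<in> mats (predual N) n" using x(1) pp unfolding mats_def by blast
    have "cmat_norm ({..<n} \<times> {..<m}) (\<lambda>(i, k) (j, l). ?d (x i j) (y k l))
       = cmat_norm ({..<n} \<times> {..<m}) (\<lambda>p q. (case p of (i, k) \<Rightarrow> \<lambda>(j, l). u (x i j) (y k l)) q - (case p of (i, k) \<Rightarrow> \<lambda>(j, l). \<phi> (x i j) (y k l)) q)"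
      by (rule cmat_norm_mono_cong) auto
    also have "\<dots> \<le> cmat_norm ({..<n} \<times> {..<m}) (\<lambda>(i, k) (j, l). u (x i j) (y k l)) + cmat_norm ({..<n} \<times> {..<m}) (\<lambda>(i, k) (j, l). \<phi> (x i j) (y k l))"
      by (rule cmat_norm_diff_le) simp
    also have "\<dots> \<le> C * opmat_norm {..<n} x * opmat_norm {..<m} y + predual_mat_norm N n (\<lambda>i j. \<phi> (x i j)) * opmat_norm {..<m} y"
      by (rule add_mono[OF C(2)[OF x(1) y(1)] cmat_norm_le_predual_mat_norm[OF N pm y(1)]])
    also have "\<dots> \<le> C * 1 * 1 + (\<bar>D\<bar> * 1) * 1"
    proof (intro add_mono mult_mono x(2) y(2) ny nx C(1))
      have "predual_mat_norm N n (\<lambda>i j. \<phi> (x i j)) \<le> D * opmat_norm {..<n} x" by (rule D[OF x(1)])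
      also have "\<dots> \<le> \<bar>D\<bar> * opmat_norm {..<n} x" by (rule mult_right_mono[OF abs_ge_self nx])
      also have "\<dots> \<le> \<bar>D\<bar> * 1" by (rule mult_left_mono[OF x(2)]) simp
      finally show "predual_mat_norm N n (\<lambda>i j. \<phi> (x i j)) \<le> \<bar>D\<bar> * 1" .
    qed (use C(1) in auto)
    finally show ?thesis by simp
  qed
  \<comment> \<open>Constant matrices, used with size \<open>Suc 0\<close>, present \<open>x\<close>
    and \<open>y\<close> as matrices with one entry.\<close>
  define X where "X = (\<lambda>(i::nat) (j::nat). x)"
  define Y where "Y = (\<lambda>(i::nat) (j::nat). y)"
  have one: "opmat_norm {..<Suc 0} (\<lambda>i j. a) \<le> 1" if "a \<in> bounded_ops" "onorm a \<le> 1" for a :: "'c::chilbert_space op"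
  proof (rule opmat_norm_leI)
    fix \<xi> :: "nat \<Rightarrow> 'c"
    have "norm (a (\<xi> 0)) \<le> onorm a * norm (\<xi> 0)" by (rule cblinear_norm_le) (use that bounded_ops_iff in blast)
    also have "\<dots> \<le> 1 * norm (\<xi> 0)" by (rule mult_right_mono[OF that(2)]) simp
    finally show "L2_set (\<lambda>i. norm (\<Sum>j<Suc 0. a (\<xi> j))) {..<Suc 0} \<le> 1 * L2_set (\<lambda>j. norm (\<xi> j)) {..<Suc 0}"
      by (simp add: L2_set_def)
  qed simp
  have X: "X \<in> mats M (Suc 0)" "opmat_norm {..<Suc 0} X \<le> 1"
    unfolding X_def using x Mb one[of x] by (auto simp: mats_def)
  have Y: "Y \<in> mats N (Suc 0)" "opmat_norm {..<Suc 0} Y \<le> 1"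
    unfolding Y_def using y Nb one[of y] by (auto simp: mats_def)
  have "cmod (u x y - \<phi> x y) \<le> cmat_norm ({..<Suc 0} \<times> {..<Suc 0}) (\<lambda>(i, k) (j, l). ?d (X i j) (Y k l))"
  proof -
    have "{..<Suc 0} \<times> {..<Suc 0} = {(0::nat, 0::nat)}" by auto
    then show ?thesis
      using cmat_form_le[of "{..<Suc 0} \<times> {..<Suc 0}" "\<lambda>(i, k) (j, l). ?d (X i j) (Y k l)" "\<lambda>_. 1" "\<lambda>_. 1"]
      by (simp add: X_def Y_def L2_set_def)
  qed
  also have "\<dots> \<le> predual_mat_norm N (Suc 0) (\<lambda>i j. ?d (X i j))"
    using cmat_norm_le_predual_mat_norm_unit[where n = "Suc 0" and m = "Suc 0" and y = Y and f = "\<lambda>i j. ?d (X i j)" and N = N and C = "C + \<bar>D\<bar>"] bd[OF X] Y by auto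
  also have "\<dots> \<le> cb_norm M N ?d"
    unfolding cb_norm_def
  proof (rule cSup_upper)
    show "bdd_above {predual_mat_norm N n (\<lambda>i j. ?d (x i j)) |n x. x \<in> mats M n \<and> opmat_norm {..<n} x \<le> 1}"
    proof (rule bdd_aboveI[of _ "C + \<bar>D\<bar>"], clarify)
      fix n x assume "x \<in> mats M n" "opmat_norm {..<n} x \<le> 1"
      from bd[OF this] show "predual_mat_norm N n (\<lambda>i j. ?d (x i j)) \<le> C + \<bar>D\<bar>"
        by (intro predual_mat_norm_leI) (use C(1) in auto)
    qed
    show "predual_mat_norm N (Suc 0) (\<lambda>i j. ?d (X i j)) \<in> {predual_mat_norm N n (\<lambda>i j. ?d (x i j)) |n x. x \<in> mats M n \<and> opmat_norm {..<n} x \<le> 1}"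
      using X by blast
  qed
  finally show ?thesis .
qed

subsection \<open>Commutants\<close>

lemma commutant_bounded: "commutant S \<subseteq> bounded_ops"
  unfolding commutant_def by blast

lemma commutant_triple:
  assumes "S \<subseteq> bounded_ops"
  shows "commutant (commutant (commutant S)) = commutant S"
proof
  have 1: "X \<subseteq> commutant (commutant X)" if "X \<subseteq> bounded_ops" for X :: "'a op set"
  proof
    fix a assume "a \<in> X"
    then show "a \<in> commutant (commutant X)" using that unfolding commutant_def by auto
  qed
  show "commutant S \<subseteq> commutant (commutant (commutant S))" by (rule 1[OF commutant_bounded])
  have "S \<subseteq> commutant (commutant S)" by (rule 1[OF assms])
  then show "commutant (commutant (commutant S)) \<subseteq> commutant S" unfolding commutant_def by blast
qed

lemma op_tensor_set_bounded:
  assumes "M \<subseteq> bounded_ops" "N \<subseteq> bounded_ops"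
  shows "{op_tensor a b |a b. a \<in> M \<and> b \<in> N} \<subseteq> bounded_ops"
  using assms op_tensor(1) by blast

lemma vn_tensor_facts:
  assumes M: "M \<subseteq> bounded_ops" and N: "N \<subseteq> bounded_ops"
  shows "op_subspace (vn_tensor M N)" "commutant (commutant (vn_tensor M N)) = vn_tensor M N"
    "\<And>a b. a \<in> M \<Longrightarrow> b \<in> N \<Longrightarrow> op_tensor a b \<in> vn_tensor M N"
proof -
  note S = op_tensor_set_bounded[OF M N]
  show "op_subspace (vn_tensor M N)" unfolding vn_tensor_def by (rule op_subspace_commutant[OF commutant_bounded])
  show "commutant (commutant (vn_tensor M N)) = vn_tensor M N"
    unfolding vn_tensor_def by (rule commutant_triple[OF commutant_bounded])
  fix a b assume ab: "a \<in> M" "b \<in> N"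
  have "op_tensor a b \<in> bounded_ops" using ab M N op_tensor(1) by blast
  moreover have "x \<circ> op_tensor a b = op_tensor a b \<circ> x" if "x \<in> commutant {op_tensor a b |a b. a \<in> M \<and> b \<in> N}" for x
  proof -
    have "op_tensor a b \<in> {op_tensor a b |a b. a \<in> M \<and> b \<in> N}" using ab by blast
    then show ?thesis using that unfolding commutant_def by simp
  qed
  ultimately show "op_tensor a b \<in> vn_tensor M N"
    unfolding vn_tensor_def commutant_def[of "commutant _"] by blast
qed

section \<open>Slices, product functionals and factorizations on the spatial tensor product\<close>

lemma id_bounded_op: "id \<in> bounded_ops"
  unfolding bounded_ops_iff id_def by (rule cblinear_id)

text \<open>\<open>z \<otimes> 1\<close> commutes with the generators and so with their double
  commutant. Together with the version for the right leg this is how membership in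
  \<open>vn_tensor M N\<close> is exploited.\<close>

lemma vn_tensor_commutes_left:
  assumes M: "M \<subseteq> bounded_ops" and N: "N \<subseteq> bounded_ops" and a: "a \<in> vn_tensor M N" and z: "z \<in> commutant M"
  shows "a (z v \<otimes>\<^sub>h \<zeta>) = op_tensor z id (a (v \<otimes>\<^sub>h \<zeta>))"
proof -
  have zb: "z \<in> bounded_ops" and zc: "\<And>x w. x \<in> M \<Longrightarrow> x (z w) = z (x w)"
    using z unfolding commutant_def by (auto simp: fun_eq_iff)
  note Z = op_tensor[OF zb id_bounded_op]
  have "op_tensor x y \<circ> op_tensor z id = op_tensor z id \<circ> op_tensor x y" if "x \<in> M" "y \<in> N" for x y
  proof (rule cblinear_eq_on_tensors)
    have b: "x \<in> bounded_ops" "y \<in> bounded_ops" using that M N by auto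
    note X = op_tensor[OF b]
    show "cblinear (op_tensor x y \<circ> op_tensor z id)" "cblinear (op_tensor z id \<circ> op_tensor x y)"
      unfolding comp_def
      using cblinear_compose[OF X(1)[unfolded bounded_ops_iff] Z(1)[unfolded bounded_ops_iff]]
        cblinear_compose[OF Z(1)[unfolded bounded_ops_iff] X(1)[unfolded bounded_ops_iff]] by auto
    fix v w show "(op_tensor x y \<circ> op_tensor z id) (v \<otimes>\<^sub>h w) = (op_tensor z id \<circ> op_tensor x y) (v \<otimes>\<^sub>h w)"
      by (simp add: X(2) Z(2) zc[OF that(1)])
  qed
  then have "op_tensor z id \<in> commutant {op_tensor a b |a b. a \<in> M \<and> b \<in> N}"
    unfolding commutant_def using Z(1) by blast
  then have "op_tensor z id \<circ> a = a \<circ> op_tensor z id" using a unfolding vn_tensor_def commutant_def[of "commutant _"] by blast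
  then show ?thesis using Z(2) by (metis comp_apply id_apply)
qed

lemma vn_tensor_commutes_right:
  assumes M: "M \<subseteq> bounded_ops" and N: "N \<subseteq> bounded_ops" and a: "a \<in> vn_tensor M N" and z: "z \<in> commutant N"
  shows "a (v \<otimes>\<^sub>h z \<zeta>) = op_tensor id z (a (v \<otimes>\<^sub>h \<zeta>))"
proof -
  have zb: "z \<in> bounded_ops" and zc: "\<And>x w. x \<in> N \<Longrightarrow> x (z w) = z (x w)"
    using z unfolding commutant_def by (auto simp: fun_eq_iff)
  note Z = op_tensor[OF id_bounded_op zb]
  have "op_tensor x y \<circ> op_tensor id z = op_tensor id z \<circ> op_tensor x y" if "x \<in> M" "y \<in> N" for x y
  proof (rule cblinear_eq_on_tensors)
    have b: "x \<in> bounded_ops" "y \<in> bounded_ops" using that M N by auto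
    note X = op_tensor[OF b]
    show "cblinear (op_tensor x y \<circ> op_tensor id z)" "cblinear (op_tensor id z \<circ> op_tensor x y)"
      unfolding comp_def
      using cblinear_compose[OF X(1)[unfolded bounded_ops_iff] Z(1)[unfolded bounded_ops_iff]]
        cblinear_compose[OF Z(1)[unfolded bounded_ops_iff] X(1)[unfolded bounded_ops_iff]] by auto
    fix v w show "(op_tensor x y \<circ> op_tensor id z) (v \<otimes>\<^sub>h w) = (op_tensor id z \<circ> op_tensor x y) (v \<otimes>\<^sub>h w)"
      by (simp add: X(2) Z(2) zc[OF that(2)])
  qed
  then have "op_tensor id z \<in> commutant {op_tensor a b |a b. a \<in> M \<and> b \<in> N}"
    unfolding commutant_def using Z(1) by blast
  then have "op_tensor id z \<circ> a = a \<circ> op_tensor id z" using a unfolding vn_tensor_def commutant_def[of "commutant _"] by blast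
  then show ?thesis using Z(2) by (metis comp_apply id_apply)
qed

lemma cinner_op_tensor_tensor:
  assumes "a \<in> bounded_ops" "b \<in> bounded_ops"
  shows "cinner (op_tensor a b z) (v \<otimes>\<^sub>h w) = cinner z (adj a v \<otimes>\<^sub>h adj b w)"
  using cinner_op_tensor_adj[OF assms] op_tensor(2)[OF adj_exists(1)[OF assms(1)] adj_exists(1)[OF assms(2)]] by simp

lemma adj_id: "adj id = id"
  by (rule ext, rule cinner_ext) (use adj_exists(3)[OF id_bounded_op] in simp)

text \<open>Since \<open>a\<close> commutes with \<open>z \<otimes> 1\<close> for \<open>z\<close>
  in the commutant of \<open>M\<close>, its slices commute with \<open>z\<close>, and the
  bicommutant property applies.\<close>

lemma slice_in:
  assumes M: "M \<subseteq> bounded_ops" "commutant (commutant M) = M" and N: "N \<subseteq> bounded_ops" and a: "a \<in> vn_tensor M N"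
  shows "slice a \<zeta> \<zeta>' \<in> M"
proof -
  have ab: "a \<in> bounded_ops" using a unfolding vn_tensor_def commutant_def[of "commutant _"] by blast
  note s = slice[OF ab]
  have "z \<circ> slice a \<zeta> \<zeta>' = slice a \<zeta> \<zeta>' \<circ> z" if z: "z \<in> commutant M" for z
  proof
    fix v
    have zb: "z \<in> bounded_ops" using z unfolding commutant_def by blast
    have "slice a \<zeta> \<zeta>' (z v) = z (slice a \<zeta> \<zeta>' v)"
    proof (rule cinner_ext)
      fix w
      have "cinner (slice a \<zeta> \<zeta>' (z v)) w = cinner (op_tensor z id (a (v \<otimes>\<^sub>h \<zeta>))) (w \<otimes>\<^sub>h \<zeta>')"
        unfolding s(2) vn_tensor_commutes_left[OF M(1) N a z] ..
      also have "\<dots> = cinner (z (slice a \<zeta> \<zeta>' v)) w"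
        unfolding cinner_op_tensor_tensor[OF zb id_bounded_op] adj_id adj_exists(2)[OF zb] s(2) by simp
      finally show "cinner (slice a \<zeta> \<zeta>' (z v)) w = cinner (z (slice a \<zeta> \<zeta>' v)) w" .
    qed
    then show "(z \<circ> slice a \<zeta> \<zeta>') v = (slice a \<zeta> \<zeta>' \<circ> z) v" by simp
  qed
  then have "slice a \<zeta> \<zeta>' \<in> commutant (commutant M)" unfolding commutant_def[of "commutant M"] using s(1) by blast
  then show ?thesis using M(2) by simp
qed

text \<open>The operator \<open>b\<close> is \<open>(f \<otimes> id)(a)\<close>.\<close>

lemma first_leg:
  assumes M: "op_subspace M" "commutant (commutant M) = M" and N: "N \<subseteq> bounded_ops" "commutant (commutant N) = N"
    and a: "a \<in> vn_tensor M N" and f: "f \<in> predual M"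
  obtains b where "b \<in> N" "\<And>\<zeta> \<zeta>'. cinner (b \<zeta>) \<zeta>' = f (slice a \<zeta> \<zeta>')"
proof -
  have Mb: "M \<subseteq> bounded_ops" using M(1) unfolding op_subspace_def by blast
  have ab: "a \<in> bounded_ops" using a unfolding vn_tensor_def commutant_def[of "commutant _"] by blast
  note s = slice[OF ab] and sM = slice_in[OF Mb M(2) N(1) a]
  obtain \<xi> \<eta> where "normal_rep M f \<xi> \<eta>" using f predual_iff[OF M(1)] by blast
  then have r: "sqsum \<xi>" "sqsum \<eta>" "\<And>a. a \<in> M \<Longrightarrow> f a = trf \<xi> \<eta> a" unfolding normal_rep_def by auto
  have fadd: "f (op_add x y) = f x + f y" and fsc: "f (op_scale c x) = c * f x" if "x \<in> M" "y \<in> M" for x y c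
    using f that unfolding predual_def by auto
  define C where "C = onorm a * ((sqnorm \<xi> + sqnorm \<eta>) / 2)"
  have a0: "0 \<le> onorm a" using ab onorm_nonneg bounded_ops_iff by blast
  have C: "C \<ge> 0" unfolding C_def using a0 sqnorm_nonneg[OF r(1)] sqnorm_nonneg[OF r(2)] by simp
  \<comment> \<open>This makes the form \<open>f (slice a \<zeta> \<zeta>')\<close> bounded in
    \<open>\<zeta>\<close> and \<open>\<zeta>'\<close>.\<close>
  have on: "onorm (slice a \<zeta> \<zeta>') \<le> onorm a * norm \<zeta> * norm \<zeta>'" for \<zeta> \<zeta>'
  proof (rule onorm_bound)
    show "0 \<le> onorm a * norm \<zeta> * norm \<zeta>'" using a0 by simp
    fix v
    show "norm (slice a \<zeta> \<zeta>' v) \<le> onorm a * norm \<zeta> * norm \<zeta>' * norm v"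
    proof (rule norm_le_from_cinner)
      show "0 \<le> onorm a * norm \<zeta> * norm \<zeta>' * norm v" using a0 by simp
      fix w
      have "cmod (cinner (slice a \<zeta> \<zeta>' v) w) \<le> norm (a (v \<otimes>\<^sub>h \<zeta>)) * norm (w \<otimes>\<^sub>h \<zeta>')" unfolding s(2) by (rule norm_cinner_le)
      also have "\<dots> \<le> (onorm a * norm (v \<otimes>\<^sub>h \<zeta>)) * norm (w \<otimes>\<^sub>h \<zeta>')"
        by (rule mult_right_mono[OF cblinear_norm_le]) (use ab in \<open>auto simp: bounded_ops_iff\<close>)
      finally show "cmod (cinner (slice a \<zeta> \<zeta>' v) w) \<le> onorm a * norm \<zeta> * norm \<zeta>' * norm v * norm w"
        by (simp add: norm_tensor mult_ac)
    qed
  qed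
  have cb: "cblinear x" if "x \<in> M" for x using that Mb bounded_ops_iff by blast
  obtain b where b: "cblinear b" "\<And>v w. cinner (b v) w = f (slice a v w)" "\<And>v. norm (b v) \<le> C * norm v"
  proof (rule sesquilinear_rep[of "\<lambda>v w. f (slice a v w)" C])
    have al: "cblinear a" using ab bounded_ops_iff by blast
    show "f (slice a (v + v') w) = f (slice a v w) + f (slice a v' w)" for v v' w
      unfolding fadd[OF sM sM, symmetric]
      by (rule arg_cong[where f = f], rule ext, rule cinner_ext)
         (simp add: s(2) op_add_def cinner_add_left tensor_add_right cblinear_simps(1)[OF al])
    show "f (slice a v (w + w')) = f (slice a v w) + f (slice a v w')" for v w w'
      unfolding fadd[OF sM sM, symmetric]
      by (rule arg_cong[where f = f], rule ext, rule cinner_ext)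
         (simp add: s(2) op_add_def cinner_add_left tensor_add_right cinner_add_right)
    show "f (slice a (c *\<^sub>C v) w) = c * f (slice a v w)" for c v w
      unfolding fsc[OF sM sM, symmetric]
      by (rule arg_cong[where f = f], rule ext, rule cinner_ext)
         (simp add: s(2) op_scale_def cinner_scaleC_left tensor_scaleC_right cblinear_simps(5)[OF al])
    show "f (slice a v (c *\<^sub>C w)) = cnj c * f (slice a v w)" for c v w
      unfolding fsc[OF sM sM, symmetric]
      by (rule arg_cong[where f = f], rule ext, rule cinner_ext)
         (simp add: s(2) op_scale_def cinner_scaleC_left tensor_scaleC_right cinner_scaleC_right)
    show "cmod (f (slice a v w)) \<le> C * norm v * norm w" for v w
    proof -
      have "cmod (f (slice a v w)) \<le> onorm (slice a v w) * ((sqnorm \<xi> + sqnorm \<eta>) / 2)"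
        unfolding r(3)[OF sM] by (rule trf_sums(4)[OF cb[OF sM] r(1,2)])
      also have "\<dots> \<le> (onorm a * norm v * norm w) * ((sqnorm \<xi> + sqnorm \<eta>) / 2)"
        using sqnorm_nonneg[OF r(1)] sqnorm_nonneg[OF r(2)] by (intro mult_right_mono on) simp
      finally show ?thesis unfolding C_def by (simp add: mult_ac)
    qed
  qed (use C in auto)
  have "z \<circ> b = b \<circ> z" if z: "z \<in> commutant N" for z
  proof
    fix \<zeta>
    have zb: "z \<in> bounded_ops" using z unfolding commutant_def by blast
    have "b (z \<zeta>) = z (b \<zeta>)"
    proof (rule cinner_ext)
      fix w
      \<comment> \<open>Right multiplication by \<open>1 \<otimes> z\<close> can be moved to the
        left of \<open>a\<close> and then, as an adjoint, into the second slicing vector.\<close>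
      have "slice a (z \<zeta>) w = slice a \<zeta> (adj z w)"
      proof (rule ext, rule cinner_ext)
        fix v u show "cinner (slice a (z \<zeta>) w v) u = cinner (slice a \<zeta> (adj z w) v) u"
          unfolding s(2) vn_tensor_commutes_right[OF Mb N(1) a z] cinner_op_tensor_tensor[OF id_bounded_op zb] adj_id by simp
      qed
      then show "cinner (b (z \<zeta>)) w = cinner (z (b \<zeta>)) w" unfolding adj_exists(2)[OF zb] b(2) by simp
    qed
    then show "(z \<circ> b) \<zeta> = (b \<circ> z) \<zeta>" by simp
  qed
  then have "b \<in> commutant (commutant N)" unfolding commutant_def[of "commutant N"] using b(1) bounded_ops_iff by blast
  then show thesis using that N(2) b(2) by simp
qed

text \<open>This is \<open>f \<otimes> g\<close>, represented by all the tensors of the two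
  representing sequences. The last property is the Fubini rule: \<open>f \<otimes> g\<close> at
  \<open>a\<close> is \<open>g\<close> applied to \<open>(f \<otimes> id)(a)\<close>.\<close>

lemma product_functional:
  assumes M: "op_subspace M" "commutant (commutant M) = M" and N: "op_subspace N" "commutant (commutant N) = N"
    and f: "f \<in> predual M" and g: "g \<in> predual N"
  obtains h where "h \<in> normals (vn_tensor M N)"
    "\<And>x y. x \<in> M \<Longrightarrow> y \<in> N \<Longrightarrow> h (op_tensor x y) = f x * g y"
    "\<And>a b. a \<in> vn_tensor M N \<Longrightarrow> b \<in> N \<Longrightarrow> (\<And>\<zeta> \<zeta>'. cinner (b \<zeta>) \<zeta>' = f (slice a \<zeta> \<zeta>')) \<Longrightarrow> h a = g b"
proof -
  have Mb: "M \<subseteq> bounded_ops" and Nb: "N \<subseteq> bounded_ops" using M(1) N(1) unfolding op_subspace_def by auto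
  obtain \<xi> \<eta> where "normal_rep M f \<xi> \<eta>" using f predual_iff[OF M(1)] by blast
  then have r: "sqsum \<xi>" "sqsum \<eta>" "\<And>a. a \<in> M \<Longrightarrow> f a = trf \<xi> \<eta> a" unfolding normal_rep_def by auto
  obtain \<xi>' \<eta>' where "normal_rep N g \<xi>' \<eta>'" using g predual_iff[OF N(1)] by blast
  then have r': "sqsum \<xi>'" "sqsum \<eta>'" "\<And>a. a \<in> N \<Longrightarrow> g a = trf \<xi>' \<eta>' a" unfolding normal_rep_def by auto
  have sq: "sqsum (\<lambda>s. x s \<otimes>\<^sub>h z)" "sqnorm (\<lambda>s. x s \<otimes>\<^sub>h z) = sqnorm x * (norm z)\<^sup>2" if "sqsum x" for x :: "nat \<Rightarrow> 'a" and z :: 'b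
  proof -
    have e: "(\<lambda>s. (norm (x s \<otimes>\<^sub>h z))\<^sup>2) = (\<lambda>s. (norm (x s))\<^sup>2 * (norm z)\<^sup>2)" by (simp add: norm_tensor power_mult_distrib)
    show "sqsum (\<lambda>s. x s \<otimes>\<^sub>h z)" unfolding sqsum_def e by (rule summable_mult2[OF that[unfolded sqsum_def]])
    show "sqnorm (\<lambda>s. x s \<otimes>\<^sub>h z) = sqnorm x * (norm z)\<^sup>2"
      unfolding sqnorm_def e by (rule suminf_mult2[OF that[unfolded sqsum_def], symmetric])
  qed
  have sm: "summable (\<lambda>t. sqnorm (\<lambda>s. x s \<otimes>\<^sub>h y t))" if "sqsum x" "sqsum y" for x :: "nat \<Rightarrow> 'a" and y :: "nat \<Rightarrow> 'b"
    unfolding sq(2)[OF that(1)] by (rule summable_mult[OF that(2)[unfolded sqsum_def]])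
  define X where "X = flatten (\<lambda>t s. \<xi> s \<otimes>\<^sub>h \<xi>' t)"
  define Y where "Y = flatten (\<lambda>t s. \<eta> s \<otimes>\<^sub>h \<eta>' t)"
  have XY: "sqsum X" "sqsum Y" unfolding X_def Y_def
    using flatten_sqsum(1)[OF sq(1)[OF r(1)] sm[OF r(1) r'(1)]] flatten_sqsum(1)[OF sq(1)[OF r(2)] sm[OF r(2) r'(2)]] by auto
  have hs: "(\<lambda>t. trf (\<lambda>s. \<xi> s \<otimes>\<^sub>h \<xi>' t) (\<lambda>s. \<eta> s \<otimes>\<^sub>h \<eta>' t) a) sums trf X Y a" if "a \<in> bounded_ops" for a
    unfolding X_def Y_def
    by (rule trf_flatten[OF that[unfolded bounded_ops_iff] sq(1)[OF r(1)] sm[OF r(1) r'(1)] sq(1)[OF r(2)] sm[OF r(2) r'(2)]])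
  have Kb: "vn_tensor M N \<subseteq> bounded_ops" unfolding vn_tensor_def by (rule commutant_bounded)
  have 3: "trf X Y a = g b" if a: "a \<in> vn_tensor M N" and b: "b \<in> N" "\<And>\<zeta> \<zeta>'. cinner (b \<zeta>) \<zeta>' = f (slice a \<zeta> \<zeta>')" for a b
  proof -
    have ab: "a \<in> bounded_ops" using a Kb by blast
    have "trf (\<lambda>s. \<xi> s \<otimes>\<^sub>h \<xi>' t) (\<lambda>s. \<eta> s \<otimes>\<^sub>h \<eta>' t) a = cinner (b (\<xi>' t)) (\<eta>' t)" for t
      unfolding b(2) r(3)[OF slice_in[OF Mb M(2) Nb a]] trf_def slice(2)[OF ab] ..
    then have "(\<lambda>t. cinner (b (\<xi>' t)) (\<eta>' t)) sums trf X Y a" using hs[OF ab] by simp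
    then show ?thesis unfolding r'(3)[OF b(1)] trf_def by (rule sums_unique)
  qed
  have "trf X Y (op_tensor x y) = f x * g y" if xy: "x \<in> M" "y \<in> N" for x y
  proof -
    have xb: "x \<in> bounded_ops" and yb: "y \<in> bounded_ops" using xy Mb Nb by auto
    note T = op_tensor[OF xb yb]
    have "trf (\<lambda>s. \<xi> s \<otimes>\<^sub>h \<xi>' t) (\<lambda>s. \<eta> s \<otimes>\<^sub>h \<eta>' t) (op_tensor x y) = f x * cinner (y (\<xi>' t)) (\<eta>' t)" for t
    proof -
      have "(\<lambda>s. cinner (x (\<xi> s)) (\<eta> s) * cinner (y (\<xi>' t)) (\<eta>' t)) sums (f x * cinner (y (\<xi>' t)) (\<eta>' t))"
        unfolding r(3)[OF xy(1)] by (rule sums_mult2[OF trf_sums(2)[OF xb[unfolded bounded_ops_iff] r(1,2)]])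
      then show ?thesis unfolding trf_def T(2) cinner_tensor by (simp add: sums_iff)
    qed
    then have "(\<lambda>t. f x * cinner (y (\<xi>' t)) (\<eta>' t)) sums trf X Y (op_tensor x y)" using hs[OF T(1)] by simp
    moreover have "(\<lambda>t. f x * cinner (y (\<xi>' t)) (\<eta>' t)) sums (f x * g y)"
      unfolding r'(3)[OF xy(2)] by (rule sums_mult[OF trf_sums(2)[OF yb[unfolded bounded_ops_iff] r'(1,2)]])
    ultimately show ?thesis by (rule sums_unique2)
  qed
  moreover have "trf X Y \<in> normals (vn_tensor M N)" unfolding normals_def normal_rep_def using XY by blast
  ultimately show thesis using that[of "trf X Y"] 3 by blast
qed

text \<open>Gram-Schmidt, where a vector that depends on the earlier ones adds nothing, so
  \<open>m\<close> may be smaller than \<open>n\<close>. Finite families are what matches the finite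
  test matrices in \<open>predual_mat_norm\<close>.\<close>

lemma finite_orthonormal_span:
  fixes \<zeta> :: "nat \<Rightarrow> 'a::chilbert_space"
  shows "\<exists>m e. (\<forall>k<m. \<forall>l<m. cinner (e k) (e l) = (if k = l then 1 else 0)) \<and> (\<forall>j<n. \<zeta> j = (\<Sum>l<(m::nat). cinner (\<zeta> j) (e l) *\<^sub>C e l))"
proof (induction n)
  case 0
  show ?case by (intro exI[of _ 0]) simp
next
  case (Suc n)
  then obtain m e where o: "\<And>k l. k < m \<Longrightarrow> l < m \<Longrightarrow> cinner (e k) (e l) = (if k = l then 1 else 0)"
    and z: "\<And>j. j < n \<Longrightarrow> \<zeta> j = (\<Sum>l<(m::nat). cinner (\<zeta> j) (e l) *\<^sub>C e l)" by blast
  define p where "p = (\<Sum>l<m. cinner (\<zeta> n) (e l) *\<^sub>C e l)"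
  define r where "r = \<zeta> n - p"
  have re: "cinner r (e k) = 0" if "k < m" for k
  proof -
    have "cinner p (e k) = (\<Sum>l<m. if l = k then cinner (\<zeta> n) (e l) else 0)"
      unfolding p_def cinner_sum_left cinner_scaleC_left by (intro sum.cong refl) (use o that in simp)
    then show ?thesis unfolding r_def cinner_diff_left using that by simp
  qed
  then have er: "cinner (e k) r = 0" if "k < m" for k using that cinner_commute[of "e k" r] by simp
  show ?case
  proof (cases "r = 0")
    case True
    then have "\<zeta> n = (\<Sum>l<m. cinner (\<zeta> n) (e l) *\<^sub>C e l)" unfolding r_def p_def by simp
    then show ?thesis using o z by (intro exI[of _ m] exI[of _ e]) (auto simp: less_Suc_eq)
  next
    case False
    define u where "u = inverse (norm r) *\<^sub>R r"
    have uu: "cinner u u = 1"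
      using False by (simp add: u_def cinner_scaleR_left cinner_scaleR_right cinner_same power2_eq_square)
    have eu: "cinner (e k) u = 0" if "k < m" for k using er[OF that] by (simp add: u_def cinner_scaleR_right)
    define e' where "e' = e(m := u)"
    have o': "cinner (e' k) (e' l) = (if k = l then 1 else 0)" if "k < Suc m" "l < Suc m" for k l
      using that o uu re er unfolding e'_def
      by (auto simp: less_Suc_eq u_def cinner_scaleR_left cinner_scaleR_right)
    have s': "(\<Sum>l<Suc m. cinner x (e' l) *\<^sub>C e' l) = (\<Sum>l<m. cinner x (e l) *\<^sub>C e l) + cinner x u *\<^sub>C u" for x
      by (simp add: e'_def)
    have z': "\<zeta> j = (\<Sum>l<Suc m. cinner (\<zeta> j) (e' l) *\<^sub>C e' l)" if "j < Suc n" for j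
    proof (cases "j = n")
      case True
      have ru: "r = cinner r u *\<^sub>C u"
      proof -
        have "cinner r u = of_real (norm r)"
          using False by (simp add: u_def cinner_scaleR_right cinner_same power2_eq_square)
        then show ?thesis using False by (simp add: u_def scaleC_of_real)
      qed
      have "cinner p u = 0" unfolding p_def cinner_sum_left cinner_scaleC_left
        by (rule sum.neutral) (simp add: eu)
      then have "cinner (\<zeta> n) u = cinner r u" unfolding r_def cinner_diff_left by simp
      then have "\<zeta> n = p + cinner (\<zeta> n) u *\<^sub>C u" using ru unfolding r_def by simp
      then show ?thesis unfolding True s' p_def .
    next
      case False
      then have j: "j < n" using that by simp
      have "cinner (\<zeta> j) u = cinner (\<Sum>l<m. cinner (\<zeta> j) (e l) *\<^sub>C e l) u" using z[OF j] by simp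
      also have "\<dots> = 0" unfolding cinner_sum_left cinner_scaleC_left
        by (rule sum.neutral) (simp add: eu)
      finally show ?thesis unfolding s' using z[OF j] by simp
    qed
    show ?thesis using o' z' by blast
  qed
qed

lemma norm_orthonormal_sum:
  fixes e :: "nat \<Rightarrow> 'a::chilbert_space" and v :: "nat \<Rightarrow> 'b::chilbert_space"
  assumes "\<And>k l. k < m \<Longrightarrow> l < m \<Longrightarrow> cinner (e k) (e l) = (if k = l then 1 else 0)"
  shows "norm (\<Sum>l<m. v l \<otimes>\<^sub>h e l) = L2_set (\<lambda>l. norm (v l)) {..<m}"
    and "norm (\<Sum>l<m. c l *\<^sub>C e l) = L2_set (\<lambda>l. cmod (c l)) {..<m}"
proof -
  have "complex_of_real ((norm (\<Sum>l<m. v l \<otimes>\<^sub>h e l))\<^sup>2) = (\<Sum>k<m. \<Sum>l<m. cinner (v l) (v k) * cinner (e l) (e k))"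
    unfolding cinner_same[symmetric] cinner_sum_left cinner_sum_right cinner_tensor ..
  also have "\<dots> = (\<Sum>k<m. \<Sum>l<m. if l = k then cinner (v l) (v k) else 0)"
    by (intro sum.cong refl) (simp add: assms)
  also have "\<dots> = of_real (\<Sum>l<m. (norm (v l))\<^sup>2)" by (simp add: cinner_same)
  finally have "(norm (\<Sum>l<m. v l \<otimes>\<^sub>h e l))\<^sup>2 = (\<Sum>l<m. (norm (v l))\<^sup>2)" using of_real_eq_iff by blast
  then show "norm (\<Sum>l<m. v l \<otimes>\<^sub>h e l) = L2_set (\<lambda>l. norm (v l)) {..<m}" unfolding L2_set_def by (metis norm_ge_zero real_sqrt_unique)
  have "complex_of_real ((norm (\<Sum>l<m. c l *\<^sub>C e l))\<^sup>2) = (\<Sum>k<m. \<Sum>l<m. c l * cnj (c k) * cinner (e l) (e k))"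
    unfolding cinner_same[symmetric] cinner_sum_left cinner_sum_right cinner_scaleC_left cinner_scaleC_right sum_distrib_left by (simp add: mult_ac)
  also have "\<dots> = (\<Sum>k<m. \<Sum>l<m. if l = k then c l * cnj (c k) else 0)"
    by (intro sum.cong refl) (simp add: assms)
  also have "\<dots> = of_real (\<Sum>l<m. (cmod (c l))\<^sup>2)" by (simp flip: complex_norm_square)
  finally have "(norm (\<Sum>l<m. c l *\<^sub>C e l))\<^sup>2 = (\<Sum>l<m. (cmod (c l))\<^sup>2)" using of_real_eq_iff by blast
  then show "norm (\<Sum>l<m. c l *\<^sub>C e l) = L2_set (\<lambda>l. cmod (c l)) {..<m}" unfolding L2_set_def by (metis norm_ge_zero real_sqrt_unique)
qed

text \<open>The matrix of slices is the compression of \<open>a\<close> to the first space tensored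
  with the span of the \<open>e k\<close>: mapping \<open>v\<close> to the sum of the
  \<open>v l \<otimes>\<^sub>h e l\<close> is isometric.\<close>

lemma slice_matrix_norm_le:
  fixes a :: "('a::chilbert_space, 'b::chilbert_space) htensor op" and e :: "nat \<Rightarrow> 'b"
  assumes ab: "a \<in> bounded_ops"
    and o: "\<And>k l. k < m \<Longrightarrow> l < m \<Longrightarrow> cinner (e k) (e l) = (if k = l then 1 else 0)"
  shows "opmat_norm {..<m} (\<lambda>k l. slice a (e l) (e k)) \<le> onorm a"
proof (rule opmat_norm_le_formI)
  show "0 \<le> onorm a" using ab onorm_nonneg bounded_ops_iff by blast
  fix v w :: "nat \<Rightarrow> 'a"
  let ?V = "\<Sum>l<m. v l \<otimes>\<^sub>h e l" and ?W = "\<Sum>k<m. w k \<otimes>\<^sub>h e k"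
  have al: "cblinear a" using ab bounded_ops_iff by blast
  have "(\<Sum>k<m. cinner (\<Sum>l<m. slice a (e l) (e k) (v l)) (w k)) = (\<Sum>k<m. \<Sum>l<m. cinner (a (v l \<otimes>\<^sub>h e l)) (w k \<otimes>\<^sub>h e k))"
    unfolding cinner_sum_left slice(2)[OF ab] ..
  also have "\<dots> = cinner (a ?V) ?W"
    unfolding cblinear_simps(7)[OF al] cinner_sum_left cinner_sum_right by (rule refl sum.swap)
  finally have s: "(\<Sum>k<m. cinner (\<Sum>l<m. slice a (e l) (e k) (v l)) (w k)) = cinner (a ?V) ?W" .
  have "(\<Sum>k<m. inner (\<Sum>l<m. slice a (e l) (e k) (v l)) (w k)) = Re (cinner (a ?V) ?W)"
    unfolding s[symmetric] inner_eq_Re_cinner Re_sum ..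
  also have "\<dots> \<le> norm (a ?V) * norm ?W" using norm_cinner_le[of "a ?V" ?W] complex_Re_le_cmod order_trans by blast
  also have "\<dots> \<le> (onorm a * norm ?V) * norm ?W" by (rule mult_right_mono[OF cblinear_norm_le[OF al]]) simp
  also have "\<dots> = onorm a * L2_set (\<lambda>l. norm (v l)) {..<m} * L2_set (\<lambda>k. norm (w k)) {..<m}"
    by (simp only: norm_orthonormal_sum(1)[where e = e and m = m, OF o])
  finally show "(\<Sum>k<m. inner (\<Sum>l<m. slice a (e l) (e k) (v l)) (w k))
      \<le> onorm a * L2_set (\<lambda>l. norm (v l)) {..<m} * L2_set (\<lambda>k. norm (w k)) {..<m}" .
qed

text \<open>A statement about the operator matrix \<open>(f i j \<otimes> id)(a)\<close>, whereas
  \<open>predual_mat_norm\<close> knows scalar matrices only. In an orthonormal family spanning the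
  test vectors, the form of \<open>b\<close> becomes that of the scalar matrix with entries
  \<open>f i j (y k l)\<close>, where \<open>y\<close> is the matrix of slices of
  \<open>a\<close>.\<close>

lemma first_leg_matrix_norm_le:
  fixes M :: "'a::chilbert_space op set" and N :: "'b::chilbert_space op set"
  assumes M: "op_subspace M" "commutant (commutant M) = M" and N: "N \<subseteq> bounded_ops"
    and a: "a \<in> vn_tensor M N" and f: "f \<in> mats (predual M) p"
    and bN: "\<And>i j. i < p \<Longrightarrow> j < p \<Longrightarrow> b i j \<in> N"
    and b: "\<And>i j \<zeta> \<eta>. i < p \<Longrightarrow> j < p \<Longrightarrow> cinner (b i j \<zeta>) \<eta> = f i j (slice a \<zeta> \<eta>)"
  shows "opmat_norm {..<p} b \<le> predual_mat_norm M p f * onorm a"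
proof (rule opmat_norm_le_formI)
  have Mb: "M \<subseteq> bounded_ops" using M(1) unfolding op_subspace_def by blast
  have ab: "a \<in> bounded_ops" using a unfolding vn_tensor_def commutant_def[of "commutant _"] by blast
  have a0: "0 \<le> onorm a" using ab onorm_nonneg bounded_ops_iff by blast
  have f0: "0 \<le> predual_mat_norm M p f" by (rule predual_mat_norm_nonneg[OF M(1) f])
  show "0 \<le> predual_mat_norm M p f * onorm a" using a0 f0 by simp
  fix \<zeta> \<eta> :: "nat \<Rightarrow> 'b"
  \<comment> \<open>Both families of test vectors are listed together, so that a single orthonormal
    family expands all of them.\<close>
  define z where "z j = (if j < p then \<zeta> j else \<eta> (j - p))" for j
  obtain m e where o: "\<And>k l. k < m \<Longrightarrow> l < m \<Longrightarrow> cinner (e k) (e l) = (if k = l then 1 else 0)"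
    and zs: "\<And>j. j < 2 * p \<Longrightarrow> z j = (\<Sum>l<(m::nat). cinner (z j) (e l) *\<^sub>C e l)"
    using finite_orthonormal_span[of "2 * p" z] by blast
  define c where "c = (\<lambda>(j, l). cinner (\<zeta> j) (e l))"
  define d where "d = (\<lambda>(j, l). cinner (\<eta> j) (e l))"
  have zc: "\<zeta> j = (\<Sum>l<m. c (j, l) *\<^sub>C e l)" if "j < p" for j using zs[of j] that by (simp add: z_def c_def)
  have zd: "\<eta> j = (\<Sum>l<m. d (j, l) *\<^sub>C e l)" if "j < p" for j using zs[of "j + p"] that by (simp add: z_def d_def)
  define y where "y k l = slice a (e l) (e k)" for k l
  let ?I = "{..<p} \<times> {..<m}"
  have ij: "cinner (b i j (\<zeta> j)) (\<eta> i) = (\<Sum>k<m. \<Sum>l<m. f i j (y k l) * c (j, l) * cnj (d (i, k)))" if "i < p" "j < p" for i j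
  proof -
    have bl: "cblinear (b i j)" using bN[OF that] N bounded_ops_iff by blast
    have "cinner (b i j (\<zeta> j)) (\<eta> i) = (\<Sum>k<m. \<Sum>l<m. c (j, l) * (cnj (d (i, k)) * cinner (b i j (e l)) (e k)))"
      by (subst zc[OF that(2)], subst zd[OF that(1)])
         (simp add: cblinear_simps(7)[OF bl] cblinear_simps(5)[OF bl] cinner_sum_left cinner_sum_right cinner_scaleC_left cinner_scaleC_right sum_distrib_left mult_ac)
    then show ?thesis unfolding b[OF that] y_def by (simp add: mult_ac)
  qed
  have "(\<Sum>i<p. cinner (\<Sum>j<p. b i j (\<zeta> j)) (\<eta> i)) = (\<Sum>i<p. \<Sum>j<p. \<Sum>k<m. \<Sum>l<m. f i j (y k l) * c (j, l) * cnj (d (i, k)))"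
    unfolding cinner_sum_left by (intro sum.cong refl) (simp add: ij)
  also have "\<dots> = (\<Sum>i<p. \<Sum>k<m. \<Sum>j<p. \<Sum>l<m. f i j (y k l) * c (j, l) * cnj (d (i, k)))"
    by (rule sum.cong[OF refl], rule sum.swap)
  also have "\<dots> = (\<Sum>P\<in>?I. \<Sum>Q\<in>?I. (case P of (i, k) \<Rightarrow> \<lambda>(j, l). f i j (y k l)) Q * c Q * cnj (d P))"
    unfolding sum_Times by simp
  finally have s: "(\<Sum>i<p. cinner (\<Sum>j<p. b i j (\<zeta> j)) (\<eta> i)) = (\<Sum>P\<in>?I. \<Sum>Q\<in>?I. (case P of (i, k) \<Rightarrow> \<lambda>(j, l). f i j (y k l)) Q * c Q * cnj (d P))" .
  have Lc: "L2_set (\<lambda>P. cmod (c P)) ?I = L2_set (\<lambda>j. norm (\<zeta> j)) {..<p}"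
  proof -
    have "L2_set (\<lambda>P. cmod (c P)) ?I = L2_set (\<lambda>j. L2_set (\<lambda>l. cmod (c (j, l))) {..<m}) {..<p}"
      using L2_set_prod[of "\<lambda>j l. cmod (c (j, l))" "{..<p}" "{..<m}"] by (simp add: case_prod_unfold)
    also have "\<dots> = L2_set (\<lambda>j. norm (\<zeta> j)) {..<p}"
      by (rule L2_set_cong[OF refl]) (use zc norm_orthonormal_sum(2)[where e = e and m = m, OF o] in simp)
    finally show ?thesis .
  qed
  have Ld: "L2_set (\<lambda>P. cmod (d P)) ?I = L2_set (\<lambda>j. norm (\<eta> j)) {..<p}"
  proof -
    have "L2_set (\<lambda>P. cmod (d P)) ?I = L2_set (\<lambda>j. L2_set (\<lambda>l. cmod (d (j, l))) {..<m}) {..<p}"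
      using L2_set_prod[of "\<lambda>j l. cmod (d (j, l))" "{..<p}" "{..<m}"] by (simp add: case_prod_unfold)
    also have "\<dots> = L2_set (\<lambda>j. norm (\<eta> j)) {..<p}"
      by (rule L2_set_cong[OF refl]) (use zd norm_orthonormal_sum(2)[where e = e and m = m, OF o] in simp)
    finally show ?thesis .
  qed
  have yM: "y \<in> mats M m" unfolding mats_def y_def using slice_in[OF Mb M(2) N a] by blast
  have cm: "cmat_norm ?I (\<lambda>(i, k) (j, l). f i j (y k l)) \<le> predual_mat_norm M p f * onorm a"
  proof -
    have "cmat_norm ?I (\<lambda>(i, k) (j, l). f i j (y k l)) \<le> predual_mat_norm M p f * opmat_norm {..<m} y"
      by (rule cmat_norm_le_predual_mat_norm[OF M(1) f yM])
    also have "\<dots> \<le> predual_mat_norm M p f * onorm a"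
      unfolding y_def[abs_def] by (rule mult_left_mono[OF slice_matrix_norm_le[OF ab o] f0])
    finally show ?thesis .
  qed
  have "(\<Sum>i<p. inner (\<Sum>j<p. b i j (\<zeta> j)) (\<eta> i)) = Re (\<Sum>i<p. cinner (\<Sum>j<p. b i j (\<zeta> j)) (\<eta> i))"
    unfolding inner_eq_Re_cinner Re_sum ..
  also have "\<dots> \<le> cmod (\<Sum>i<p. cinner (\<Sum>j<p. b i j (\<zeta> j)) (\<eta> i))" by (rule complex_Re_le_cmod)
  also have "\<dots> \<le> cmat_norm ?I (\<lambda>(i, k) (j, l). f i j (y k l)) * L2_set (\<lambda>P. cmod (c P)) ?I * L2_set (\<lambda>P. cmod (d P)) ?I"
    unfolding s by (rule cmat_form_le) simp
  also have "\<dots> \<le> (predual_mat_norm M p f * onorm a) * L2_set (\<lambda>P. cmod (c P)) ?I * L2_set (\<lambda>P. cmod (d P)) ?I"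
    by (intro mult_right_mono cm L2_set_nonneg)
  finally show "(\<Sum>i<p. inner (\<Sum>j<p. b i j (\<zeta> j)) (\<eta> i))
      \<le> predual_mat_norm M p f * onorm a * L2_set (\<lambda>j. norm (\<zeta> j)) {..<p} * L2_set (\<lambda>i. norm (\<eta> i)) {..<p}"
    unfolding Lc Ld .
qed

lemma normals_sum:
  assumes "M \<subseteq> bounded_ops" "finite I" "\<And>i. i \<in> I \<Longrightarrow> f i \<in> normals M"
  shows "(\<lambda>a. \<Sum>i\<in>I. f i a) \<in> normals M"
  using assms(2,3)
proof (induction I rule: finite_induct)
  case empty
  then show ?case using fn_subspaceD(1)[OF fn_subspace_normals[OF assms(1)]] by simp
next
  case (insert i I)
  have "(\<lambda>a. f i a + (\<Sum>i\<in>I. f i a)) \<in> normals M"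
    by (rule fn_subspaceD(2)[OF fn_subspace_normals[OF assms(1)]]) (use insert in auto)
  then show ?case using insert.hyps by simp
qed

text \<open>Slicing first with \<open>f\<close> and then with \<open>g\<close>: the matrix \<open>(f\<^sub>i\<^sub>j \<otimes> id)(a)\<close> over \<open>N\<close> has norm at most
  \<open>\<parallel>f\<parallel> \<parallel>a\<parallel>\<close>, and \<open>g\<close> maps it to a scalar matrix.\<close>

lemma factorization_functional:
  fixes M :: "'a::chilbert_space op set" and N :: "'b::chilbert_space op set"
  assumes M: "op_subspace M" "commutant (commutant M) = M" and N: "op_subspace N" "commutant (commutant N) = N"
    and f: "f \<in> mats (predual M) p" and g: "g \<in> mats (predual N) q"
  shows "\<exists>h\<in>normals (vn_tensor M N).
    (\<forall>x\<in>M. \<forall>y\<in>N. h (op_tensor x y) = (\<Sum>i<p. \<Sum>j<p. \<Sum>k<q. \<Sum>l<q. \<alpha> i k * (f i j x * g k l y) * \<beta> j l)) \<and>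
    (\<forall>a\<in>vn_tensor M N. cmod (h a) \<le> sqrt (\<Sum>i<p. \<Sum>k<q. (cmod (\<alpha> i k))\<^sup>2) * predual_mat_norm M p f
       * predual_mat_norm N q g * sqrt (\<Sum>j<p. \<Sum>l<q. (cmod (\<beta> j l))\<^sup>2) * onorm a)"
proof -
  have Mb: "M \<subseteq> bounded_ops" and Nb: "N \<subseteq> bounded_ops" using M(1) N(1) unfolding op_subspace_def by auto
  let ?K = "vn_tensor M N"
  have Kb: "?K \<subseteq> bounded_ops" unfolding vn_tensor_def by (rule commutant_bounded)
  note KD = fn_subspaceD[OF fn_subspace_normals[OF Kb]]
  \<comment> \<open>The chosen functional has to be tied to elementary tensors and to slices at
    once: the former identify it with \<open>u\<close>, the latter give its norm.\<close>
  define R where "R i j k l h \<longleftrightarrow> h \<in> normals ?K \<and> (\<forall>x\<in>M. \<forall>y\<in>N. h (op_tensor x y) = f i j x * g k l y)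
      \<and> (\<forall>a\<in>?K. \<forall>b\<in>N. (\<forall>\<zeta> \<zeta>'. cinner (b \<zeta>) \<zeta>' = f i j (slice a \<zeta> \<zeta>')) \<longrightarrow> h a = g k l b)" for i j k l h
  define H where "H i j k l = (SOME h. R i j k l h)" for i j k l
  have HR: "R i j k l (H i j k l)" if "i < p" "j < p" "k < q" "l < q" for i j k l
  proof -
    have fg: "f i j \<in> predual M" "g k l \<in> predual N" using f g that unfolding mats_def by auto
    obtain h where "h \<in> normals ?K" "\<And>x y. x \<in> M \<Longrightarrow> y \<in> N \<Longrightarrow> h (op_tensor x y) = f i j x * g k l y"
      "\<And>a b. a \<in> ?K \<Longrightarrow> b \<in> N \<Longrightarrow> (\<And>\<zeta> \<zeta>'. cinner (b \<zeta>) \<zeta>' = f i j (slice a \<zeta> \<zeta>')) \<Longrightarrow> h a = g k l b"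
      using product_functional[OF M N fg] by metis
    then have "R i j k l h" unfolding R_def by blast
    then show ?thesis unfolding H_def by (rule someI[where P = "R i j k l"])
  qed
  have H: "\<And>i j k l. i < p \<Longrightarrow> j < p \<Longrightarrow> k < q \<Longrightarrow> l < q \<Longrightarrow> H i j k l \<in> normals ?K"
    "\<And>i j k l x y. i < p \<Longrightarrow> j < p \<Longrightarrow> k < q \<Longrightarrow> l < q \<Longrightarrow> x \<in> M \<Longrightarrow> y \<in> N \<Longrightarrow> H i j k l (op_tensor x y) = f i j x * g k l y"
    "\<And>i j k l a b. i < p \<Longrightarrow> j < p \<Longrightarrow> k < q \<Longrightarrow> l < q \<Longrightarrow> a \<in> ?K \<Longrightarrow> b \<in> N \<Longrightarrow>
       (\<forall>\<zeta> \<zeta>'. cinner (b \<zeta>) \<zeta>' = f i j (slice a \<zeta> \<zeta>')) \<Longrightarrow> H i j k l a = g k l b"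
    using HR unfolding R_def by blast+
  define h where "h = (\<lambda>a. \<Sum>i<p. \<Sum>j<p. \<Sum>k<q. \<Sum>l<q. (\<alpha> i k * \<beta> j l) * H i j k l a)"
  have "h \<in> normals ?K"
    unfolding h_def by (intro normals_sum[OF Kb] finite_lessThan KD(3) H(1)) auto
  moreover have "h (op_tensor x y) = (\<Sum>i<p. \<Sum>j<p. \<Sum>k<q. \<Sum>l<q. \<alpha> i k * (f i j x * g k l y) * \<beta> j l)"
    if "x \<in> M" "y \<in> N" for x y
    unfolding h_def by (intro sum.cong refl) (use H(2) that in \<open>simp add: mult_ac\<close>)
  moreover have "cmod (h a) \<le> sqrt (\<Sum>i<p. \<Sum>k<q. (cmod (\<alpha> i k))\<^sup>2) * predual_mat_norm M p f
       * predual_mat_norm N q g * sqrt (\<Sum>j<p. \<Sum>l<q. (cmod (\<beta> j l))\<^sup>2) * onorm a" if a: "a \<in> ?K" for a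
  proof -
    have "\<exists>b. b \<in> N \<and> (\<forall>\<zeta> \<zeta>'. cinner (b \<zeta>) \<zeta>' = f i j (slice a \<zeta> \<zeta>'))" if "i < p" "j < p" for i j
    proof -
      have "f i j \<in> predual M" using f that unfolding mats_def by auto
      from first_leg[OF M Nb N(2) a this] show ?thesis by metis
    qed
    then obtain b where b: "\<And>i j. i < p \<Longrightarrow> j < p \<Longrightarrow> b i j \<in> N"
      "\<And>i j \<zeta> \<zeta>'. i < p \<Longrightarrow> j < p \<Longrightarrow> cinner (b i j \<zeta>) \<zeta>' = f i j (slice a \<zeta> \<zeta>')" by metis
    let ?J = "{..<q} \<times> {..<p}"
    have bm: "b \<in> mats N p" using b(1) unfolding mats_def by blast
    have g0: "0 \<le> predual_mat_norm N q g" by (rule predual_mat_norm_nonneg[OF N(1) g])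
    \<comment> \<open>The norm over \<open>N\<close> puts the index of \<open>g\<close> first, so
      rows and columns are indexed by \<open>(k, i)\<close> and \<open>(l, j)\<close>, and
      \<open>\<alpha>\<close> and \<open>\<beta>\<close> are transposed. The conjugate in
      \<open>\<delta>\<close> cancels the one in the form.\<close>
    define \<gamma> where "\<gamma> = (\<lambda>(l, j). \<beta> j l)"
    define \<delta> where "\<delta> = (\<lambda>(k, i). cnj (\<alpha> i k))"
    have Lg: "L2_set (\<lambda>P. cmod (\<gamma> P)) ?J = sqrt (\<Sum>j<p. \<Sum>l<q. (cmod (\<beta> j l))\<^sup>2)"
      unfolding L2_set_def sum_Times \<gamma>_def by (subst sum.swap) simp
    have Ld: "L2_set (\<lambda>P. cmod (\<delta> P)) ?J = sqrt (\<Sum>i<p. \<Sum>k<q. (cmod (\<alpha> i k))\<^sup>2)"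
      unfolding L2_set_def sum_Times \<delta>_def by (subst sum.swap) simp
    have "h a = (\<Sum>i<p. \<Sum>j<p. \<Sum>k<q. \<Sum>l<q. g k l (b i j) * \<beta> j l * \<alpha> i k)"
      unfolding h_def
    proof (intro sum.cong refl)
      fix i j k l assume "i \<in> {..<p}" "j \<in> {..<p}" "k \<in> {..<q}" "l \<in> {..<q}"
      then have lt: "i < p" "j < p" "k < q" "l < q" by auto
      have "H i j k l a = g k l (b i j)" by (rule H(3)[OF lt a b(1)[OF lt(1,2)]]) (use b(2)[OF lt(1,2)] in blast)
      then show "\<alpha> i k * \<beta> j l * H i j k l a = g k l (b i j) * \<beta> j l * \<alpha> i k" by simp
    qed
    also have "\<dots> = (\<Sum>i<p. \<Sum>k<q. \<Sum>j<p. \<Sum>l<q. g k l (b i j) * \<beta> j l * \<alpha> i k)"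
      by (rule sum.cong[OF refl], rule sum.swap)
    also have "\<dots> = (\<Sum>i<p. \<Sum>k<q. \<Sum>l<q. \<Sum>j<p. g k l (b i j) * \<beta> j l * \<alpha> i k)"
      by (rule sum.cong[OF refl], rule sum.cong[OF refl], rule sum.swap)
    also have "\<dots> = (\<Sum>k<q. \<Sum>i<p. \<Sum>l<q. \<Sum>j<p. g k l (b i j) * \<beta> j l * \<alpha> i k)"
      by (rule sum.swap)
    also have "\<dots> = (\<Sum>P\<in>?J. \<Sum>Q\<in>?J. (case P of (k, i) \<Rightarrow> \<lambda>(l, j). g k l (b i j)) Q * \<gamma> Q * cnj (\<delta> P))"
      unfolding sum_Times \<gamma>_def \<delta>_def by simp
    finally have s: "h a = (\<Sum>P\<in>?J. \<Sum>Q\<in>?J. (case P of (k, i) \<Rightarrow> \<lambda>(l, j). g k l (b i j)) Q * \<gamma> Q * cnj (\<delta> P))" .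
    have "cmod (h a) \<le> cmat_norm ?J (\<lambda>(k, i) (l, j). g k l (b i j)) * L2_set (\<lambda>P. cmod (\<gamma> P)) ?J * L2_set (\<lambda>P. cmod (\<delta> P)) ?J"
      unfolding s by (rule cmat_form_le) simp
    also have "\<dots> \<le> (predual_mat_norm N q g * opmat_norm {..<p} b) * L2_set (\<lambda>P. cmod (\<gamma> P)) ?J * L2_set (\<lambda>P. cmod (\<delta> P)) ?J"
      by (intro mult_right_mono cmat_norm_le_predual_mat_norm[OF N(1) g bm] L2_set_nonneg)
    also have "\<dots> \<le> (predual_mat_norm N q g * (predual_mat_norm M p f * onorm a)) * L2_set (\<lambda>P. cmod (\<gamma> P)) ?J * L2_set (\<lambda>P. cmod (\<delta> P)) ?J"
      by (intro mult_right_mono mult_left_mono g0 first_leg_matrix_norm_le[OF M Nb a f b] L2_set_nonneg)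
    finally show ?thesis unfolding Lg Ld by (simp add: mult_ac)
  qed
  ultimately show ?thesis by (intro bexI[of _ h] conjI ballI)
qed

subsection \<open>Elements of \<open>Nor\<close> extend normally\<close>

lemma zero_predual: "op_subspace M \<Longrightarrow> (\<lambda>x\<in>M. 0) \<in> predual M"
  by (rule predual_vector_functional[where \<xi> = 0 and \<eta> = 0]) auto

text \<open>Diagonal matrices of functionals, with the identity matrix as row and as column, leave
  only the diagonal terms. This shows that the infimum in \<open>proj_norm\<close> of an algebraic
  tensor is over a nonempty set.\<close>

lemma alg_tensor_factorization:
  assumes M: "op_subspace M" and N: "op_subspace N"
    and mn: "\<And>i. i < k \<Longrightarrow> \<mu> i \<in> predual M \<and> \<nu> i \<in> predual N"
  shows "\<exists>f\<in>mats (predual M) k. \<exists>g\<in>mats (predual N) k.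
    \<forall>x\<in>M. \<forall>y\<in>N. (\<Sum>i<k. \<mu> i x * \<nu> i y) =
      (\<Sum>i<k. \<Sum>j<k. \<Sum>k'<k. \<Sum>l<k. (if i = k' then 1 else 0) * (f i j x * g k' l y) * (if j = l then 1 else 0))"
proof -
  define f where "f i j = (if i = j then \<mu> i else (\<lambda>x\<in>M. 0))" for i j
  define g where "g i j = (if i = j then \<nu> i else (\<lambda>x\<in>N. 0))" for i j
  have "f \<in> mats (predual M) k" "g \<in> mats (predual N) k"
    unfolding mats_def f_def g_def using mn zero_predual[OF M] zero_predual[OF N] by auto
  moreover have "(\<Sum>i<k. \<mu> i x * \<nu> i y) =
      (\<Sum>i<k. \<Sum>j<k. \<Sum>k'<k. \<Sum>l<k. (if i = k' then 1 else 0) * (f i j x * g k' l y) * (if j = l then 1 else 0))"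
    if x: "x \<in> M" and y: "y \<in> N" for x y
  proof (rule sum.cong[OF refl])
    fix i assume i: "i \<in> {..<k}"
    have "(\<Sum>k'<k. \<Sum>l<k. (if i = k' then 1 else 0) * (f i j x * g k' l y) * (if j = l then 1 else 0)) = f i j x * g i j y"
      if j: "j \<in> {..<k}" for j
    proof -
      have "(\<Sum>l<k. (if i = k' then 1 else 0) * (f i j x * g k' l y) * (if j = l then 1 else 0)) = (if i = k' then f i j x * g k' j y else 0)" for k'
      proof -
        have "(\<Sum>l<k. (if i = k' then 1 else 0) * (f i j x * g k' l y) * (if j = l then 1 else 0))
          = (\<Sum>l<k. if j = l then (if i = k' then 1 else 0) * (f i j x * g k' l y) else 0)"
          by (rule sum.cong) auto
        then show ?thesis using j by simp
      qed
      then show ?thesis using i by simp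
    qed
    then have "(\<Sum>j<k. \<Sum>k'<k. \<Sum>l<k. (if i = k' then 1 else 0) * (f i j x * g k' l y) * (if j = l then 1 else 0)) = (\<Sum>j<k. f i j x * g i j y)"
      by (intro sum.cong refl) blast
    also have "\<dots> = (\<Sum>j<k. if i = j then \<mu> i x * \<nu> i y else 0)"
      by (rule sum.cong[OF refl]) (use x in \<open>simp add: f_def g_def\<close>)
    also have "\<dots> = \<mu> i x * \<nu> i y" using i by simp
    finally show "\<mu> i x * \<nu> i y = (\<Sum>j<k. \<Sum>k'<k. \<Sum>l<k. (if i = k' then 1 else 0) * (f i j x * g k' l y) * (if j = l then 1 else 0))" by simp
  qed
  ultimately show ?thesis by (intro bexI[of _ f] bexI[of _ g] ballI)
qed

lemma alg_tensor_functional: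
  assumes M: "op_subspace M" "commutant (commutant M) = M" and N: "op_subspace N" "commutant (commutant N) = N"
    and u: "u \<in> alg_tensor M N"
  obtains h where "h \<in> normals (vn_tensor M N)" "\<And>x y. x \<in> M \<Longrightarrow> y \<in> N \<Longrightarrow> h (op_tensor x y) = u x y"
proof -
  obtain k \<mu> \<nu> where ue: "u = (\<lambda>x\<in>M. \<lambda>y\<in>N. \<Sum>i<(k::nat). \<mu> i x * \<nu> i y)" and mn: "\<And>i. i < k \<Longrightarrow> \<mu> i \<in> predual M \<and> \<nu> i \<in> predual N"
    using u unfolding alg_tensor_def by blast
  obtain f g where fg: "f \<in> mats (predual M) k" "g \<in> mats (predual N) k" and
    e: "\<forall>x\<in>M. \<forall>y\<in>N. (\<Sum>i<k. \<mu> i x * \<nu> i y) =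
      (\<Sum>i<k. \<Sum>j<k. \<Sum>k'<k. \<Sum>l<k. (if i = k' then 1 else 0) * (f i j x * g k' l y) * (if j = l then 1 else 0))"
    using alg_tensor_factorization[where \<mu> = \<mu> and \<nu> = \<nu>, OF M(1) N(1) mn] by blast
  from factorization_functional[OF M N fg, of "\<lambda>i k'. if i = k' then 1 else 0" "\<lambda>j l. if j = l then 1 else 0"]
  obtain h where h: "h \<in> normals (vn_tensor M N)" "\<forall>x\<in>M. \<forall>y\<in>N. h (op_tensor x y) =
      (\<Sum>i<k. \<Sum>j<k. \<Sum>k'<k. \<Sum>l<k. (if i = k' then 1 else 0) * (f i j x * g k' l y) * (if j = l then 1 else 0))"
    by (elim bexE conjE)
  show thesis by (rule that[OF h(1)]) (simp add: h(2) ue e)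
qed

text \<open>Some admissible factorization has its product of norms below \<open>e\<close>, and
  \<open>factorization_functional\<close> turns this product into a bound on the unit ball.
  Nonemptiness of the set of factorizations is obtained by writing the difference as one finite sum
  of products.\<close>

lemma proj_norm_less_functional:
  assumes M: "op_subspace M" "commutant (commutant M) = M" and N: "op_subspace N" "commutant (commutant N) = N"
    and u: "u \<in> alg_tensor M N" and v: "v \<in> alg_tensor M N" and less: "proj_norm M N (\<lambda>x y. u x y - v x y) < e"
  shows "\<exists>h. h \<in> normals (vn_tensor M N) \<and> (\<forall>x\<in>M. \<forall>y\<in>N. h (op_tensor x y) = u x y - v x y)
    \<and> (\<forall>a\<in>vn_tensor M N. onorm a \<le> 1 \<longrightarrow> cmod (h a) \<le> e)"
proof -
  obtain k \<mu> \<nu> where ue: "u = (\<lambda>x\<in>M. \<lambda>y\<in>N. \<Sum>i<(k::nat). \<mu> i x * \<nu> i y)" and mn: "\<And>i. i < k \<Longrightarrow> \<mu> i \<in> predual M \<and> \<nu> i \<in> predual N"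
    using u unfolding alg_tensor_def by blast
  obtain k' \<mu>' \<nu>' where ve: "v = (\<lambda>x\<in>M. \<lambda>y\<in>N. \<Sum>i<(k'::nat). \<mu>' i x * \<nu>' i y)" and mn': "\<And>i. i < k' \<Longrightarrow> \<mu>' i \<in> predual M \<and> \<nu>' i \<in> predual N"
    using v unfolding alg_tensor_def by blast
  \<comment> \<open>The minus sign of \<open>v\<close> is absorbed into the first legs, so that
    \<open>u - v\<close> is a sum of products over the concatenated index range.\<close>
  have neg: "(\<lambda>x\<in>M. - \<mu>' i x) \<in> predual M" if i: "i < k'" for i
  proof -
    have Mb: "M \<subseteq> bounded_ops" using M(1) unfolding op_subspace_def by blast
    obtain \<xi> \<eta> where "normal_rep M (\<mu>' i) \<xi> \<eta>" using mn'[OF i] predual_iff[OF M(1)] by blast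
    from normal_rep_scale[OF Mb this, of "\<lambda>x\<in>M. - \<mu>' i x" "-1" 1]
    show ?thesis unfolding predual_iff[OF M(1)] by auto
  qed
  define m where "m i = (if i < k then \<mu> i else (\<lambda>x\<in>M. - \<mu>' (i - k) x))" for i
  define n where "n i = (if i < k then \<nu> i else \<nu>' (i - k))" for i
  have mnp: "m i \<in> predual M \<and> n i \<in> predual N" if "i < k + k'" for i
  proof (cases "i < k")
    case False
    then have "i - k < k'" using that by simp
    then show ?thesis using False neg mn' unfolding m_def n_def by simp
  qed (use mn in \<open>simp add: m_def n_def\<close>)
  have diff: "u x y - v x y = (\<Sum>i<k + k'. m i x * n i y)" if "x \<in> M" "y \<in> N" for x y
  proof -
    have "u x y - v x y = (\<Sum>i<k. \<mu> i x * \<nu> i y) + (\<Sum>i<k'. - \<mu>' i x * \<nu>' i y)"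
      using that by (simp add: ue ve sum_negf)
    also have "\<dots> = (\<Sum>i<k + k'. m i x * n i y)"
      unfolding sum_concat_lessThan by (rule sum.cong) (use that in \<open>auto simp: m_def n_def\<close>)
    finally show ?thesis .
  qed
  obtain f g where fg: "f \<in> mats (predual M) (k + k')" "g \<in> mats (predual N) (k + k')" and
    e: "\<forall>x\<in>M. \<forall>y\<in>N. (\<Sum>i<k + k'. m i x * n i y) =
      (\<Sum>i<k + k'. \<Sum>j<k + k'. \<Sum>k''<k + k'. \<Sum>l<k + k'. (if i = k'' then 1 else 0) * (f i j x * g k'' l y) * (if j = l then 1 else 0))"
    using alg_tensor_factorization[where \<mu> = m and \<nu> = n, OF M(1) N(1) mnp] by blast
  define S where "S = {sqrt (\<Sum>i<p. \<Sum>k<q. (cmod (\<alpha> i k))\<^sup>2) * predual_mat_norm M p f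
       * predual_mat_norm N q g * sqrt (\<Sum>j<p. \<Sum>l<q. (cmod (\<beta> j l))\<^sup>2) |
     (p::nat) (q::nat) (\<alpha> :: nat \<Rightarrow> nat \<Rightarrow> complex) f g (\<beta> :: nat \<Rightarrow> nat \<Rightarrow> complex).
     f \<in> mats (predual M) p \<and> g \<in> mats (predual N) q
     \<and> (\<forall>x\<in>M. \<forall>y\<in>N. u x y - v x y =
          (\<Sum>i<p. \<Sum>j<p. \<Sum>k<q. \<Sum>l<q. \<alpha> i k * (f i j x * g k l y) * \<beta> j l))}"
  define \<delta> where "\<delta> = (\<lambda>i j :: nat. if i = j then 1 else 0 :: complex)"
  have "sqrt (\<Sum>i<k + k'. \<Sum>l<k + k'. (cmod (\<delta> i l))\<^sup>2) * predual_mat_norm M (k + k') f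
       * predual_mat_norm N (k + k') g * sqrt (\<Sum>j<k + k'. \<Sum>l<k + k'. (cmod (\<delta> j l))\<^sup>2) \<in> S"
    unfolding S_def
  proof (rule CollectI, rule exI[of _ "k + k'"], rule exI[of _ "k + k'"], rule exI[of _ \<delta>], rule exI[of _ f],
      rule exI[of _ g], rule exI[of _ \<delta>], intro conjI refl fg ballI)
    fix x y assume "x \<in> M" "y \<in> N"
    then show "u x y - v x y = (\<Sum>i<k + k'. \<Sum>j<k + k'. \<Sum>k''<k + k'. \<Sum>l<k + k'. \<delta> i k'' * (f i j x * g k'' l y) * \<delta> j l)"
      unfolding \<delta>_def using diff e by simp
  qed
  then have "S \<noteq> {}" by blast
  from cInf_lessD[OF this less[unfolded proj_norm_def, folded S_def]]
  obtain s where s: "s \<in> S" "s < e" by blast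
  from s(1) obtain p q \<alpha> f g \<beta> where s': "s = sqrt (\<Sum>i<p. \<Sum>k<q. (cmod (\<alpha> i k))\<^sup>2) * predual_mat_norm M p f
       * predual_mat_norm N q g * sqrt (\<Sum>j<p. \<Sum>l<q. (cmod (\<beta> j l))\<^sup>2)" and
     f: "f \<in> mats (predual M) (p::nat)" and g: "g \<in> mats (predual N) (q::nat)"
     and eq: "\<forall>x\<in>M. \<forall>y\<in>N. u x y - v x y =
          (\<Sum>i<p. \<Sum>j<p. \<Sum>k<q. \<Sum>l<q. \<alpha> i k * (f i j x * g k l y) * \<beta> j l)"
    unfolding S_def by (elim CollectE exE conjE)
  note z = s(2)[unfolded s']
  from factorization_functional[OF M N f g, of \<alpha> \<beta>]
  obtain h where h: "h \<in> normals (vn_tensor M N)"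
    "\<forall>x\<in>M. \<forall>y\<in>N. h (op_tensor x y) = (\<Sum>i<p. \<Sum>j<p. \<Sum>k<q. \<Sum>l<q. \<alpha> i k * (f i j x * g k l y) * \<beta> j l)"
    "\<forall>a\<in>vn_tensor M N. cmod (h a) \<le> sqrt (\<Sum>i<p. \<Sum>k<q. (cmod (\<alpha> i k))\<^sup>2) * predual_mat_norm M p f
       * predual_mat_norm N q g * sqrt (\<Sum>j<p. \<Sum>l<q. (cmod (\<beta> j l))\<^sup>2) * onorm a" by (elim bexE conjE)
  have "cmod (h a) \<le> e" if a: "a \<in> vn_tensor M N" "onorm a \<le> 1" for a
  proof -
    let ?z = "sqrt (\<Sum>i<p. \<Sum>k<q. (cmod (\<alpha> i k))\<^sup>2) * predual_mat_norm M p f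
       * predual_mat_norm N q g * sqrt (\<Sum>j<p. \<Sum>l<q. (cmod (\<beta> j l))\<^sup>2)"
    have "0 \<le> ?z"
      by (intro mult_nonneg_nonneg predual_mat_norm_nonneg M(1) N(1) f g) (simp_all add: sum_nonneg)
    then have "?z * onorm a \<le> ?z * 1" by (rule mult_left_mono[OF a(2)])
    then show ?thesis using bspec[OF h(3) a(1)] z by linarith
  qed
  then show ?thesis using h(1,2) eq by (intro exI[of _ h]) auto
qed

text \<open>\<open>Q\<close> is a general relation because it is used both for the projective norm
  and for uniform estimates on a unit ball. Summing all thresholds up to \<open>k\<close> makes
  \<open>R\<close> monotone, so \<open>R k\<close> and \<open>R (Suc k)\<close> are both beyond the
  \<open>k\<close>-th one.\<close>

lemma fast_subsequence:
  fixes Q :: "nat \<Rightarrow> nat \<Rightarrow> real \<Rightarrow> bool"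
  assumes "\<And>e. e > 0 \<Longrightarrow> \<exists>K. \<forall>m\<ge>K. \<forall>n\<ge>K. Q m n e"
  shows "\<exists>R. (\<forall>k. k \<le> R k) \<and> (\<forall>k. Q (R (Suc k)) (R k) ((1/2) ^ k))"
proof -
  have "\<exists>K. \<forall>m\<ge>K. \<forall>n\<ge>K. Q m n ((1/2) ^ k)" for k :: nat by (rule assms) simp
  then obtain K where K: "\<And>k m n. m \<ge> K k \<Longrightarrow> n \<ge> K k \<Longrightarrow> Q m n ((1/2) ^ k)" by metis
  define R where "R k = k + (\<Sum>i\<le>k. K i)" for k
  have RK: "K k \<le> R k" for k unfolding R_def by (simp add: sum.atMost_Suc[symmetric] trans_le_add2 member_le_sum)
  have "K k \<le> R (Suc k)" for k
  proof -
    have "R k \<le> R (Suc k)" by (simp add: R_def)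
    then show ?thesis using RK[of k] by linarith
  qed
  then show ?thesis using RK K by (intro exI[of _ R]) (simp add: R_def)
qed

lemma LIMSEQ_fast_subsequence:
  fixes s :: "nat \<Rightarrow> 'a::real_normed_vector"
  assumes "s \<longlonglongrightarrow> L" "\<And>k. k \<le> R k"
  shows "(\<lambda>k. s (R (Suc k)) - s (R k)) sums (L - s (R 0))"
proof -
  have "filterlim R at_top sequentially"
    by (rule filterlim_at_top_mono[OF filterlim_ident]) (simp add: assms(2))
  then have "(\<lambda>k. s (R k)) \<longlonglongrightarrow> L" by (rule filterlim_compose[OF assms(1)])
  then show ?thesis by (rule telescope_sums)
qed

lemma op_unit_scaling:
  assumes M: "op_subspace M" and x: "x \<in> M"
  obtains s x' where "x' \<in> M" "onorm x' \<le> 1" "x = op_scale s x'"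
proof -
  have xl: "cblinear x" using M x unfolding op_subspace_def bounded_ops_iff[symmetric] by blast
  \<comment> \<open>Adding 1 keeps the scaling factor positive also for the zero operator.\<close>
  define s where "s = onorm x + 1"
  have s: "s > 0" using onorm_nonneg[OF xl] by (simp add: s_def)
  define x' where "x' = op_scale (of_real (inverse s)) x"
  have "x' \<in> M" using M x unfolding x'_def op_subspace_def by blast
  moreover have "onorm x' \<le> 1"
  proof (rule onorm_bound)
    fix v
    have "norm (x' v) = inverse s * norm (x v)" using s by (simp add: x'_def op_scale_def norm_scaleC norm_inverse)
    also have "\<dots> \<le> inverse s * (onorm x * norm v)" by (rule mult_left_mono[OF cblinear_norm_le[OF xl]]) (use s in simp)
    also have "\<dots> \<le> inverse s * (s * norm v)" using s by (intro mult_left_mono mult_right_mono) (auto simp: s_def)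
    also have "\<dots> = 1 * norm v" using s by simp
    finally show "norm (x' v) \<le> 1 * norm v" .
  qed simp
  moreover have "x = op_scale (of_real s) x'" using s by (simp add: x'_def op_scale_def scaleC_scaleC)
  ultimately show thesis using that by blast
qed

lemma alg_tensor_linear:
  assumes M: "op_subspace M" and N: "op_subspace N" and u: "u \<in> alg_tensor M N"
  shows "x \<in> M \<Longrightarrow> y \<in> N \<Longrightarrow> u (op_scale c x) (op_scale d y) = c * d * u x y"
    and "y \<in> N \<Longrightarrow> (\<lambda>x. u x y) \<in> normals M"
proof -
  have Mb: "M \<subseteq> bounded_ops" using M unfolding op_subspace_def by blast
  obtain k \<mu> \<nu> where ue: "u = (\<lambda>x\<in>M. \<lambda>y\<in>N. \<Sum>i<(k::nat). \<mu> i x * \<nu> i y)" and mn: "\<And>i. i < k \<Longrightarrow> \<mu> i \<in> predual M \<and> \<nu> i \<in> predual N"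
    using u unfolding alg_tensor_def by blast
  show "u (op_scale c x) (op_scale d y) = c * d * u x y" if xy: "x \<in> M" "y \<in> N"
  proof -
    have "op_scale c x \<in> M" "op_scale d y \<in> N" using xy M N unfolding op_subspace_def by auto
    moreover have "\<mu> i (op_scale c x) * \<nu> i (op_scale d y) = c * d * (\<mu> i x * \<nu> i y)" if "i < k" for i
      using mn[OF that] xy unfolding predual_def by simp
    ultimately show ?thesis using xy by (simp add: ue sum_distrib_left)
  qed
  show "(\<lambda>x. u x y) \<in> normals M" if y: "y \<in> N"
  proof -
    note KD = fn_subspaceD[OF fn_subspace_normals[OF Mb]]
    have "(\<lambda>x. \<nu> i y * \<mu> i x) \<in> normals M" if "i < k" for i
      by (rule KD(3)) (use mn[OF that] predual_iff[OF M] in \<open>auto simp: normals_def\<close>)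
    then have "(\<lambda>x. \<Sum>i<k. \<nu> i y * \<mu> i x) \<in> normals M" by (intro normals_sum[OF Mb]) auto
    then obtain \<xi> \<eta> where "normal_rep M (\<lambda>x. \<Sum>i<k. \<nu> i y * \<mu> i x) \<xi> \<eta>" unfolding normals_def by blast
    then have "normal_rep M (\<lambda>x. u x y) \<xi> \<eta>" unfolding normal_rep_def using y by (simp add: ue mult.commute)
    then show ?thesis unfolding normals_def by blast
  qed
qed

text \<open>Both sides are homogeneous in \<open>x\<close> and in \<open>y\<close>, so the estimate
  for contractions is enough.\<close>

lemma Nor_pointwise:
  assumes M: "op_subspace M" and N: "op_subspace N" and \<phi>: "\<phi> \<in> CB M N" and u: "\<And>n. u n \<in> alg_tensor M N"
    and lim: "(\<lambda>n. cb_norm M N (\<lambda>x y. u n x y - \<phi> x y)) \<longlonglongrightarrow> 0" and x: "x \<in> M" and y: "y \<in> N"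
  shows "(\<lambda>n. u n x y) \<longlonglongrightarrow> \<phi> x y"
proof -
  obtain s x' where x': "x' \<in> M" "onorm x' \<le> 1" "x = op_scale s x'" using op_unit_scaling[OF M x] by blast
  obtain t y' where y': "y' \<in> N" "onorm y' \<le> 1" "y = op_scale t y'" using op_unit_scaling[OF N y] by blast
  have "(\<lambda>n. u n x' y' - \<phi> x' y') \<longlonglongrightarrow> 0"
    by (rule Lim_null_comparison[OF always_eventually lim]) (use pointwise_le_cb_norm[OF M N u \<phi> x'(1,2) y'(1,2)] in blast)
  then have "(\<lambda>n. u n x' y') \<longlonglongrightarrow> \<phi> x' y'" by (rule LIM_zero_cancel)
  then have "(\<lambda>n. s * t * u n x' y') \<longlonglongrightarrow> s * t * \<phi> x' y'" by (rule tendsto_mult_left)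
  moreover have "\<phi> x y = s * t * \<phi> x' y'"
  proof -
    have l: "\<phi> \<in> linear_into_predual M N" using \<phi> unfolding CB_def by blast
    then have "\<phi> x' \<in> predual N" using x'(1) unfolding linear_into_predual_def by (auto simp: PiE_iff)
    then have "\<phi> x' y = t * \<phi> x' y'" using y' unfolding predual_def by simp
    moreover have "\<phi> x y = s * \<phi> x' y" using l x' y unfolding linear_into_predual_def by simp
    ultimately show ?thesis by simp
  qed
  moreover have "u n x y = s * t * u n x' y'" for n
    unfolding x'(3) y'(3) by (rule alg_tensor_linear(1)[OF M N u x'(1) y'(1)])
  ultimately show ?thesis by simp
qed

text \<open>For a contraction \<open>y\<close> the functionals \<open>x \<mapsto> u n x y\<close>
  are normal and uniformly Cauchy on the unit ball of \<open>M\<close>, by comparison with the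
  cb-norms. Their limit is then normal by completeness of the predual of \<open>M\<close>.\<close>

lemma Nor_subset_CB_normal:
  assumes M: "op_subspace M" "commutant (commutant M) = M" and N: "op_subspace N"
  shows "Nor M N \<subseteq> CB_normal M N"
proof
  fix \<phi> assume "\<phi> \<in> Nor M N"
  then obtain u where \<phi>: "\<phi> \<in> CB M N" and u: "\<And>n. u n \<in> alg_tensor M N"
    and lim: "(\<lambda>n. cb_norm M N (\<lambda>x y. u n x y - \<phi> x y)) \<longlonglongrightarrow> 0" unfolding Nor_def by blast
  have Mb: "M \<subseteq> bounded_ops" using M(1) unfolding op_subspace_def by blast
  note KD = fn_subspaceD[OF fn_subspace_normals[OF Mb]]
  have pp: "\<phi> \<in> M \<rightarrow> predual N" using \<phi> unfolding CB_def linear_into_predual_def by (auto simp: PiE_iff)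
  let ?c = "\<lambda>n. cb_norm M N (\<lambda>x y. u n x y - \<phi> x y)"
  have unit: "\<exists>f\<in>normals M. \<forall>x\<in>M. f x = \<phi> x y" if y: "y \<in> N" "onorm y \<le> 1" for y
  proof -
    have "\<exists>K. \<forall>m\<ge>K. \<forall>n\<ge>K. \<forall>x\<in>M. onorm x \<le> 1 \<longrightarrow> cmod (u m x y - u n x y) \<le> e" if e: "e > 0" for e
    proof -
      have "eventually (\<lambda>n. dist (?c n) 0 < e / 2) sequentially" using lim e by (intro tendstoD) auto
      then obtain K where K: "\<And>n. n \<ge> K \<Longrightarrow> ?c n < e / 2" unfolding eventually_sequentially dist_real_def by fastforce
      have "cmod (u m x y - u n x y) \<le> e" if "m \<ge> K" "n \<ge> K" "x \<in> M" "onorm x \<le> 1" for m n x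
      proof -
        have "cmod (u m x y - u n x y) \<le> cmod (u m x y - \<phi> x y) + cmod (u n x y - \<phi> x y)"
          using norm_triangle_ineq4[of "u m x y - \<phi> x y" "u n x y - \<phi> x y"] by simp
        also have "\<dots> \<le> ?c m + ?c n"
          by (intro add_mono pointwise_le_cb_norm[OF M(1) N u \<phi> that(3,4) y])
        finally show ?thesis using K[OF that(1)] K[OF that(2)] by linarith
      qed
      then show ?thesis by blast
    qed
    from fast_subsequence[of "\<lambda>m n e. \<forall>x\<in>M. onorm x \<le> 1 \<longrightarrow> cmod (u m x y - u n x y) \<le> e", OF this]
    obtain R where R: "\<And>k. k \<le> R k"
      "\<And>k. \<forall>x\<in>M. onorm x \<le> 1 \<longrightarrow> cmod (u (R (Suc k)) x y - u (R k) x y) \<le> (1/2) ^ k"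
      by blast
    have nu: "(\<lambda>x. u n x y) \<in> normals M" for n by (rule alg_tensor_linear(2)[OF M(1) N u y(1)])
    have nd: "(\<lambda>x. u (R (Suc k)) x y - u (R k) x y) \<in> normals M" for k
      using KD(2)[OF nu[of "R (Suc k)"] KD(4)[OF nu[of "R k"]]] by simp
    obtain f where f: "f \<in> normals M" "\<And>x. x \<in> M \<Longrightarrow> (\<lambda>k. u (R (Suc k)) x y - u (R k) x y) sums f x"
      using normals_series[where g = "\<lambda>k x. u (R (Suc k)) x y - u (R k) x y" and e = "\<lambda>k. (1/2) ^ k", OF M nd]
        R(2) summable_geometric[of "1/2 :: real"] by auto
    have "f x + u (R 0) x y = \<phi> x y" if x: "x \<in> M" for x
    proof -
      have "(\<lambda>k. u (R (Suc k)) x y - u (R k) x y) sums (\<phi> x y - u (R 0) x y)"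
        by (rule LIMSEQ_fast_subsequence[OF Nor_pointwise[OF M(1) N \<phi> u lim x y(1)] R(1)])
      from sums_unique2[OF f(2)[OF x] this] show ?thesis by simp
    qed
    moreover have "(\<lambda>x. f x + u (R 0) x y) \<in> normals M" by (rule KD(2)[OF f(1) nu])
    ultimately show ?thesis by (intro bexI[of _ "\<lambda>x. f x + u (R 0) x y"]) auto
  qed
  have "normal_map M N \<phi>"
  proof (rule normal_mapI[OF pp])
    fix y assume y: "y \<in> N"
    obtain t y' where y': "y' \<in> N" "onorm y' \<le> 1" "y = op_scale t y'" using op_unit_scaling[OF N y] by blast
    obtain f where f: "f \<in> normals M" "\<And>x. x \<in> M \<Longrightarrow> f x = \<phi> x y'" using unit[OF y'(1,2)] by blast
    from KD(3)[OF f(1), of t] obtain \<xi> \<eta> where "normal_rep M (\<lambda>x. t * f x) \<xi> \<eta>" unfolding normals_def by blast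
    moreover have "\<phi> x y = t * \<phi> x y'" if "x \<in> M" for x
      using pp that y' unfolding predual_def by auto
    ultimately have "normal_rep M (\<lambda>x\<in>M. \<phi> x y) \<xi> \<eta>" unfolding normal_rep_def using f(2) by simp
    then show "(\<lambda>x\<in>M. \<phi> x y) \<in> predual M" unfolding predual_iff[OF M(1)] by auto
  qed
  then show "\<phi> \<in> CB_normal M N" using \<phi> unfolding CB_normal_def by blast
qed

text \<open>Convergence in cb-norm determines only the values at \<open>x \<otimes> y\<close>. The
  functional on the whole tensor product is a telescoping series, and its convergence rests on the
  Cauchy property in the projective norm.\<close>

lemma Nor_extends_normally:
  assumes M: "op_subspace M" "commutant (commutant M) = M" and N: "op_subspace N" "commutant (commutant N) = N"
    and \<phi>: "\<phi> \<in> Nor M N"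
  shows "extends_normally M N \<phi>"
proof -
  obtain u where \<phi>: "\<phi> \<in> CB M N" and u: "\<And>n. u n \<in> alg_tensor M N"
    and cau: "\<And>e. e > 0 \<Longrightarrow> \<exists>K. \<forall>m\<ge>K. \<forall>n\<ge>K. proj_norm M N (\<lambda>x y. u m x y - u n x y) < e"
    and lim: "(\<lambda>n. cb_norm M N (\<lambda>x y. u n x y - \<phi> x y)) \<longlonglongrightarrow> 0" using \<phi> unfolding Nor_def by blast
  have Mb: "M \<subseteq> bounded_ops" and Nb: "N \<subseteq> bounded_ops" using M(1) N(1) unfolding op_subspace_def by auto
  let ?K = "vn_tensor M N"
  note K = vn_tensor_facts[OF Mb Nb]
  have Kb: "?K \<subseteq> bounded_ops" using K(1) unfolding op_subspace_def by blast
  from fast_subsequence[of "\<lambda>m n e. proj_norm M N (\<lambda>x y. u m x y - u n x y) < e", OF cau]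
  obtain R where R: "\<And>k. k \<le> R k" "\<And>k. proj_norm M N (\<lambda>x y. u (R (Suc k)) x y - u (R k) x y) < (1/2) ^ k"
    by blast
  have "\<exists>h. h \<in> normals ?K \<and> (\<forall>x\<in>M. \<forall>y\<in>N. h (op_tensor x y) = u (R (Suc k)) x y - u (R k) x y)
    \<and> (\<forall>a\<in>?K. onorm a \<le> 1 \<longrightarrow> cmod (h a) \<le> (1/2) ^ k)" for k
    by (rule proj_norm_less_functional[OF M N u u R(2)])
  then obtain H where H: "\<And>k. H k \<in> normals ?K"
    "\<And>k x y. x \<in> M \<Longrightarrow> y \<in> N \<Longrightarrow> H k (op_tensor x y) = u (R (Suc k)) x y - u (R k) x y"
    "\<And>k a. a \<in> ?K \<Longrightarrow> onorm a \<le> 1 \<Longrightarrow> cmod (H k a) \<le> (1/2) ^ k" by metis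
  obtain f where f: "f \<in> normals ?K" "\<And>a. a \<in> ?K \<Longrightarrow> (\<lambda>k. H k a) sums f a"
    using normals_series[where g = H and e = "\<lambda>k. (1/2) ^ k", OF K(1,2) H(1,3)] summable_geometric[of "1/2 :: real"] by auto
  obtain h0 where h0: "h0 \<in> normals ?K" "\<And>x y. x \<in> M \<Longrightarrow> y \<in> N \<Longrightarrow> h0 (op_tensor x y) = u (R 0) x y"
    using alg_tensor_functional[OF M N u] by metis
  have "(\<lambda>a. f a + h0 a) \<in> normals ?K" by (rule fn_subspaceD(2)[OF fn_subspace_normals[OF Kb] f(1) h0(1)])
  then obtain \<xi> \<eta> where "normal_rep ?K (\<lambda>a. f a + h0 a) \<xi> \<eta>" unfolding normals_def by blast
  then have "normal_rep ?K (\<lambda>a\<in>?K. f a + h0 a) \<xi> \<eta>" unfolding normal_rep_def by simp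
  then have p: "(\<lambda>a\<in>?K. f a + h0 a) \<in> predual ?K" unfolding predual_iff[OF K(1)] by auto
  have "(\<lambda>a\<in>?K. f a + h0 a) (op_tensor x y) = \<phi> x y" if x: "x \<in> M" and y: "y \<in> N" for x y
  proof -
    have "(\<lambda>k. u (R (Suc k)) x y - u (R k) x y) sums (\<phi> x y - u (R 0) x y)"
      by (rule LIMSEQ_fast_subsequence[OF Nor_pointwise[OF M(1) N(1) \<phi> u lim x y] R(1)])
    moreover have "(\<lambda>k. u (R (Suc k)) x y - u (R k) x y) sums f (op_tensor x y)"
      using f(2)[OF K(3)[OF x y]] H(2)[OF x y] by simp
    ultimately have "f (op_tensor x y) = \<phi> x y - u (R 0) x y" by (rule sums_unique2[symmetric])
    then show ?thesis using h0(2)[OF x y] K(3)[OF x y] by simp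
  qed
  then show ?thesis unfolding extends_normally_def using p by blast
qed

subsection \<open>Square summable sequences of vectors\<close>

lemma sqsum_add:
  assumes "sqsum f" "sqsum g"
  shows "sqsum (\<lambda>n. f n + g n)"
  unfolding sqsum_def
proof (rule summable_comparison_test)
  show "summable (\<lambda>n. 2 * (norm (f n))\<^sup>2 + 2 * (norm (g n))\<^sup>2)"
    by (rule summable_add[OF summable_mult[OF assms(1)[unfolded sqsum_def]] summable_mult[OF assms(2)[unfolded sqsum_def]]])
  have "(norm (f n + g n))\<^sup>2 \<le> 2 * (norm (f n))\<^sup>2 + 2 * (norm (g n))\<^sup>2" for n
  proof -
    have "(norm (f n + g n))\<^sup>2 \<le> (norm (f n) + norm (g n))\<^sup>2" by (intro power_mono norm_triangle_ineq) simp
    also have "\<dots> \<le> 2 * (norm (f n))\<^sup>2 + 2 * (norm (g n))\<^sup>2"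
      using sum_squares_bound[of "norm (f n)" "norm (g n)"] by (simp add: power2_sum)
    finally show ?thesis .
  qed
  then show "\<exists>N. \<forall>n\<ge>N. norm ((norm (f n + g n))\<^sup>2) \<le> 2 * (norm (f n))\<^sup>2 + 2 * (norm (g n))\<^sup>2" by simp
qed

text \<open>The countable multiple of a Hilbert space, as a type of its own, so that adjoints and
  bounded relations are available for maps into it.\<close>

typedef (overloaded) 'a l2seq = "{f :: nat \<Rightarrow> 'a::chilbert_space. sqsum f}"
  by (rule exI[of _ "\<lambda>_. 0"]) (simp add: sqsum_def)

setup_lifting type_definition_l2seq

lemma sqsum_Rep [simp]: "sqsum (Rep_l2seq x)"
  using Rep_l2seq[of x] by simp

instantiation l2seq :: (chilbert_space) real_inner
begin

lift_definition zero_l2seq :: "'a l2seq" is "\<lambda>_. 0" by (simp add: sqsum_def)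

lift_definition plus_l2seq :: "'a l2seq \<Rightarrow> 'a l2seq \<Rightarrow> 'a l2seq" is "\<lambda>f g n. f n + g n" by (rule sqsum_add)

lift_definition scaleR_l2seq :: "real \<Rightarrow> 'a l2seq \<Rightarrow> 'a l2seq" is "\<lambda>r f n. of_real r *\<^sub>C f n" by (rule sqsum_scaleC(1))

lift_definition uminus_l2seq :: "'a l2seq \<Rightarrow> 'a l2seq" is "\<lambda>f n. (-1) *\<^sub>C f n" by (rule sqsum_scaleC(1))

lift_definition inner_l2seq :: "'a l2seq \<Rightarrow> 'a l2seq \<Rightarrow> real" is "\<lambda>f g. Re (trf f g (\<lambda>x. x))" .

definition minus_l2seq :: "'a l2seq \<Rightarrow> 'a l2seq \<Rightarrow> 'a l2seq" where "minus_l2seq x y = x + - y"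

definition norm_l2seq :: "'a l2seq \<Rightarrow> real" where "norm_l2seq x = sqrt (inner x x)"

definition sgn_l2seq :: "'a l2seq \<Rightarrow> 'a l2seq" where "sgn_l2seq x = scaleR (inverse (norm x)) x"

definition dist_l2seq :: "'a l2seq \<Rightarrow> 'a l2seq \<Rightarrow> real" where "dist_l2seq x y = norm (x - y)"

definition uniformity_l2seq :: "('a l2seq \<times> 'a l2seq) filter" where
  "uniformity_l2seq = (INF e\<in>{0<..}. principal {(x, y). dist x y < e})"

definition open_l2seq :: "'a l2seq set \<Rightarrow> bool" where
  "open_l2seq U \<longleftrightarrow> (\<forall>x\<in>U. eventually (\<lambda>(x', y). x' = x \<longrightarrow> y \<in> U) uniformity)"

lemma trf_id_sums:
  assumes "sqsum f" "sqsum g"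
  shows "(\<lambda>n. cinner (f n) (g n)) sums trf f g (\<lambda>x. x)"
  using trf_sums(2)[OF cblinear_id assms] .

lemma trf_id_same:
  assumes "sqsum f"
  shows "trf f f (\<lambda>x. x) = of_real (sqnorm f)"
proof -
  have "(\<lambda>n. complex_of_real ((norm (f n))\<^sup>2)) sums of_real (sqnorm f)"
    unfolding sqnorm_def by (rule sums_of_real[OF summable_sums[OF assms[unfolded sqsum_def]]])
  then show ?thesis using sums_unique2[OF trf_id_sums[OF assms assms]] by (simp add: cinner_same)
qed

lemma l2seq_inner_same: "inner x x = sqnorm (Rep_l2seq x)" for x :: "'a l2seq"
  by (simp add: inner_l2seq.rep_eq trf_id_same)

lemma trf_id_commute:
  assumes "sqsum f" "sqsum g"
  shows "trf f g (\<lambda>x. x) = cnj (trf g f (\<lambda>x. x))"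
proof -
  have "(\<lambda>n. cnj (cinner (g n) (f n))) sums cnj (trf g f (\<lambda>x. x))"
    using trf_id_sums[OF assms(2,1)] by (simp add: sums_cnj)
  then show ?thesis using sums_unique2[OF trf_id_sums[OF assms]] by (simp add: cinner_commute[symmetric])
qed

lemma trf_id_add:
  assumes "sqsum f" "sqsum g" "sqsum h"
  shows "trf (\<lambda>n. f n + g n) h (\<lambda>x. x) = trf f h (\<lambda>x. x) + trf g h (\<lambda>x. x)"
  using sums_add[OF trf_id_sums[OF assms(1,3)] trf_id_sums[OF assms(2,3)]]
    sums_unique2[OF trf_id_sums[OF sqsum_add[OF assms(1,2)] assms(3)]] by (simp add: cinner_add_left)

lemma trf_id_scale:
  assumes "sqsum f" "sqsum h"
  shows "trf (\<lambda>n. c *\<^sub>C f n) h (\<lambda>x. x) = c * trf f h (\<lambda>x. x)"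
  using trf_scaleC[OF cblinear_id assms, of c 1] by simp

lemma norm_le_sqnorm:
  assumes "sqsum f"
  shows "(norm (f n))\<^sup>2 \<le> sqnorm f" "(\<Sum>n<N. (norm (f n))\<^sup>2) \<le> sqnorm f"
proof -
  have s: "(\<Sum>n\<in>I. (norm (f n))\<^sup>2) \<le> sqnorm f" if "finite I" for I
    unfolding sqnorm_def by (rule sum_le_suminf[OF assms[unfolded sqsum_def] that]) simp
  show "(norm (f n))\<^sup>2 \<le> sqnorm f" using s[of "{n}"] by simp
  show "(\<Sum>n<N. (norm (f n))\<^sup>2) \<le> sqnorm f" by (rule s) simp
qed

instance
proof
  fix x y z :: "'a l2seq" and a b :: real and U :: "'a l2seq set"
  note eqI = Rep_l2seq_inject[THEN iffD1, OF ext]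
  note rep = plus_l2seq.rep_eq zero_l2seq.rep_eq scaleR_l2seq.rep_eq uminus_l2seq.rep_eq
  show "x + y + z = x + (y + z)" by (rule eqI) (simp add: rep add.assoc)
  show "x + y = y + x" by (rule eqI) (simp add: rep add.commute)
  show "0 + x = x" by (rule eqI) (simp add: rep)
  show "- x + x = 0" by (rule eqI) (simp add: rep scaleC_minus_one)
  show "x - y = x + - y" by (rule minus_l2seq_def)
  show "a *\<^sub>R (x + y) = a *\<^sub>R x + a *\<^sub>R y" by (rule eqI) (simp add: rep scaleC_add_right)
  show "(a + b) *\<^sub>R x = a *\<^sub>R x + b *\<^sub>R x" by (rule eqI) (simp add: rep scaleC_add_left)
  show "a *\<^sub>R b *\<^sub>R x = (a * b) *\<^sub>R x" by (rule eqI) (simp add: rep scaleC_scaleC)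
  show "1 *\<^sub>R x = x" by (rule eqI) (simp add: rep)
  show "sgn x = inverse (norm x) *\<^sub>R x" by (rule sgn_l2seq_def)
  show "dist x y = norm (x - y)" by (rule dist_l2seq_def)
  show "(uniformity :: ('a l2seq \<times> 'a l2seq) filter) = (INF e\<in>{0<..}. principal {(x, y). dist x y < e})"
    by (rule uniformity_l2seq_def)
  show "open U = (\<forall>x\<in>U. eventually (\<lambda>(x', y). x' = x \<longrightarrow> y \<in> U) uniformity)" by (rule open_l2seq_def)
  show "inner x y = inner y x"
    using trf_id_commute[of "Rep_l2seq x" "Rep_l2seq y"] by (simp add: inner_l2seq.rep_eq)
  show "inner (x + y) z = inner x z + inner y z"
    by (simp add: inner_l2seq.rep_eq plus_l2seq.rep_eq trf_id_add)
  show "inner (a *\<^sub>R x) y = a * inner x y"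
    by (simp add: inner_l2seq.rep_eq scaleR_l2seq.rep_eq trf_id_scale)
  show "0 \<le> inner x x" unfolding l2seq_inner_same by (rule sqnorm_nonneg) simp
  show "inner x x = 0 \<longleftrightarrow> x = 0"
  proof
    assume "inner x x = 0"
    then have "(norm (Rep_l2seq x n))\<^sup>2 \<le> 0" for n
      using norm_le_sqnorm(1)[OF sqsum_Rep, of x n] unfolding l2seq_inner_same by simp
    then show "x = 0" by (intro eqI) (simp add: rep)
  next
    assume "x = 0"
    then show "inner x x = 0" by (simp add: l2seq_inner_same rep sqnorm_def)
  qed
  show "norm x = sqrt (inner x x)" by (rule norm_l2seq_def)
qed

end

lemma l2seq_norm: "(norm x)\<^sup>2 = sqnorm (Rep_l2seq x)"
  unfolding power2_norm_eq_inner by (rule l2seq_inner_same)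

lemma Rep_l2seq_diff: "Rep_l2seq (x - y) n = Rep_l2seq x n - Rep_l2seq y n"
  unfolding minus_l2seq_def plus_l2seq.rep_eq uminus_l2seq.rep_eq by (simp add: scaleC_minus_one)

instantiation l2seq :: (chilbert_space) chilbert_space
begin

lift_definition scaleC_l2seq :: "complex \<Rightarrow> 'a l2seq \<Rightarrow> 'a l2seq" is "\<lambda>c f n. c *\<^sub>C f n" by (rule sqsum_scaleC(1))

lift_definition cinner_l2seq :: "'a l2seq \<Rightarrow> 'a l2seq \<Rightarrow> complex" is "\<lambda>f g. trf f g (\<lambda>x. x)" .

instance
proof
  fix X :: "nat \<Rightarrow> 'a l2seq"
  assume X: "Cauchy X"
  let ?r = "\<lambda>m n. Rep_l2seq (X m) n"
  have comp: "norm (?r m n - ?r k n) \<le> norm (X m - X k)" for m k n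
    by (rule power2_le_imp_le)
       (use norm_le_sqnorm(1)[OF sqsum_Rep, of "X m - X k" n] in \<open>simp_all add: l2seq_norm Rep_l2seq_diff\<close>)
  have "Cauchy (\<lambda>m. ?r m n)" for n
  proof (rule metric_CauchyI)
    fix e :: real assume "e > 0"
    then obtain M where "\<forall>m\<ge>M. \<forall>k\<ge>M. dist (X m) (X k) < e" using metric_CauchyD[OF X] by blast
    then show "\<exists>M. \<forall>m\<ge>M. \<forall>k\<ge>M. dist (?r m n) (?r k n) < e"
      using le_less_trans[OF comp] unfolding dist_norm by blast
  qed
  then have "\<exists>l. (\<lambda>m. ?r m n) \<longlonglongrightarrow> l" for n using Cauchy_convergent convergent_def by blast
  then obtain L where L: "\<And>n. (\<lambda>m. ?r m n) \<longlonglongrightarrow> L n" by metis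
  \<comment> \<open>The Cauchy estimate is uniform over finite partial sums, and in those the second
    index may tend to infinity coordinatewise.\<close>
  have near: "\<exists>M. \<forall>m\<ge>M. \<forall>N. (\<Sum>n<N. (norm (?r m n - L n))\<^sup>2) \<le> e\<^sup>2" if e: "e > 0" for e :: real
  proof -
    obtain M where M: "\<And>m k. m \<ge> M \<Longrightarrow> k \<ge> M \<Longrightarrow> dist (X m) (X k) < e" using metric_CauchyD[OF X e] by blast
    have "(\<Sum>n<N. (norm (?r m n - L n))\<^sup>2) \<le> e\<^sup>2" if m: "m \<ge> M" for m N
    proof (rule LIMSEQ_le_const2)
      show "(\<lambda>k. \<Sum>n<N. (norm (?r m n - ?r k n))\<^sup>2) \<longlonglongrightarrow> (\<Sum>n<N. (norm (?r m n - L n))\<^sup>2)"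
        by (intro tendsto_intros L)
      have "(\<Sum>n<N. (norm (?r m n - ?r k n))\<^sup>2) \<le> e\<^sup>2" if "k \<ge> M" for k
      proof -
        have "(\<Sum>n<N. (norm (?r m n - ?r k n))\<^sup>2) \<le> (norm (X m - X k))\<^sup>2"
          using norm_le_sqnorm(2)[OF sqsum_Rep, of "X m - X k" N] by (simp add: Rep_l2seq_diff l2seq_norm)
        also have "\<dots> \<le> e\<^sup>2" using M[OF m that] by (intro power_mono) (auto simp: dist_norm)
        finally show ?thesis .
      qed
      then show "\<exists>K. \<forall>k\<ge>K. (\<Sum>n<N. (norm (?r m n - ?r k n))\<^sup>2) \<le> e\<^sup>2" by blast
    qed
    then show ?thesis by blast
  qed
  have sq: "sqsum f" if "\<And>N. (\<Sum>n<N. (norm (f n))\<^sup>2) \<le> B" for f :: "nat \<Rightarrow> 'a" and B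
    unfolding sqsum_def by (rule summableI_nonneg_bounded[OF _ that]) simp
  obtain M1 where M1: "\<And>N. (\<Sum>n<N. (norm (?r M1 n - L n))\<^sup>2) \<le> 1\<^sup>2"
    using near[of 1] by (metis le_refl zero_less_one)
  have "sqsum (\<lambda>n. (-1) *\<^sub>C (?r M1 n - L n))" by (rule sqsum_scaleC(1)[OF sq[OF M1]])
  from sqsum_add[OF sqsum_Rep[of "X M1"] this] have Ls: "sqsum L" by (simp add: scaleC_minus_one)
  have "X \<longlonglongrightarrow> Abs_l2seq L"
  proof (rule metric_LIMSEQ_I)
    fix e :: real assume e: "e > 0"
    obtain M where M: "\<And>m N. m \<ge> M \<Longrightarrow> (\<Sum>n<N. (norm (?r m n - L n))\<^sup>2) \<le> (e/2)\<^sup>2"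
      using near[of "e/2"] half_gt_zero[OF e] by blast
    have "dist (X m) (Abs_l2seq L) < e" if m: "m \<ge> M" for m
    proof -
      have r: "Rep_l2seq (X m - Abs_l2seq L) n = ?r m n - L n" for n
        using Ls by (simp add: Rep_l2seq_diff Abs_l2seq_inverse)
      have "(norm (X m - Abs_l2seq L))\<^sup>2 \<le> (e/2)\<^sup>2"
        unfolding l2seq_norm sqnorm_def r
      proof (rule suminf_le_const)
        show "summable (\<lambda>n. (norm (?r m n - L n))\<^sup>2)" using sq[OF M[OF m]] unfolding sqsum_def .
      qed (rule M[OF m])
      then have "norm (X m - Abs_l2seq L) \<le> e / 2" by (rule power2_le_imp_le) (use e in simp)
      then show ?thesis using e unfolding dist_norm by linarith
    qed
    then show "\<exists>M. \<forall>m\<ge>M. dist (X m) (Abs_l2seq L) < e" by blast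
  qed
  then show "convergent X" unfolding convergent_def by blast
next
  fix x y z :: "'a l2seq" and a :: real and c d :: complex
  note eqI = Rep_l2seq_inject[THEN iffD1, OF ext]
  note rep = plus_l2seq.rep_eq scaleC_l2seq.rep_eq scaleR_l2seq.rep_eq
  show "c *\<^sub>C (x + y) = c *\<^sub>C x + c *\<^sub>C y" by (rule eqI) (simp only: rep scaleC_add_right)
  show "(c + d) *\<^sub>C x = c *\<^sub>C x + d *\<^sub>C x" by (rule eqI) (simp only: rep scaleC_add_left)
  show "c *\<^sub>C d *\<^sub>C x = (c * d) *\<^sub>C x" by (rule eqI) (simp only: rep scaleC_scaleC)
  show "complex_of_real a *\<^sub>C x = a *\<^sub>R x" by (rule eqI) (simp only: rep)
  show "cinner x y = cnj (cinner y x)" unfolding cinner_l2seq.rep_eq by (rule trf_id_commute) simp_all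
  show "cinner (x + y) z = cinner x z + cinner y z"
    by (simp add: cinner_l2seq.rep_eq plus_l2seq.rep_eq trf_id_add)
  show "cinner (c *\<^sub>C x) y = c * cinner x y"
    by (simp add: cinner_l2seq.rep_eq scaleC_l2seq.rep_eq trf_id_scale)
  show "inner x y = Re (cinner x y)" by (simp add: inner_l2seq.rep_eq cinner_l2seq.rep_eq)
qed

end

section \<open>Amplification of operators to the countable multiple\<close>

definition amp :: "'a::chilbert_space op \<Rightarrow> 'a l2seq op" where
  "amp t x = Abs_l2seq (\<lambda>n. t (Rep_l2seq x n))"

lemma sqsum_op:
  assumes t: "cblinear t" and f: "sqsum f"
  shows "sqsum (\<lambda>n. t (f n))"
  unfolding sqsum_def
proof (rule summable_comparison_test[OF _ summable_mult[OF f[unfolded sqsum_def], of "(onorm t)\<^sup>2"]], intro exI allI impI)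
  fix n
  have "(norm (t (f n)))\<^sup>2 \<le> (onorm t * norm (f n))\<^sup>2" by (rule power_mono[OF cblinear_norm_le[OF t]]) simp
  then show "norm ((norm (t (f n)))\<^sup>2) \<le> (onorm t)\<^sup>2 * (norm (f n))\<^sup>2" by (simp add: power_mult_distrib)
qed

lemma Rep_amp:
  assumes "cblinear t"
  shows "Rep_l2seq (amp t x) n = t (Rep_l2seq x n)"
  unfolding amp_def using Abs_l2seq_inverse[of "\<lambda>n. t (Rep_l2seq x n)"] sqsum_op[OF assms sqsum_Rep[of x]] by simp

text \<open>An infinite sum of vector functionals becomes a single vector functional of the
  amplification, which gives the normal extension the vectors \<open>Z\<close> and
  \<open>E\<close>.\<close>

lemma cinner_amp: "cblinear t \<Longrightarrow> cinner (amp t x) y = trf (Rep_l2seq x) (Rep_l2seq y) t"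
  unfolding cinner_l2seq.rep_eq trf_def by (simp add: Rep_amp)

lemma cinner_amp_adj:
  assumes "t \<in> bounded_ops"
  shows "cinner (amp t x) y = cinner x (amp (adj t) y)"
  unfolding cinner_l2seq.rep_eq trf_def
  using assms adj_exists(1)[OF assms] by (simp add: Rep_amp bounded_ops_iff adj_exists(2)[OF assms])

text \<open>The bound \<open>C\<close> is kept general so that it can be \<open>onorm t\<close> when
  the amplified operator is \<open>t \<otimes> 1\<close>.\<close>

lemma norm_amp_le:
  assumes t: "cblinear t" and C: "C \<ge> 0" "\<And>v. norm (t v) \<le> C * norm v"
  shows "norm (amp t x) \<le> C * norm x"
proof (rule power2_le_imp_le)
  have s: "summable (\<lambda>n. (norm (Rep_l2seq x n))\<^sup>2)" "summable (\<lambda>n. (norm (Rep_l2seq (amp t x) n))\<^sup>2)"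
    using sqsum_Rep unfolding sqsum_def by auto
  have "sqnorm (Rep_l2seq (amp t x)) \<le> (\<Sum>n. C\<^sup>2 * (norm (Rep_l2seq x n))\<^sup>2)"
    unfolding sqnorm_def
  proof (rule suminf_le[OF _ s(2) summable_mult[OF s(1)]])
    fix n
    have "(norm (t (Rep_l2seq x n)))\<^sup>2 \<le> (C * norm (Rep_l2seq x n))\<^sup>2" by (rule power_mono[OF C(2)]) simp
    then show "(norm (Rep_l2seq (amp t x) n))\<^sup>2 \<le> C\<^sup>2 * (norm (Rep_l2seq x n))\<^sup>2" by (simp add: Rep_amp[OF t] power_mult_distrib)
  qed
  also have "\<dots> = C\<^sup>2 * sqnorm (Rep_l2seq x)" unfolding sqnorm_def by (rule suminf_mult[OF s(1)])
  finally show "(norm (amp t x))\<^sup>2 \<le> (C * norm x)\<^sup>2" unfolding power_mult_distrib l2seq_norm .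
qed (use C in simp)

lemma cblinear_amp:
  assumes t: "cblinear t"
  shows "cblinear (amp t)"
proof (rule cblinearI)
  note eqI = Rep_l2seq_inject[THEN iffD1, OF ext]
  show "amp t (x + y) = amp t x + amp t y" for x y
    by (rule eqI) (simp add: Rep_amp[OF t] plus_l2seq.rep_eq cblinear_simps(1)[OF t])
  show "amp t (c *\<^sub>C x) = c *\<^sub>C amp t x" for c x
    by (rule eqI) (simp add: Rep_amp[OF t] scaleC_l2seq.rep_eq cblinear_simps(5)[OF t])
  show "norm (amp t x) \<le> norm x * onorm t" for x
    using norm_amp_le[OF t onorm_nonneg[OF t] cblinear_norm_le[OF t], of x] by (simp add: mult.commute)
qed

lemma amp_compose:
  assumes "cblinear s" "cblinear t"
  shows "amp (s \<circ> t) x = amp s (amp t x)"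
proof (rule Rep_l2seq_inject[THEN iffD1, OF ext])
  have "cblinear (s \<circ> t)" unfolding comp_def by (rule cblinear_compose[OF assms])
  then show "Rep_l2seq (amp (s \<circ> t) x) n = Rep_l2seq (amp s (amp t x)) n" for n by (simp add: Rep_amp assms)
qed

subsection \<open>A normally extending vector form makes the factor injective\<close>

lemma op_tensor_compose:
  assumes "a \<in> bounded_ops" "b \<in> bounded_ops" "c \<in> bounded_ops" "d \<in> bounded_ops"
  shows "op_tensor a b \<circ> op_tensor c d = op_tensor (a \<circ> c) (b \<circ> d)"
proof (rule cblinear_eq_on_tensors)
  have ac: "a \<circ> c \<in> bounded_ops" and bd: "b \<circ> d \<in> bounded_ops"
    using assms unfolding bounded_ops_iff comp_def by (simp_all add: cblinear_compose)
  show "cblinear (op_tensor a b \<circ> op_tensor c d)"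
    unfolding comp_def using op_tensor(1)[OF assms(1,2)] op_tensor(1)[OF assms(3,4)]
    by (simp add: cblinear_compose bounded_ops_iff)
  show "cblinear (op_tensor (a \<circ> c) (b \<circ> d))" using op_tensor(1)[OF ac bd] by (simp add: bounded_ops_iff)
  show "(op_tensor a b \<circ> op_tensor c d) (x \<otimes>\<^sub>h y) = op_tensor (a \<circ> c) (b \<circ> d) (x \<otimes>\<^sub>h y)" for x y
    by (simp add: op_tensor(2)[OF assms(1,2)] op_tensor(2)[OF assms(3,4)] op_tensor(2)[OF ac bd])
qed

lemma commutant_compose: "a \<in> commutant S \<Longrightarrow> b \<in> commutant S \<Longrightarrow> a \<circ> b \<in> commutant S"
  unfolding commutant_def bounded_ops_iff by (auto simp: fun_eq_iff comp_def cblinear_compose)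

lemma adj_adj: "a \<in> bounded_ops \<Longrightarrow> adj (adj a) = a"
  by (rule ext, rule cinner_ext) (simp only: adj_exists(3)[OF adj_exists(1)] adj_exists(2))

lemma commutant_adj:
  assumes S: "S \<subseteq> bounded_ops" "\<And>a. a \<in> S \<Longrightarrow> adj a \<in> S" and y: "y \<in> commutant S"
  shows "adj y \<in> commutant S"
proof -
  have yb: "y \<in> bounded_ops" and yc: "\<And>x v. x \<in> S \<Longrightarrow> x (y v) = y (x v)"
    using y unfolding commutant_def by (auto simp: fun_eq_iff)
  have "x (adj y v) = adj y (x v)" if "x \<in> S" for x v
  proof (rule cinner_ext)
    fix w
    have xb: "x \<in> bounded_ops" using S(1) that by blast
    show "cinner (x (adj y v)) w = cinner (adj y (x v)) w"
      unfolding adj_exists(2)[OF xb] adj_exists(3)[OF yb] yc[OF S(2)[OF that], symmetric] ..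
  qed
  then show ?thesis unfolding commutant_def using adj_exists(1)[OF yb] by (auto simp: fun_eq_iff)
qed

text \<open>The triples \<open>(a Z, a E, \<pi>(a) \<xi>)\<close> for \<open>a\<close> in the algebraic tensor product of \<open>M\<close> and \<open>N\<close>, where
  \<open>\<pi>(x \<otimes> y) = x y\<close>.\<close>

inductive_set orbit :: "'h::chilbert_space op set \<Rightarrow> 'h op set \<Rightarrow> ('h, 'h) htensor l2seq \<Rightarrow> ('h, 'h) htensor l2seq
    \<Rightarrow> 'h \<Rightarrow> (('h, 'h) htensor l2seq \<times> ('h, 'h) htensor l2seq \<times> 'h) set"
  for M N Z E \<xi> where
  base: "x \<in> M \<Longrightarrow> y \<in> N \<Longrightarrow> (amp (op_tensor x y) Z, amp (op_tensor x y) E, x (y \<xi>)) \<in> orbit M N Z E \<xi>"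
| zero: "(0, 0, 0) \<in> orbit M N Z E \<xi>"
| add: "(d, e, w) \<in> orbit M N Z E \<xi> \<Longrightarrow> (d', e', w') \<in> orbit M N Z E \<xi> \<Longrightarrow> (d + d', e + e', w + w') \<in> orbit M N Z E \<xi>"
| scale: "(d, e, w) \<in> orbit M N Z E \<xi> \<Longrightarrow> (c *\<^sub>C d, c *\<^sub>C e, c *\<^sub>C w) \<in> orbit M N Z E \<xi>"

text \<open>Polarization enters as \<open>\<parallel>\<pi>(a) \<xi>\<parallel>\<^sup>2 = Re \<langle>a Z, a E\<rangle> \<le> \<parallel>a (Z + E)\<parallel>\<^sup>2\<close>.\<close>

lemma injective_if_extends_normally:
  fixes M N :: "'h::chilbert_space op set"
  assumes M: "op_subspace M" "commutant (commutant M) = M" "id \<in> M" "\<And>a. a \<in> M \<Longrightarrow> adj a \<in> M"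
    and N: "N = commutant M" and fac: "M \<inter> N = range (\<lambda>c. op_scale c id)"
    and x1: "norm \<xi> = 1" and en: "extends_normally M N (vector_form M N \<xi>)"
  shows "injective_vna M"
proof -
  have Mb: "M \<subseteq> bounded_ops" using M(1) unfolding op_subspace_def by blast
  have Ns: "op_subspace N" unfolding N by (rule op_subspace_commutant[OF Mb])
  have Nb: "N \<subseteq> bounded_ops" using Ns unfolding op_subspace_def by blast
  have comm: "x (y v) = y (x v)" if "x \<in> M" "y \<in> N" for x y v
    using that unfolding N commutant_def by (auto simp: fun_eq_iff)
  have idN: "id \<in> N" unfolding N commutant_def using id_bounded_op by auto
  have NM: "commutant N = M" unfolding N by (rule M(2))
  have Nadj: "adj y \<in> N" if "y \<in> N" for y using commutant_adj[OF Mb M(4)] that unfolding N by blast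
  have Mcomp: "a \<circ> b \<in> M" if "a \<in> M" "b \<in> M" for a b using commutant_compose[of a N b] that unfolding NM by blast
  have Ncomp: "a \<circ> b \<in> N" if "a \<in> N" "b \<in> N" for a b using commutant_compose[of a M b] that unfolding N by blast
  have tb: "op_tensor x y \<in> bounded_ops" if "x \<in> M" "y \<in> N" for x y using op_tensor(1) that Mb Nb by blast
  note tl = tb[unfolded bounded_ops_iff]
  note K = vn_tensor_facts[OF Mb Nb]
  obtain \<omega> where \<omega>: "\<omega> \<in> predual (vn_tensor M N)" "\<And>x y. x \<in> M \<Longrightarrow> y \<in> N \<Longrightarrow> \<omega> (op_tensor x y) = vector_form M N \<xi> x y"
    using en unfolding extends_normally_def by blast
  obtain \<zeta> \<eta> where r: "sqsum \<zeta>" "sqsum \<eta>" "\<And>a. a \<in> vn_tensor M N \<Longrightarrow> \<omega> a = trf \<zeta> \<eta> a"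
    using \<omega>(1) predual_iff[OF K(1)] unfolding normal_rep_def by blast
  define Z where "Z = Abs_l2seq \<zeta>"
  define E where "E = Abs_l2seq \<eta>"
  have RZ: "Rep_l2seq Z = \<zeta>" "Rep_l2seq E = \<eta>" using r(1,2) by (simp_all add: Z_def E_def Abs_l2seq_inverse)
  have form: "cinner (amp (op_tensor x y) Z) E = cinner (x (y \<xi>)) \<xi>" if "x \<in> M" "y \<in> N" for x y
    unfolding cinner_amp[OF tl[OF that]] RZ r(3)[OF K(3)[OF that], symmetric] \<omega>(2)[OF that]
    using that by (simp add: vector_form_def)
  let ?G = "orbit M N Z E \<xi>"
  \<comment> \<open>As \<open>M\<close> and \<open>N\<close> commute, the inner product is the
    vector form at \<open>adj x' \<circ> x\<close> and \<open>adj y' \<circ> y\<close>. The form is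
    known there through \<open>Z\<close> and \<open>E\<close>, and the adjoints then move over to
    \<open>E\<close>.\<close>
  have basepair: "cinner (x (y \<xi>)) (x' (y' \<xi>)) = cinner (amp (op_tensor x y) Z) (amp (op_tensor x' y') E)"
    if xy: "x \<in> M" "y \<in> N" and xy': "x' \<in> M" "y' \<in> N" for x y x' y'
  proof -
    have b: "x \<in> bounded_ops" "y \<in> bounded_ops" "x' \<in> bounded_ops" "y' \<in> bounded_ops" using that Mb Nb by auto
    note a = adj_exists(1)[OF b(3)] adj_exists(1)[OF b(4)]
    have "cinner (x (y \<xi>)) (x' (y' \<xi>)) = cinner (adj y' (adj x' (x (y \<xi>)))) \<xi>"
      by (simp add: adj_exists(3)[OF b(3)] adj_exists(3)[OF b(4)])
    also have "adj y' (adj x' (x (y \<xi>))) = (adj x' \<circ> x) ((adj y' \<circ> y) \<xi>)"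
      using comm[OF Mcomp[OF M(4)[OF xy'(1)] xy(1)] Nadj[OF xy'(2)], of "y \<xi>"] by simp
    also have "cinner \<dots> \<xi> = cinner (amp (op_tensor (adj x' \<circ> x) (adj y' \<circ> y)) Z) E"
      by (rule form[OF Mcomp[OF M(4)[OF xy'(1)] xy(1)] Ncomp[OF Nadj[OF xy'(2)] xy(2)], symmetric])
    also have "\<dots> = cinner (amp (op_tensor (adj x') (adj y')) (amp (op_tensor x y) Z)) E"
      unfolding op_tensor_compose[OF a b(1,2), symmetric]
        amp_compose[OF op_tensor(1)[OF a, unfolded bounded_ops_iff] op_tensor(1)[OF b(1,2), unfolded bounded_ops_iff]] ..
    also have "\<dots> = cinner (amp (op_tensor x y) Z) (amp (op_tensor x' y') E)"
    proof -
      have "adj (op_tensor (adj x') (adj y')) = op_tensor x' y'"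
      proof (rule ext, rule cinner_ext)
        fix v w show "cinner (adj (op_tensor (adj x') (adj y')) v) w = cinner (op_tensor x' y' v) w"
          unfolding adj_exists(3)[OF op_tensor(1)[OF a]] cinner_op_tensor_adj[OF b(3,4)] ..
      qed
      then show ?thesis using cinner_amp_adj[OF op_tensor(1)[OF a]] by simp
    qed
    finally show ?thesis .
  qed
  \<comment> \<open>Both sides are sesquilinear in the two orbit elements, so two nested inductions
    reduce the identity to \<open>basepair\<close>.\<close>
  have pair: "cinner w w' = cinner d e'" if "(d, e, w) \<in> ?G" "(d', e', w') \<in> ?G" for d e w d' e' w'
  proof -
    have half: "cinner (x (y \<xi>)) w' = cinner (amp (op_tensor x y) Z) e'" if xy: "x \<in> M" "y \<in> N" and g: "(d', e', w') \<in> ?G" for x y d' e' w'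
      using g
    proof (induction d' e' w' rule: orbit.induct)
      case (base x' y')
      then show ?case by (rule basepair[OF xy])
    qed (simp_all add: cinner_add_right cinner_scaleC_right)
    show ?thesis using that(1)
    proof (induction d e w rule: orbit.induct)
      case (base x y)
      then show ?case using half that(2) by blast
    qed (simp_all add: cinner_add_left cinner_scaleC_left)
  qed
  have inv: "(amp (op_tensor x y) d, amp (op_tensor x y) e, x (y w)) \<in> ?G" if xy: "x \<in> M" "y \<in> N" and g: "(d, e, w) \<in> ?G" for x y d e w
    using g
  proof (induction d e w rule: orbit.induct)
    case (base x' y')
    have b: "x \<in> bounded_ops" "y \<in> bounded_ops" "x' \<in> bounded_ops" "y' \<in> bounded_ops" using xy base Mb Nb by auto
    have e: "amp (op_tensor x y) (amp (op_tensor x' y') k) = amp (op_tensor (x \<circ> x') (y \<circ> y')) k" for k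
      unfolding op_tensor_compose[OF b, symmetric] amp_compose[OF tl[OF xy] tl[OF base]] ..
    have "x (y (x' (y' \<xi>))) = (x \<circ> x') ((y \<circ> y') \<xi>)" using comm[OF base(1) xy(2), of "y' \<xi>"] by simp
    then show ?case unfolding e using orbit.base[OF Mcomp[OF xy(1) base(1)] Ncomp[OF xy(2) base(2)]] by metis
  next
    case zero
    have l: "cblinear x" "cblinear y" using xy Mb Nb bounded_ops_iff by auto
    show ?case
      using orbit.zero by (simp add: cblinear_simps(4)[OF cblinear_amp[OF tl[OF xy]]] cblinear_simps(4)[OF l(1)] cblinear_simps(4)[OF l(2)])
  next
    case (add d e w d' e' w')
    have l: "cblinear x" "cblinear y" using xy Mb Nb bounded_ops_iff by auto
    show ?case
      using orbit.add[OF add.IH] by (simp add: cblinear_simps(1)[OF cblinear_amp[OF tl[OF xy]]] cblinear_simps(1)[OF l(1)] cblinear_simps(1)[OF l(2)])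
  next
    case (scale d e w c)
    have l: "cblinear x" "cblinear y" using xy Mb Nb bounded_ops_iff by auto
    show ?case
      using orbit.scale[OF scale.IH] by (simp add: cblinear_simps(5)[OF cblinear_amp[OF tl[OF xy]]] cblinear_simps(5)[OF l(1)] cblinear_simps(5)[OF l(2)])
  qed
  \<comment> \<open>As \<open>d\<close> and \<open>e\<close> come from the same \<open>a\<close>,
    their sum is \<open>a (Z + E)\<close>; this is the relation sending \<open>a (Z + E)\<close> to
    \<open>\<pi>(a) \<xi>\<close>, with \<open>Z + E\<close> as the vector
    \<open>\<chi>\<close>.\<close>
  define R where "R = {(d + e, w) |d e w. (d, e, w) \<in> ?G}"
  have Radd: "(s + s', w + w') \<in> R" if ss: "(s, w) \<in> R" "(s', w') \<in> R" for s w s' w'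
  proof -
    obtain d e d' e' where g: "(d, e, w) \<in> ?G" "(d', e', w') \<in> ?G" and s: "s = d + e" "s' = d' + e'"
      using ss unfolding R_def by blast
    have "s + s' = (d + d') + (e + e')" unfolding s by (simp add: algebra_simps)
    then show ?thesis unfolding R_def using orbit.add[OF g] by blast
  qed
  have Rsc: "(c *\<^sub>C s, c *\<^sub>C w) \<in> R" if sw: "(s, w) \<in> R" for c s w
  proof -
    obtain d e where g: "(d, e, w) \<in> ?G" and s: "s = d + e" using sw unfolding R_def by blast
    show ?thesis unfolding R_def s scaleC_add_right using orbit.scale[OF g] by blast
  qed
  have R0: "(0, 0) \<in> R"
  proof -
    have "(0 + 0, 0) \<in> R" unfolding R_def using orbit.zero by blast
    then show ?thesis by simp
  qed
  have Rbd: "norm w \<le> 1 * norm s" if sw: "(s, w) \<in> R" for s w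
  proof -
    obtain d e where g: "(d, e, w) \<in> ?G" and s: "s = d + e" using sw unfolding R_def by blast
    have "(norm w)\<^sup>2 = inner d e" using pair[OF g g] by (simp add: power2_norm_eq_inner inner_eq_Re_cinner)
    also have "\<dots> \<le> (norm (d + e))\<^sup>2"
    proof -
      \<comment> \<open>The difference of the two sides is half of the sum of the squared norms of
        \<open>d + e\<close>, \<open>d\<close> and \<open>e\<close>.\<close>
      have "0 \<le> inner d d + inner e e + inner d e + inner e d - inner d e"
      proof -
        have "0 \<le> inner (d + e) (d + e) + inner d d + inner e e" by simp
        then show ?thesis by (simp add: inner_add_left inner_add_right inner_commute)
      qed
      then show ?thesis by (simp add: power2_norm_eq_inner inner_add_left inner_add_right)
    qed
    finally have "norm w \<le> norm (d + e)" by (rule power2_le_imp_le) simp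
    then show ?thesis unfolding s mult_1 .
  qed
  have "\<exists>T. cblinear T \<and> (\<forall>v. T v \<in> closure (fst ` R)) \<and> (\<forall>s w v. (s, w) \<in> R \<longrightarrow> cinner s (T v) = cinner w v)"
  proof (rule relation_adjoint[of R 1])
    fix T assume "cblinear T" "\<And>v. T v \<in> closure (fst ` R)" "\<And>s w v. (s, w) \<in> R \<Longrightarrow> cinner s (T v) = cinner w v"
    then show ?thesis by (intro exI[of _ T] conjI allI impI)
  qed (fact R0 Radd Rsc Rbd zero_le_one)+
  then obtain T where T: "cblinear T" "\<And>v. T v \<in> closure (fst ` R)" "\<And>s w v. (s, w) \<in> R \<Longrightarrow> cinner s (T v) = cinner w v"
    by (elim exE conjE) simp
  have dom: "\<And>s t. s \<in> fst ` R \<Longrightarrow> t \<in> fst ` R \<Longrightarrow> s + t \<in> fst ` R" "\<And>c s. s \<in> fst ` R \<Longrightarrow> c *\<^sub>C s \<in> fst ` R"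
  proof -
    fix s t assume "s \<in> fst ` R" "t \<in> fst ` R"
    then obtain w w' where "(s, w) \<in> R" "(t, w') \<in> R" by force
    from Radd[OF this] show "s + t \<in> fst ` R" by (rule image_eqI[rotated]) simp
  next
    fix c s assume "s \<in> fst ` R"
    then obtain w where "(s, w) \<in> R" by force
    from Rsc[OF this] show "c *\<^sub>C s \<in> fst ` R" by (rule image_eqI[rotated]) simp
  qed
  have Rinv: "(amp (op_tensor x y) s, x (y w)) \<in> R" if xy: "x \<in> M" "y \<in> N" and sw: "(s, w) \<in> R" for x y s w
  proof -
    obtain d e where g: "(d, e, w) \<in> ?G" and s: "s = d + e" using sw unfolding R_def by blast
    show ?thesis unfolding R_def s cblinear_simps(1)[OF cblinear_amp[OF tl[OF xy]]] using inv[OF xy g] by blast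
  qed
  have adjT: "cinner (amp (op_tensor x y) k) k' = cinner k (amp (op_tensor (adj x) (adj y)) k')"
    if xy: "x \<in> M" "y \<in> N" for x y k k'
  proof -
    have b: "x \<in> bounded_ops" "y \<in> bounded_ops" using xy Mb Nb by auto
    have "adj (op_tensor x y) = op_tensor (adj x) (adj y)"
    proof (rule ext, rule cinner_ext_right)
      fix v w show "cinner w (adj (op_tensor x y) v) = cinner w (op_tensor (adj x) (adj y) v)"
        unfolding adj_exists(2)[OF tb[OF xy], symmetric] cinner_op_tensor_adj[OF b] ..
    qed
    then show ?thesis using cinner_amp_adj[OF tb[OF xy]] by simp
  qed
  \<comment> \<open>The closed domain is invariant under the amplified \<open>x \<otimes> y\<close>,
    so both sides lie in it, and vectors there are determined by pairing with the domain, where the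
    adjoints of \<open>x\<close> and \<open>y\<close> can be moved onto \<open>R\<close>.\<close>
  have inter: "T (x (y v)) = amp (op_tensor x y) (T v)" if xy: "x \<in> M" "y \<in> N" for x y v
  proof (rule closure_subspace_unique)
    show "T (x (y v)) \<in> closure (fst ` R)" by (rule T(2))
    have "amp (op_tensor x y) ` closure (fst ` R) \<subseteq> closure (amp (op_tensor x y) ` (fst ` R))"
      by (rule closure_bounded_linear_image_subset[OF cblinear_bounded_linear[OF cblinear_amp[OF tl[OF xy]]]])
    also have "\<dots> \<subseteq> closure (fst ` R)" by (rule closure_mono) (use Rinv[OF xy] in force)
    finally show "amp (op_tensor x y) (T v) \<in> closure (fst ` R)" using T(2) by blast
    fix s assume "s \<in> fst ` R"
    then obtain w where sw: "(s, w) \<in> R" by force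
    have b: "x \<in> bounded_ops" "y \<in> bounded_ops" using xy Mb Nb by auto
    note xy' = M(4)[OF xy(1)] Nadj[OF xy(2)]
    have "cinner s (amp (op_tensor x y) (T v)) = cinner (amp (op_tensor (adj x) (adj y)) s) (T v)"
      unfolding adjT[OF xy'] adj_adj[OF b(1)] adj_adj[OF b(2)] ..
    also have "\<dots> = cinner (adj x (adj y w)) v" by (rule T(3)[OF Rinv[OF xy' sw]])
    also have "\<dots> = cinner w (x (y v))"
      unfolding comm[OF xy'] adj_exists(3)[OF b(2)] adj_exists(3)[OF b(1)] comm[OF xy] ..
    finally show "cinner s (T (x (y v))) = cinner s (amp (op_tensor x y) (T v))" unfolding T(3)[OF sw] by simp
  qed (fact dom)+
  have Tx: "T (x v) = amp (op_tensor x id) (T v)" if "x \<in> M" for x v using inter[OF that idN, of v] by simp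
  have Ty: "T (y v) = amp (op_tensor id y) (T v)" if "y \<in> N" for y v using inter[OF M(3) that, of v] by simp
  have nT: "norm (T v) \<le> onorm T * norm v" for v by (rule cblinear_norm_le[OF T(1)])
  have oT: "0 \<le> onorm T" by (rule onorm_nonneg[OF T(1)])
  \<comment> \<open>\<open>D\<close> is \<open>T^* T\<close>. Commuting with \<open>M\<close> and
    with \<open>N\<close>, it lies in \<open>N\<close> and in \<open>M\<close>, and the factor
    property makes it a scalar.\<close>
  obtain D where D: "cblinear D" "\<And>v w. cinner (D v) w = cinner (T v) (T w)"
  proof (rule sesquilinear_rep[of "\<lambda>v w. cinner (T v) (T w)" "onorm T * onorm T"])
    show "cmod (cinner (T v) (T w)) \<le> onorm T * onorm T * norm v * norm w" for v w
    proof -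
      have "cmod (cinner (T v) (T w)) \<le> norm (T v) * norm (T w)" by (rule norm_cinner_le)
      also have "\<dots> \<le> (onorm T * norm v) * (onorm T * norm w)" by (intro mult_mono nT) (simp_all add: oT)
      finally show ?thesis by (simp add: mult_ac)
    qed
  qed (use oT in \<open>auto simp: cblinear_simps(1)[OF T(1)] cblinear_simps(5)[OF T(1)] cinner_add_left cinner_add_right cinner_scaleC_left cinner_scaleC_right\<close>)
  have Db: "D \<in> bounded_ops" using D(1) by (simp add: bounded_ops_iff)
  have aid: "adj (id :: 'h op) = id" by (rule adj_id)
  have "x \<circ> D = D \<circ> x" if x: "x \<in> M" for x
  proof (rule ext, rule cinner_ext)
    fix v w
    have xb: "x \<in> bounded_ops" using x Mb by blast
    show "cinner ((x \<circ> D) v) w = cinner ((D \<circ> x) v) w"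
      unfolding comp_def adj_exists(2)[OF xb] D(2) Tx[OF x] Tx[OF M(4)[OF x]] adjT[OF x idN] aid ..
  qed
  then have "D \<in> N" unfolding N commutant_def using Db by blast
  moreover have "y \<circ> D = D \<circ> y" if y: "y \<in> N" for y
  proof (rule ext, rule cinner_ext)
    fix v w
    have yb: "y \<in> bounded_ops" using y Nb by blast
    show "cinner ((y \<circ> D) v) w = cinner ((D \<circ> y) v) w"
      unfolding comp_def adj_exists(2)[OF yb] D(2) Ty[OF y] Ty[OF Nadj[OF y]] adjT[OF M(3) y] aid ..
  qed
  then have "D \<in> M" unfolding NM[symmetric] commutant_def using Db by blast
  ultimately have "D \<in> range (\<lambda>c. op_scale c id)" using fac by blast
  then obtain c where c: "D = op_scale c id" by blast
  have Tc: "cinner (T v) (T w) = c * cinner v w" for v w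
    unfolding D(2)[symmetric] c by (simp add: op_scale_def cinner_scaleC_left)
  define q where "q = (norm (T \<xi>))\<^sup>2"
  have cq: "c = of_real q" using Tc[of \<xi> \<xi>] x1 by (simp add: q_def cinner_same)
  \<comment> \<open>\<open>Z + E\<close> corresponds to \<open>\<xi>\<close> under \<open>R\<close>,
    so its pairing with \<open>T \<xi>\<close> is the squared norm of the unit vector
    \<open>\<xi>\<close>.\<close>
  have "T \<xi> \<noteq> 0"
  proof
    assume z: "T \<xi> = 0"
    have "(amp (op_tensor id id) Z + amp (op_tensor id id) E, \<xi>) \<in> R"
      unfolding R_def using orbit.base[OF M(3) idN, of Z E \<xi>] by force
    from T(3)[OF this, of \<xi>] show False using x1 by (simp add: z cinner_same)
  qed
  then have q: "q > 0" by (simp add: q_def)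
  have Tn: "(norm (T v))\<^sup>2 = q * (norm v)\<^sup>2" for v
  proof -
    have "complex_of_real ((norm (T v))\<^sup>2) = of_real (q * (norm v)\<^sup>2)"
      using Tc[of v v] unfolding cq cinner_same by simp
    then show ?thesis using of_real_eq_iff by blast
  qed
  have Tn': "norm (T v) = sqrt q * norm v" for v
    using Tn[of v] q by (metis norm_ge_zero real_sqrt_mult real_sqrt_abs2 abs_of_nonneg real_sqrt_power real_sqrt_pow2_iff real_sqrt_unique)
  \<comment> \<open>\<open>F t\<close> is \<open>T^* (t \<otimes> 1) T / q\<close>, with
    \<open>q\<close> the scalar of \<open>T^* T\<close>.\<close>
  define P where "P t A \<longleftrightarrow> cblinear A \<and> (\<forall>v w. cinner (A v) w = cinner (amp (op_tensor t id) (T v)) (T w) / of_real q)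
     \<and> (\<forall>v. norm (A v) \<le> onorm t * norm v)" for t A
  define F where "F t = (SOME A. P t A)" for t
  have PF: "P t (F t)" if t: "t \<in> bounded_ops" for t
  proof -
    have tl': "cblinear (op_tensor t (id :: 'h op))" using op_tensor(1)[OF t id_bounded_op] by (simp add: bounded_ops_iff)
    have ot: "0 \<le> onorm t" using t onorm_nonneg bounded_ops_iff by blast
    note al = cblinear_amp[OF tl']
    obtain A where "cblinear A" "\<And>v w. cinner (A v) w = cinner (amp (op_tensor t id) (T v)) (T w) / of_real q"
      "\<And>v. norm (A v) \<le> onorm t * norm v"
    proof (rule sesquilinear_rep[of "\<lambda>v w. cinner (amp (op_tensor t id) (T v)) (T w) / of_real q" "onorm t"])
      show "cmod (cinner (amp (op_tensor t id) (T v)) (T w) / of_real q) \<le> onorm t * norm v * norm w" for v w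
      proof -
        have "cmod (cinner (amp (op_tensor t id) (T v)) (T w)) \<le> norm (amp (op_tensor t id) (T v)) * norm (T w)" by (rule norm_cinner_le)
        also have "\<dots> \<le> (onorm t * norm (T v)) * norm (T w)"
          by (rule mult_right_mono[OF norm_amp_le[OF tl' ot norm_op_tensor_id_le[OF t]]]) simp
        \<comment> \<open>\<open>T\<close> multiplies norms exactly by the square root of
          \<open>q\<close>, so the division by \<open>q\<close> leaves the constant
          \<open>onorm t\<close>.\<close>
        also have "\<dots> = onorm t * norm v * norm w * q" unfolding Tn' using q by simp
        finally show ?thesis using q by (simp add: norm_divide field_simps)
      qed
    qed (use ot in \<open>auto simp: cblinear_simps(1)[OF T(1)] cblinear_simps(5)[OF T(1)] cblinear_simps(1)[OF al] cblinear_simps(5)[OF al]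
          cinner_add_left cinner_add_right cinner_scaleC_left cinner_scaleC_right add_divide_distrib\<close>)
    then have "P t A" unfolding P_def by blast
    then show ?thesis unfolding F_def by (rule someI[where P = "P t"])
  qed
  then have F: "\<And>t. t \<in> bounded_ops \<Longrightarrow> F t \<in> bounded_ops" "\<And>t v w. t \<in> bounded_ops \<Longrightarrow> cinner (F t v) w = cinner (amp (op_tensor t id) (T v)) (T w) / of_real q"
    "\<And>t v. t \<in> bounded_ops \<Longrightarrow> norm (F t v) \<le> onorm t * norm v"
    unfolding P_def bounded_ops_iff by auto
  \<comment> \<open>In this form linearity of \<open>F\<close> follows from linearity of
    \<open>trf\<close> in the operator.\<close>
  have Ftr: "cinner (F t v) w = trf (Rep_l2seq (T v)) (Rep_l2seq (T w)) (op_tensor t id) / of_real q" if "t \<in> bounded_ops" for t v w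
    unfolding F(2)[OF that] by (subst cinner_amp) (use op_tensor(1)[OF that id_bounded_op] in \<open>auto simp: bounded_ops_iff\<close>)
  have trl: "op_linear bounded_ops (trf (Rep_l2seq k) (Rep_l2seq k'))" for k k' :: "('h, 'h) htensor l2seq"
    by (rule op_linear_trf) auto
  show ?thesis
    unfolding injective_vna_def
  proof (intro exI[of _ F] conjI ballI allI)
    fix a b :: "'h op" assume a: "a \<in> bounded_ops" and b: "b \<in> bounded_ops"
    have ab: "op_add a b \<in> bounded_ops" using cblinear_add a b unfolding op_add_def bounded_ops_iff by blast
    have e: "op_tensor (op_add a b) (id :: 'h op) = op_add (op_tensor a id) (op_tensor b id)"
    proof (rule cblinear_eq_on_tensors)
      show "cblinear (op_add (op_tensor a id) (op_tensor b (id :: 'h op)))"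
        unfolding op_add_def using cblinear_add op_tensor(1)[OF a id_bounded_op] op_tensor(1)[OF b id_bounded_op] unfolding bounded_ops_iff by blast
      show "op_tensor (op_add a b) id (x \<otimes>\<^sub>h y) = op_add (op_tensor a id) (op_tensor b id) (x \<otimes>\<^sub>h y)" for x y :: 'h
        by (simp add: op_tensor(2)[OF ab id_bounded_op] op_add_def[of "op_tensor a id"] op_tensor(2)[OF a id_bounded_op] op_tensor(2)[OF b id_bounded_op])
           (simp add: op_add_def tensor_add_left)
    qed (use op_tensor(1)[OF ab id_bounded_op] in \<open>simp add: bounded_ops_iff\<close>)
    show "F (op_add a b) = op_add (F a) (F b)"
    proof (rule ext, rule cinner_ext)
      fix v w
      show "cinner (F (op_add a b) v) w = cinner (op_add (F a) (F b) v) w"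
        unfolding Ftr[OF ab] e trl[unfolded op_linear_def, THEN conjunct1, rule_format, OF op_tensor(1)[OF a id_bounded_op] op_tensor(1)[OF b id_bounded_op]]
        by (simp add: op_add_def[of "F a"] cinner_add_left Ftr[OF a] Ftr[OF b] add_divide_distrib)
    qed
  next
    fix d and a :: "'h op" assume a: "a \<in> bounded_ops"
    have da: "op_scale d a \<in> bounded_ops" using cblinear_scaleC a unfolding op_scale_def bounded_ops_iff by blast
    have e: "op_tensor (op_scale d a) (id :: 'h op) = op_scale d (op_tensor a id)"
    proof (rule cblinear_eq_on_tensors)
      show "cblinear (op_scale d (op_tensor a (id :: 'h op)))"
        unfolding op_scale_def using cblinear_scaleC op_tensor(1)[OF a id_bounded_op] unfolding bounded_ops_iff by blast
      show "op_tensor (op_scale d a) id (x \<otimes>\<^sub>h y) = op_scale d (op_tensor a id) (x \<otimes>\<^sub>h y)" for x y :: 'h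
        by (simp add: op_tensor(2)[OF da id_bounded_op] op_scale_def[of d "op_tensor a id"] op_tensor(2)[OF a id_bounded_op])
           (simp add: op_scale_def tensor_scaleC_left)
    qed (use op_tensor(1)[OF da id_bounded_op] in \<open>simp add: bounded_ops_iff\<close>)
    show "F (op_scale d a) = op_scale d (F a)"
    proof (rule ext, rule cinner_ext)
      fix v w
      show "cinner (F (op_scale d a) v) w = cinner (op_scale d (F a) v) w"
        unfolding Ftr[OF da] e trl[unfolded op_linear_def, THEN conjunct2, rule_format, OF op_tensor(1)[OF a id_bounded_op]]
        by (simp add: op_scale_def[of d "F a"] cinner_scaleC_left Ftr[OF a])
    qed
  next
    fix t :: "'h op" assume t: "t \<in> bounded_ops"
    show "onorm (F t) \<le> onorm t"
      by (rule onorm_bound) (use F(3)[OF t] t onorm_nonneg bounded_ops_iff in auto)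
    have "y \<circ> F t = F t \<circ> y" if y: "y \<in> N" for y
    proof (rule ext, rule cinner_ext)
      fix v w
      have yb: "y \<in> bounded_ops" using y Nb by blast
      have tl': "cblinear (op_tensor t (id :: 'h op))" using op_tensor(1)[OF t id_bounded_op] by (simp add: bounded_ops_iff)
      \<comment> \<open>\<open>t \<otimes> 1\<close> and \<open>1 \<otimes> y\<close> act on
        different legs and commute for every \<open>t\<close>. As \<open>T\<close> intertwines
        \<open>y\<close> with \<open>1 \<otimes> y\<close>, \<open>F t\<close> commutes with
        \<open>N\<close> and lies in \<open>N' = M\<close>.\<close>
      have cm: "op_tensor t id \<circ> op_tensor id y = op_tensor id y \<circ> op_tensor t (id :: 'h op)"
        unfolding op_tensor_compose[OF t id_bounded_op id_bounded_op yb] op_tensor_compose[OF id_bounded_op yb t id_bounded_op] by simp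
      have "amp (op_tensor t id) (amp (op_tensor id y) k) = amp (op_tensor id y) (amp (op_tensor t id) k)" for k
        unfolding amp_compose[OF tl' tl[OF M(3) y], symmetric] amp_compose[OF tl[OF M(3) y] tl', symmetric] cm ..
      then show "cinner ((y \<circ> F t) v) w = cinner ((F t \<circ> y) v) w"
        unfolding comp_def adj_exists(2)[OF yb] F(2)[OF t] Ty[OF y] Ty[OF Nadj[OF y]]
        by (simp add: adjT[OF M(3) y] aid)
    qed
    then have "F t \<in> commutant N" unfolding commutant_def using F(1)[OF t] by blast
    then show "F t \<in> M" unfolding NM .
  next
    fix a assume a: "a \<in> M"
    then have ab: "a \<in> bounded_ops" using Mb by blast
    \<comment> \<open>For \<open>a\<close> in \<open>M\<close> the operator
      \<open>a \<otimes> 1\<close> passes through \<open>T\<close> as \<open>a\<close>, leaving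
      \<open>T^* T\<close>, whose scalar \<open>q\<close> is divided out.\<close>
    show "F a = a"
      by (rule ext, rule cinner_ext) (use q in \<open>simp add: F(2)[OF ab] Tx[OF a, symmetric] Tc cq\<close>)
  qed
qed

theorem mainTheorem7:
  fixes M N :: "'h::chilbert_space op set"
  assumes "factor M" and "type_II1 M" and "\<not> injective_vna M" and "standard_form M"
    and "N = commutant M"
  shows "(\<forall>\<xi>. norm \<xi> = 1 \<longrightarrow> vector_form M N \<xi> \<in> CB_normal M N)
    \<and> \<not> (\<forall>\<xi>. norm \<xi> = 1 \<longrightarrow> extends_normally M N (vector_form M N \<xi>))
    \<and> Nor M N \<subset> CB_normal M N"
proof -
  have vna: "von_neumann_algebra M" and id0: "(id :: 'h op) \<noteq> (\<lambda>_. 0)" and fac: "M \<inter> N = range (\<lambda>c. op_scale c id)"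
    using assms(1,5) unfolding factor_def by auto
  have Mb: "M \<subseteq> bounded_ops" and idM: "id \<in> M" and Madj: "\<And>a. a \<in> M \<Longrightarrow> adj a \<in> M" and bic: "commutant (commutant M) = M"
    using vna unfolding von_neumann_algebra_def by auto
  have Ms: "op_subspace M" using op_subspace_commutant[OF commutant_bounded, of M] bic by simp
  have Ns: "op_subspace N" unfolding assms(5) by (rule op_subspace_commutant[OF Mb])
  have Nbic: "commutant (commutant N) = N" unfolding assms(5) by (rule commutant_triple[OF Mb])
  have cbn: "vector_form M N \<xi> \<in> CB_normal M N" if "norm \<xi> = 1" for \<xi>
    by (rule vector_form_CB_normal[OF Ms assms(5) that])
  \<comment> \<open>This excludes every unit vector and not just one, so any unit vector will do
    below.\<close>
  have not_ext: "\<not> extends_normally M N (vector_form M N \<xi>)" if "norm \<xi> = 1" for \<xi>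
    using injective_if_extends_normally[OF Ms bic idM Madj assms(5) fac that] assms(3) by blast
  \<comment> \<open>A factor acts on a nonzero space, so a unit vector exists. Its vector form
    refutes the extension claim and separates \<open>Nor\<close> from
    \<open>CB_normal\<close>.\<close>
  obtain v :: 'h where "v \<noteq> 0" using id0 by (auto simp: fun_eq_iff)
  then have "norm (v /\<^sub>R norm v) = 1" by simp
  then obtain \<xi> :: 'h where \<xi>: "norm \<xi> = 1" by blast
  have "vector_form M N \<xi> \<notin> Nor M N"
    using Nor_extends_normally[OF Ms bic Ns Nbic] not_ext[OF \<xi>] by blast
  then have "Nor M N \<subset> CB_normal M N" using Nor_subset_CB_normal[OF Ms bic Ns] cbn[OF \<xi>] by blast
  then show ?thesis using cbn not_ext \<xi> by blast
qed

end
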